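(* The imaginary axis is contained in the resolvent set of $\mathsf A$: $i\mathbb R\subset\varrho(\mathsf A)$.
   Context: Fix constants $\ell,\rho_1,\rho_2,\rho_3,k,k_0,b,\varpi,l,\gamma>0$ with $l\ell\neq n\pi$ for every positive integer $n$. $L^2,H^1,H^1_0,H^2$ are complex Lebesgue/Sobolev spaces on $(0,\ell)$; $L^2_*=\{f\in L^2:\int_0^\ell f=0\}$, $H^1_*=H^1\cap L^2_*$ with norm $\|f_x\|$. Memory kernels $\mu,\nu:(0,\infty)\to(0,\infty)$ are nonincreasing, absolutely continuous, summable, with finite limits at $0$, and satisfy $\mu'+\delta_\mu\mu\le0$, $\nu'+\delta_\nu\nu\le 0$ a.e. for some $\delta_\mu,\delta_\nu>0$; $g(s)=\int_s^\infty\mu$, $h(s)=\int_s^\infty\nu$ satisfy $\int_0^\infty g=\int_0^\infty h=1$. $\mathcal{M}=L^2_\mu((0,\infty);H^1_0)$ with inner product $\int_0^\infty\mu(s)\langle\eta_{1x}(s),\eta_{2x}(s)\rangle ds$, $\mathcal N$ likewise with $\nu$; $T\eta=-\eta'$ with $D(T)=\{\eta:\eta,\eta'\in\mathcal M,\ \lim_{s\to0}\|\eta_x(s)\|=0\}$. $\mathcal H=H^1_0\times L^2\times H^1_*\times L^2_*\times H^1_*\times L^2_*\times L^2\times\mathcal M\times L^2\times\mathcal N$ with norm $\|u\|_{\mathcal H}^2=k\|\varphi_x+\psi+lw\|^2+\rho_1\|\Phi\|^2+b\|\psi_x\|^2+\rho_2\|\Psi\|^2+k_0\|w_x-l\varphi\|^2+\rho_1\|W\|^2+\rho_3\|\vartheta\|^2+\varpi\|\eta\|_{\mathcal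 M}^2+\rho_3\|\xi\|^2+\varpi\|\zeta\|_{\mathcal N}^2$. $\mathsf A u=\big(\Phi,\ \tfrac{k}{\rho_1}(\varphi_x+\psi+lw)_x+\tfrac{lk_0}{\rho_1}(w_x-l\varphi)-\tfrac{l\gamma}{\rho_1}\xi,\ \Psi,\ \tfrac{b}{\rho_2}\psi_{xx}-\tfrac{k}{\rho_2}(\varphi_x+\psi+lw)-\tfrac{\gamma}{\rho_2}\vartheta_x,\ W,\ \tfrac{k_0}{\rho_1}(w_x-l\varphi)_x-\tfrac{lk}{\rho_1}(\varphi_x+\psi+lw)-\tfrac{\gamma}{\rho_1}\xi_x,\ \tfrac{\varpi}{\rho_3}\int_0^\infty\mu\eta_{xx}ds-\tfrac{\gamma}{\rho_3}\Psi_x,\ T\eta+\vartheta,\ \tfrac{\varpi}{\rho_3}\int_0^\infty\nu\zeta_{xx}ds-\tfrac{\gamma}{\rho_3}(W_x-l\Phi),\ T\zeta+\xi\big)$ with $D(\mathsf A)=\{u\in\mathcal H:\varphi\in H^2;\ \Phi,\psi_x,w_x\in H^1_0;\ \Psi,W\in H^1;\ \vartheta,\xi\in H^1_0;\ \int_0^\infty\mu\eta\,ds,\int_0^\infty\nu\zeta\,ds\in H^2;\ \eta,\zeta\in D(T)\}$; it generates a $C_0$ contraction semigroup on $\mathcal H$. *)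

theory Defs
  imports "HOL-Analysis.Analysis"
begin

definition abs_cont_on :: "real set \<Rightarrow> (real \<Rightarrow> real) \<Rightarrow> bool" where
  "abs_cont_on S f \<longleftrightarrow>
     (\<forall>\<epsilon>>0. \<exists>\<delta>>0. \<forall>(n::nat) (a::nat \<Rightarrow> real) b.
        (\<forall>i<n. a i \<le> b i \<and> {a i..b i} \<subseteq> S) \<and>
        (\<forall>i<n. \<forall>j<n. i \<noteq> j \<longrightarrow> b i \<le> a j \<or> b j \<le> a i) \<and>
        (\<Sum>i<n. b i - a i) < \<delta>
        \<longrightarrow> (\<Sum>i<n. \<bar>f (b i) - f (a i)\<bar>) < \<epsilon>)"

definition smooth_fun :: "(real \<Rightarrow> real) \<Rightarrow> bool" where
  "smooth_fun \<phi> \<longleftrightarrow> (\<forall>n. ((deriv ^^ n) \<phi>) differentiable_on UNIV)"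

definition test_fun :: "real set \<Rightarrow> (real \<Rightarrow> real) \<Rightarrow> bool" where
  "test_fun S \<phi> \<longleftrightarrow> smooth_fun \<phi> \<and>
     (\<exists>K. compact K \<and> K \<subseteq> S \<and> (\<forall>x. x \<notin> K \<longrightarrow> \<phi> x = 0))"

text \<open>Elements are represented by functions real => complex; only the values on (0,ell)
  matter and equality is almost-everywhere equality.\<close>

abbreviation Om :: "real \<Rightarrow> real measure" where
  "Om ell \<equiv> lebesgue_on {0<..<ell}"

abbreviation Hl :: "real measure" where
  "Hl \<equiv> lebesgue_on {0<..}"

definition L2 :: "real \<Rightarrow> (real \<Rightarrow> complex) \<Rightarrow> bool" where
  "L2 ell f \<longleftrightarrow> f \<in> borel_measurable (Om ell) \<and>
      integrable (Om ell) (\<lambda>x. (cmod (f x))\<^sup>2)"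

definition L2n :: "real \<Rightarrow> (real \<Rightarrow> complex) \<Rightarrow> real" where
  "L2n ell f = sqrt (integral\<^sup>L (Om ell) (\<lambda>x. (cmod (f x))\<^sup>2))"

definition L2i :: "real \<Rightarrow> (real \<Rightarrow> complex) \<Rightarrow> (real \<Rightarrow> complex) \<Rightarrow> complex" where
  "L2i ell f g = integral\<^sup>L (Om ell) (\<lambda>x. f x * cnj (g x))"

definition L2s :: "real \<Rightarrow> (real \<Rightarrow> complex) \<Rightarrow> bool" where
  "L2s ell f \<longleftrightarrow> L2 ell f \<and> integral\<^sup>L (Om ell) f = 0"

definition weak_deriv :: "real \<Rightarrow> (real \<Rightarrow> complex) \<Rightarrow> (real \<Rightarrow> complex) \<Rightarrow> bool" where
  "weak_deriv ell f g \<longleftrightarrow>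
     (\<forall>\<phi>. test_fun {0<..<ell} \<phi> \<longrightarrow>
        integral\<^sup>L (Om ell) (\<lambda>x. f x * of_real (deriv \<phi> x))
          = - integral\<^sup>L (Om ell) (\<lambda>x. g x * of_real (\<phi> x)))"

definition H1 :: "real \<Rightarrow> (real \<Rightarrow> complex) \<Rightarrow> bool" where
  "H1 ell f \<longleftrightarrow> L2 ell f \<and> (\<exists>g. L2 ell g \<and> weak_deriv ell f g)"

text \<open>The weak derivative f_x (a chosen representative; unique a.e.).\<close>
definition dx :: "real \<Rightarrow> (real \<Rightarrow> complex) \<Rightarrow> real \<Rightarrow> complex" where
  "dx ell f = (SOME g. L2 ell g \<and> weak_deriv ell f g)"

definition H2 :: "real \<Rightarrow> (real \<Rightarrow> complex) \<Rightarrow> bool" where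
  "H2 ell f \<longleftrightarrow> H1 ell f \<and> H1 ell (dx ell f)"

definition H10 :: "real \<Rightarrow> (real \<Rightarrow> complex) \<Rightarrow> bool" where
  "H10 ell f \<longleftrightarrow> H1 ell f \<and>
     (\<exists>p q :: nat \<Rightarrow> real \<Rightarrow> real.
        (\<forall>n. test_fun {0<..<ell} (p n) \<and> test_fun {0<..<ell} (q n)) \<and>
        ((\<lambda>n. (L2n ell (\<lambda>x. f x - Complex (p n x) (q n x)))\<^sup>2
             + (L2n ell (\<lambda>x. dx ell f x - Complex (deriv (p n) x) (deriv (q n) x)))\<^sup>2)
          \<longlonglongrightarrow> 0))"

definition H1s :: "real \<Rightarrow> (real \<Rightarrow> complex) \<Rightarrow> bool" where
  "H1s ell f \<longleftrightarrow> H1 ell f \<and> L2s ell f"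

text \<open>eta s x: history variable at s>0, point x in (0,ell). Strong measurability is
  expressed via weak measurability (Pettis; H^1_0 is separable).\<close>
definition Mem :: "real \<Rightarrow> (real \<Rightarrow> real) \<Rightarrow> (real \<Rightarrow> real \<Rightarrow> complex) \<Rightarrow> bool" where
  "Mem ell \<mu> \<eta> \<longleftrightarrow> (AE s in Hl. H10 ell (\<eta> s)) \<and>
     (\<forall>g. L2 ell g \<longrightarrow> (\<lambda>s. L2i ell (dx ell (\<eta> s)) g) \<in> borel_measurable Hl) \<and>
     integrable Hl (\<lambda>s. \<mu> s * (L2n ell (dx ell (\<eta> s)))\<^sup>2)"

definition Memn2 :: "real \<Rightarrow> (real \<Rightarrow> real) \<Rightarrow> (real \<Rightarrow> real \<Rightarrow> complex) \<Rightarrow> real" where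
  "Memn2 ell \<mu> \<eta> = integral\<^sup>L Hl (\<lambda>s. \<mu> s * (L2n ell (dx ell (\<eta> s)))\<^sup>2)"

definition sderiv :: "real \<Rightarrow> (real \<Rightarrow> real \<Rightarrow> complex) \<Rightarrow> (real \<Rightarrow> real \<Rightarrow> complex) \<Rightarrow> bool" where
  "sderiv ell \<eta> \<eta>' \<longleftrightarrow>
     (\<forall>\<phi> v. test_fun {0<..} \<phi> \<and> H10 ell v \<longrightarrow>
        integral\<^sup>L Hl (\<lambda>s. L2i ell (dx ell (\<eta> s)) (dx ell v) * of_real (deriv \<phi> s))
          = - integral\<^sup>L Hl (\<lambda>s. L2i ell (dx ell (\<eta>' s)) (dx ell v) * of_real (\<phi> s)))"

definition DT :: "real \<Rightarrow> (real \<Rightarrow> real) \<Rightarrow> (real \<Rightarrow> real \<Rightarrow> complex) \<Rightarrow> bool" where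
  "DT ell \<mu> \<eta> \<longleftrightarrow> Mem ell \<mu> \<eta> \<and> (\<exists>\<eta>'. Mem ell \<mu> \<eta>' \<and> sderiv ell \<eta> \<eta>') \<and>
     (\<forall>\<epsilon>>0. \<exists>\<delta>>0. AE s in Hl. s < \<delta> \<longrightarrow> L2n ell (dx ell (\<eta> s)) < \<epsilon>)"

definition Top :: "real \<Rightarrow> (real \<Rightarrow> real) \<Rightarrow> (real \<Rightarrow> real \<Rightarrow> complex) \<Rightarrow> real \<Rightarrow> real \<Rightarrow> complex" where
  "Top ell \<mu> \<eta> = (\<lambda>s x. - (SOME \<eta>'. Mem ell \<mu> \<eta>' \<and> sderiv ell \<eta> \<eta>') s x)"

text \<open>int_0^infinity mu(s) eta(s) ds as an H^1_0-valued integral (weak form).\<close>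
definition memint :: "real \<Rightarrow> (real \<Rightarrow> real) \<Rightarrow> (real \<Rightarrow> real \<Rightarrow> complex) \<Rightarrow> real \<Rightarrow> complex" where
  "memint ell \<mu> \<eta> = (SOME I. H10 ell I \<and>
     (\<forall>v. H10 ell v \<longrightarrow> L2i ell (dx ell I) (dx ell v)
        = integral\<^sup>L Hl (\<lambda>s. of_real (\<mu> s) * L2i ell (dx ell (\<eta> s)) (dx ell v))))"

record state =
  cphi :: "real \<Rightarrow> complex"
  cPhi :: "real \<Rightarrow> complex"
  cpsi :: "real \<Rightarrow> complex"
  cPsi :: "real \<Rightarrow> complex"
  cw :: "real \<Rightarrow> complex"
  cW :: "real \<Rightarrow> complex"
  cth :: "real \<Rightarrow> complex"
  ceta :: "real \<Rightarrow> real \<Rightarrow> complex"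
  cxi :: "real \<Rightarrow> complex"
  czeta :: "real \<Rightarrow> real \<Rightarrow> complex"

definition inH :: "real \<Rightarrow> (real \<Rightarrow> real) \<Rightarrow> (real \<Rightarrow> real) \<Rightarrow> state \<Rightarrow> bool" where
  "inH ell \<mu> \<nu> u \<longleftrightarrow> H10 ell (cphi u) \<and> L2 ell (cPhi u) \<and> H1s ell (cpsi u) \<and> L2s ell (cPsi u)
     \<and> H1s ell (cw u) \<and> L2s ell (cW u) \<and> L2 ell (cth u) \<and> Mem ell \<mu> (ceta u)
     \<and> L2 ell (cxi u) \<and> Mem ell \<nu> (czeta u)"

definition eqH :: "real \<Rightarrow> state \<Rightarrow> state \<Rightarrow> bool" where
  "eqH ell u v \<longleftrightarrow>
     (AE x in Om ell. cphi u x = cphi v x \<and> cPhi u x = cPhi v x \<and> cpsi u x = cpsi v x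
        \<and> cPsi u x = cPsi v x \<and> cw u x = cw v x \<and> cW u x = cW v x
        \<and> cth u x = cth v x \<and> cxi u x = cxi v x) \<and>
     (AE s in Hl. AE x in Om ell. ceta u s x = ceta v s x) \<and>
     (AE s in Hl. AE x in Om ell. czeta u s x = czeta v s x)"

definition Hnorm :: "real \<Rightarrow> real \<Rightarrow> real \<Rightarrow> real \<Rightarrow> real \<Rightarrow> real \<Rightarrow> real \<Rightarrow> real \<Rightarrow> real
    \<Rightarrow> (real \<Rightarrow> real) \<Rightarrow> (real \<Rightarrow> real) \<Rightarrow> state \<Rightarrow> real" where
  "Hnorm ell \<rho>1 \<rho>2 \<rho>3 k k0 b \<omega> l \<mu> \<nu> u = sqrt (
       k * (L2n ell (\<lambda>x. dx ell (cphi u) x + cpsi u x + of_real l * cw u x))\<^sup>2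
     + \<rho>1 * (L2n ell (cPhi u))\<^sup>2
     + b * (L2n ell (dx ell (cpsi u)))\<^sup>2
     + \<rho>2 * (L2n ell (cPsi u))\<^sup>2
     + k0 * (L2n ell (\<lambda>x. dx ell (cw u) x - of_real l * cphi u x))\<^sup>2
     + \<rho>1 * (L2n ell (cW u))\<^sup>2
     + \<rho>3 * (L2n ell (cth u))\<^sup>2
     + \<omega> * Memn2 ell \<mu> (ceta u)
     + \<rho>3 * (L2n ell (cxi u))\<^sup>2
     + \<omega> * Memn2 ell \<nu> (czeta u))"

definition DA :: "real \<Rightarrow> (real \<Rightarrow> real) \<Rightarrow> (real \<Rightarrow> real) \<Rightarrow> state \<Rightarrow> bool" where
  "DA ell \<mu> \<nu> u \<longleftrightarrow> inH ell \<mu> \<nu> u \<and> H2 ell (cphi u) \<and> H10 ell (cPhi u)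
     \<and> H10 ell (dx ell (cpsi u)) \<and> H10 ell (dx ell (cw u)) \<and> H1 ell (cPsi u) \<and> H1 ell (cW u)
     \<and> H10 ell (cth u) \<and> H10 ell (cxi u)
     \<and> H2 ell (memint ell \<mu> (ceta u)) \<and> H2 ell (memint ell \<nu> (czeta u))
     \<and> DT ell \<mu> (ceta u) \<and> DT ell \<nu> (czeta u)"

definition Aop :: "real \<Rightarrow> real \<Rightarrow> real \<Rightarrow> real \<Rightarrow> real \<Rightarrow> real \<Rightarrow> real \<Rightarrow> real \<Rightarrow> real \<Rightarrow> real
    \<Rightarrow> (real \<Rightarrow> real) \<Rightarrow> (real \<Rightarrow> real) \<Rightarrow> state \<Rightarrow> state" where
  "Aop ell \<rho>1 \<rho>2 \<rho>3 k k0 b \<omega> l \<gamma> \<mu> \<nu> u =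
    (let S = (\<lambda>x. dx ell (cphi u) x + cpsi u x + of_real l * cw u x);
         R = (\<lambda>x. dx ell (cw u) x - of_real l * cphi u x);
         Ie = memint ell \<mu> (ceta u);
         Iz = memint ell \<nu> (czeta u)
     in \<lparr> cphi = cPhi u,
          cPhi = (\<lambda>x. of_real (k/\<rho>1) * dx ell S x + of_real (l*k0/\<rho>1) * R x
                        - of_real (l*\<gamma>/\<rho>1) * cxi u x),
          cpsi = cPsi u,
          cPsi = (\<lambda>x. of_real (b/\<rho>2) * dx ell (dx ell (cpsi u)) x - of_real (k/\<rho>2) * S x
                        - of_real (\<gamma>/\<rho>2) * dx ell (cth u) x),
          cw = cW u,
          cW = (\<lambda>x. of_real (k0/\<rho>1) * dx ell R x - of_real (l*k/\<rho>1) * S x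
                        - of_real (\<gamma>/\<rho>1) * dx ell (cxi u) x),
          cth = (\<lambda>x. of_real (\<omega>/\<rho>3) * dx ell (dx ell Ie) x - of_real (\<gamma>/\<rho>3) * dx ell (cPsi u) x),
          ceta = (\<lambda>s x. Top ell \<mu> (ceta u) s x + cth u x),
          cxi = (\<lambda>x. of_real (\<omega>/\<rho>3) * dx ell (dx ell Iz) x
                        - of_real (\<gamma>/\<rho>3) * (dx ell (cW u) x - of_real l * cPhi u x)),
          czeta = (\<lambda>s x. Top ell \<nu> (czeta u) s x + cxi u x) \<rparr>)"

definition shiftA :: "real \<Rightarrow> real \<Rightarrow> real \<Rightarrow> real \<Rightarrow> real \<Rightarrow> real \<Rightarrow> real \<Rightarrow> real \<Rightarrow> real \<Rightarrow> real
    \<Rightarrow> (real \<Rightarrow> real) \<Rightarrow> (real \<Rightarrow> real) \<Rightarrow> complex \<Rightarrow> state \<Rightarrow> state" where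
  "shiftA ell \<rho>1 \<rho>2 \<rho>3 k k0 b \<omega> l \<gamma> \<mu> \<nu> c u =
    (let v = Aop ell \<rho>1 \<rho>2 \<rho>3 k k0 b \<omega> l \<gamma> \<mu> \<nu> u in
     \<lparr> cphi = (\<lambda>x. c * cphi u x - cphi v x),
       cPhi = (\<lambda>x. c * cPhi u x - cPhi v x),
       cpsi = (\<lambda>x. c * cpsi u x - cpsi v x),
       cPsi = (\<lambda>x. c * cPsi u x - cPsi v x),
       cw = (\<lambda>x. c * cw u x - cw v x),
       cW = (\<lambda>x. c * cW u x - cW v x),
       cth = (\<lambda>x. c * cth u x - cth v x),
       ceta = (\<lambda>s x. c * ceta u s x - ceta v s x),
       cxi = (\<lambda>x. c * cxi u x - cxi v x),
       czeta = (\<lambda>s x. c * czeta u s x - czeta v s x) \<rparr>)"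

definition resolvent_set_A :: "real \<Rightarrow> real \<Rightarrow> real \<Rightarrow> real \<Rightarrow> real \<Rightarrow> real \<Rightarrow> real \<Rightarrow> real \<Rightarrow> real \<Rightarrow> real
    \<Rightarrow> (real \<Rightarrow> real) \<Rightarrow> (real \<Rightarrow> real) \<Rightarrow> complex set" where
  "resolvent_set_A ell \<rho>1 \<rho>2 \<rho>3 k k0 b \<omega> l \<gamma> \<mu> \<nu> =
    {c. (\<forall>F. inH ell \<mu> \<nu> F \<longrightarrow>
            (\<exists>U. DA ell \<mu> \<nu> U \<and> eqH ell (shiftA ell \<rho>1 \<rho>2 \<rho>3 k k0 b \<omega> l \<gamma> \<mu> \<nu> c U) F))
      \<and> (\<forall>U V. DA ell \<mu> \<nu> U \<and> DA ell \<mu> \<nu> V \<and>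
            eqH ell (shiftA ell \<rho>1 \<rho>2 \<rho>3 k k0 b \<omega> l \<gamma> \<mu> \<nu> c U)
                    (shiftA ell \<rho>1 \<rho>2 \<rho>3 k k0 b \<omega> l \<gamma> \<mu> \<nu> c V) \<longrightarrow> eqH ell U V)
      \<and> (\<exists>C. \<forall>U. DA ell \<mu> \<nu> U \<longrightarrow>
            Hnorm ell \<rho>1 \<rho>2 \<rho>3 k k0 b \<omega> l \<mu> \<nu> U
              \<le> C * Hnorm ell \<rho>1 \<rho>2 \<rho>3 k k0 b \<omega> l \<mu> \<nu> (shiftA ell \<rho>1 \<rho>2 \<rho>3 k k0 b \<omega> l \<gamma> \<mu> \<nu> c U))}"

definition kernel :: "(real \<Rightarrow> real) \<Rightarrow> bool" where
  "kernel \<mu> \<longleftrightarrow> (\<forall>s>0. \<mu> s > 0)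
     \<and> (\<forall>s t. 0 < s \<and> s \<le> t \<longrightarrow> \<mu> t \<le> \<mu> s)
     \<and> (\<forall>a b. 0 < a \<longrightarrow> abs_cont_on {a..b} \<mu>)
     \<and> integrable Hl \<mu>
     \<and> (\<exists>L. (\<mu> \<longlongrightarrow> L) (at_right 0))
     \<and> (\<exists>\<delta>>0. AE s in Hl. deriv \<mu> s + \<delta> * \<mu> s \<le> 0)
     \<and> integrable Hl (\<lambda>s. integral\<^sup>L (lebesgue_on {s<..}) \<mu>)
     \<and> integral\<^sup>L Hl (\<lambda>s. integral\<^sup>L (lebesgue_on {s<..}) \<mu>) = 1"

end

theory Submission
  imports Defs "HOL-Computational_Algebra.Polynomial"
begin

text \<open>
  Expanding \<open>cphi, cPhi, cth, cxi, ceta, czeta\<close> in sines and \<open>cpsi, cPsi, cw, cW\<close> in cosines decouples the resolvent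
  equation at \<open>\<i>\<beta>\<close> into one system per frequency \<open>a = n\<pi>/ell\<close>. The memory variable with source \<open>F\<close> is
  \<open>\<eta>(s) = \<integral>\<^sub>0\<^sup>s exp(-\<i>\<beta>(s - r)) (\<theta> + F(r)) dr\<close>, so that \<open>\<integral> \<mu> \<eta>\<close> is \<open>c \<theta>\<close> up to data, with \<open>Re c > 0\<close> because
  \<open>\<mu>\<close> is decreasing; what remains is a 5 by 5 complex system. In its kernel dissipation forces the two temperatures to vanish, then
  the coupling forces all strains to vanish, and \<open>a \<noteq> l\<close> excludes the remaining rigid solutions. Divided by
  \<open>a\<^sup>2\<close>, the systems tend to an invertible diagonal one, so their inverses are bounded uniformly in the frequency.
  The solution operator of the memory equation is bounded since the kernels decay exponentially; this follows from
  \<open>\<mu>' + \<delta> \<mu> \<le> 0\<close> a.e. once monotone functions are known to be differentiable almost everywhere (Vitali coverings).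
\<close>

section \<open>Square-integrable functions\<close>

text \<open>The parities match the boundary conditions: \<open>cphi\<close>, \<open>cPhi\<close>,
  \<open>cth\<close>, \<open>cxi\<close> and the memories vanish at the ends, and so do the
  derivatives of \<open>cpsi\<close> and \<open>cw\<close>. Hence \<open>dx\<close> exchanges sines
  and cosines without boundary terms, and each line of the operator stays within one basis. The
  mean-zero conditions remove the frequency 0. The obstacle is that \<open>dx\<close>,
  \<open>memint\<close> and \<open>Top\<close> are choices of representatives, hence not linear on
  the nose. All computations are therefore made with Fourier coefficients, which do not depend on
  the choice, and a.e. equality is recovered from completeness of the bases. Membership in the
  spaces becomes square-summability with weights 1, a or a^2; the weight a comes from the uniform
  estimate, the weight a^2 that the domain demands is read off the equations. The kernel inequality
  holds only a.e., and \<open>deriv\<close> is unspecified where the kernel is not differentiable,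
  so a.e. differentiability must be known before the inequality can be integrated.\<close>

lemma borel_measurable_cnj [measurable]: "f \<in> borel_measurable M \<Longrightarrow> (\<lambda>x. cnj (f x)) \<in> borel_measurable M"
  by (rule borel_measurable_continuous_on[where f=cnj]) (auto intro: continuous_intros)

lemma finite_measure_Om: "finite_measure (Om ell)"
  by (intro finite_measure_lebesgue_on) simp

lemma integrable_mult_square:
  fixes f g :: "'a \<Rightarrow> real"
  assumes [measurable]: "f \<in> borel_measurable M" "g \<in> borel_measurable M"
    and "integrable M (\<lambda>x. (f x)\<^sup>2)" "integrable M (\<lambda>x. (g x)\<^sup>2)"
  shows "integrable M (\<lambda>x. f x * g x)"
proof (rule Bochner_Integration.integrable_bound)
  show "integrable M (\<lambda>x. (f x)\<^sup>2 + (g x)\<^sup>2)" using assms by auto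
  have "\<bar>a * b\<bar> \<le> a\<^sup>2 + b\<^sup>2" for a b :: real
    using sum_squares_bound[of "\<bar>a\<bar>" "\<bar>b\<bar>"] abs_ge_zero[of "a*b"] unfolding abs_mult power2_abs by linarith
  then show "AE x in M. norm (f x * g x) \<le> norm ((f x)\<^sup>2 + (g x)\<^sup>2)" by auto
qed measurable

lemma Cauchy_Schwarz_integral:
  fixes f g :: "'a \<Rightarrow> real"
  assumes [measurable]: "f \<in> borel_measurable M" "g \<in> borel_measurable M"
    and f: "integrable M (\<lambda>x. (f x)\<^sup>2)" and g: "integrable M (\<lambda>x. (g x)\<^sup>2)"
  shows "(integral\<^sup>L M (\<lambda>x. \<bar>f x * g x\<bar>))\<^sup>2 \<le> integral\<^sup>L M (\<lambda>x. (f x)\<^sup>2) * integral\<^sup>L M (\<lambda>x. (g x)\<^sup>2)"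
proof -
  have i: "integrable M (\<lambda>x. \<bar>f x * g x\<bar>)"
    using integrable_mult_square[OF assms] by auto
  have "(\<integral>\<^sup>+x. ennreal \<bar>f x\<bar> * ennreal \<bar>g x\<bar> \<partial>M)\<^sup>2
      \<le> (\<integral>\<^sup>+x. (ennreal \<bar>f x\<bar>)\<^sup>2 \<partial>M) * (\<integral>\<^sup>+x. (ennreal \<bar>g x\<bar>)\<^sup>2 \<partial>M)"
    by (rule Cauchy_Schwarz_nn_integral) measurable
  also have "(\<integral>\<^sup>+x. ennreal \<bar>f x\<bar> * ennreal \<bar>g x\<bar> \<partial>M) = ennreal (integral\<^sup>L M (\<lambda>x. \<bar>f x * g x\<bar>))"
    using nn_integral_eq_integral[OF i] by (simp add: ennreal_mult' abs_mult)
  also have "(\<integral>\<^sup>+x. (ennreal \<bar>f x\<bar>)\<^sup>2 \<partial>M) = ennreal (integral\<^sup>L M (\<lambda>x. (f x)\<^sup>2))"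
    using nn_integral_eq_integral[OF f] by (simp add: ennreal_power)
  also have "(\<integral>\<^sup>+x. (ennreal \<bar>g x\<bar>)\<^sup>2 \<partial>M) = ennreal (integral\<^sup>L M (\<lambda>x. (g x)\<^sup>2))"
    using nn_integral_eq_integral[OF g] by (simp add: ennreal_power)
  finally show ?thesis
    by (simp add: ennreal_power flip: ennreal_mult')
qed

lemma L2_0 [simp]: "L2 ell (\<lambda>x. 0)" by (simp add: L2_def)

lemma L2_bound:
  assumes [measurable]: "h \<in> borel_measurable (Om ell)" and "integrable (Om ell) g" "\<And>x. x \<in> {0<..<ell} \<Longrightarrow> (cmod (h x))\<^sup>2 \<le> g x"
  shows "L2 ell h"
  unfolding L2_def
  by (intro conjI Bochner_Integration.integrable_bound[OF assms(2)] AE_I2)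
     (use assms in \<open>auto intro: order_trans[OF _ abs_ge_self]\<close>)

lemma cmod_add_sq: "(cmod (a + b))\<^sup>2 \<le> 2 * (cmod a)\<^sup>2 + 2 * (cmod b)\<^sup>2"
proof -
  have "(cmod (a + b))\<^sup>2 \<le> (cmod a + cmod b)\<^sup>2" by (intro power_mono norm_triangle_ineq) auto
  also have "\<dots> \<le> 2 * (cmod a)\<^sup>2 + 2 * (cmod b)\<^sup>2"
    using zero_le_power2[of "cmod a - cmod b"] by (simp add: power2_eq_square algebra_simps)
  finally show ?thesis .
qed

lemma L2_add: assumes "L2 ell f" "L2 ell g" shows "L2 ell (\<lambda>x. f x + g x)"
proof (rule L2_bound)
  show "integrable (Om ell) (\<lambda>x. 2 * (cmod (f x))\<^sup>2 + 2 * (cmod (g x))\<^sup>2)" "(\<lambda>x. f x + g x) \<in> borel_measurable (Om ell)"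
    using assms by (auto simp: L2_def)
qed (rule cmod_add_sq)

lemma L2_cmult: "L2 ell f \<Longrightarrow> L2 ell (\<lambda>x. c * f x)"
  by (auto simp: L2_def norm_mult power_mult_distrib)

lemma L2_diff: "L2 ell f \<Longrightarrow> L2 ell g \<Longrightarrow> L2 ell (\<lambda>x. f x - g x)"
  using L2_add[OF _ L2_cmult[of ell g "-1"]] by simp

lemma L2_sum: "(\<And>i. i \<in> A \<Longrightarrow> L2 ell (f i)) \<Longrightarrow> L2 ell (\<lambda>x. \<Sum>i\<in>A. f i x)"
  by (induction A rule: infinite_finite_induct) (auto intro: L2_add)

lemma L2_bounded:
  assumes [measurable]: "f \<in> borel_measurable (Om ell)" and B: "\<And>x. x \<in> {0<..<ell} \<Longrightarrow> cmod (f x) \<le> B"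
  shows "L2 ell f"
proof (rule L2_bound)
  interpret finite_measure "Om ell" by (rule finite_measure_Om)
  show "integrable (Om ell) (\<lambda>x. B\<^sup>2)" by simp
  show "(cmod (f x))\<^sup>2 \<le> B\<^sup>2" if "x \<in> {0<..<ell}" for x using B[OF that] by (intro power_mono) auto
qed fact

text \<open>Completeness of Lebesgue measure. It gives measurability of expressions in
  \<open>dx\<close> or in a chosen memory, which are known only up to null sets.\<close>

lemma borel_measurable_lebesgue_on_AE:
  fixes f g :: "'a::euclidean_space \<Rightarrow> 'b::euclidean_space"
  assumes "f \<in> borel_measurable (lebesgue_on S)" "AE x in lebesgue_on S. f x = g x" "S \<in> sets lebesgue"
  shows "g \<in> borel_measurable (lebesgue_on S)"
proof -
  have 1: "(\<lambda>x. if x \<in> S then f x else 0) \<in> borel_measurable lebesgue"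
    using assms by (simp add: borel_measurable_if)
  have 2: "AE x in lebesgue. (if x \<in> S then f x else 0) = (if x \<in> S then g x else 0)"
    using assms by (subst (asm) AE_restrict_space_iff) auto
  show ?thesis
    using borel_measurable_AE[OF 1 2] assms(3) by (simp add: borel_measurable_if)
qed

lemma L2_cong_AE:
  assumes "L2 ell f" and ae: "AE x in Om ell. f x = g x"
  shows "L2 ell g"
proof -
  have [measurable]: "f \<in> borel_measurable (Om ell)" using assms by (simp add: L2_def)
  have g[measurable]: "g \<in> borel_measurable (Om ell)"
    using borel_measurable_lebesgue_on_AE[OF _ ae] by simp
  have "integrable (Om ell) (\<lambda>x. (cmod (g x))\<^sup>2)"
    by (rule iffD1[OF integrable_cong_AE[where f="\<lambda>x. (cmod (f x))\<^sup>2"]]) (use assms in \<open>auto simp: L2_def\<close>)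
  then show ?thesis by (simp add: L2_def g)
qed

lemma L2i_integrable:
  assumes "L2 ell f" "L2 ell g" shows "integrable (Om ell) (\<lambda>x. f x * cnj (g x))"
proof (rule Bochner_Integration.integrable_bound[where f="\<lambda>x. cmod (f x) * cmod (g x)"])
  have [measurable]: "f \<in> borel_measurable (Om ell)" "g \<in> borel_measurable (Om ell)"
    using assms by (auto simp: L2_def)
  show "integrable (Om ell) (\<lambda>x. cmod (f x) * cmod (g x))"
    by (rule integrable_mult_square) (use assms in \<open>auto simp: L2_def\<close>)
  show "(\<lambda>x. f x * cnj (g x)) \<in> borel_measurable (Om ell)"
    by measurable
qed (auto simp: norm_mult)

lemma L2_integrable: assumes "L2 ell f" shows "integrable (Om ell) f"
  using L2i_integrable[OF assms L2_bounded[of "\<lambda>x. 1"]] by auto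

lemma L2n_nonneg [simp]: "0 \<le> L2n ell f" by (simp add: L2n_def)

lemma L2n_sq: "(L2n ell f)\<^sup>2 = integral\<^sup>L (Om ell) (\<lambda>x. (cmod (f x))\<^sup>2)"
  by (simp add: L2n_def)

lemma L2i_self: "L2i ell f f = of_real ((L2n ell f)\<^sup>2)"
  unfolding L2i_def L2n_sq by (subst complex_norm_square[symmetric]) (simp add: integral_complex_of_real[symmetric])

lemma L2n_cong_AE:
  assumes "AE x in Om ell. f x = g x" "L2 ell f"
  shows "L2n ell f = L2n ell g"
proof -
  have [measurable]: "f \<in> borel_measurable (Om ell)" "g \<in> borel_measurable (Om ell)"
    using assms L2_cong_AE[OF assms(2,1)] by (auto simp: L2_def)
  show ?thesis unfolding L2n_def
    by (intro arg_cong[of _ _ sqrt] integral_cong_AE) (use assms in auto)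
qed

lemma L2i_cong_AE:
  assumes "AE x in Om ell. f x = f' x" "AE x in Om ell. g x = g' x" "L2 ell f" "L2 ell g"
  shows "L2i ell f g = L2i ell f' g'"
proof -
  have [measurable]: "f \<in> borel_measurable (Om ell)" "g \<in> borel_measurable (Om ell)"
     "f' \<in> borel_measurable (Om ell)" "g' \<in> borel_measurable (Om ell)"
    using assms(3,4) L2_cong_AE[OF assms(3,1)] L2_cong_AE[OF assms(4,2)] by (auto simp: L2_def)
  show ?thesis unfolding L2i_def
    by (intro integral_cong_AE) (use assms in auto)
qed

lemma L2i_add_left: "L2 ell f \<Longrightarrow> L2 ell g \<Longrightarrow> L2 ell h \<Longrightarrow> L2i ell (\<lambda>x. f x + g x) h = L2i ell f h + L2i ell g h"
  by (simp add: L2i_def distrib_right L2i_integrable)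

lemma L2i_cmult_left: "L2i ell (\<lambda>x. c * f x) h = c * L2i ell f h"
  by (simp add: L2i_def mult.assoc)

lemma L2i_diff_left: "L2 ell f \<Longrightarrow> L2 ell g \<Longrightarrow> L2 ell h \<Longrightarrow> L2i ell (\<lambda>x. f x - g x) h = L2i ell f h - L2i ell g h"
  by (simp add: L2i_def left_diff_distrib L2i_integrable)

lemma L2i_commute: "L2i ell g f = cnj (L2i ell f g)"
  unfolding L2i_def by (simp add: mult.commute flip: Bochner_Integration.integral_cnj)

lemma L2i_0_left [simp]: "L2i ell (\<lambda>x. 0) h = 0"
  by (simp add: L2i_def)

lemma L2i_sum_left:
  "(\<And>i. i \<in> A \<Longrightarrow> L2 ell (f i)) \<Longrightarrow> L2 ell h \<Longrightarrow> L2i ell (\<lambda>x. \<Sum>i\<in>A. f i x) h = (\<Sum>i\<in>A. L2i ell (f i) h)"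
  by (induction A rule: infinite_finite_induct) (auto simp: L2i_add_left L2_sum)

lemma L2i_Cauchy_Schwarz:
  assumes "L2 ell f" "L2 ell g"
  shows "cmod (L2i ell f g) \<le> L2n ell f * L2n ell g"
proof -
  have [measurable]: "f \<in> borel_measurable (Om ell)" "g \<in> borel_measurable (Om ell)"
    using assms by (auto simp: L2_def)
  have "cmod (L2i ell f g) \<le> integral\<^sup>L (Om ell) (\<lambda>x. \<bar>cmod (f x) * cmod (g x)\<bar>)"
    unfolding L2i_def by (rule order_trans[OF integral_norm_bound]) (simp add: norm_mult)
  also have "\<dots> \<le> sqrt ((integral\<^sup>L (Om ell) (\<lambda>x. \<bar>cmod (f x) * cmod (g x)\<bar>))\<^sup>2)"
    by simp
  also have "\<dots> \<le> sqrt (integral\<^sup>L (Om ell) (\<lambda>x. (cmod (f x))\<^sup>2) * integral\<^sup>L (Om ell) (\<lambda>x. (cmod (g x))\<^sup>2))"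
    by (intro real_sqrt_le_mono Cauchy_Schwarz_integral) (use assms in \<open>auto simp: L2_def\<close>)
  finally show ?thesis by (simp add: L2n_def real_sqrt_mult)
qed

lemma L2n_cmult: "L2n ell (\<lambda>x. c * f x) = cmod c * L2n ell f"
  by (simp add: L2n_def norm_mult power_mult_distrib real_sqrt_mult)

lemma L2n_triangle:
  assumes "L2 ell f" "L2 ell g"
  shows "L2n ell (\<lambda>x. f x + g x) \<le> L2n ell f + L2n ell g"
proof -
  have "(L2n ell (\<lambda>x. f x + g x))\<^sup>2 = Re (L2i ell (\<lambda>x. f x + g x) (\<lambda>x. f x + g x))"
    by (simp add: L2i_self)
  also have "\<dots> = Re (L2i ell f (\<lambda>x. f x + g x) + L2i ell g (\<lambda>x. f x + g x))"
    using assms by (simp add: L2i_add_left L2_add)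
  also have "\<dots> \<le> cmod (L2i ell f (\<lambda>x. f x + g x)) + cmod (L2i ell g (\<lambda>x. f x + g x))"
    by (simp add: add_mono complex_Re_le_cmod)
  also have "\<dots> \<le> L2n ell f * L2n ell (\<lambda>x. f x + g x) + L2n ell g * L2n ell (\<lambda>x. f x + g x)"
    using assms by (intro add_mono L2i_Cauchy_Schwarz L2_add)
  finally have "L2n ell (\<lambda>x. f x + g x) * L2n ell (\<lambda>x. f x + g x) \<le> (L2n ell f + L2n ell g) * L2n ell (\<lambda>x. f x + g x)"
    by (simp add: power2_eq_square distrib_right)
  then show ?thesis
    by (cases "L2n ell (\<lambda>x. f x + g x) = 0") (use L2n_nonneg[of ell "\<lambda>x. f x + g x"] L2n_nonneg[of ell f] L2n_nonneg[of ell g] in \<open>auto simp del: L2n_nonneg\<close>)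
qed

lemma L1_le_L2:
  assumes "L2 ell f"
  shows "integral\<^sup>L (Om ell) (\<lambda>x. cmod (f x)) \<le> sqrt (measure (Om ell) (space (Om ell))) * L2n ell f"
proof -
  interpret finite_measure "Om ell" by (rule finite_measure_Om)
  have [measurable]: "f \<in> borel_measurable (Om ell)"
    using assms by (auto simp: L2_def)
  have "integral\<^sup>L (Om ell) (\<lambda>x. cmod (f x)) \<le> sqrt ((integral\<^sup>L (Om ell) (\<lambda>x. \<bar>1 * cmod (f x)\<bar>))\<^sup>2)"
    by simp
  also have "\<dots> \<le> sqrt (integral\<^sup>L (Om ell) (\<lambda>x. 1\<^sup>2) * integral\<^sup>L (Om ell) (\<lambda>x. (cmod (f x))\<^sup>2))"
    by (intro real_sqrt_le_mono Cauchy_Schwarz_integral) (use assms in \<open>auto simp: L2_def\<close>)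
  finally show ?thesis by (simp add: L2n_def real_sqrt_mult)
qed

text \<open>On a bounded interval an L2-Cauchy sequence is Cauchy in L1, so a subsequence converges
  a.e.; Fatou's lemma then bounds the L2 distance of the whole sequence to the pointwise
  limit.\<close>

lemma L2_complete:
  assumes L: "\<And>n. L2 ell (P n)"
    and cauchy: "\<And>e. e > 0 \<Longrightarrow> \<exists>N. \<forall>i\<ge>N. \<forall>j\<ge>N. L2n ell (\<lambda>x. P i x - P j x) < e"
  shows "\<exists>f. L2 ell f \<and> (\<lambda>n. L2n ell (\<lambda>x. P n x - f x)) \<longlonglongrightarrow> 0"
proof -
  have [measurable]: "P n \<in> borel_measurable (Om ell)" for n
    using L by (auto simp: L2_def)
  define K where "K = sqrt (measure (Om ell) (space (Om ell)))"
  have K: "K \<ge> 0" by (simp add: K_def)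
  have "\<exists>N. \<forall>i\<ge>N. \<forall>j\<ge>N. (LINT x|Om ell. norm (P i x - P j x)) < e" if "e > 0" for e
  proof -
    obtain N where N: "\<forall>i\<ge>N. \<forall>j\<ge>N. L2n ell (\<lambda>x. P i x - P j x) < e / (K + 1)"
      using cauchy[of "e / (K+1)"] \<open>e > 0\<close> K by auto
    have "(LINT x|Om ell. norm (P i x - P j x)) < e" if "i \<ge> N" "j \<ge> N" for i j
    proof -
      have "(LINT x|Om ell. norm (P i x - P j x)) \<le> K * L2n ell (\<lambda>x. P i x - P j x)"
        using L1_le_L2[OF L2_diff[OF L L]] by (simp add: K_def)
      also have "\<dots> \<le> K * (e / (K + 1))" using N that K by (intro mult_left_mono) (auto intro: less_imp_le)
      also have "\<dots> < e" using K \<open>e > 0\<close> by (simp add: field_simps)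
      finally show ?thesis .
    qed
    then show ?thesis by blast
  qed
  then obtain r where r: "strict_mono r" "AE x in Om ell. Cauchy (\<lambda>i. P (r i) x)"
    using cauchy_L1_AE_cauchy_subseq[of "Om ell" P] L2_integrable[OF L] by blast
  define f where "f x = lim (\<lambda>i. P (r i) x)" for x
  have f[measurable]: "f \<in> borel_measurable (Om ell)"
    unfolding f_def by (intro borel_measurable_lim_metric) simp
  have conv: "AE x in Om ell. (\<lambda>i. P (r i) x) \<longlonglongrightarrow> f x"
    using r(2) by eventually_elim (auto simp: f_def convergent_LIMSEQ_iff Cauchy_convergent_iff)
  \<comment> \<open>Fatou along the subsequence: every far member \<open>P (r i)\<close> is within e
    of \<open>P n\<close>, hence so is the a.e. limit.\<close>
  have key: "(\<integral>\<^sup>+x. ennreal ((cmod (P n x - f x))\<^sup>2) \<partial>Om ell) \<le> ennreal (e\<^sup>2)"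
    if N: "\<forall>i\<ge>N. \<forall>j\<ge>N. L2n ell (\<lambda>x. P i x - P j x) < e" and "n \<ge> N" for e N n
  proof -
    have e: "e \<ge> 0" using N \<open>n \<ge> N\<close> L2n_nonneg[of ell] by (meson less_imp_le order_trans)
    have "(\<integral>\<^sup>+x. ennreal ((cmod (P n x - f x))\<^sup>2) \<partial>Om ell)
       = (\<integral>\<^sup>+x. liminf (\<lambda>i. ennreal ((cmod (P n x - P (r i) x))\<^sup>2)) \<partial>Om ell)"
    proof (rule nn_integral_cong_AE, use conv in eventually_elim)
      case (elim x)
      then have "(\<lambda>i. ennreal ((cmod (P n x - P (r i) x))\<^sup>2)) \<longlonglongrightarrow> ennreal ((cmod (P n x - f x))\<^sup>2)"
        by (intro tendsto_intros tendsto_ennrealI)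
      then show ?case using lim_imp_Liminf[OF _ \<open>(\<lambda>i. ennreal ((cmod (P n x - P (r i) x))\<^sup>2)) \<longlonglongrightarrow> _\<close>] by simp
    qed
    also have "\<dots> \<le> liminf (\<lambda>i. (\<integral>\<^sup>+x. ennreal ((cmod (P n x - P (r i) x))\<^sup>2) \<partial>Om ell))"
      by (intro nn_integral_liminf) measurable
    also have "\<dots> \<le> ennreal (e\<^sup>2)"
    proof (rule Liminf_le)
      show "\<forall>\<^sub>F i in sequentially. (\<integral>\<^sup>+x. ennreal ((cmod (P n x - P (r i) x))\<^sup>2) \<partial>Om ell) \<le> ennreal (e\<^sup>2)"
      proof (rule eventually_sequentiallyI[of N])
        fix i assume "N \<le> i"
        then have ri: "r i \<ge> N" using seq_suble[OF r(1), of i] by simp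
        have "(\<integral>\<^sup>+x. ennreal ((cmod (P n x - P (r i) x))\<^sup>2) \<partial>Om ell) = ennreal ((L2n ell (\<lambda>x. P n x - P (r i) x))\<^sup>2)"
          unfolding L2n_sq using L2_diff[OF L L] by (intro nn_integral_eq_integral) (auto simp: L2_def)
        also have "\<dots> \<le> ennreal (e\<^sup>2)"
          using N ri \<open>n \<ge> N\<close> e by (intro ennreal_leI power_mono) (auto intro: less_imp_le)
        finally show "(\<integral>\<^sup>+x. ennreal ((cmod (P n x - P (r i) x))\<^sup>2) \<partial>Om ell) \<le> ennreal (e\<^sup>2)" .
      qed
    qed simp
    finally show ?thesis .
  qed
  have Ld: "L2 ell (\<lambda>x. P n x - f x) \<and> L2n ell (\<lambda>x. P n x - f x) \<le> e"
    if N: "\<forall>i\<ge>N. \<forall>j\<ge>N. L2n ell (\<lambda>x. P i x - P j x) < e" and "n \<ge> N" for e N n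
  proof -
    have e: "e \<ge> 0" using N \<open>n \<ge> N\<close> L2n_nonneg[of ell] by (meson less_imp_le order_trans)
    have *: "integrable (Om ell) (\<lambda>x. (cmod (P n x - f x))\<^sup>2)"
      by (rule integrableI_bounded) (use key[OF that] in \<open>auto simp: le_less_trans\<close>)
    then have "L2 ell (\<lambda>x. P n x - f x)" unfolding L2_def by simp
    moreover have "ennreal ((L2n ell (\<lambda>x. P n x - f x))\<^sup>2) \<le> ennreal (e\<^sup>2)"
      unfolding L2n_sq using key[OF that] * by (subst (asm) nn_integral_eq_integral) auto
    then have "(L2n ell (\<lambda>x. P n x - f x))\<^sup>2 \<le> e\<^sup>2" by simp
    then have "L2n ell (\<lambda>x. P n x - f x) \<le> e" by (rule power2_le_imp_le) fact
    ultimately show ?thesis by simp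
  qed
  obtain N where N: "\<forall>i\<ge>N. \<forall>j\<ge>N. L2n ell (\<lambda>x. P i x - P j x) < 1"
    using cauchy[of 1] by auto
  have "L2 ell (\<lambda>x. P N x - f x)" using Ld[OF N, of N] by auto
  then have "L2 ell f" using L2_diff[OF L[of N]] by fastforce
  moreover have "(\<lambda>n. L2n ell (\<lambda>x. P n x - f x)) \<longlonglongrightarrow> 0"
  proof (rule LIMSEQ_I)
    fix e :: real assume "e > 0"
    then obtain N where N: "\<forall>i\<ge>N. \<forall>j\<ge>N. L2n ell (\<lambda>x. P i x - P j x) < e/2"
      using cauchy[of "e/2"] by auto
    have "norm (L2n ell (\<lambda>x. P n x - f x) - 0) < e" if "n \<ge> N" for n
      using Ld[OF N that] \<open>e > 0\<close> by simp
    then show "\<exists>N. \<forall>n\<ge>N. norm (L2n ell (\<lambda>x. P n x - f x) - 0) < e" by blast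
  qed
  ultimately show ?thesis by blast
qed

lemma L2i_tendsto_left:
  assumes "\<And>n. L2 ell (P n)" "L2 ell f" "L2 ell g" "(\<lambda>n. L2n ell (\<lambda>x. P n x - f x)) \<longlonglongrightarrow> 0"
  shows "(\<lambda>n. L2i ell (P n) g) \<longlonglongrightarrow> L2i ell f g"
proof -
  have "(\<lambda>n. L2i ell (P n) g - L2i ell f g) \<longlonglongrightarrow> 0"
  proof (rule Lim_null_comparison)
    show "\<forall>\<^sub>F n in sequentially. norm (L2i ell (P n) g - L2i ell f g) \<le> L2n ell (\<lambda>x. P n x - f x) * L2n ell g"
      using L2i_Cauchy_Schwarz[OF L2_diff[OF assms(1,2)] assms(3)] assms
      by (intro always_eventually) (simp add: L2i_diff_left)
    show "(\<lambda>n. L2n ell (\<lambda>x. P n x - f x) * L2n ell g) \<longlonglongrightarrow> 0"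
      using tendsto_mult_left_zero[OF assms(4)] by simp
  qed
  then show ?thesis by (simp add: LIM_zero_iff)
qed

section \<open>Square-summable sequences, orthonormal systems and Parseval's identity\<close>

definition sqs :: "(nat \<Rightarrow> complex) \<Rightarrow> bool" where
  "sqs c \<longleftrightarrow> summable (\<lambda>n. (cmod (c n))\<^sup>2)"

lemma sqs_bound: "summable g \<Longrightarrow> (\<And>n. (cmod (c n))\<^sup>2 \<le> g n) \<Longrightarrow> sqs c"
  unfolding sqs_def by (rule summable_comparison_test') auto

lemma sqs_add: "sqs c \<Longrightarrow> sqs d \<Longrightarrow> sqs (\<lambda>n. c n + d n)"
  by (rule sqs_bound[where g="\<lambda>n. 2 * (cmod (c n))\<^sup>2 + 2 * (cmod (d n))\<^sup>2"])
     (auto simp: sqs_def intro: cmod_add_sq summable_add summable_mult)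

lemma sqs_cmult: "sqs c \<Longrightarrow> sqs (\<lambda>n. a * c n)"
  by (auto simp: sqs_def norm_mult power_mult_distrib intro: summable_mult)

lemma sqs_cmult_iff: "a \<noteq> 0 \<Longrightarrow> sqs (\<lambda>n. a * c n) \<longleftrightarrow> sqs c"
  using sqs_cmult[of c a] sqs_cmult[of "\<lambda>n. a * c n" "1/a"] by auto

lemma sqs_minus_iff: "sqs (\<lambda>n. - c n) \<longleftrightarrow> sqs c"
  by (simp add: sqs_def)

lemma sqs_diff: "sqs c \<Longrightarrow> sqs d \<Longrightarrow> sqs (\<lambda>n. c n - d n)"
  using sqs_add[of c "\<lambda>n. - d n"] by (simp add: sqs_minus_iff)

text \<open>\<open>I\<close> marks the indices that carry a nonzero vector. The sines are indexed
  from 0 like the cosines, with the zero function at index 0, so that both families share one index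
  and one theory.\<close>

locale onsys =
  fixes ell :: real and e :: "nat \<Rightarrow> real \<Rightarrow> complex" and I :: "nat \<Rightarrow> bool"
  assumes L2_e: "L2 ell (e n)"
    and orth: "L2i ell (e m) (e n) = (if m = n \<and> I n then 1 else 0)"
begin

definition coef :: "(real \<Rightarrow> complex) \<Rightarrow> nat \<Rightarrow> complex" where
  "coef f n = L2i ell f (e n)"

definition part :: "(nat \<Rightarrow> complex) \<Rightarrow> nat set \<Rightarrow> real \<Rightarrow> complex" where
  "part c A x = (\<Sum>i\<in>A. c i * e i x)"

lemma L2_part: "L2 ell (part c A)"
  unfolding part_def by (intro L2_sum L2_cmult L2_e)

lemma coef_part: "finite A \<Longrightarrow> coef (part c A) n = (if n \<in> A \<and> I n then c n else 0)"
  unfolding coef_def part_def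
proof -
  assume A: "finite A"
  have "L2i ell (\<lambda>x. \<Sum>i\<in>A. c i * e i x) (e n) = (\<Sum>i\<in>A. if i = n then (if I n then c n else 0) else 0)"
    by (subst L2i_sum_left) (auto intro!: sum.cong L2_cmult L2_e simp: L2i_cmult_left orth)
  then show "L2i ell (\<lambda>x. \<Sum>i\<in>A. c i * e i x) (e n) = (if n \<in> A \<and> I n then c n else 0)"
    using A by simp
qed

lemma L2i_part:
  assumes "finite A" "L2 ell f"
  shows "L2i ell f (part c A) = (\<Sum>i\<in>A. coef f i * cnj (c i))"
proof -
  have "L2i ell (part c A) f = (\<Sum>i\<in>A. c i * cnj (coef f i))"
    unfolding part_def coef_def
    by (subst L2i_sum_left) (auto intro: L2_cmult L2_e assms simp: L2i_cmult_left L2i_commute[of ell f])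
  then have "cnj (L2i ell (part c A) f) = (\<Sum>i\<in>A. coef f i * cnj (c i))"
    by (simp add: mult.commute)
  then show ?thesis by (simp add: L2i_commute[of ell f])
qed

lemma coef_not_I: assumes "L2 ell f" "\<not> I n" shows "coef f n = 0"
proof -
  have "L2n ell (e n) = 0" using orth[of n n] assms(2) unfolding L2i_self by simp
  then show ?thesis
    using L2i_Cauchy_Schwarz[OF assms(1) L2_e, of n] by (simp add: coef_def)
qed

lemma L2n_part:
  assumes "finite A"
  shows "(L2n ell (part c A))\<^sup>2 = (\<Sum>i\<in>{i\<in>A. I i}. (cmod (c i))\<^sup>2)"
proof -
  have "complex_of_real ((L2n ell (part c A))\<^sup>2) = L2i ell (part c A) (part c A)" by (simp only: L2i_self)
  also have "\<dots> = (\<Sum>i\<in>A. coef (part c A) i * cnj (c i))"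
    by (rule L2i_part[OF assms L2_part])
  also have "\<dots> = (\<Sum>i\<in>A. if I i then complex_of_real ((cmod (c i))\<^sup>2) else 0)"
    by (intro sum.cong refl) (auto simp: coef_part[OF assms] simp del: of_real_power simp: complex_norm_square)
  also have "\<dots> = complex_of_real (\<Sum>i\<in>{i\<in>A. I i}. (cmod (c i))\<^sup>2)"
    using assms unfolding sum.inter_filter[OF assms] of_real_sum by (intro sum.cong) auto
  finally show ?thesis using of_real_eq_iff by blast
qed

text \<open>Expanding the square, the two mixed terms and the square of the projection are all the
  same sum; two enter with a minus sign and one with a plus.\<close>

lemma bessel_part:
  assumes "L2 ell f" "finite A"
  shows "(L2n ell (\<lambda>x. f x - part (coef f) A x))\<^sup>2 = (L2n ell f)\<^sup>2 - (\<Sum>i\<in>A. (cmod (coef f i))\<^sup>2)"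
proof -
  let ?p = "part (coef f) A"
  have 1: "L2i ell f ?p = of_real (\<Sum>i\<in>A. (cmod (coef f i))\<^sup>2)"
    unfolding L2i_part[OF assms(2,1)] of_real_sum by (intro sum.cong refl complex_norm_square[symmetric])
  have "(L2n ell ?p)\<^sup>2 = (\<Sum>i\<in>A. (cmod (coef f i))\<^sup>2)"
    unfolding L2n_part[OF assms(2)] by (rule sum.mono_neutral_left) (use assms coef_not_I in auto)
  then have 2: "L2i ell ?p ?p = of_real (\<Sum>i\<in>A. (cmod (coef f i))\<^sup>2)"
    unfolding L2i_self by (rule arg_cong)
  have 3: "L2i ell ?p f = of_real (\<Sum>i\<in>A. (cmod (coef f i))\<^sup>2)"
    by (subst L2i_commute) (simp add: 1)
  let ?d = "\<lambda>x. f x - ?p x"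
  have d: "L2 ell ?d" by (intro L2_diff L2_part assms)
  have "complex_of_real ((L2n ell ?d)\<^sup>2) = L2i ell f ?d - L2i ell ?p ?d"
    unfolding L2i_self[symmetric] by (rule L2i_diff_left) (intro assms L2_part d)+
  also have "L2i ell f ?d = cnj (L2i ell f f - L2i ell ?p f)"
    by (subst L2i_commute, subst L2i_diff_left) (auto intro: assms L2_part)
  also have "L2i ell ?p ?d = cnj (L2i ell f ?p - L2i ell ?p ?p)"
    by (subst L2i_commute, subst L2i_diff_left) (auto intro: assms L2_part)
  also have "cnj (L2i ell f f - L2i ell ?p f) - cnj (L2i ell f ?p - L2i ell ?p ?p)
      = of_real ((L2n ell f)\<^sup>2 - (\<Sum>i\<in>A. (cmod (coef f i))\<^sup>2))"
    unfolding 1 2 3 unfolding L2i_self complex_cnj_diff complex_cnj_complex_of_real of_real_diff by (simp only: diff_self diff_0_right)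
  finally show ?thesis using of_real_eq_iff by blast
qed

lemma sqs_coef: assumes "L2 ell f" shows "sqs (coef f)"
  unfolding sqs_def
proof (rule summableI_nonneg_bounded)
  show "sum (\<lambda>n. (cmod (coef f n))\<^sup>2) {..<n} \<le> (L2n ell f)\<^sup>2" for n
    using bessel_part[OF assms, of "{..<n}"] zero_le_power2[of "L2n ell (\<lambda>x. f x - part (coef f) {..<n} x)"]
    by simp
qed simp

lemma Riesz_Fischer_limit:
  assumes c: "sqs c"
  shows "\<exists>f. L2 ell f \<and> (\<lambda>n. L2n ell (\<lambda>x. part c {..<n} x - f x)) \<longlonglongrightarrow> 0"
proof (rule L2_complete[OF L2_part])
  fix r :: real assume "r > 0"
  obtain N where N: "\<And>m n. m \<ge> N \<Longrightarrow> norm (sum (\<lambda>n. (cmod (c n))\<^sup>2) {m..<n}) < r\<^sup>2"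
    using summable_Cauchy[of "\<lambda>n. (cmod (c n))\<^sup>2"] c \<open>r > 0\<close> unfolding sqs_def by (meson zero_less_power)
  have *: "L2n ell (\<lambda>x. part c {..<i} x - part c {..<j} x) < r" if "N \<le> j" "j \<le> i" for i j
  proof -
    have 1: "(\<lambda>x. part c {..<i} x - part c {..<j} x) = part c {j..<i}"
    proof
      fix x
      have "sum (\<lambda>i. c i * e i x) {0..<i} - sum (\<lambda>i. c i * e i x) {0..<j} = sum (\<lambda>i. c i * e i x) {j..<i}"
        by (rule sum_diff_nat_ivl) (use that in auto)
      then show "part c {..<i} x - part c {..<j} x = part c {j..<i} x"
        by (simp add: part_def lessThan_atLeast0)
    qed
    have "(L2n ell (part c {j..<i}))\<^sup>2 \<le> (\<Sum>i\<in>{j..<i}. (cmod (c i))\<^sup>2)"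
      by (subst L2n_part) (auto intro!: sum_mono2)
    also have "\<dots> < r\<^sup>2"
    proof -
      have "\<bar>\<Sum>i\<in>{j..<i}. (cmod (c i))\<^sup>2\<bar> < r\<^sup>2"
        using N[of j i] that(1) by (simp only: real_norm_def)
      then show ?thesis by linarith
    qed
    finally have "(L2n ell (\<lambda>x. part c {..<i} x - part c {..<j} x))\<^sup>2 < r\<^sup>2"
      unfolding 1 .
    then show ?thesis by (rule power2_less_imp_less) (use \<open>r > 0\<close> in simp)
  qed
  have sym: "L2n ell (\<lambda>x. part c {..<i} x - part c {..<j} x) = L2n ell (\<lambda>x. part c {..<j} x - part c {..<i} x)" for i j
    by (simp add: L2n_def norm_minus_commute)
  show "\<exists>N. \<forall>i\<ge>N. \<forall>j\<ge>N. L2n ell (\<lambda>x. part c {..<i} x - part c {..<j} x) < r"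
    using * sym by (intro exI[of _ N] allI impI) (metis nle_le)
qed

lemma Riesz_Fischer:
  assumes c: "sqs c" and I: "\<And>n. \<not> I n \<Longrightarrow> c n = 0"
  shows "\<exists>f. L2 ell f \<and> (\<forall>n. coef f n = c n)"
proof -
  obtain f where f: "L2 ell f" "(\<lambda>n. L2n ell (\<lambda>x. part c {..<n} x - f x)) \<longlonglongrightarrow> 0"
    using Riesz_Fischer_limit[OF c] by blast
  have "coef f n = c n" for n
  proof -
    have "(\<lambda>m. coef (part c {..<m}) n) \<longlonglongrightarrow> coef f n"
      unfolding coef_def by (rule L2i_tendsto_left[OF L2_part f(1) L2_e f(2)])
    moreover have "(\<lambda>m. coef (part c {..<m}) n) \<longlonglongrightarrow> c n"
      by (rule tendsto_eventually) (rule eventually_sequentiallyI[of "Suc n"], use I[of n] in \<open>auto simp: coef_part\<close>)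
    ultimately show ?thesis by (rule LIMSEQ_unique)
  qed
  with f show ?thesis by blast
qed

end

locale onbasis = onsys +
  assumes complete: "L2 ell f \<Longrightarrow> (\<And>n. coef f n = 0) \<Longrightarrow> AE x in Om ell. f x = 0"
begin

lemma coef_eq_AE:
  assumes "L2 ell f" "L2 ell g" "\<And>n. coef f n = coef g n"
  shows "AE x in Om ell. f x = g x"
proof -
  have "AE x in Om ell. f x - g x = 0"
    by (rule complete) (use assms in \<open>auto intro: L2_diff L2_e simp: coef_def L2i_diff_left L2_e\<close>)
  then show ?thesis by simp
qed

text \<open>The partial sums converge to some g by Riesz-Fischer; g has the same coefficients as f,
  and completeness identifies the two a.e.\<close>

lemma part_tendsto:
  assumes "L2 ell f"
  shows "(\<lambda>n. L2n ell (\<lambda>x. part (coef f) {..<n} x - f x)) \<longlonglongrightarrow> 0"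
proof -
  obtain g where g: "L2 ell g" "(\<lambda>n. L2n ell (\<lambda>x. part (coef f) {..<n} x - g x)) \<longlonglongrightarrow> 0"
    using Riesz_Fischer_limit[OF sqs_coef[OF assms]] by blast
  have "coef g n = coef f n" for n
  proof -
    have "(\<lambda>m. coef (part (coef f) {..<m}) n) \<longlonglongrightarrow> coef g n"
      using L2i_tendsto_left[OF L2_part g(1) L2_e g(2), of n] by (simp only: coef_def[symmetric])
    moreover have "(\<lambda>m. coef (part (coef f) {..<m}) n) \<longlonglongrightarrow> coef f n"
      by (rule tendsto_eventually)
         (rule eventually_sequentiallyI[of "Suc n"], use coef_not_I[OF assms, of n] in \<open>auto simp: coef_part\<close>)
    ultimately show ?thesis by (rule LIMSEQ_unique)
  qed
  then have ae: "AE x in Om ell. g x = f x" by (intro coef_eq_AE g assms)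
  have "L2n ell (\<lambda>x. part (coef f) {..<n} x - g x) = L2n ell (\<lambda>x. part (coef f) {..<n} x - f x)" for n
    by (rule L2n_cong_AE) (use ae in \<open>auto intro: L2_diff L2_part g\<close>)
  then show ?thesis using g(2) by simp
qed

lemma parseval:
  assumes "L2 ell f" shows "(\<lambda>n. (cmod (coef f n))\<^sup>2) sums (L2n ell f)\<^sup>2"
proof -
  have "L2n ell (\<lambda>x. f x - part (coef f) {..<n} x) = L2n ell (\<lambda>x. part (coef f) {..<n} x - f x)" for n
    by (simp add: L2n_def norm_minus_commute)
  then have "(L2n ell (\<lambda>x. part (coef f) {..<n} x - f x))\<^sup>2 = (L2n ell f)\<^sup>2 - (\<Sum>i<n. (cmod (coef f i))\<^sup>2)" for n
    using bessel_part[OF assms, of "{..<n}"] by simp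
  then have "(\<lambda>n. (L2n ell f)\<^sup>2 - (\<Sum>i<n. (cmod (coef f i))\<^sup>2)) \<longlonglongrightarrow> 0\<^sup>2"
    using tendsto_power[OF part_tendsto[OF assms], of 2] by simp
  from tendsto_diff[OF tendsto_const[of "(L2n ell f)\<^sup>2"] this] show ?thesis
    by (simp add: sums_def)
qed

lemma parseval_inner:
  assumes "L2 ell f" "L2 ell g"
  shows "(\<lambda>n. coef f n * cnj (coef g n)) sums L2i ell f g"
proof -
  have "(\<lambda>n. L2i ell (part (coef f) {..<n}) g) \<longlonglongrightarrow> L2i ell f g"
    by (rule L2i_tendsto_left[OF L2_part assms part_tendsto[OF assms(1)]])
  moreover have "L2i ell (part (coef f) {..<n}) g = (\<Sum>i<n. coef f i * cnj (coef g i))" for n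
    by (subst L2i_commute) (simp add: L2i_part assms mult.commute)
  ultimately show ?thesis by (simp add: sums_def)
qed

end

section \<open>Smooth functions and cutoffs\<close>

text \<open>Smoothness is a statement about all iterates of \<open>deriv\<close>, and a class of
  differentiable functions closed under \<open>deriv\<close> makes the induction immediate. The
  smoothness proofs below differ mainly in the choice of P.\<close>

lemma smooth_fun_class:
  assumes "P f" and D: "\<And>f. P f \<Longrightarrow> f differentiable_on UNIV \<and> P (deriv f)"
  shows "smooth_fun f"
proof -
  have "P ((deriv ^^ n) f)" for n
    by (induction n) (simp_all add: assms(1) D[THEN conjunct2])
  then show ?thesis using D[THEN conjunct1] by (simp add: smooth_fun_def)
qed

lemma smooth_fun_DERIV:
  assumes "smooth_fun f" shows "(f has_real_derivative deriv f x) (at x)"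
proof -
  have "f differentiable_on UNIV" using assms unfolding smooth_fun_def by (metis funpow_0)
  then show ?thesis
    by (simp add: DERIV_deriv_iff_real_differentiable differentiable_on_def)
qed

lemma smooth_fun_deriv: assumes "smooth_fun f" shows "smooth_fun (deriv f)"
  unfolding smooth_fun_def
proof
  fix n show "(deriv ^^ n) (deriv f) differentiable_on UNIV"
    using assms[unfolded smooth_fun_def, rule_format, of "Suc n"] by (simp add: funpow_swap1)
qed

lemma smooth_fun_continuous: assumes "smooth_fun f" shows "continuous_on A f"
  using smooth_fun_DERIV[OF assms] by (meson DERIV_isCont continuous_at_imp_continuous_on)

lemma differentiable_on_UNIV_real:
  fixes f :: "real \<Rightarrow> real"
  shows "(\<And>x. (f has_real_derivative g x) (at x)) \<Longrightarrow> f differentiable_on UNIV"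
  by (auto simp: differentiable_on_def real_differentiable_def)

lemma smooth_fun_mult:
  assumes "smooth_fun f" "smooth_fun g"
  shows "smooth_fun (\<lambda>x. f x * g x)"
proof -
  \<comment> \<open>The product rule doubles the number of products, so the class consists of finite
    sums of products of smooth functions.\<close>
  define P where "P h \<longleftrightarrow> (\<exists>(m::nat) F G. (\<forall>i<m. smooth_fun (F i) \<and> smooth_fun (G i)) \<and>
      h = (\<lambda>x. \<Sum>i<m. F i x * G i x))" for h :: "real \<Rightarrow> real"
  have D: "h differentiable_on UNIV \<and> P (deriv h)" if Ph: "P h" for h
  proof -
    obtain m F G where *: "\<forall>i<(m::nat). smooth_fun (F i) \<and> smooth_fun (G i)"
      "h = (\<lambda>x. \<Sum>i<m. F i x * G i x)" using Ph unfolding P_def by blast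
    have d: "(h has_real_derivative (\<Sum>i<m. deriv (F i) x * G i x + F i x * deriv (G i) x)) (at x)" for x
      unfolding *(2) using *(1) by (auto intro!: derivative_eq_intros smooth_fun_DERIV sum.cong)
    define F' where "F' i = (if i < m then deriv (F i) else F (i - m))" for i
    define G' where "G' i = (if i < m then G i else deriv (G (i - m)))" for i
    have sm: "\<forall>i<m+m. smooth_fun (F' i) \<and> smooth_fun (G' i)"
      using *(1) by (auto simp: F'_def G'_def smooth_fun_deriv)
    have "(\<Sum>i<m+m. F' i x * G' i x) = (\<Sum>i<m. deriv (F i) x * G i x) + (\<Sum>i<m. F i x * deriv (G i) x)" for x
    proof -
      have "(\<Sum>i<m+m. F' i x * G' i x) = (\<Sum>i\<in>{0..<m}. F' i x * G' i x) + (\<Sum>i\<in>{m..<m+m}. F' i x * G' i x)"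
        unfolding lessThan_atLeast0 by (simp add: sum.atLeastLessThan_concat)
      also have "(\<Sum>i\<in>{m..<m+m}. F' i x * G' i x) = (\<Sum>i\<in>{0..<m}. F' (i+m) x * G' (i+m) x)"
        using sum.shift_bounds_nat_ivl[of "\<lambda>i. F' i x * G' i x" 0 m m] by simp
      finally show ?thesis by (simp add: F'_def G'_def lessThan_atLeast0)
    qed
    then have "deriv h = (\<lambda>x. \<Sum>i<m+m. F' i x * G' i x)"
      using d by (auto simp: fun_eq_iff sum.distrib intro!: DERIV_imp_deriv)
    then have "P (deriv h)" unfolding P_def using sm by blast
    with differentiable_on_UNIV_real[OF d] show ?thesis by blast
  qed
  have "P (\<lambda>x. f x * g x)" unfolding P_def
    by (rule exI[of _ 1], rule exI[of _ "\<lambda>_. f"], rule exI[of _ "\<lambda>_. g"]) (use assms in simp)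
  then show ?thesis using D by (rule smooth_fun_class[of P])
qed

lemma smooth_fun_affine:
  assumes "smooth_fun f" shows "smooth_fun (\<lambda>x. f (a * x + b))"
proof -
  define P where "P h \<longleftrightarrow> (\<exists>c F. smooth_fun F \<and> h = (\<lambda>x. c * F (a * x + b)))" for h :: "real \<Rightarrow> real"
  have D: "h differentiable_on UNIV \<and> P (deriv h)" if Ph: "P h" for h
  proof -
    obtain c F where *: "smooth_fun F" "h = (\<lambda>x. c * F (a * x + b))" using Ph unfolding P_def by blast
    have d: "(h has_real_derivative (c * a) * deriv F (a * x + b)) (at x)" for x
    proof -
      have "((\<lambda>x. F (a * x + b)) has_real_derivative deriv F (a * x + b) * a) (at x)"
        by (rule DERIV_chain2[OF smooth_fun_DERIV[OF *(1)]]) (auto intro!: derivative_eq_intros)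
      from DERIV_cmult[OF this, of c] show ?thesis by (simp add: *(2) ac_simps)
    qed
    then have "deriv h = (\<lambda>x. (c * a) * deriv F (a * x + b))" by (auto simp: fun_eq_iff intro!: DERIV_imp_deriv)
    then have "P (deriv h)" unfolding P_def using smooth_fun_deriv[OF *(1)] by blast
    with differentiable_on_UNIV_real[OF d] show ?thesis by blast
  qed
  have "P (\<lambda>x. f (a * x + b))" unfolding P_def
    by (rule exI[of _ 1], rule exI[of _ f]) (use assms in simp)
  then show ?thesis using D by (rule smooth_fun_class[of P])
qed

lemma smooth_fun_sin_cos: "smooth_fun (\<lambda>x. A * sin (a * x) + B * cos (a * x))"
proof -
  define P where "P h \<longleftrightarrow> (\<exists>A B. h = (\<lambda>x. A * sin (a * x) + B * cos (a * x)))" for h :: "real \<Rightarrow> real"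
  have D: "h differentiable_on UNIV \<and> P (deriv h)" if Ph: "P h" for h
  proof -
    obtain A B where *: "h = (\<lambda>x. A * sin (a * x) + B * cos (a * x))" using Ph unfolding P_def by blast
    have d: "(h has_real_derivative (- B * a) * sin (a * x) + (A * a) * cos (a * x)) (at x)" for x
      unfolding * by (auto intro!: derivative_eq_intros)
    then have "deriv h = (\<lambda>x. (- B * a) * sin (a * x) + (A * a) * cos (a * x))"
      by (auto simp: fun_eq_iff intro!: DERIV_imp_deriv)
    then have "P (deriv h)" unfolding P_def by blast
    with differentiable_on_UNIV_real[OF d] show ?thesis by blast
  qed
  have "P (\<lambda>x. A * sin (a * x) + B * cos (a * x))" unfolding P_def by blast
  then show ?thesis using D by (rule smooth_fun_class[of P])
qed

lemma smooth_fun_sin: "smooth_fun (\<lambda>x. A * sin (a * x))"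
  using smooth_fun_sin_cos[of A a 0] by simp

lemma smooth_fun_cos: "smooth_fun (\<lambda>x. A * cos (a * x))"
  using smooth_fun_sin_cos[of 0 a A] by simp

text \<open>The classical smooth function vanishing to infinite order at 0. It tends to 1 at
  infinity, so rescaled copies serve as cutoffs.\<close>

definition flat :: "real \<Rightarrow> real" where
  "flat x = (if x > 0 then exp (- (1/x)) else 0)"

lemma poly_exp_tendsto_0: "((\<lambda>y. poly p y * exp (- y)) \<longlongrightarrow> 0) at_top" for p :: "real poly"
proof -
  have "((\<lambda>y. \<Sum>i\<le>degree p. coeff p i * (y ^ i / exp y)) \<longlongrightarrow> (\<Sum>i\<le>degree p. coeff p i * 0)) at_top"
    by (intro tendsto_intros tendsto_power_div_exp_0)
  then show ?thesis
    by (simp add: poly_altdef sum_divide_distrib exp_minus field_simps)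
qed

text \<open>With y = 1/x, the derivative of p(y) exp(-y) in x is y^2 (p(y) - p'(y)) exp(-y).
  Functions of this form are thus closed under \<open>deriv\<close>, which yields the smoothness of
  \<open>flat\<close>.\<close>

lemma DERIV_flat_poly:
  fixes p :: "real poly"
  defines "f \<equiv> \<lambda>p x. if x > 0 then poly p (1/x) * exp (- (1/x)) else (0::real)"
  shows "(f p has_real_derivative f ([:0,0,1:] * (p - pderiv p)) x) (at x)"
proof (cases x "0::real" rule: linorder_cases)
  case less
  have "((\<lambda>x. 0::real) has_real_derivative f ([:0,0,1:] * (p - pderiv p)) x) (at x)"
    using less by (simp add: f_def)
  then show ?thesis
    by (rule DERIV_cong_ev[THEN iffD1, rotated -1])
       (use less in \<open>auto simp: f_def eventually_nhds intro!: exI[of _ "{..<0}"]\<close>)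
next
  case greater
  have "((\<lambda>x. poly p (1/x) * exp (- (1/x))) has_real_derivative
      (poly (pderiv p) (1/x) * (-1 / x\<^sup>2) * exp (- (1/x)) + exp (- (1/x)) * (1/x\<^sup>2) * poly p (1/x))) (at x)"
  proof (rule derivative_eq_intros)
    show "((\<lambda>x. poly p (1/x)) has_real_derivative poly (pderiv p) (1/x) * (-1 / x\<^sup>2)) (at x)"
      by (rule DERIV_chain2[OF poly_DERIV]) (use greater in \<open>auto intro!: derivative_eq_intros simp: power2_eq_square\<close>)
    show "((\<lambda>x. exp (- (1/x))) has_real_derivative exp (- (1/x)) * (1/x\<^sup>2)) (at x)"
      using greater by (auto intro!: derivative_eq_intros simp: power2_eq_square)
  qed simp
  also have "(poly (pderiv p) (1/x) * (-1 / x\<^sup>2) * exp (- (1/x)) + exp (- (1/x)) * (1/x\<^sup>2) * poly p (1/x))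
    = f ([:0,0,1:] * (p - pderiv p)) x"
    using greater by (simp add: f_def field_simps power2_eq_square)
  finally show ?thesis
    by (rule DERIV_cong_ev[THEN iffD1, rotated -1])
       (use greater in \<open>auto simp: f_def eventually_nhds intro!: exI[of _ "{0<..}"]\<close>)
next
  case equal
  have "((\<lambda>h. (f p h - f p 0) / h) \<longlongrightarrow> 0) (at_right 0)"
  proof -
    \<comment> \<open>Dividing by h is multiplying by y = 1/h, hence \<open>pCons 0 p\<close>; the
      exponential beats every polynomial.\<close>
    have "((\<lambda>h. poly (pCons 0 p) (inverse h) * exp (- (inverse h))) \<longlongrightarrow> 0) (at_right (0::real))"
      by (rule filterlim_compose[OF poly_exp_tendsto_0 filterlim_inverse_at_top_right])
    moreover have "\<forall>\<^sub>F h in at_right 0. poly (pCons 0 p) (inverse h) * exp (- (inverse h)) = (f p h - f p 0) / h"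
      by (auto simp: f_def field_simps eventually_at_filter)
    ultimately show ?thesis by (rule Lim_transform_eventually)
  qed
  moreover have "((\<lambda>h. (f p h - f p 0) / h) \<longlongrightarrow> 0) (at_left 0)"
    by (rule tendsto_eventually) (auto simp: f_def eventually_at_filter)
  ultimately have "((\<lambda>h. (f p h - f p 0) / h) \<longlongrightarrow> 0) (at 0)"
    by (rule filterlim_split_at_real[rotated])
  then show ?thesis unfolding equal DERIV_def add_0 by (simp add: f_def)
qed

lemma smooth_fun_flat: "smooth_fun flat"
proof -
  define f where "f p x = (if x > 0 then poly p (1/x) * exp (- (1/x)) else (0::real))" for p x
  have D: "(f p has_real_derivative f ([:0,0,1:] * (p - pderiv p)) x) (at x)" for p x
    unfolding f_def[abs_def] by (rule DERIV_flat_poly)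
  have "h differentiable_on UNIV \<and> deriv h \<in> range f" if hr: "h \<in> range f" for h
  proof -
    obtain p where h: "h = f p" using hr by blast
    have "deriv h = f ([:0,0,1:] * (p - pderiv p))"
      unfolding h using D by (auto simp: fun_eq_iff intro!: DERIV_imp_deriv)
    then show ?thesis using differentiable_on_UNIV_real[OF D] unfolding h by blast
  qed
  moreover have "flat = f 1" by (auto simp: f_def flat_def fun_eq_iff)
  ultimately show ?thesis by (intro smooth_fun_class[of "\<lambda>h. h \<in> range f"]) auto
qed

lemma deriv_flat: "deriv flat x = (if x > 0 then (1/x)\<^sup>2 * exp (- (1/x)) else 0)"
proof (rule DERIV_imp_deriv)
  have "flat = (\<lambda>x. if x > 0 then poly 1 (1/x) * exp (- (1/x)) else (0::real))"
    by (auto simp: flat_def fun_eq_iff)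
  then show "(flat has_real_derivative (if x > 0 then (1/x)\<^sup>2 * exp (- (1/x)) else 0)) (at x)"
    using DERIV_flat_poly[of 1 x] by (simp add: power2_eq_square cong: if_cong)
qed

lemma flat_bounds: "0 \<le> flat x" "flat x \<le> 1"
  by (auto simp: flat_def)

lemma flat_eq_0: "x \<le> 0 \<Longrightarrow> flat x = 0"
  by (auto simp: flat_def)

section \<open>Test functions and cutoffs near the ends of the interval\<close>

lemma test_fun_smooth: "test_fun S \<phi> \<Longrightarrow> smooth_fun \<phi>"
  by (simp add: test_fun_def)

lemma test_fun_mult:
  assumes "test_fun S \<phi>" "smooth_fun g" shows "test_fun S (\<lambda>x. \<phi> x * g x)"
proof -
  obtain K where K: "compact K" "K \<subseteq> S" "\<And>x. x \<notin> K \<Longrightarrow> \<phi> x = 0"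
    using assms unfolding test_fun_def by blast
  have "smooth_fun (\<lambda>x. \<phi> x * g x)" using assms by (auto simp: test_fun_def intro: smooth_fun_mult)
  moreover have "\<forall>x. x \<notin> K \<longrightarrow> \<phi> x * g x = 0" using K(3) by simp
  ultimately show ?thesis using K(1,2) unfolding test_fun_def by blast
qed

lemma test_fun_deriv:
  assumes "test_fun S \<phi>" shows "test_fun S (deriv \<phi>)"
proof -
  obtain K where K: "compact K" "K \<subseteq> S" "\<And>x. x \<notin> K \<Longrightarrow> \<phi> x = 0"
    using assms unfolding test_fun_def by blast
  have "deriv \<phi> x = 0" if "x \<notin> K" for x
  proof (rule DERIV_imp_deriv)
    have "open (- K)" using K(1) by (simp add: compact_imp_closed open_Compl)
    moreover have "((\<lambda>x. 0::real) has_real_derivative 0) (at x)" by simp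
    ultimately show "(\<phi> has_real_derivative 0) (at x)"
      using has_field_derivative_transform_within_open[of "\<lambda>x. 0" 0 x "-K" \<phi>] K(3) that by auto
  qed
  then show ?thesis using assms K smooth_fun_deriv unfolding test_fun_def by blast
qed

lemma test_fun_mono: "test_fun S \<phi> \<Longrightarrow> S \<subseteq> T \<Longrightarrow> test_fun T \<phi>"
  unfolding test_fun_def by blast

lemma test_fun_outside: "test_fun S \<phi> \<Longrightarrow> x \<notin> S \<Longrightarrow> \<phi> x = 0"
  unfolding test_fun_def by blast

lemma test_fun_bounded:
  assumes "test_fun S \<phi>" shows "\<exists>B. \<forall>x. \<bar>\<phi> x\<bar> \<le> B"
proof -
  obtain K where K: "compact K" "\<And>x. x \<notin> K \<Longrightarrow> \<phi> x = 0"
    using assms unfolding test_fun_def by blast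
  have "bounded (\<phi> ` K)"
    using K(1) smooth_fun_continuous[OF test_fun_smooth[OF assms]] by (intro compact_imp_bounded compact_continuous_image)
  then obtain B where "B > 0" "\<And>x. x \<in> K \<Longrightarrow> \<bar>\<phi> x\<bar> \<le> B" unfolding bounded_pos by auto
  then show ?thesis using K(2) by (metis abs_zero less_imp_le)
qed

text \<open>The compact support is bounded. This reduces weak derivatives on the half-line to those
  on bounded intervals.\<close>

lemma test_fun_half_line:
  assumes "test_fun {0<..} \<phi>"
  obtains L where "L > 0" "test_fun {0<..<L} \<phi>"
proof -
  obtain K where K: "compact K" "K \<subseteq> {0<..}" "\<And>x. x \<notin> K \<Longrightarrow> \<phi> x = 0"
    using assms unfolding test_fun_def by blast
  obtain B where B: "B > 0" "\<And>x. x \<in> K \<Longrightarrow> norm x \<le> B"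
    using compact_imp_bounded[OF K(1)] unfolding bounded_pos by auto
  show ?thesis
  proof
    show "test_fun {0<..<B+1} \<phi>" unfolding test_fun_def
      using test_fun_smooth[OF assms] K B(2) by (force intro!: exI[of _ K])
  qed (use B in simp)
qed

text \<open>\<open>flat\<close> has no plateau, so a cutoff never equals 1 and only tends to 1
  pointwise. It vanishes within 1/(m+1) of either end, which makes its product with any smooth
  function a test function.\<close>

definition cutoff :: "real \<Rightarrow> nat \<Rightarrow> real \<Rightarrow> real" where
  "cutoff ell m x = flat (real (Suc m) * x - 1) * flat (real (Suc m) * (ell - x) - 1)"

lemma smooth_fun_cutoff: "smooth_fun (cutoff ell m)"
proof -
  have "smooth_fun (\<lambda>x. flat (real (Suc m) * x + (-1)) * flat (- real (Suc m) * x + (real (Suc m) * ell - 1)))"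
    by (intro smooth_fun_mult smooth_fun_affine smooth_fun_flat)
  then show ?thesis by (simp add: cutoff_def[abs_def] algebra_simps)
qed

lemma test_fun_cutoff:
  assumes "smooth_fun g" shows "test_fun {0<..<ell} (\<lambda>x. cutoff ell m x * g x)"
  unfolding test_fun_def
proof (intro conjI exI)
  show "smooth_fun (\<lambda>x. cutoff ell m x * g x)" by (intro smooth_fun_mult smooth_fun_cutoff assms)
  let ?d = "1 / real (Suc m)"
  show "compact {?d..ell - ?d}" by simp
  show "{?d..ell - ?d} \<subseteq> {0<..<ell}"
  proof
    fix x assume "x \<in> {?d..ell - ?d}"
    moreover have "?d > 0" by simp
    ultimately show "x \<in> {0<..<ell}" unfolding atLeastAtMost_iff greaterThanLessThan_iff by linarith
  qed
  show "\<forall>x. x \<notin> {?d..ell - ?d} \<longrightarrow> cutoff ell m x * g x = 0"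
    by (auto simp: cutoff_def not_le field_simps intro!: flat_eq_0 simp del: of_nat_Suc)
qed

lemma cutoff_bounds: "0 \<le> cutoff ell m x" "cutoff ell m x \<le> 1"
  unfolding cutoff_def by (auto intro!: mult_nonneg_nonneg mult_le_one flat_bounds)

lemma flat_tendsto_1: "(flat \<longlongrightarrow> 1) at_top"
proof -
  have "((\<lambda>x. exp (- (1/x))) \<longlongrightarrow> exp (- 0)) (at_top :: real filter)"
    by (intro tendsto_intros tendsto_divide_0[OF tendsto_const] filterlim_at_top_imp_at_infinity filterlim_ident)
  moreover have "\<forall>\<^sub>F x in at_top. exp (- (1/x)) = flat x"
    using eventually_gt_at_top[of 0] by eventually_elim (simp add: flat_def)
  ultimately have "(flat \<longlongrightarrow> exp (- 0)) at_top" by (rule Lim_transform_eventually)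
  then show ?thesis by simp
qed

lemma filterlim_Suc_mult_at_top:
  assumes "c > 0" shows "filterlim (\<lambda>m. real (Suc m) * c - 1) at_top sequentially"
proof -
  have "filterlim (\<lambda>m. -1 + c * real (Suc m)) at_top sequentially"
    by (intro filterlim_tendsto_add_at_top[OF tendsto_const] filterlim_tendsto_pos_mult_at_top[OF tendsto_const assms]
          filterlim_compose[OF filterlim_real_sequentially filterlim_Suc])
  then show ?thesis by (simp add: algebra_simps)
qed

lemma cutoff_tendsto_1:
  assumes "x \<in> {0<..<ell}" shows "(\<lambda>m. cutoff ell m x) \<longlonglongrightarrow> 1"
proof -
  have "(\<lambda>m. cutoff ell m x) \<longlonglongrightarrow> 1 * 1"
    unfolding cutoff_def
    by (intro tendsto_mult filterlim_compose[OF flat_tendsto_1] filterlim_Suc_mult_at_top) (use assms in auto)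
  then show ?thesis by simp
qed

text \<open>With y = M x - 1 the first bound says that M x times the derivative of
  \<open>flat\<close> at M x - 1 is at most 3: the slope of the cutoff is of order 1/x uniformly in
  M. The constant comes from u + u^2 <= 3 (1 + u + u^2/2) <= 3 exp u at u = 1/y.\<close>

lemma flat_weight_bound: "(y + 1) * deriv flat y \<le> 3" "0 \<le> deriv flat y"
proof -
  show "0 \<le> deriv flat y" by (simp add: deriv_flat)
  show "(y + 1) * deriv flat y \<le> 3"
  proof (cases "y > 0")
    case True
    define u where "u = 1 / y"
    have u: "u > 0" using True by (simp add: u_def)
    have "1 + u + u\<^sup>2 / 2 \<le> exp u" using exp_lower_Taylor_quadratic[of u] u by simp
    then have "u + u\<^sup>2 \<le> 3 * exp u" using u zero_le_power2[of u] by linarith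
    then have "(u + u\<^sup>2) * exp (- u) \<le> 3" by (simp add: exp_minus field_simps)
    moreover have "(y + 1) * deriv flat y = (u + u\<^sup>2) * exp (- u)"
      using True by (simp add: deriv_flat u_def field_simps power2_eq_square)
    ultimately show ?thesis by simp
  qed (simp add: deriv_flat)
qed

lemma deriv_cutoff:
  "deriv (cutoff ell m) x = real (Suc m) * deriv flat (real (Suc m) * x - 1) * flat (real (Suc m) * (ell - x) - 1)
     - real (Suc m) * deriv flat (real (Suc m) * (ell - x) - 1) * flat (real (Suc m) * x - 1)"
proof (rule DERIV_imp_deriv)
  have 1: "((\<lambda>x. flat (real (Suc m) * x - 1)) has_real_derivative deriv flat (real (Suc m) * x - 1) * real (Suc m)) (at x)"
    by (rule DERIV_chain2[OF smooth_fun_DERIV[OF smooth_fun_flat]]) (auto intro!: derivative_eq_intros)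
  have 2: "((\<lambda>x. flat (real (Suc m) * (ell - x) - 1)) has_real_derivative deriv flat (real (Suc m) * (ell - x) - 1) * (- real (Suc m))) (at x)"
    by (rule DERIV_chain2[OF smooth_fun_DERIV[OF smooth_fun_flat]]) (auto intro!: derivative_eq_intros)
  show "(cutoff ell m has_real_derivative real (Suc m) * deriv flat (real (Suc m) * x - 1) * flat (real (Suc m) * (ell - x) - 1)
     - real (Suc m) * deriv flat (real (Suc m) * (ell - x) - 1) * flat (real (Suc m) * x - 1)) (at x)"
    unfolding cutoff_def[abs_def] by (rule DERIV_cong[OF DERIV_mult[OF 1 2]]) (simp add: algebra_simps)
qed

text \<open>Each of the two factors of the cutoff contributes 3. The slope may blow up like the
  inverse distance to the boundary, which is what a function vanishing linearly at the ends
  compensates.\<close>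

lemma deriv_cutoff_bound:
  assumes "x \<in> {0<..<ell}" shows "\<bar>deriv (cutoff ell m) x\<bar> * (min x (ell - x)) \<le> 6"
proof -
  let ?M = "real (Suc m)"
  have a: "?M * deriv flat (?M * y - 1) * flat z * min x (ell - x) \<le> 3"
    and a0: "0 \<le> ?M * deriv flat (?M * y - 1) * flat z" if "y \<ge> min x (ell - x)" for y z
  proof -
    show "0 \<le> ?M * deriv flat (?M * y - 1) * flat z"
      by (intro mult_nonneg_nonneg flat_weight_bound flat_bounds) simp
    have "?M * deriv flat (?M * y - 1) * flat z * min x (ell - x) \<le> ?M * deriv flat (?M * y - 1) * 1 * y"
      by (intro mult_mono mult_nonneg_nonneg flat_weight_bound flat_bounds that) (use assms that in auto)
    also have "\<dots> \<le> 3" using flat_weight_bound(1)[of "?M * y - 1"] by (simp add: algebra_simps)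
    finally show "?M * deriv flat (?M * y - 1) * flat z * min x (ell - x) \<le> 3" .
  qed
  have "\<bar>deriv (cutoff ell m) x\<bar> \<le> ?M * deriv flat (?M * x - 1) * flat (?M * (ell - x) - 1)
     + ?M * deriv flat (?M * (ell - x) - 1) * flat (?M * x - 1)"
    unfolding deriv_cutoff using a0[of x "?M * (ell - x) - 1"] a0[of "ell - x" "?M * x - 1"]
    by (simp add: abs_le_iff del: of_nat_Suc)
  then have "\<bar>deriv (cutoff ell m) x\<bar> * (min x (ell - x)) \<le> (?M * deriv flat (?M * x - 1) * flat (?M * (ell - x) - 1)
     + ?M * deriv flat (?M * (ell - x) - 1) * flat (?M * x - 1)) * (min x (ell - x))"
    by (rule mult_right_mono) (use assms in auto)
  also have "\<dots> \<le> 3 + 3" unfolding distrib_right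
    by (intro add_mono a) auto
  finally show ?thesis by simp
qed

lemma mult_deriv_flat_tendsto_0:
  assumes "c > 0" shows "(\<lambda>m. real (Suc m) * deriv flat (real (Suc m) * c - 1)) \<longlonglongrightarrow> 0"
proof -
  have "((\<lambda>y. (y + 1) * ((1/y)\<^sup>2 * exp (- (1/y)))) \<longlongrightarrow> 0) (at_top :: real filter)"
  proof -
    have "((\<lambda>y. (1/y + (1/y)\<^sup>2) * exp (- (1/y))) \<longlongrightarrow> (0 + 0\<^sup>2) * exp (- 0)) (at_top :: real filter)"
      by (intro tendsto_intros tendsto_divide_0[OF tendsto_const] filterlim_at_top_imp_at_infinity filterlim_ident)
    moreover have "\<forall>\<^sub>F y in at_top. (1/y + (1/y)\<^sup>2) * exp (- (1/y)) = (y + 1) * ((1/y)\<^sup>2 * exp (- (1/y :: real)))"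
      using eventually_gt_at_top[of 0] by eventually_elim (simp add: field_simps power2_eq_square)
    ultimately show ?thesis using Lim_transform_eventually by fastforce
  qed
  moreover have "\<forall>\<^sub>F y in at_top. (y + 1) * ((1/y)\<^sup>2 * exp (- (1/y))) = (y + 1) * deriv flat y"
    using eventually_gt_at_top[of 0] by eventually_elim (simp add: deriv_flat)
  ultimately have "((\<lambda>y. (y + 1) * deriv flat y) \<longlongrightarrow> 0) at_top"
    by (rule Lim_transform_eventually)
  from filterlim_compose[OF this filterlim_Suc_mult_at_top[OF assms]]
  have "(\<lambda>m. (real (Suc m) * c) * deriv flat (real (Suc m) * c - 1)) \<longlonglongrightarrow> 0" by simp
  from tendsto_mult_right[OF this, of "1/c"] show ?thesis using assms by (simp add: mult.assoc)
qed

lemma deriv_cutoff_tendsto_0: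
  assumes "x \<in> {0<..<ell}" shows "(\<lambda>m. deriv (cutoff ell m) x) \<longlonglongrightarrow> 0"
proof -
  have "(\<lambda>m. deriv (cutoff ell m) x) \<longlonglongrightarrow> 0 * 1 - 0 * 1"
    unfolding deriv_cutoff
    by (intro tendsto_mult tendsto_diff mult_deriv_flat_tendsto_0 filterlim_compose[OF flat_tendsto_1] filterlim_Suc_mult_at_top)
      (use assms in auto)
  then show ?thesis by simp
qed

section \<open>Sine and cosine bases\<close>

lemma integrable_Ioo_continuous:
  fixes f :: "real \<Rightarrow> 'a::euclidean_space"
  assumes "continuous_on {a..b} f" shows "integrable (lebesgue_on {a<..<b}) f"
proof -
  interpret finite_measure "lebesgue_on {a<..<b}" by (rule finite_measure_lebesgue_on) simp
  obtain B where B: "\<forall>x\<in>{a..b}. norm (f x) \<le> B"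
    using compact_imp_bounded[OF compact_continuous_image[OF assms compact_Icc]] unfolding bounded_iff by auto
  have "f \<in> borel_measurable (lebesgue_on {a<..<b})"
    by (intro continuous_imp_measurable_on_sets_lebesgue continuous_on_subset[OF assms]) auto
  then show ?thesis
    using B by (intro integrable_const_bound[of _ B] AE_I2) auto
qed

lemmas integrable_Om_continuous = integrable_Ioo_continuous[where a=0]

lemma L2_continuous:
  assumes "continuous_on {0..ell} f" shows "L2 ell f"
proof -
  obtain B where B: "\<forall>x\<in>{0..ell}. norm (f x) \<le> B"
    using compact_imp_bounded[OF compact_continuous_image[OF assms compact_Icc]] unfolding bounded_iff by auto
  have "f \<in> borel_measurable (Om ell)"
    by (intro continuous_imp_measurable_on_sets_lebesgue continuous_on_subset[OF assms]) auto
  then show ?thesis by (rule L2_bounded[where B=B]) (use B in auto)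
qed

lemma integral_Ioo_FTC:
  fixes F :: "real \<Rightarrow> 'a::euclidean_space"
  assumes "a \<le> b" "\<And>x. x \<in> {a..b} \<Longrightarrow> (F has_vector_derivative f x) (at x)" "continuous_on {a..b} f"
  shows "integral\<^sup>L (lebesgue_on {a<..<b}) f = F b - F a"
proof -
  have "(f has_integral (F b - F a)) {a..b}"
    by (rule fundamental_theorem_of_calculus) (use assms in \<open>auto intro: has_vector_derivative_at_within\<close>)
  then have "integral {a<..<b} f = F b - F a"
    by (metis integral_open_interval_real integral_unique)
  moreover have "integral\<^sup>L (lebesgue_on {a<..<b}) f = integral {a<..<b} f"
    by (intro lebesgue_integral_eq_integral integrable_Ioo_continuous assms) auto
  ultimately show ?thesis by simp
qed

lemmas integral_Om_FTC = integral_Ioo_FTC[where a=0]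

section \<open>The frequencies and the two trigonometric systems\<close>

definition freq :: "real \<Rightarrow> nat \<Rightarrow> real" where "freq ell n = real n * pi / ell"

definition sinb :: "real \<Rightarrow> nat \<Rightarrow> real \<Rightarrow> complex" where
  "sinb ell n x = complex_of_real (sqrt (2/ell) * sin (freq ell n * x))"

text \<open>The normalisation changes at n = 0, where the squared cosine integrates to ell and not
  to ell/2.\<close>

definition cosb :: "real \<Rightarrow> nat \<Rightarrow> real \<Rightarrow> complex" where
  "cosb ell n x = complex_of_real (sqrt ((if n = 0 then 1 else 2)/ell) * cos (freq ell n * x))"

lemma freq_0 [simp]: "freq ell 0 = 0" by (simp add: freq_def)

lemma freq_pos: "0 < ell \<Longrightarrow> 0 < n \<Longrightarrow> 0 < freq ell n" by (simp add: freq_def)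

lemma freq_nonneg: "0 < ell \<Longrightarrow> 0 \<le> freq ell n" by (simp add: freq_def)

lemma sinb_0 [simp]: "sinb ell 0 x = 0" by (simp add: sinb_def)

lemma continuous_sinb: "continuous_on A (sinb ell n)"
  unfolding sinb_def by (intro continuous_intros)

lemma continuous_cosb: "continuous_on A (cosb ell n)"
  unfolding cosb_def by (intro continuous_intros)

lemma L2_sinb: "L2 ell (sinb ell n)" by (intro L2_continuous continuous_sinb)

lemma L2_cosb: "L2 ell (cosb ell n)" by (intro L2_continuous continuous_cosb)

lemma deriv_sinb: "(sinb ell n has_vector_derivative of_real (freq ell n) * cosb ell n x) (at x)"
proof -
  have "((\<lambda>x. sqrt (2/ell) * sin (freq ell n * x)) has_real_derivative freq ell n * (sqrt ((if n = 0 then 1 else 2)/ell) * cos (freq ell n * x))) (at x)"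
    by (auto intro!: derivative_eq_intros)
  from has_vector_derivative_of_real[OF this] show ?thesis by (simp add: sinb_def[abs_def] cosb_def)
qed

lemma deriv_cosb: "(cosb ell n has_vector_derivative - of_real (freq ell n) * sinb ell n x) (at x)"
proof -
  have "((\<lambda>x. sqrt ((if n = 0 then 1 else 2)/ell) * cos (freq ell n * x)) has_real_derivative - freq ell n * (sqrt (2/ell) * sin (freq ell n * x))) (at x)"
    by (auto intro!: derivative_eq_intros)
  from has_vector_derivative_of_real[OF this] show ?thesis by (simp add: sinb_def cosb_def[abs_def])
qed

lemma sin_freq_end: "0 < ell \<Longrightarrow> sin (freq ell n * ell) = 0"
  by (simp add: freq_def)

lemma integral_cos_freq:
  assumes "0 < ell" shows "integral\<^sup>L (Om ell) (\<lambda>x. cos (freq ell n * x)) = (if n = 0 then ell else 0)"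
proof (cases "n = 0")
  case True
  have "integral\<^sup>L (Om ell) (\<lambda>x. 1::real) = ell - 0"
    by (rule integral_Om_FTC[where F="\<lambda>x. x"]) (use assms in \<open>auto intro!: derivative_eq_intros\<close>)
  then show ?thesis using True by simp
next
  case False
  have "integral\<^sup>L (Om ell) (\<lambda>x. cos (freq ell n * x)) = sin (freq ell n * ell) / freq ell n - sin (freq ell n * 0) / freq ell n"
    by (rule integral_Om_FTC[where F="\<lambda>x. sin (freq ell n * x) / freq ell n"])
       (use assms False freq_pos[of ell n] in \<open>auto intro!: derivative_eq_intros continuous_intros simp flip: has_real_derivative_iff_has_vector_derivative\<close>)
  then show ?thesis using False sin_freq_end[OF assms, of n] by simp
qed

lemma integral_cos_diff_sum:
  assumes "0 < ell"
  shows "integral\<^sup>L (Om ell) (\<lambda>x. cos (freq ell m * x - freq ell n * x)) = (if m = n then ell else 0)"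
    "integral\<^sup>L (Om ell) (\<lambda>x. cos (freq ell m * x + freq ell n * x)) = (if m = 0 \<and> n = 0 then ell else 0)"
proof -
  have 1: "cos (freq ell m * x - freq ell n * x) = cos (freq ell (if m \<le> n then n - m else m - n) * x)" for x
  proof (cases "m \<le> n")
    case True
    have "freq ell m * x - freq ell n * x = - (freq ell (n - m) * x)"
      using True assms by (simp add: freq_def of_nat_diff field_simps)
    then show ?thesis using True by (simp only: cos_minus if_True)
  next
    case False
    have "freq ell m * x - freq ell n * x = freq ell (m - n) * x"
      using False assms by (simp add: freq_def of_nat_diff field_simps)
    then show ?thesis using False by simp
  qed
  show "integral\<^sup>L (Om ell) (\<lambda>x. cos (freq ell m * x - freq ell n * x)) = (if m = n then ell else 0)"
    unfolding 1 by (subst integral_cos_freq[OF assms]) auto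
  have 2: "freq ell m * x + freq ell n * x = freq ell (m + n) * x" for x
    using assms by (simp add: freq_def field_simps)
  show "integral\<^sup>L (Om ell) (\<lambda>x. cos (freq ell m * x + freq ell n * x)) = (if m = 0 \<and> n = 0 then ell else 0)"
    unfolding 2 by (subst integral_cos_freq[OF assms]) auto
qed

lemma onsys_sinb:
  assumes "0 < ell" shows "onsys ell (sinb ell) (\<lambda>n. 0 < n)"
proof
  show "L2 ell (sinb ell n)" for n by (rule L2_sinb)
  fix m n
  have "L2i ell (sinb ell m) (sinb ell n) = of_real (integral\<^sup>L (Om ell) (\<lambda>x. 1/ell * (cos (freq ell m * x - freq ell n * x) - cos (freq ell m * x + freq ell n * x))))"
    unfolding L2i_def sinb_def integral_complex_of_real[symmetric]
  proof (intro Bochner_Integration.integral_cong refl)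
    fix x
    have "(sqrt (2/ell) * sin (freq ell m * x)) * (sqrt (2/ell) * sin (freq ell n * x))
        = (sqrt (2/ell) * sqrt (2/ell)) * (sin (freq ell m * x) * sin (freq ell n * x))"
      by (simp only: mult_ac)
    also have "\<dots> = 1/ell * (cos (freq ell m * x - freq ell n * x) - cos (freq ell m * x + freq ell n * x))"
      unfolding sin_times_sin using assms by (simp add: field_simps)
    finally show "complex_of_real (sqrt (2/ell) * sin (freq ell m * x)) * cnj (complex_of_real (sqrt (2/ell) * sin (freq ell n * x)))
       = complex_of_real (1/ell * (cos (freq ell m * x - freq ell n * x) - cos (freq ell m * x + freq ell n * x)))"
      unfolding complex_cnj_complex_of_real of_real_mult[symmetric] by (rule arg_cong)
  qed
  also have "\<dots> = of_real (1/ell * ((if m = n then ell else 0) - (if m = 0 \<and> n = 0 then ell else 0)))"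
    using assms by (simp add: integral_cos_diff_sum integrable_Om_continuous continuous_intros)
  finally show "L2i ell (sinb ell m) (sinb ell n) = (if m = n \<and> 0 < n then 1 else 0)"
    using assms by (auto split: if_splits)
qed

lemma onsys_cosb:
  assumes "0 < ell" shows "onsys ell (cosb ell) (\<lambda>n. True)"
proof
  show "L2 ell (cosb ell n)" for n by (rule L2_cosb)
  fix m n :: nat
  let ?r = "\<lambda>n. sqrt ((if n = 0 then 1 else 2)/ell)"
  have "L2i ell (cosb ell m) (cosb ell n) = of_real (integral\<^sup>L (Om ell) (\<lambda>x. ?r m * ?r n / 2 * (cos (freq ell m * x - freq ell n * x) + cos (freq ell m * x + freq ell n * x))))"
    unfolding L2i_def cosb_def integral_complex_of_real[symmetric]
  proof (intro Bochner_Integration.integral_cong refl)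
    fix x
    have "(?r m * cos (freq ell m * x)) * (?r n * cos (freq ell n * x))
        = (?r m * ?r n) * (cos (freq ell m * x) * cos (freq ell n * x))"
      by (simp only: mult_ac)
    also have "\<dots> = ?r m * ?r n / 2 * (cos (freq ell m * x - freq ell n * x) + cos (freq ell m * x + freq ell n * x))"
      unfolding cos_times_cos by (simp only: times_divide_eq_right times_divide_eq_left)
    finally show "complex_of_real (?r m * cos (freq ell m * x)) * cnj (complex_of_real (?r n * cos (freq ell n * x)))
       = complex_of_real (?r m * ?r n / 2 * (cos (freq ell m * x - freq ell n * x) + cos (freq ell m * x + freq ell n * x)))"
      unfolding complex_cnj_complex_of_real of_real_mult[symmetric] by (rule arg_cong)
  qed
  also have "\<dots> = of_real (?r m * ?r n / 2 * ((if m = n then ell else 0) + (if m = 0 \<and> n = 0 then ell else 0)))"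
    using assms by (simp add: integral_cos_diff_sum integrable_Om_continuous continuous_intros)
  finally show "L2i ell (cosb ell m) (cosb ell n) = (if m = n \<and> True then 1 else 0)"
    using assms by (auto split: if_splits simp flip: of_real_mult)
qed

text \<open>On (0, ell) the map x to cos (pi x / ell) is injective, so a continuous function of x is
  a continuous function of this cosine, and Weierstrass approximates it by polynomials there. Hence
  h annihilates all continuous functions, then indicators of measurable sets, and vanishes
  a.e.\<close>

lemma cos_powers_complete:
  fixes h :: "real \<Rightarrow> complex"
  assumes ell: "0 < ell" and h: "integrable (Om ell) h"
    and z: "\<And>k. integral\<^sup>L (Om ell) (\<lambda>x. h x * of_real (cos (pi * x / ell) ^ k)) = 0"
  shows "AE x in Om ell. h x = 0"
proof -
  have [measurable]: "h \<in> borel_measurable (Om ell)" using h by auto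
  have hb: "integrable (Om ell) (\<lambda>x. h x * of_real (g x))"
    if [measurable]: "g \<in> borel_measurable (Om ell)" and "\<And>x. x \<in> {0<..<ell} \<Longrightarrow> \<bar>g x\<bar> \<le> B" for g :: "real \<Rightarrow> real" and B
  proof (rule Bochner_Integration.integrable_bound[of _ "\<lambda>x. B * cmod (h x)"])
    show "AE x in Om ell. cmod (h x * complex_of_real (g x)) \<le> norm (B * cmod (h x))"
    proof (rule AE_I2)
      fix x assume "x \<in> space (Om ell)"
      then have "\<bar>g x\<bar> \<le> B" using that(2) by simp
      then have "cmod (h x) * \<bar>g x\<bar> \<le> \<bar>B\<bar> * cmod (h x)"
        by (subst mult.commute) (intro mult_right_mono, auto)
      then show "cmod (h x * complex_of_real (g x)) \<le> norm (B * cmod (h x))"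
        by (simp add: norm_mult abs_mult)
    qed
  qed (use h in auto)
  have poly: "integral\<^sup>L (Om ell) (\<lambda>x. h x * of_real (\<Sum>i\<le>n. a i * cos (pi * x / ell) ^ i)) = 0" for n :: nat and a
  proof -
    have "integral\<^sup>L (Om ell) (\<lambda>x. h x * of_real (\<Sum>i\<le>n. a i * cos (pi * x / ell) ^ i))
      = integral\<^sup>L (Om ell) (\<lambda>x. \<Sum>i\<le>n. of_real (a i) * (h x * of_real (cos (pi * x / ell) ^ i)))"
      by (intro Bochner_Integration.integral_cong refl) (simp add: sum_distrib_left algebra_simps)
    also have "\<dots> = (\<Sum>i\<le>n. of_real (a i) * integral\<^sup>L (Om ell) (\<lambda>x. h x * of_real (cos (pi * x / ell) ^ i)))"
    proof (subst Bochner_Integration.integral_sum)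
      fix i
      have "(\<lambda>x. cos (pi * x / ell) ^ i) \<in> borel_measurable (Om ell)"
        by (intro continuous_imp_measurable_on_sets_lebesgue continuous_intros) (use ell in auto)
      then show "integrable (Om ell) (\<lambda>x. of_real (a i) * (h x * of_real (cos (pi * x / ell) ^ i)))"
        by (intro integrable_mult_right hb[where B=1]) (auto simp: power_abs intro: power_le_one)
    qed simp
    also have "\<dots> = 0" using z by simp
    finally show ?thesis .
  qed
  have cont: "integral\<^sup>L (Om ell) (\<lambda>x. h x * of_real (g x)) = 0" if g: "continuous_on UNIV g" for g :: "real \<Rightarrow> real"
  proof -
    define G where "G y = g (ell / pi * arccos y)" for y
    have Gc: "continuous_on {-1..1} G" unfolding G_def
      by (intro continuous_on_compose2[OF g] continuous_intros) auto
    have G: "G (cos (pi * x / ell)) = g x" if "x \<in> {0<..<ell}" for x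
      using that ell unfolding G_def by (subst arccos_cos) (auto simp: field_simps)
    have gm[measurable]: "g \<in> borel_measurable (Om ell)"
      by (intro continuous_imp_measurable_on_sets_lebesgue continuous_on_subset[OF g]) auto
    obtain B where B: "\<forall>y\<in>{-1..1}. \<bar>G y\<bar> \<le> B"
      using compact_imp_bounded[OF compact_continuous_image[OF Gc compact_Icc]] unfolding bounded_iff by auto
    have gB: "\<bar>g x\<bar> \<le> B" if "x \<in> {0<..<ell}" for x
      using G[OF that] B[rule_format, of "cos (pi * x / ell)"] by simp
    have "cmod (integral\<^sup>L (Om ell) (\<lambda>x. h x * of_real (g x))) \<le> e * integral\<^sup>L (Om ell) (\<lambda>x. cmod (h x))" if "e > 0" for e
    proof -
      obtain q where q: "real_polynomial_function q" "\<And>y. y \<in> {-1..1} \<Longrightarrow> \<bar>G y - q y\<bar> < e"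
        using Stone_Weierstrass_real_polynomial_function[OF compact_Icc Gc \<open>e > 0\<close>] by blast
      obtain a n where an: "q = (\<lambda>x. \<Sum>i\<le>n. a i * x ^ i)"
        using q(1) real_polynomial_function_iff_sum by auto
      have qm[measurable]: "(\<lambda>x. q (cos (pi * x / ell))) \<in> borel_measurable (Om ell)"
        unfolding an by (intro continuous_imp_measurable_on_sets_lebesgue continuous_intros) (use ell in auto)
      have close: "\<bar>g x - q (cos (pi * x / ell))\<bar> \<le> e" if "x \<in> {0<..<ell}" for x
        using q(2)[of "cos (pi * x / ell)"] G[OF that] by simp
      have qB: "\<bar>q (cos (pi * x / ell))\<bar> \<le> B + e" if "x \<in> {0<..<ell}" for x
        using close[OF that] gB[OF that] by linarith
      have "integral\<^sup>L (Om ell) (\<lambda>x. h x * of_real (g x)) = integral\<^sup>L (Om ell) (\<lambda>x. h x * of_real (g x))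
          - integral\<^sup>L (Om ell) (\<lambda>x. h x * of_real (q (cos (pi * x / ell))))"
        using poly[where a=a and n=n] by (simp add: an)
      also have "\<dots> = integral\<^sup>L (Om ell) (\<lambda>x. h x * of_real (g x - q (cos (pi * x / ell))))"
        using hb[OF gm gB] hb[OF qm qB] by (subst Bochner_Integration.integral_diff[symmetric]) (auto simp: algebra_simps)
      also have "cmod \<dots> \<le> integral\<^sup>L (Om ell) (\<lambda>x. e * cmod (h x))"
      proof (rule order_trans[OF integral_norm_bound integral_mono])
        show "integrable (Om ell) (\<lambda>x. cmod (h x * complex_of_real (g x - q (cos (pi * x / ell)))))"
          using hb[of "\<lambda>x. g x - q (cos (pi * x / ell))" e] close by auto
        show "integrable (Om ell) (\<lambda>x. e * cmod (h x))" using h by auto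
        show "cmod (h x * complex_of_real (g x - q (cos (pi * x / ell)))) \<le> e * cmod (h x)" if "x \<in> space (Om ell)" for x
          using mult_right_mono[OF close[of x] norm_ge_zero[of "h x"]] that unfolding norm_mult norm_of_real
          by (simp add: mult.commute)
      qed
      finally show ?thesis by simp
    qed
    note e_bound = this
    show ?thesis
    proof (rule ccontr)
      assume n: "integral\<^sup>L (Om ell) (\<lambda>x. h x * of_real (g x)) \<noteq> 0"
      define N where "N = cmod (integral\<^sup>L (Om ell) (\<lambda>x. h x * of_real (g x)))"
      define H where "H = integral\<^sup>L (Om ell) (\<lambda>x. cmod (h x))"
      have "N > 0" "H \<ge> 0" using n by (auto simp: N_def H_def)
      have "N / (2 * (H + 1)) > 0" using \<open>N > 0\<close> \<open>H \<ge> 0\<close> by simp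
      from e_bound[OF this] have "N \<le> N / (2 * (H + 1)) * H" unfolding N_def H_def .
      also have "\<dots> < N" using \<open>N > 0\<close> mult_nonneg_nonneg[OF \<open>H \<ge> 0\<close> less_imp_le[OF \<open>N > 0\<close>]] \<open>H \<ge> 0\<close>
        by (simp add: field_simps add_nonneg_pos)
      finally show False by simp
    qed
  qed
  interpret finite_measure "Om ell" by (rule finite_measure_Om)
  show ?thesis
  proof (rule density_zero[OF h])
    fix A assume A: "A \<in> sets (Om ell)"
    then have "A \<in> sets lebesgue" by (simp add: sets_restrict_space_iff)
    then have "(indicator A :: real \<Rightarrow> real) measurable_on UNIV"
      by (intro lebesgue_measurable_imp_measurable_on) (auto simp: lebesgue_on_UNIV_eq)
    then obtain N G where NG: "negligible N" "\<And>n. continuous_on UNIV (G n)"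
      "\<And>x. x \<notin> N \<Longrightarrow> (\<lambda>n. G n x) \<longlonglongrightarrow> (indicator A x :: real)"
      unfolding measurable_on_def by auto
    \<comment> \<open>Clipping to [0,1] does not disturb the limit, which is an indicator value, and
      provides |h| as dominating function.\<close>
    define g where "g n x = max 0 (min 1 (G n x))" for n :: nat and x
    have gc: "continuous_on UNIV (g n)" for n unfolding g_def by (intro continuous_intros NG)
    have gl: "(\<lambda>n. g n x) \<longlonglongrightarrow> indicator A x" if "x \<notin> N" for x
    proof -
      have "(\<lambda>n. g n x) \<longlonglongrightarrow> max 0 (min 1 (indicator A x))"
        unfolding g_def by (intro tendsto_intros NG that)
      then show ?thesis by (auto simp: indicator_def)
    qed
    have gm[measurable]: "g n \<in> borel_measurable (Om ell)" for n
      by (intro continuous_imp_measurable_on_sets_lebesgue continuous_on_subset[OF gc]) auto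
    have [measurable]: "A \<in> sets (Om ell)" by fact
    have ae: "AE x in Om ell. x \<notin> N"
      using NG(1) by (simp add: AE_restrict_space_iff negligible_iff_null_sets AE_not_in[THEN eventually_mono])
    have "(\<lambda>n. integral\<^sup>L (Om ell) (\<lambda>x. h x * of_real (g n x))) \<longlonglongrightarrow> integral\<^sup>L (Om ell) (\<lambda>x. h x * of_real (indicator A x))"
    proof (rule integral_dominated_convergence[where w="\<lambda>x. cmod (h x)"])
      show "AE x in Om ell. (\<lambda>n. h x * complex_of_real (g n x)) \<longlonglongrightarrow> h x * complex_of_real (indicator A x)"
        using ae by eventually_elim (intro tendsto_intros gl)
      show "AE x in Om ell. norm (h x * complex_of_real (g n x)) \<le> cmod (h x)" for n
        by (rule AE_I2) (auto simp: norm_mult g_def mult_left_le)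
    qed (use h in auto)
    then have "integral\<^sup>L (Om ell) (\<lambda>x. h x * of_real (indicator A x)) = 0"
      using cont[OF gc] by (simp add: LIMSEQ_const_iff)
    then show "set_lebesgue_integral (Om ell) A h = 0"
      by (simp add: set_lebesgue_integral_def scaleR_conv_of_real mult.commute)
  qed
qed

text \<open>Multiplication by cos (pi x / ell) turns a cosine into the mean of its two neighbours,
  so orthogonality to all cosines propagates to products of powers of cos (pi x / ell) with cosines;
  the factor of index 0 leaves the powers alone.\<close>

lemma onbasis_cosb:
  assumes ell: "0 < ell" shows "onbasis ell (cosb ell) (\<lambda>n. True)"
proof -
  interpret onsys ell "cosb ell" "\<lambda>n. True" by (rule onsys_cosb[OF ell])
  show ?thesis
  proof
    fix f assume f: "L2 ell f" and z: "\<And>n. coef f n = 0"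
    have z0: "integral\<^sup>L (Om ell) (\<lambda>x. f x * of_real (cos (freq ell n * x))) = 0" for n
    proof -
      have "L2i ell f (cosb ell n) = of_real (sqrt ((if n = 0 then 1 else 2)/ell)) * integral\<^sup>L (Om ell) (\<lambda>x. f x * of_real (cos (freq ell n * x)))"
        unfolding L2i_def by (subst integral_mult_right_zero[symmetric]) (simp add: cosb_def mult_ac)
      then show ?thesis using z[of n] ell by (auto simp: coef_def split: if_splits)
    qed
    have int: "integrable (Om ell) (\<lambda>x. f x * of_real (g x))" if "continuous_on {0..ell} g" for g :: "real \<Rightarrow> real"
      using L2i_integrable[OF f L2_continuous[of ell "\<lambda>x. of_real (g x)"]] that by (simp add: continuous_intros)
    have "integral\<^sup>L (Om ell) (\<lambda>x. f x * of_real (cos (pi * x / ell) ^ k * cos (freq ell n * x))) = 0" for k n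
    proof (induction k arbitrary: n)
      case (Suc k)
      let ?J = "\<lambda>m x. f x * of_real (cos (pi * x / ell) ^ k * cos (freq ell m * x))"
      have i: "integrable (Om ell) (?J m)" for m
        by (rule int) (use ell in \<open>intro continuous_intros; simp\<close>)
      \<comment> \<open>At n = 0 the lower neighbour has index -1, which is the index 1 again
        because cosine is even.\<close>
      have E: "f x * of_real (cos (pi * x / ell) ^ Suc k * cos (freq ell n * x)) = (?J (n + 1) x + ?J (if n = 0 then 1 else n - 1) x) / 2" for x
      proof -
        have a: "freq ell (n + 1) * x = freq ell n * x + pi * x / ell" using ell by (simp add: freq_def field_simps)
        have b: "cos (freq ell (if n = 0 then 1 else n - 1) * x) = cos (freq ell n * x - pi * x / ell)"
          using ell by (cases n) (auto simp: freq_def field_simps)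
        have "cos (pi * x / ell) * cos (freq ell n * x) = (cos (freq ell (n + 1) * x) + cos (freq ell (if n = 0 then 1 else n - 1) * x)) / 2"
          unfolding a b by (simp add: cos_add cos_diff)
        then have "cos (pi * x / ell) ^ Suc k * cos (freq ell n * x) = (cos (pi * x / ell) ^ k * cos (freq ell (n + 1) * x) + cos (pi * x / ell) ^ k * cos (freq ell (if n = 0 then 1 else n - 1) * x)) / 2"
          by (simp only: power_Suc mult.assoc mult.left_commute[of "cos (pi * x / ell)"]) (simp add: algebra_simps)
        then have "complex_of_real (cos (pi * x / ell) ^ Suc k * cos (freq ell n * x)) = (complex_of_real (cos (pi * x / ell) ^ k * cos (freq ell (n + 1) * x)) + complex_of_real (cos (pi * x / ell) ^ k * cos (freq ell (if n = 0 then 1 else n - 1) * x))) / 2"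
          by (simp only: of_real_add of_real_divide of_real_numeral)
        then show ?thesis by (simp only: distrib_left times_divide_eq_right)
      qed
      show ?case unfolding E integral_divide_zero
        by (subst Bochner_Integration.integral_add[OF i i]) (simp only: Suc.IH, simp)
    qed (use z0 in simp)
    from this[of _ 0] have "integral\<^sup>L (Om ell) (\<lambda>x. f x * of_real (cos (pi * x / ell) ^ k)) = 0" for k by simp
    then show "AE x in Om ell. f x = 0"
      by (intro cos_powers_complete[OF ell L2_integrable[OF f]])
  qed
qed

text \<open>The same recursion for sines, taken at n = 1, shows that f sin (pi x / ell) is
  orthogonal to all powers of cos (pi x / ell) and hence zero a.e.; this sine has no zero inside the
  interval.\<close>

lemma onbasis_sinb:
  assumes ell: "0 < ell" shows "onbasis ell (sinb ell) (\<lambda>n. 0 < n)"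
proof -
  interpret onsys ell "sinb ell" "\<lambda>n. 0 < n" by (rule onsys_sinb[OF ell])
  show ?thesis
  proof
    fix f assume f: "L2 ell f" and z: "\<And>n. coef f n = 0"
    have z0: "integral\<^sup>L (Om ell) (\<lambda>x. f x * of_real (sin (freq ell n * x))) = 0" for n
    proof -
      have "L2i ell f (sinb ell n) = of_real (sqrt (2/ell)) * integral\<^sup>L (Om ell) (\<lambda>x. f x * of_real (sin (freq ell n * x)))"
        unfolding L2i_def by (subst integral_mult_right_zero[symmetric]) (simp add: sinb_def mult_ac)
      then show ?thesis using z[of n] ell by (auto simp: coef_def split: if_splits)
    qed
    have int: "integrable (Om ell) (\<lambda>x. f x * of_real (g x))" if "continuous_on {0..ell} g" for g :: "real \<Rightarrow> real"
      using L2i_integrable[OF f L2_continuous[of ell "\<lambda>x. of_real (g x)"]] that by (simp add: continuous_intros)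
    have "integral\<^sup>L (Om ell) (\<lambda>x. f x * of_real (cos (pi * x / ell) ^ k * sin (freq ell n * x))) = 0" for k n
    proof (induction k arbitrary: n)
      case (Suc k)
      show ?case
      proof (cases "n = 0")
        case False
        let ?J = "\<lambda>m x. f x * of_real (cos (pi * x / ell) ^ k * sin (freq ell m * x))"
        have i: "integrable (Om ell) (?J m)" for m
          by (rule int) (use ell in \<open>intro continuous_intros; simp\<close>)
        have E: "f x * of_real (cos (pi * x / ell) ^ Suc k * sin (freq ell n * x)) = (?J (n + 1) x + ?J (n - 1) x) / 2" for x
        proof -
          have a: "freq ell (n + 1) * x = freq ell n * x + pi * x / ell" using ell by (simp add: freq_def field_simps)
          have b: "freq ell (n - 1) * x = freq ell n * x - pi * x / ell"
            using ell False by (cases n) (auto simp: freq_def field_simps)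
          have "cos (pi * x / ell) * sin (freq ell n * x) = (sin (freq ell (n + 1) * x) + sin (freq ell (n - 1) * x)) / 2"
            unfolding a b by (simp add: sin_add sin_diff)
          then have "cos (pi * x / ell) ^ Suc k * sin (freq ell n * x) = (cos (pi * x / ell) ^ k * sin (freq ell (n + 1) * x) + cos (pi * x / ell) ^ k * sin (freq ell (n - 1) * x)) / 2"
            by (simp only: power_Suc mult.assoc mult.left_commute[of "cos (pi * x / ell)"]) (simp add: algebra_simps)
          then have "complex_of_real (cos (pi * x / ell) ^ Suc k * sin (freq ell n * x)) = (complex_of_real (cos (pi * x / ell) ^ k * sin (freq ell (n + 1) * x)) + complex_of_real (cos (pi * x / ell) ^ k * sin (freq ell (n - 1) * x))) / 2"
            by (simp only: of_real_add of_real_divide of_real_numeral)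
          then show ?thesis by (simp only: distrib_left times_divide_eq_right)
        qed
        show ?thesis unfolding E integral_divide_zero
          by (subst Bochner_Integration.integral_add[OF i i]) (simp only: Suc.IH, simp)
      qed simp
    qed (use z0 in simp)
    from this[of _ 1] have "integral\<^sup>L (Om ell) (\<lambda>x. (f x * of_real (sin (pi * x / ell))) * of_real (cos (pi * x / ell) ^ k)) = 0" for k
      by (simp add: freq_def mult_ac)
    moreover have "integrable (Om ell) (\<lambda>x. f x * of_real (sin (pi * x / ell)))"
      by (rule int) (use ell in \<open>intro continuous_intros; simp\<close>)
    ultimately have "AE x in Om ell. f x * of_real (sin (pi * x / ell)) = 0"
      by (intro cos_powers_complete[OF ell])
    moreover have "sin (pi * x / ell) \<noteq> 0" if "x \<in> {0<..<ell}" for x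
    proof -
      have "pi * x / ell < pi" using ell that by (simp add: field_simps)
      then show ?thesis using ell that sin_gt_zero[of "pi * x / ell"] by simp
    qed
    ultimately show "AE x in Om ell. f x = 0"
      by (auto elim!: eventually_mono[OF eventually_conj[OF _ AE_space]])
  qed
qed

section \<open>Sine and cosine coefficients\<close>

definition sinc :: "real \<Rightarrow> (real \<Rightarrow> complex) \<Rightarrow> nat \<Rightarrow> complex" where
  "sinc ell f n = L2i ell f (sinb ell n)"

definition cosc :: "real \<Rightarrow> (real \<Rightarrow> complex) \<Rightarrow> nat \<Rightarrow> complex" where
  "cosc ell f n = L2i ell f (cosb ell n)"

lemma sinc_0 [simp]: "sinc ell f 0 = 0" by (simp add: sinc_def L2i_def)

lemma sinc_add: "L2 ell f \<Longrightarrow> L2 ell g \<Longrightarrow> sinc ell (\<lambda>x. f x + g x) n = sinc ell f n + sinc ell g n"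
  and sinc_diff: "L2 ell f \<Longrightarrow> L2 ell g \<Longrightarrow> sinc ell (\<lambda>x. f x - g x) n = sinc ell f n - sinc ell g n"
  and sinc_cmult: "sinc ell (\<lambda>x. c * f x) n = c * sinc ell f n"
  and cosc_add: "L2 ell f \<Longrightarrow> L2 ell g \<Longrightarrow> cosc ell (\<lambda>x. f x + g x) n = cosc ell f n + cosc ell g n"
  and cosc_diff: "L2 ell f \<Longrightarrow> L2 ell g \<Longrightarrow> cosc ell (\<lambda>x. f x - g x) n = cosc ell f n - cosc ell g n"
  and cosc_cmult: "cosc ell (\<lambda>x. c * f x) n = c * cosc ell f n"
  by (simp_all add: sinc_def cosc_def L2i_add_left L2i_diff_left L2i_cmult_left L2_sinb L2_cosb)

lemma sinc_cong_AE: "AE x in Om ell. f x = g x \<Longrightarrow> L2 ell f \<Longrightarrow> sinc ell f n = sinc ell g n"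
  and cosc_cong_AE: "AE x in Om ell. f x = g x \<Longrightarrow> L2 ell f \<Longrightarrow> cosc ell f n = cosc ell g n"
  unfolding sinc_def cosc_def by (rule L2i_cong_AE; simp add: L2_sinb L2_cosb)+

text \<open>The mean is a nonzero multiple of the coefficient at index 0, so the mean-zero spaces
  are those without a zero mode.\<close>

lemma L2s_iff:
  assumes "0 < ell" shows "L2s ell f \<longleftrightarrow> L2 ell f \<and> cosc ell f 0 = 0"
proof -
  have "cosc ell f 0 = of_real (sqrt (1/ell)) * integral\<^sup>L (Om ell) f"
    unfolding cosc_def L2i_def by (subst integral_mult_right_zero[symmetric]) (simp add: cosb_def mult_ac)
  then show ?thesis using assms by (auto simp: L2s_def)
qed

context
  fixes ell :: real
  assumes ell: "0 < ell"
begin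

interpretation S: onbasis ell "sinb ell" "\<lambda>n. 0 < n" by (rule onbasis_sinb[OF ell])
interpretation C: onbasis ell "cosb ell" "\<lambda>n. True" by (rule onbasis_cosb[OF ell])

lemma sinc_coef: "S.coef f = sinc ell f" by (auto simp: S.coef_def sinc_def)
lemma cosc_coef: "C.coef f = cosc ell f" by (auto simp: C.coef_def cosc_def)

lemmas sinc_eq_AE = S.coef_eq_AE[unfolded sinc_coef]
lemmas cosc_eq_AE = C.coef_eq_AE[unfolded cosc_coef]
lemmas sinc_parseval = S.parseval[unfolded sinc_coef]
lemmas cosc_parseval = C.parseval[unfolded cosc_coef]
lemmas sinc_parseval_inner = S.parseval_inner[unfolded sinc_coef]
lemmas cosc_parseval_inner = C.parseval_inner[unfolded cosc_coef]
lemmas sqs_sinc = S.sqs_coef[unfolded sinc_coef]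
lemmas sqs_cosc = C.sqs_coef[unfolded cosc_coef]

lemma sinc_Riesz_Fischer: "sqs c \<Longrightarrow> c 0 = 0 \<Longrightarrow> \<exists>f. L2 ell f \<and> (\<forall>n. sinc ell f n = c n)"
  using S.Riesz_Fischer[of c] unfolding sinc_coef by simp

lemma cosc_Riesz_Fischer: "sqs c \<Longrightarrow> \<exists>f. L2 ell f \<and> (\<forall>n. cosc ell f n = c n)"
  using C.Riesz_Fischer[of c] unfolding cosc_coef by simp

lemma sinc_part_tendsto:
  "L2 ell f \<Longrightarrow> (\<lambda>n. L2n ell (\<lambda>x. (\<Sum>i<n. sinc ell f i * sinb ell i x) - f x)) \<longlonglongrightarrow> 0"
  using S.part_tendsto[of f] unfolding sinc_coef S.part_def .

lemma cosc_part_tendsto: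
  "L2 ell f \<Longrightarrow> (\<lambda>n. L2n ell (\<lambda>x. (\<Sum>i<n. cosc ell f i * cosb ell i x) - f x)) \<longlonglongrightarrow> 0"
  using C.part_tendsto[of f] unfolding cosc_coef C.part_def .

end

section \<open>Sobolev spaces in terms of Fourier coefficients\<close>

lemma smooth_fun_vector_derivative:
  assumes "smooth_fun \<phi>"
  shows "((\<lambda>x. complex_of_real (\<phi> x)) has_vector_derivative of_real (deriv \<phi> x)) (at x)"
  by (rule has_vector_derivative_of_real) (rule smooth_fun_DERIV[OF assms])

lemma L2_of_real_smooth: "smooth_fun \<phi> \<Longrightarrow> L2 ell (\<lambda>x. complex_of_real (\<phi> x))"
  by (intro L2_continuous continuous_intros smooth_fun_continuous)

lemma test_fun_ends: "test_fun {0<..<ell} \<phi> \<Longrightarrow> \<phi> 0 = 0" "test_fun {0<..<ell} \<phi> \<Longrightarrow> \<phi> ell = 0"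
  by (auto intro: test_fun_outside)

lemma integral_parts_test:
  fixes F :: "real \<Rightarrow> complex"
  assumes "0 < ell" and \<phi>: "test_fun {0<..<ell} \<phi>"
    and F: "\<And>x. (F has_vector_derivative F' x) (at x)" "continuous_on UNIV F'"
  shows "integral\<^sup>L (Om ell) (\<lambda>x. F x * of_real (deriv \<phi> x)) = - integral\<^sup>L (Om ell) (\<lambda>x. F' x * of_real (\<phi> x))"
proof -
  note sm = test_fun_smooth[OF \<phi>]
  have F0: "continuous_on A F" for A
    by (meson F(1) continuous_at_imp_continuous_on has_vector_derivative_continuous)
  have F1: "continuous_on A F'" for A by (rule continuous_on_subset[OF F(2)]) simp
  have c: "continuous_on A (\<lambda>x. F x * of_real (deriv \<phi> x))" "continuous_on A (\<lambda>x. F' x * of_real (\<phi> x))" for A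
    by (intro continuous_intros F0 F1 smooth_fun_continuous smooth_fun_deriv sm)+
  have "integral\<^sup>L (Om ell) (\<lambda>x. F x * of_real (deriv \<phi> x) + F' x * of_real (\<phi> x)) = F ell * of_real (\<phi> ell) - F 0 * of_real (\<phi> 0)"
  proof (rule integral_Om_FTC)
    show "((\<lambda>x. F x * of_real (\<phi> x)) has_vector_derivative F x * of_real (deriv \<phi> x) + F' x * of_real (\<phi> x)) (at x)" for x
      by (rule has_vector_derivative_mult F smooth_fun_vector_derivative sm)+
  qed (use assms c in \<open>auto intro: continuous_on_add\<close>)
  then show ?thesis
    by (simp add: test_fun_ends[OF \<phi>] Bochner_Integration.integral_add integrable_Om_continuous c eq_neg_iff_add_eq_0)
qed

lemma sinc_deriv_test:
  assumes "0 < ell" and \<phi>: "test_fun {0<..<ell} \<phi>"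
  shows "sinc ell (\<lambda>x. of_real (deriv \<phi> x)) n = - of_real (freq ell n) * cosc ell (\<lambda>x. of_real (\<phi> x)) n"
proof -
  have "sinc ell (\<lambda>x. of_real (deriv \<phi> x)) n = integral\<^sup>L (Om ell) (\<lambda>x. sinb ell n x * of_real (deriv \<phi> x))"
    by (simp add: sinc_def L2i_def sinb_def mult.commute)
  also have "\<dots> = - integral\<^sup>L (Om ell) (\<lambda>x. (of_real (freq ell n) * cosb ell n x) * of_real (\<phi> x))"
    by (rule integral_parts_test[OF assms deriv_sinb]) (intro continuous_intros continuous_cosb)
  also have "\<dots> = - of_real (freq ell n) * integral\<^sup>L (Om ell) (\<lambda>x. of_real (\<phi> x) * cnj (cosb ell n x))"
    by (subst integral_mult_right_zero[symmetric]) (simp add: cosb_def mult_ac)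
  finally show ?thesis by (simp add: cosc_def L2i_def)
qed

lemma cosc_deriv_test:
  assumes "0 < ell" and \<phi>: "test_fun {0<..<ell} \<phi>"
  shows "cosc ell (\<lambda>x. of_real (deriv \<phi> x)) n = of_real (freq ell n) * sinc ell (\<lambda>x. of_real (\<phi> x)) n"
proof -
  have "cosc ell (\<lambda>x. of_real (deriv \<phi> x)) n = integral\<^sup>L (Om ell) (\<lambda>x. cosb ell n x * of_real (deriv \<phi> x))"
    by (simp add: cosc_def L2i_def cosb_def mult.commute)
  also have "\<dots> = - integral\<^sup>L (Om ell) (\<lambda>x. (- of_real (freq ell n) * sinb ell n x) * of_real (\<phi> x))"
    by (rule integral_parts_test[OF assms deriv_cosb]) (intro continuous_intros continuous_sinb)
  also have "\<dots> = of_real (freq ell n) * integral\<^sup>L (Om ell) (\<lambda>x. of_real (\<phi> x) * cnj (sinb ell n x))"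
    by (subst integral_mult_right_zero[symmetric]) (simp add: sinb_def mult_ac)
  finally show ?thesis by (simp add: sinc_def L2i_def)
qed

lemma L2n_dominated:
  assumes m: "\<And>m. f m \<in> borel_measurable (Om ell)"
    and b: "\<And>m x. x \<in> {0<..<ell} \<Longrightarrow> cmod (f m x) \<le> B"
    and l: "\<And>x. x \<in> {0<..<ell} \<Longrightarrow> (\<lambda>m. f m x) \<longlonglongrightarrow> 0"
  shows "(\<lambda>m. L2n ell (f m)) \<longlonglongrightarrow> 0"
proof -
  interpret finite_measure "Om ell" by (rule finite_measure_Om)
  have "(\<lambda>m. integral\<^sup>L (Om ell) (\<lambda>x. (cmod (f m x))\<^sup>2)) \<longlonglongrightarrow> integral\<^sup>L (Om ell) (\<lambda>x. 0)"
  proof (rule integral_dominated_convergence[where w="\<lambda>x. B\<^sup>2"])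
    show "AE x in Om ell. (\<lambda>m. (cmod (f m x))\<^sup>2) \<longlonglongrightarrow> 0"
      by (rule AE_I2) (use tendsto_power[OF tendsto_norm_zero[OF l], of _ 2] in simp)
    show "AE x in Om ell. norm ((cmod (f m x))\<^sup>2) \<le> B\<^sup>2" for m
      by (rule AE_I2) (use b in \<open>simp add: power_mono\<close>)
  qed (use m in auto)
  from tendsto_real_sqrt[OF this] show ?thesis by (simp add: L2n_def)
qed

text \<open>The reflection of x to ell - x changes the sine at most by its sign, so the linear bound
  at 0 holds at both ends.\<close>

lemma abs_sin_le_dist_end:
  assumes "0 < ell" "x \<in> {0<..<ell}"
  shows "\<bar>sin (freq ell n * x)\<bar> \<le> freq ell n * min x (ell - x)"
proof -
  have "\<bar>sin (freq ell n * x)\<bar> \<le> \<bar>freq ell n * x\<bar>" by (rule abs_sin_x_le_abs_x)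
  moreover have "\<bar>sin (freq ell n * x)\<bar> \<le> \<bar>freq ell n * (ell - x)\<bar>"
  proof -
    have "freq ell n * x = real n * pi - freq ell n * (ell - x)" using assms by (simp add: freq_def field_simps)
    then have "\<bar>sin (freq ell n * x)\<bar> = \<bar>sin (freq ell n * (ell - x))\<bar>"
      by (simp add: sin_diff abs_mult cos_npi)
    then show ?thesis using abs_sin_x_le_abs_x by metis
  qed
  ultimately show ?thesis using assms freq_nonneg[OF assms(1), of n] by (auto simp: min_def abs_mult)
qed

text \<open>The witnesses are cut-off sines. The dangerous term is the slope of the cutoff times the
  sine; it stays bounded because the inverse distance in \<open>deriv_cutoff_bound\<close> meets the
  linear vanishing of the sine. Pointwise limits and dominated convergence do the rest.\<close>

lemma sinb_test_approx:
  fixes n :: nat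
  assumes ell: "0 < ell"
  obtains p where "\<And>m::nat. test_fun {0<..<ell} (p m)"
    "(\<lambda>m. L2n ell (\<lambda>x. of_real (p m x) - sinb ell n x)) \<longlonglongrightarrow> 0"
    "(\<lambda>m. L2n ell (\<lambda>x. of_real (deriv (p m) x) - of_real (freq ell n) * cosb ell n x)) \<longlonglongrightarrow> 0"
proof
  define p where "p m x = cutoff ell m x * (sqrt (2/ell) * sin (freq ell n * x))" for m x
  define s where "s x = sqrt (2/ell) * sin (freq ell n * x)" for x
  define s' where "s' x = freq ell n * (sqrt ((if n = 0 then 1 else 2)/ell) * cos (freq ell n * x))" for x
  have sm: "smooth_fun s" unfolding s_def by (rule smooth_fun_sin)
  have s's: "(s has_real_derivative s' x) (at x)" for x
    unfolding s_def s'_def by (auto intro!: derivative_eq_intros)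
  have p: "p m = (\<lambda>x. cutoff ell m x * s x)" for m by (simp add: p_def s_def fun_eq_iff)
  show "test_fun {0<..<ell} (p m)" for m unfolding p by (rule test_fun_cutoff[OF sm])
  note cm = smooth_fun_continuous[OF smooth_fun_cutoff] smooth_fun_continuous[OF smooth_fun_deriv[OF smooth_fun_cutoff]]
  have sB: "\<bar>s x\<bar> \<le> sqrt (2/ell)" for x
    using ell by (simp add: s_def abs_mult mult_left_le)
  have cs: "continuous_on A s" "continuous_on A s'" for A
    unfolding s_def s'_def by (intro continuous_intros)+
  have "(\<lambda>m. L2n ell (\<lambda>x. of_real (p m x - s x))) \<longlonglongrightarrow> 0"
  proof (rule L2n_dominated[where B="sqrt (2/ell)"])
    show "(\<lambda>x. complex_of_real (p m x - s x)) \<in> borel_measurable (Om ell)" for m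
      unfolding p by (intro continuous_imp_measurable_on_sets_lebesgue continuous_intros cs cm) auto
    show "cmod (complex_of_real (p m x - s x)) \<le> sqrt (2/ell)" for m x
    proof -
      have "p m x - s x = (cutoff ell m x - 1) * s x" unfolding p by (simp add: algebra_simps)
      moreover have "\<bar>cutoff ell m x - 1\<bar> \<le> 1" using cutoff_bounds[of ell m x] by linarith
      ultimately show ?thesis using mult_mono[OF _ sB[of x], of "\<bar>cutoff ell m x - 1\<bar>" 1] ell
        by (simp only: norm_of_real abs_mult mult_1)
    qed
    show "(\<lambda>m. complex_of_real (p m x - s x)) \<longlonglongrightarrow> 0" if "x \<in> {0<..<ell}" for x
    proof -
      have "(\<lambda>m. complex_of_real (p m x - s x)) \<longlonglongrightarrow> of_real (1 * s x - s x)"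
        unfolding p by (intro tendsto_intros cutoff_tendsto_1 that)
      then show ?thesis by simp
    qed
  qed
  then show "(\<lambda>m. L2n ell (\<lambda>x. of_real (p m x) - sinb ell n x)) \<longlonglongrightarrow> 0"
    by (simp add: sinb_def s_def)
  have dp: "deriv (p m) x = deriv (cutoff ell m) x * s x + s' x * cutoff ell m x" for m x
    unfolding p by (rule DERIV_imp_deriv, rule DERIV_mult[OF smooth_fun_DERIV[OF smooth_fun_cutoff] s's])
  \<comment> \<open>First summand: the 6 of \<open>deriv_cutoff_bound\<close> times the ratio of the
    sine to the distance from the boundary. Second summand: a bound of s', since the cutoff differs
    from 1 by at most 1.\<close>
  define B where "B = 6 * (sqrt (2/ell) * freq ell n) + freq ell n * sqrt ((if n = 0 then 1 else 2)/ell)"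
  have "(\<lambda>m. L2n ell (\<lambda>x. of_real (deriv (p m) x - s' x))) \<longlonglongrightarrow> 0"
  proof (rule L2n_dominated[where B=B])
    show "(\<lambda>x. complex_of_real (deriv (p m) x - s' x)) \<in> borel_measurable (Om ell)" for m
      unfolding dp by (intro continuous_imp_measurable_on_sets_lebesgue continuous_intros cs cm) auto
    show "cmod (complex_of_real (deriv (p m) x - s' x)) \<le> B" if x: "x \<in> {0<..<ell}" for m x
    proof -
      have "deriv (p m) x - s' x = deriv (cutoff ell m) x * s x + (cutoff ell m x - 1) * s' x"
        unfolding dp by (simp add: algebra_simps)
      also have "\<bar>\<dots>\<bar> \<le> \<bar>deriv (cutoff ell m) x * s x\<bar> + \<bar>(cutoff ell m x - 1) * s' x\<bar>" by simp
      also have "\<dots> \<le> B" unfolding B_def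
      proof (rule add_mono)
        have "\<bar>s x\<bar> \<le> sqrt (2/ell) * (freq ell n * min x (ell - x))"
          using abs_sin_le_dist_end[OF ell x, of n] ell by (simp add: s_def abs_mult mult_left_mono)
        then have "\<bar>deriv (cutoff ell m) x\<bar> * \<bar>s x\<bar> \<le> \<bar>deriv (cutoff ell m) x\<bar> * (sqrt (2/ell) * (freq ell n * min x (ell - x)))"
          by (rule mult_left_mono) simp
        also have "\<dots> = (\<bar>deriv (cutoff ell m) x\<bar> * min x (ell - x)) * (sqrt (2/ell) * freq ell n)" by (simp only: mult_ac)
        also have "\<dots> \<le> 6 * (sqrt (2/ell) * freq ell n)"
          by (rule mult_right_mono[OF deriv_cutoff_bound[OF x]]) (use ell freq_nonneg in auto)
        finally show "\<bar>deriv (cutoff ell m) x * s x\<bar> \<le> 6 * (sqrt (2/ell) * freq ell n)" by (simp add: abs_mult)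
        have "\<bar>cutoff ell m x - 1\<bar> \<le> 1" using cutoff_bounds[of ell m x] by linarith
        moreover have "\<bar>s' x\<bar> \<le> freq ell n * sqrt ((if n = 0 then 1 else 2)/ell)"
          using ell freq_nonneg[OF ell, of n] unfolding s'_def abs_mult by (intro mult_mono) (auto simp: mult_left_le)
        ultimately have "\<bar>cutoff ell m x - 1\<bar> * \<bar>s' x\<bar> \<le> 1 * (freq ell n * sqrt ((if n = 0 then 1 else 2)/ell))"
          by (intro mult_mono) auto
        then show "\<bar>(cutoff ell m x - 1) * s' x\<bar> \<le> freq ell n * sqrt ((if n = 0 then 1 else 2)/ell)"
          by (simp add: abs_mult)
      qed
      finally show ?thesis by (simp del: of_real_diff)
    qed
    show "(\<lambda>m. complex_of_real (deriv (p m) x - s' x)) \<longlonglongrightarrow> 0" if "x \<in> {0<..<ell}" for x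
    proof -
      have "(\<lambda>m. complex_of_real (deriv (p m) x - s' x)) \<longlonglongrightarrow> of_real (0 * s x + s' x * 1 - s' x)"
        unfolding dp by (intro tendsto_intros cutoff_tendsto_1 deriv_cutoff_tendsto_0 that)
      then show ?thesis by simp
    qed
  qed
  then show "(\<lambda>m. L2n ell (\<lambda>x. of_real (deriv (p m) x) - of_real (freq ell n) * cosb ell n x)) \<longlonglongrightarrow> 0"
    by (simp add: cosb_def s'_def)
qed

lemma L2i_of_real: "L2i ell f (\<lambda>x. of_real (g x)) = integral\<^sup>L (Om ell) (\<lambda>x. f x * of_real (g x))"
  by (simp add: L2i_def)

lemma L2i_tendsto_right:
  assumes "\<And>n. L2 ell (P n)" "L2 ell f" "L2 ell g" "(\<lambda>n. L2n ell (\<lambda>x. P n x - f x)) \<longlonglongrightarrow> 0"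
  shows "(\<lambda>n. L2i ell g (P n)) \<longlonglongrightarrow> L2i ell g f"
  using tendsto_cnj[OF L2i_tendsto_left[OF assms]] by (simp flip: L2i_commute)

text \<open>The sine vanishes at both ends, so integration by parts against it leaves no boundary
  term, whatever the boundary values of f. Formally the sine is replaced by test functions
  converging to it together with their derivatives.\<close>

lemma weak_deriv_sinc:
  assumes ell: "0 < ell" and f: "L2 ell f" and g: "L2 ell g" and w: "weak_deriv ell f g"
  shows "sinc ell g n = - of_real (freq ell n) * cosc ell f n"
proof -
  obtain p where A: "\<And>m::nat. test_fun {0<..<ell} (p m)"
    "(\<lambda>m. L2n ell (\<lambda>x. of_real (p m x) - sinb ell n x)) \<longlonglongrightarrow> 0"
    "(\<lambda>m. L2n ell (\<lambda>x. of_real (deriv (p m) x) - of_real (freq ell n) * cosb ell n x)) \<longlonglongrightarrow> 0"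
    using sinb_test_approx[OF ell] by blast
  have "(\<lambda>m. L2i ell f (\<lambda>x. of_real (deriv (p m) x))) \<longlonglongrightarrow> L2i ell f (\<lambda>x. of_real (freq ell n) * cosb ell n x)"
    by (intro L2i_tendsto_right[OF _ _ f A(3)] L2_of_real_smooth smooth_fun_deriv test_fun_smooth[OF A(1)] L2_cmult L2_cosb)
  moreover have "L2i ell f (\<lambda>x. of_real (deriv (p m) x)) = - L2i ell g (\<lambda>x. of_real (p m x))" for m
    using w A(1)[of m] unfolding weak_deriv_def L2i_of_real by blast
  moreover have "(\<lambda>m. - L2i ell g (\<lambda>x. of_real (p m x))) \<longlonglongrightarrow> - L2i ell g (sinb ell n)"
    by (intro tendsto_minus L2i_tendsto_right[OF _ _ g A(2)] L2_of_real_smooth test_fun_smooth[OF A(1)] L2_sinb)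
  ultimately have "L2i ell f (\<lambda>x. of_real (freq ell n) * cosb ell n x) = - L2i ell g (sinb ell n)"
    using LIMSEQ_unique by force
  moreover have "L2i ell f (\<lambda>x. of_real (freq ell n) * cosb ell n x) = of_real (freq ell n) * L2i ell f (cosb ell n)"
    by (subst (1 2) L2i_commute) (simp add: L2i_cmult_left)
  ultimately show ?thesis by (simp add: sinc_def cosc_def)
qed

lemma H1_dx:
  assumes "H1 ell f" shows "L2 ell (dx ell f)" "weak_deriv ell f (dx ell f)"
  using someI_ex[of "\<lambda>g. L2 ell g \<and> weak_deriv ell f g"] assms unfolding H1_def dx_def by auto

lemma H1_L2: "H1 ell f \<Longrightarrow> L2 ell f" by (simp add: H1_def)
lemma H10_H1: "H10 ell f \<Longrightarrow> H1 ell f" by (simp add: H10_def)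
lemma H10_L2: "H10 ell f \<Longrightarrow> L2 ell f" by (simp add: H10_def H1_def)
lemma H10_L2_dx: "H10 ell f \<Longrightarrow> L2 ell (dx ell f)" by (intro H1_dx H10_H1)

lemma sinc_dx: "0 < ell \<Longrightarrow> H1 ell f \<Longrightarrow> sinc ell (dx ell f) n = - of_real (freq ell n) * cosc ell f n"
  by (intro weak_deriv_sinc H1_L2 H1_dx)

lemma sqs_freq_cosc: assumes "0 < ell" "H1 ell f" shows "sqs (\<lambda>n. of_real (freq ell n) * cosc ell f n)"
  using sqs_sinc[OF assms(1) H1_dx(1)[OF assms(2)]] unfolding sinc_dx[OF assms] by (simp add: sqs_minus_iff)

text \<open>Parseval in the cosine basis on the left and in the sine basis on the right turns the
  defining identity into one between coefficients, where the test function satisfies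
  \<open>cosc_deriv_test\<close>.\<close>

lemma weak_deriv_of_sinc:
  assumes ell: "0 < ell" and f: "L2 ell f" and g: "L2 ell g"
    and c: "\<And>n. sinc ell g n = - of_real (freq ell n) * cosc ell f n"
  shows "weak_deriv ell f g"
  unfolding weak_deriv_def
proof (intro allI impI)
  fix \<phi> assume \<phi>: "test_fun {0<..<ell} \<phi>"
  note sm = test_fun_smooth[OF \<phi>]
  have "(\<lambda>n. cosc ell f n * cnj (cosc ell (\<lambda>x. of_real (deriv \<phi> x)) n)) sums L2i ell f (\<lambda>x. of_real (deriv \<phi> x))"
    by (intro cosc_parseval_inner ell f L2_of_real_smooth smooth_fun_deriv sm)
  moreover have "(\<lambda>n. - (sinc ell g n * cnj (sinc ell (\<lambda>x. of_real (\<phi> x)) n))) sums - L2i ell g (\<lambda>x. of_real (\<phi> x))"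
    by (intro sums_minus sinc_parseval_inner ell g L2_of_real_smooth sm)
  moreover have "cosc ell f n * cnj (cosc ell (\<lambda>x. of_real (deriv \<phi> x)) n) = - (sinc ell g n * cnj (sinc ell (\<lambda>x. of_real (\<phi> x)) n))" for n
    by (simp add: cosc_deriv_test[OF ell \<phi>] c)
  ultimately show "(CLINT x|Om ell. f x * of_real (deriv \<phi> x)) = - (CLINT x|Om ell. g x * of_real (\<phi> x))"
    unfolding L2i_of_real using sums_unique2 by force
qed

lemma weak_deriv_of_cosc:
  assumes ell: "0 < ell" and f: "L2 ell f" and g: "L2 ell g"
    and c: "\<And>n. cosc ell g n = of_real (freq ell n) * sinc ell f n"
  shows "weak_deriv ell f g"
  unfolding weak_deriv_def
proof (intro allI impI)
  fix \<phi> assume \<phi>: "test_fun {0<..<ell} \<phi>"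
  note sm = test_fun_smooth[OF \<phi>]
  have "(\<lambda>n. sinc ell f n * cnj (sinc ell (\<lambda>x. of_real (deriv \<phi> x)) n)) sums L2i ell f (\<lambda>x. of_real (deriv \<phi> x))"
    by (intro sinc_parseval_inner ell f L2_of_real_smooth smooth_fun_deriv sm)
  moreover have "(\<lambda>n. - (cosc ell g n * cnj (cosc ell (\<lambda>x. of_real (\<phi> x)) n))) sums - L2i ell g (\<lambda>x. of_real (\<phi> x))"
    by (intro sums_minus cosc_parseval_inner ell g L2_of_real_smooth sm)
  moreover have "sinc ell f n * cnj (sinc ell (\<lambda>x. of_real (deriv \<phi> x)) n) = - (cosc ell g n * cnj (cosc ell (\<lambda>x. of_real (\<phi> x)) n))" for n
    by (simp add: sinc_deriv_test[OF ell \<phi>] c)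
  ultimately show "(CLINT x|Om ell. f x * of_real (deriv \<phi> x)) = - (CLINT x|Om ell. g x * of_real (\<phi> x))"
    unfolding L2i_of_real using sums_unique2 by force
qed

text \<open>For the converse the derivative is built by Riesz-Fischer from the sine coefficients
  that \<open>weak_deriv_sinc\<close> dictates.\<close>

lemma H1_iff:
  assumes ell: "0 < ell"
  shows "H1 ell f \<longleftrightarrow> L2 ell f \<and> sqs (\<lambda>n. of_real (freq ell n) * cosc ell f n)"
proof
  assume "L2 ell f \<and> sqs (\<lambda>n. of_real (freq ell n) * cosc ell f n)"
  then have f: "L2 ell f" and "sqs (\<lambda>n. - (of_real (freq ell n) * cosc ell f n))" by (simp_all add: sqs_minus_iff)
  then obtain g where "L2 ell g" "\<And>n. sinc ell g n = - (of_real (freq ell n) * cosc ell f n)"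
    using sinc_Riesz_Fischer[OF ell] by fastforce
  then show "H1 ell f" using weak_deriv_of_sinc[OF ell f, of g] f unfolding H1_def by auto
qed (auto simp: H1_L2 sqs_freq_cosc[OF ell])

text \<open>The density clause of \<open>H10\<close> in epsilon form, with g in place of the chosen
  derivative \<open>dx ell f\<close>; in this form it passes to linear combinations.\<close>

definition test_approx :: "real \<Rightarrow> (real \<Rightarrow> complex) \<Rightarrow> (real \<Rightarrow> complex) \<Rightarrow> bool" where
  "test_approx ell f g \<longleftrightarrow> (\<forall>e>0. \<exists>p q. test_fun {0<..<ell} p \<and> test_fun {0<..<ell} q \<and>
     L2n ell (\<lambda>x. f x - Complex (p x) (q x)) < e \<and> L2n ell (\<lambda>x. g x - Complex (deriv p x) (deriv q x)) < e)"

lemma smooth_fun_lin: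
  assumes "smooth_fun f" "smooth_fun g" shows "smooth_fun (\<lambda>x. a * f x + b * g x)"
    "deriv (\<lambda>x. a * f x + b * g x) x = a * deriv f x + b * deriv g x"
proof -
  have D: "((\<lambda>x. a * f x + b * g x) has_real_derivative a * deriv f x + b * deriv g x) (at x)"
    if "smooth_fun f" "smooth_fun g" for f g x
    by (auto intro!: derivative_eq_intros smooth_fun_DERIV that)
  then show "deriv (\<lambda>x. a * f x + b * g x) x = a * deriv f x + b * deriv g x"
    using assms by (intro DERIV_imp_deriv)
  define P where "P h \<longleftrightarrow> (\<exists>f g. smooth_fun f \<and> smooth_fun g \<and> h = (\<lambda>x. a * f x + b * g x))" for h
  show "smooth_fun (\<lambda>x. a * f x + b * g x)"
  proof (rule smooth_fun_class[of P])
    show "P (\<lambda>x. a * f x + b * g x)" unfolding P_def using assms by blast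
    fix h assume "P h"
    then obtain f g where h: "smooth_fun f" "smooth_fun g" "h = (\<lambda>x. a * f x + b * g x)" unfolding P_def by blast
    have "deriv h = (\<lambda>x. a * deriv f x + b * deriv g x)"
      unfolding h(3) using D[OF h(1,2)] by (auto intro: DERIV_imp_deriv)
    then have "P (deriv h)" unfolding P_def using smooth_fun_deriv h by blast
    then show "h differentiable_on UNIV \<and> P (deriv h)"
      using differentiable_on_UNIV_real[OF D[OF h(1,2)]] h(3) by simp
  qed
qed

lemma test_fun_lin:
  assumes "test_fun S f" "test_fun S g" shows "test_fun S (\<lambda>x. a * f x + b * g x)"
proof -
  obtain K where K: "compact K" "K \<subseteq> S" "\<And>x. x \<notin> K \<Longrightarrow> f x = 0" using assms(1) unfolding test_fun_def by blast
  obtain K' where K': "compact K'" "K' \<subseteq> S" "\<And>x. x \<notin> K' \<Longrightarrow> g x = 0" using assms(2) unfolding test_fun_def by blast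
  show ?thesis unfolding test_fun_def
    using smooth_fun_lin(1)[OF test_fun_smooth[OF assms(1)] test_fun_smooth[OF assms(2)], of a b] K K'
    by (intro conjI exI[of _ "K \<union> K'"]) auto
qed

lemma L2_Complex_smooth: "smooth_fun p \<Longrightarrow> smooth_fun q \<Longrightarrow> L2 ell (\<lambda>x. Complex (p x) (q x))"
  unfolding Complex_eq by (intro L2_add L2_cmult L2_of_real_smooth)

lemma test_approx_lin:
  assumes L: "L2 ell f" "L2 ell g" "L2 ell f'" "L2 ell g'"
    and a: "test_approx ell f g" "test_approx ell f' g'"
  shows "test_approx ell (\<lambda>x. f' x + c * f x) (\<lambda>x. g' x + c * g x)"
  unfolding test_approx_def
proof (intro allI impI)
  fix e :: real assume e: "e > 0"
  define d where "d = e / (2 * (cmod c + 1))"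
  have c1: "cmod c + 1 > 0" by (smt (verit) norm_ge_zero)
  have d: "d > 0" "cmod c * d < e / 2" using e c1 by (auto simp: d_def field_simps)
  obtain p q where pq: "test_fun {0<..<ell} p" "test_fun {0<..<ell} q"
     "L2n ell (\<lambda>x. f x - Complex (p x) (q x)) < d" "L2n ell (\<lambda>x. g x - Complex (deriv p x) (deriv q x)) < d"
    using a(1) d unfolding test_approx_def by blast
  obtain p' q' where pq': "test_fun {0<..<ell} p'" "test_fun {0<..<ell} q'"
     "L2n ell (\<lambda>x. f' x - Complex (p' x) (q' x)) < e/2" "L2n ell (\<lambda>x. g' x - Complex (deriv p' x) (deriv q' x)) < e/2"
    using a(2) e unfolding test_approx_def by (meson half_gt_zero)
  note sm = test_fun_smooth[OF pq(1)] test_fun_smooth[OF pq(2)] test_fun_smooth[OF pq'(1)] test_fun_smooth[OF pq'(2)]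
  have tc: "test_fun {0<..<ell} (\<lambda>x. Re c * p x + (- Im c) * q x)" "test_fun {0<..<ell} (\<lambda>x. Re c * q x + Im c * p x)"
    by (intro test_fun_lin pq)+
  let ?P = "\<lambda>x. 1 * p' x + 1 * (Re c * p x + (- Im c) * q x)"
  let ?Q = "\<lambda>x. 1 * q' x + 1 * (Re c * q x + Im c * p x)"
  have key: "L2n ell (\<lambda>x. (h' x + c * h x) - (u' x + c * u x)) < e"
    if "L2n ell (\<lambda>x. h x - u x) < d" "L2n ell (\<lambda>x. h' x - u' x) < e/2"
       "L2 ell h" "L2 ell h'" "L2 ell u" "L2 ell u'" for h h' u u'
  proof -
    have "L2n ell (\<lambda>x. (h' x + c * h x) - (u' x + c * u x)) = L2n ell (\<lambda>x. (h' x - u' x) + c * (h x - u x))"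
      by (simp add: algebra_simps)
    also have "\<dots> \<le> L2n ell (\<lambda>x. h' x - u' x) + cmod c * L2n ell (\<lambda>x. h x - u x)"
      using L2n_triangle[of ell "\<lambda>x. h' x - u' x" "\<lambda>x. c * (h x - u x)"] that by (simp add: L2n_cmult L2_diff L2_cmult)
    also have "\<dots> < e" using that d mult_left_mono[OF less_imp_le[OF that(1)] norm_ge_zero[of c]] by linarith
    finally show ?thesis .
  qed
  have P': "deriv ?P x = deriv p' x + (Re c * deriv p x - Im c * deriv q x)"
       "deriv ?Q x = deriv q' x + (Re c * deriv q x + Im c * deriv p x)" for x
    using smooth_fun_lin(2)[OF sm(3) test_fun_smooth[OF tc(1)], of 1 1] smooth_fun_lin(2)[OF sm(4) test_fun_smooth[OF tc(2)], of 1 1]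
      smooth_fun_lin(2)[OF sm(1,2), of "Re c" "- Im c"] smooth_fun_lin(2)[OF sm(2,1), of "Re c" "Im c"] by simp_all
  have C1: "Complex (?P x) (?Q x) = Complex (p' x) (q' x) + c * Complex (p x) (q x)" for x
    by (simp add: complex_eq_iff)
  have C2: "Complex (deriv ?P x) (deriv ?Q x) = Complex (deriv p' x) (deriv q' x) + c * Complex (deriv p x) (deriv q x)" for x
    unfolding P' by (simp add: complex_eq_iff)
  show "\<exists>p q. test_fun {0<..<ell} p \<and> test_fun {0<..<ell} q \<and>
     L2n ell (\<lambda>x. (f' x + c * f x) - Complex (p x) (q x)) < e \<and> L2n ell (\<lambda>x. (g' x + c * g x) - Complex (deriv p x) (deriv q x)) < e"
  proof (intro exI conjI)
    show "test_fun {0<..<ell} ?P" "test_fun {0<..<ell} ?Q" by (intro test_fun_lin pq' tc)+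
    show "L2n ell (\<lambda>x. (f' x + c * f x) - Complex (?P x) (?Q x)) < e" unfolding C1
      by (intro key pq pq' L L2_Complex_smooth sm)
    show "L2n ell (\<lambda>x. (g' x + c * g x) - Complex (deriv ?P x) (deriv ?Q x)) < e" unfolding C2
      by (intro key pq pq' L L2_Complex_smooth sm smooth_fun_deriv)
  qed
qed

lemma test_approx_sinb:
  assumes ell: "0 < ell" shows "test_approx ell (sinb ell n) (\<lambda>x. of_real (freq ell n) * cosb ell n x)"
  unfolding test_approx_def
proof (intro allI impI)
  fix e :: real assume e: "e > 0"
  obtain p where A: "\<And>m::nat. test_fun {0<..<ell} (p m)"
    "(\<lambda>m. L2n ell (\<lambda>x. of_real (p m x) - sinb ell n x)) \<longlonglongrightarrow> 0"
    "(\<lambda>m. L2n ell (\<lambda>x. of_real (deriv (p m) x) - of_real (freq ell n) * cosb ell n x)) \<longlonglongrightarrow> 0"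
    using sinb_test_approx[OF ell] by blast
  have z: "test_fun {0<..<ell} (\<lambda>x. 0)" using test_fun_lin[OF A(1) A(1), of 0 0 0 0] by simp
  obtain m where m: "L2n ell (\<lambda>x. of_real (p m x) - sinb ell n x) < e"
     "L2n ell (\<lambda>x. of_real (deriv (p m) x) - of_real (freq ell n) * cosb ell n x) < e"
    using eventually_happens[OF eventually_conj[OF order_tendstoD(2)[OF A(2) e] order_tendstoD(2)[OF A(3) e]]] by auto
  have s: "L2n ell (\<lambda>x. f x - g x) = L2n ell (\<lambda>x. g x - f x)" for f g
    by (simp add: L2n_def norm_minus_commute)
  have c: "Complex r 0 = of_real r" for r by (simp add: complex_of_real_def)
  show "\<exists>p q. test_fun {0<..<ell} p \<and> test_fun {0<..<ell} q \<and>
     L2n ell (\<lambda>x. sinb ell n x - Complex (p x) (q x)) < e \<and> L2n ell (\<lambda>x. of_real (freq ell n) * cosb ell n x - Complex (deriv p x) (deriv q x)) < e"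
    by (rule exI[of _ "p m"], rule exI[of _ "\<lambda>x. 0"])
       (use m z A(1) s[of "sinb ell n" "\<lambda>x. of_real (p m x)"]
          s[of "\<lambda>x. of_real (freq ell n) * cosb ell n x" "\<lambda>x. of_real (deriv (p m) x)"] in \<open>simp add: c\<close>)
qed

lemma test_approx_part:
  assumes ell: "0 < ell"
  shows "test_approx ell (\<lambda>x. \<Sum>i<n. c i * sinb ell i x) (\<lambda>x. \<Sum>i<n. c i * (of_real (freq ell i) * cosb ell i x))"
proof (induction n)
  case 0
  show ?case using test_approx_sinb[OF ell, of 0] by (simp add: sinb_def[abs_def])
next
  case (Suc n)
  show ?case unfolding sum.lessThan_Suc
    by (rule test_approx_lin[OF _ _ _ _ test_approx_sinb[OF ell] Suc]) (intro L2_sum L2_cmult L2_sinb L2_cosb)+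
qed

text \<open>The sine partial sums converge to f together with their derivatives, and each of them is
  approximated by test functions in the same sense. Choosing an approximation at scale 1/(n+1) for
  every n gives the sequences that \<open>H10\<close> asks for.\<close>

lemma H10_if_sqs:
  assumes ell: "0 < ell" and f: "L2 ell f" and s: "sqs (\<lambda>n. of_real (freq ell n) * sinc ell f n)"
  shows "H10 ell f"
proof -
  obtain g where g: "L2 ell g" "\<And>n. cosc ell g n = of_real (freq ell n) * sinc ell f n"
    using cosc_Riesz_Fischer[OF ell s] by blast
  have w: "weak_deriv ell f g" by (rule weak_deriv_of_cosc[OF ell f g])
  then have H1: "H1 ell f" unfolding H1_def using f g by blast
  \<comment> \<open>\<open>dx ell f\<close> is merely some weak derivative; its sine coefficients
    identify it with g.\<close>
  have ae: "AE x in Om ell. g x = dx ell f x"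
    using weak_deriv_sinc[OF ell f g(1) w] sinc_dx[OF ell H1] by (intro sinc_eq_AE ell g H1_dx(1)[OF H1]) simp
  have ta: "\<exists>p q. test_fun {0<..<ell} p \<and> test_fun {0<..<ell} q \<and>
     L2n ell (\<lambda>x. f x - Complex (p x) (q x)) < e \<and> L2n ell (\<lambda>x. dx ell f x - Complex (deriv p x) (deriv q x)) < e"
    if e: "e > 0" for e
  proof -
    let ?F = "\<lambda>n x. \<Sum>i<n. sinc ell f i * sinb ell i x"
    let ?G = "\<lambda>n x. \<Sum>i<n. sinc ell f i * (of_real (freq ell i) * cosb ell i x)"
    have F: "(\<lambda>n. L2n ell (\<lambda>x. ?F n x - f x)) \<longlonglongrightarrow> 0" by (rule sinc_part_tendsto[OF ell f])
    have G: "(\<lambda>n. L2n ell (\<lambda>x. ?G n x - g x)) \<longlonglongrightarrow> 0"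
      using cosc_part_tendsto[OF ell g(1)] by (simp add: g(2) mult_ac)
    have "e / 2 > 0" using e by simp
    then obtain n where n: "L2n ell (\<lambda>x. ?F n x - f x) < e/2" "L2n ell (\<lambda>x. ?G n x - g x) < e/2"
      using eventually_happens[OF eventually_conj[OF order_tendstoD(2)[OF F \<open>e / 2 > 0\<close>] order_tendstoD(2)[OF G \<open>e / 2 > 0\<close>]]]
      by (auto simp del: less_divide_eq_numeral1)
    obtain p q where pq: "test_fun {0<..<ell} p" "test_fun {0<..<ell} q"
       "L2n ell (\<lambda>x. ?F n x - Complex (p x) (q x)) < e/2" "L2n ell (\<lambda>x. ?G n x - Complex (deriv p x) (deriv q x)) < e/2"
      using test_approx_part[OF ell, where n=n and c="sinc ell f"] \<open>e / 2 > 0\<close> unfolding test_approx_def by blast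
    note sm = test_fun_smooth[OF pq(1)] test_fun_smooth[OF pq(2)]
    have tri: "L2n ell (\<lambda>x. h x - u x) < e"
      if "L2n ell (\<lambda>x. v x - h x) < e/2" "L2n ell (\<lambda>x. v x - u x) < e/2" "L2 ell h" "L2 ell u" "L2 ell v" for h u v
    proof -
      have "L2n ell (\<lambda>x. h x - u x) = L2n ell (\<lambda>x. (v x - u x) + (-1) * (v x - h x))" by simp
      also have "\<dots> \<le> L2n ell (\<lambda>x. v x - u x) + L2n ell (\<lambda>x. (-1) * (v x - h x))"
        by (intro L2n_triangle L2_diff L2_cmult that)
      finally show ?thesis using that unfolding L2n_cmult by simp
    qed
    have "L2n ell (\<lambda>x. f x - Complex (p x) (q x)) < e"
      by (rule tri[OF n(1) pq(3)]) (intro f L2_sum L2_cmult L2_sinb L2_Complex_smooth sm)+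
    moreover have "L2n ell (\<lambda>x. g x - Complex (deriv p x) (deriv q x)) < e"
      by (rule tri[OF n(2) pq(4)]) (intro g L2_sum L2_cmult L2_cosb L2_Complex_smooth sm smooth_fun_deriv)+
    moreover have "L2n ell (\<lambda>x. g x - Complex (deriv p x) (deriv q x)) = L2n ell (\<lambda>x. dx ell f x - Complex (deriv p x) (deriv q x))"
      by (rule L2n_cong_AE) (use ae in \<open>auto intro!: L2_diff g L2_Complex_smooth sm smooth_fun_deriv\<close>)
    ultimately show ?thesis using pq by auto
  qed
  define Q where "Q n p q \<longleftrightarrow> test_fun {0<..<ell} p \<and> test_fun {0<..<ell} q \<and>
     L2n ell (\<lambda>x. f x - Complex (p x) (q x)) < inverse (real (Suc n)) \<and> L2n ell (\<lambda>x. dx ell f x - Complex (deriv p x) (deriv q x)) < inverse (real (Suc n))"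
    for n p q
  have "\<forall>n. \<exists>p q. Q n p q"
    unfolding Q_def by (intro allI ta) simp
  then obtain p q where Q: "\<And>n. Q n (p n) (q n)" by metis
  then have pq: "\<And>n. test_fun {0<..<ell} (p n)" "\<And>n. test_fun {0<..<ell} (q n)"
     "\<And>n. L2n ell (\<lambda>x. f x - Complex (p n x) (q n x)) < inverse (real (Suc n))"
     "\<And>n. L2n ell (\<lambda>x. dx ell f x - Complex (deriv (p n) x) (deriv (q n) x)) < inverse (real (Suc n))"
    unfolding Q_def by blast+
  have l1: "(\<lambda>n. L2n ell (\<lambda>x. f x - Complex (p n x) (q n x))) \<longlonglongrightarrow> 0"
    by (rule tendsto_sandwich[OF _ _ tendsto_const LIMSEQ_inverse_real_of_nat]) (use pq(3) in \<open>auto intro!: always_eventually less_imp_le\<close>)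
  have l2: "(\<lambda>n. L2n ell (\<lambda>x. dx ell f x - Complex (deriv (p n) x) (deriv (q n) x))) \<longlonglongrightarrow> 0"
    by (rule tendsto_sandwich[OF _ _ tendsto_const LIMSEQ_inverse_real_of_nat]) (use pq(4) in \<open>auto intro!: always_eventually less_imp_le\<close>)
  show ?thesis unfolding H10_def
    using H1 pq(1,2) tendsto_add[OF tendsto_power[OF l1, of 2] tendsto_power[OF l2, of 2]]
    by (intro conjI exI[of _ p] exI[of _ q]) auto
qed

text \<open>Cosines do not vanish at the ends, so here the boundary condition on f is essential. The
  identity holds for test functions and passes to the limit along the sequence in
  \<open>H10\<close>.\<close>

lemma cosc_dx:
  assumes ell: "0 < ell" and f: "H10 ell f"
  shows "cosc ell (dx ell f) n = of_real (freq ell n) * sinc ell f n"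
proof -
  obtain p q where pq: "\<And>n. test_fun {0<..<ell} (p n)" "\<And>n. test_fun {0<..<ell} (q n)"
    and l: "(\<lambda>n. (L2n ell (\<lambda>x. f x - Complex (p n x) (q n x)))\<^sup>2
             + (L2n ell (\<lambda>x. dx ell f x - Complex (deriv (p n) x) (deriv (q n) x)))\<^sup>2) \<longlonglongrightarrow> 0"
    using f unfolding H10_def by blast
  note sm = test_fun_smooth[OF pq(1)] test_fun_smooth[OF pq(2)]
  let ?F = "\<lambda>m x. Complex (p m x) (q m x)" let ?G = "\<lambda>m x. Complex (deriv (p m) x) (deriv (q m) x)"
  have s: "L2n ell (\<lambda>x. f x - g x) = L2n ell (\<lambda>x. g x - f x)" for f g
    by (simp add: L2n_def norm_minus_commute)
  have lim: "a \<longlonglongrightarrow> 0" if "\<And>n. (0::real) \<le> a n" "\<And>n. (a n)\<^sup>2 \<le> c n" "c \<longlonglongrightarrow> 0" for a c :: "nat \<Rightarrow> real"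
  proof -
    have "(\<lambda>n. sqrt (c n)) \<longlonglongrightarrow> 0" using tendsto_real_sqrt[OF that(3)] by simp
    from tendsto_sandwich[OF _ _ tendsto_const this, of a] show ?thesis
      using that by (auto intro!: always_eventually real_le_rsqrt)
  qed
  have l1: "(\<lambda>m. L2n ell (\<lambda>x. ?F m x - f x)) \<longlonglongrightarrow> 0" unfolding s[of _ f] by (rule lim[OF _ _ l]) auto
  have l2: "(\<lambda>m. L2n ell (\<lambda>x. ?G m x - dx ell f x)) \<longlonglongrightarrow> 0" unfolding s[of _ "dx ell f"] by (rule lim[OF _ _ l]) auto
  have "(\<lambda>m. sinc ell (?F m) n) \<longlonglongrightarrow> sinc ell f n" unfolding sinc_def
    by (intro L2i_tendsto_left[OF _ _ _ l1] L2_Complex_smooth sm H10_L2 f L2_sinb)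
  then have "(\<lambda>m. of_real (freq ell n) * sinc ell (?F m) n) \<longlonglongrightarrow> of_real (freq ell n) * sinc ell f n"
    by (rule tendsto_mult_left)
  moreover have "(\<lambda>m. cosc ell (?G m) n) \<longlonglongrightarrow> cosc ell (dx ell f) n" unfolding cosc_def
    by (intro L2i_tendsto_left[OF _ _ _ l2] L2_Complex_smooth sm smooth_fun_deriv H10_L2_dx f L2_cosb)
  moreover have "cosc ell (?G m) n = of_real (freq ell n) * sinc ell (?F m) n" for m
    unfolding Complex_eq
    by (simp add: cosc_add sinc_add cosc_cmult sinc_cmult L2_cmult L2_of_real_smooth sm smooth_fun_deriv
        cosc_deriv_test[OF ell pq(1)] cosc_deriv_test[OF ell pq(2)] algebra_simps)
  ultimately show ?thesis using LIMSEQ_unique by force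
qed

text \<open>Compared with \<open>H1_iff\<close>, the boundary condition is encoded entirely in the
  use of sine instead of cosine coefficients.\<close>

lemma H10_iff:
  assumes ell: "0 < ell"
  shows "H10 ell f \<longleftrightarrow> L2 ell f \<and> sqs (\<lambda>n. of_real (freq ell n) * sinc ell f n)"
proof
  assume f: "H10 ell f"
  have "sqs (cosc ell (dx ell f))" by (rule sqs_cosc[OF ell H10_L2_dx[OF f]])
  moreover have "cosc ell (dx ell f) = (\<lambda>n. of_real (freq ell n) * sinc ell f n)"
    using cosc_dx[OF ell f] by auto
  ultimately show "L2 ell f \<and> sqs (\<lambda>n. of_real (freq ell n) * sinc ell f n)"
    using H10_L2[OF f] by simp
qed (use H10_if_sqs[OF ell] in blast)

lemma H10_sinb: assumes "0 < ell" shows "H10 ell (sinb ell n)"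
proof -
  interpret onsys ell "sinb ell" "\<lambda>n. 0 < n" by (rule onsys_sinb[OF assms])
  have "sqs (\<lambda>m. of_real (freq ell m) * sinc ell (sinb ell n) m)" unfolding sqs_def
    by (rule summable_finite[of "{n}"]) (auto simp: sinc_def orth)
  then show ?thesis by (simp add: H10_iff[OF assms] L2_sinb)
qed

lemma sinc_sinb: assumes "0 < ell" shows "sinc ell (sinb ell n) m = (if m = n \<and> 0 < n then 1 else 0)"
proof -
  interpret onsys ell "sinb ell" "\<lambda>n. 0 < n" by (rule onsys_sinb[OF assms])
  show ?thesis by (auto simp: sinc_def orth)
qed

lemma L2i_dx_sums:
  assumes "0 < ell" "H10 ell f" "H10 ell v"
  shows "(\<lambda>n. of_real ((freq ell n)\<^sup>2) * sinc ell f n * cnj (sinc ell v n)) sums L2i ell (dx ell f) (dx ell v)"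
proof -
  have "(\<lambda>n. cosc ell (dx ell f) n * cnj (cosc ell (dx ell v) n)) sums L2i ell (dx ell f) (dx ell v)"
    by (intro cosc_parseval_inner assms H10_L2_dx)
  then show ?thesis by (simp add: cosc_dx assms power2_eq_square mult_ac)
qed

lemma L2n_dx_sums:
  assumes "0 < ell" "H10 ell f"
  shows "(\<lambda>n. (freq ell n)\<^sup>2 * (cmod (sinc ell f n))\<^sup>2) sums (L2n ell (dx ell f))\<^sup>2"
  using cosc_parseval[OF assms(1) H10_L2_dx[OF assms(2)]]
  by (simp add: cosc_dx assms norm_mult power_mult_distrib)

text \<open>Testing a gradient pairing with a single sine isolates one coefficient. The weakly
  defined notions \<open>memint\<close> and \<open>sderiv\<close> are reduced to scalars in this
  way.\<close>

lemma L2i_dx_sinb: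
  assumes "0 < ell" "H10 ell f"
  shows "L2i ell (dx ell f) (dx ell (sinb ell n)) = of_real ((freq ell n)\<^sup>2) * sinc ell f n"
proof -
  have "(\<lambda>m. of_real ((freq ell m)\<^sup>2) * sinc ell f m * cnj (sinc ell (sinb ell n) m)) sums
     (\<Sum>m\<in>{n}. of_real ((freq ell m)\<^sup>2) * sinc ell f m * cnj (sinc ell (sinb ell n) m))"
    by (rule sums_finite) (auto simp: sinc_sinb assms)
  then have "L2i ell (dx ell f) (dx ell (sinb ell n)) = of_real ((freq ell n)\<^sup>2) * sinc ell f n * cnj (sinc ell (sinb ell n) n)"
    using L2i_dx_sums[OF assms H10_sinb[OF assms(1)], of n] sums_unique2 by force
  then show ?thesis using assms by (cases "n = 0") (auto simp: sinc_sinb)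
qed

section \<open>Exponential decay of the kernels\<close>

text \<open>A closed interval is a ball about its midpoint, so the Vitali theorem for balls applies;
  openness of U keeps sufficiently short intervals inside. P carries the bound on increments that
  the selected intervals retain.\<close>

lemma Vitali_intervals:
  fixes S U :: "real set"
  assumes U: "open U" "S \<subseteq> U"
    and P: "\<And>x d. x \<in> S \<Longrightarrow> 0 < d \<Longrightarrow> \<exists>a b. a < b \<and> x \<in> {a..b} \<and> b - a < d \<and> P a b"
  obtains C where "countable C" "\<And>i. i \<in> C \<Longrightarrow> fst i < snd i \<and> {fst i..snd i} \<subseteq> U \<and> P (fst i) (snd i)"
    "disjoint_family_on (\<lambda>i. {fst i..snd i}) C" "negligible (S - (\<Union>i\<in>C. {fst i..snd i}))"
proof -
  define K where "K = {i. fst i < snd i \<and> {fst i..snd i} \<subseteq> U \<and> P (fst i) (snd i)}"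
  have cb: "cball ((fst i + snd i) / 2) ((snd i - fst i) / 2) = {fst i..snd i}" for i :: "real \<times> real"
    by (auto simp: cball_eq_atLeastAtMost field_simps)
  have ex: "\<exists>i. i \<in> K \<and> x \<in> cball ((fst i + snd i) / 2) ((snd i - fst i) / 2) \<and> (snd i - fst i) / 2 < d"
    if x: "x \<in> S" and d: "0 < d" for x d
  proof -
    obtain e where e: "e > 0" "ball x e \<subseteq> U" using U x unfolding open_contains_ball by blast
    obtain a b where ab: "a < b" "x \<in> {a..b}" "b - a < min d e" "P a b" using P[OF x, of "min d e"] d e by auto
    have "{a..b} \<subseteq> ball x e" using ab by (auto simp: dist_real_def)
    then have "(a,b) \<in> K" using ab e by (auto simp: K_def)
    moreover have "x \<in> cball ((fst (a,b) + snd (a,b)) / 2) ((snd (a,b) - fst (a,b)) / 2)"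
      unfolding cb using ab by simp
    ultimately show ?thesis using ab by (intro exI[of _ "(a,b)"]) auto
  qed
  obtain C where C: "countable C" "C \<subseteq> K"
     "pairwise (\<lambda>i j. disjnt (cball ((fst i + snd i) / 2) ((snd i - fst i) / 2)) (cball ((fst j + snd j) / 2) ((snd j - fst j) / 2))) C"
     "negligible (S - (\<Union>i \<in> C. cball ((fst i + snd i) / 2) ((snd i - fst i) / 2)))"
    by (rule Vitali_covering_theorem_cballs[of K "\<lambda>i. (snd i - fst i) / 2" S "\<lambda>i. (fst i + snd i) / 2"])
       (use ex in \<open>auto simp: K_def\<close>)
  show ?thesis
    by (rule that[of C]) (use C in \<open>auto simp: cb K_def disjoint_family_on_def pairwise_def disjnt_def subset_eq\<close>)
qed

lemma emeasure_disjoint_intervals_le: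
  fixes C :: "(real \<times> real) set"
  assumes "countable C" "disjoint_family_on (\<lambda>i. {fst i..snd i}) C"
    and [simp]: "sets M = sets borel" "sets N = sets borel"
    and le: "\<And>i. i \<in> C \<Longrightarrow> emeasure M {fst i..snd i} \<le> c * emeasure N {fst i..snd i}"
  shows "emeasure M (\<Union>i\<in>C. {fst i..snd i}) \<le> c * emeasure N (\<Union>i\<in>C. {fst i..snd i})"
proof -
  have "emeasure M (\<Union>i\<in>C. {fst i..snd i}) = (\<integral>\<^sup>+i. emeasure M {fst i..snd i} \<partial>count_space C)"
    by (intro emeasure_UN_countable assms) auto
  also have "\<dots> \<le> (\<integral>\<^sup>+i. c * emeasure N {fst i..snd i} \<partial>count_space C)"
    by (intro nn_integral_mono) (use le in auto)
  also have "\<dots> = c * (\<integral>\<^sup>+i. emeasure N {fst i..snd i} \<partial>count_space C)"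
    by (intro nn_integral_cmult) auto
  also have "(\<integral>\<^sup>+i. emeasure N {fst i..snd i} \<partial>count_space C) = emeasure N (\<Union>i\<in>C. {fst i..snd i})"
    by (intro emeasure_UN_countable[symmetric] assms) auto
  finally show ?thesis .
qed

text \<open>A condition on derivates in the form that a Vitali covering needs: the intervals contain
  x anywhere, not necessarily as an endpoint.\<close>

definition low_quot :: "(real \<Rightarrow> real) \<Rightarrow> real \<Rightarrow> real \<Rightarrow> bool" where
  "low_quot g r x \<longleftrightarrow> (\<forall>d>0. \<exists>a b. a < b \<and> x \<in> {a..b} \<and> b - a < d \<and> g b - g a < r * (b - a))"

definition high_quot :: "(real \<Rightarrow> real) \<Rightarrow> real \<Rightarrow> real \<Rightarrow> bool" where
  "high_quot g r x \<longleftrightarrow> (\<forall>d>0. \<exists>a b. a < b \<and> x \<in> {a..b} \<and> b - a < d \<and> r * (b - a) < g b - g a)"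

context
  fixes g :: "real \<Rightarrow> real"
  assumes g_mono: "mono g" and g_cont: "continuous_on UNIV g"
begin

lemma emeasure_interval_g: "a \<le> b \<Longrightarrow> emeasure (interval_measure g) {a..b} = ennreal (g b - g a)"
  by (intro emeasure_interval_measure_Icc continuous_on_subset[OF g_cont]) (use g_mono in \<open>auto simp: mono_def\<close>)

lemma lborel_le_interval_measure:
  assumes "R > 0" "a < b" "R * (b - a) \<le> g b - g a"
  shows "emeasure lborel {a..b} \<le> ennreal (1 / R) * emeasure (interval_measure g) {a..b}"
proof -
  have "b - a \<le> (1 / R) * (g b - g a)" using assms by (simp add: field_simps)
  then show ?thesis using assms
    by (simp add: emeasure_interval_g flip: ennreal_mult')
qed

text \<open>Lebesgue's argument. Let t be the outer measure of E. Almost all of E is covered by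
  disjoint intervals of slope below r inside an open set of measure at most t + e; what lies in
  their interiors is covered again by disjoint intervals of slope above R. Comparing the increments
  of g yields t <= (r/R)(t + e) for every e, hence t = 0.\<close>

lemma negligible_quot_gap:
  assumes rR: "0 < r" "r < R" and E: "E \<subseteq> {p<..<q}"
    and lo: "\<And>x. x \<in> E \<Longrightarrow> low_quot g r x" and hi: "\<And>x. x \<in> E \<Longrightarrow> high_quot g R x"
  shows "negligible E"
proof -
  define om where "om = outer_measure_of lebesgue E"
  have "om \<le> outer_measure_of lebesgue {p<..<q}" unfolding om_def by (intro outer_measure_of_mono E)
  also have "\<dots> = emeasure lborel {p<..<q}" by simp
  also have "\<dots> < \<infinity>" by (cases "p \<le> q") auto
  finally obtain t where t: "om = ennreal t" "t \<ge> 0" by (cases om) auto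
  \<comment> \<open>E is not known to be measurable; T is a measurable hull with the same outer
    measure.\<close>
  obtain T where T: "T \<in> sets lebesgue" "E \<subseteq> T" "om = emeasure lebesgue T"
    using outer_measure_of_attain[of E lebesgue] unfolding om_def by auto
  have step: "t \<le> (r / R) * (t + e)" if e: "e > 0" for e
  proof -
    obtain U where U: "open U" "T \<subseteq> U" "U - T \<in> lmeasurable" "emeasure lebesgue (U - T) < ennreal e"
      using sets_lebesgue_outer_open[OF T(1) e] by blast
    have "emeasure lebesgue U \<le> emeasure lebesgue T + emeasure lebesgue (U - T)"
      using emeasure_subadditive[of T lebesgue "U - T"] U T by (simp add: fmeasurableD Un_absorb1)
    also have "\<dots> \<le> ennreal (t + e)" using T(3) t U(4) e by (auto simp: ennreal_plus intro: add_left_mono)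
    finally have Ule: "emeasure lborel U \<le> ennreal (t + e)" using U(1) by simp
    obtain C1 where C1: "countable C1"
      "\<And>i. i \<in> C1 \<Longrightarrow> fst i < snd i \<and> {fst i..snd i} \<subseteq> U \<and> g (snd i) - g (fst i) < r * (snd i - fst i)"
      "disjoint_family_on (\<lambda>i. {fst i..snd i}) C1" "negligible (E - (\<Union>i\<in>C1. {fst i..snd i}))"
    proof (rule Vitali_intervals[of U E "\<lambda>a b. g b - g a < r * (b - a)"])
      show "\<exists>a b. a < b \<and> x \<in> {a..b} \<and> b - a < d \<and> g b - g a < r * (b - a)" if "x \<in> E" "0 < d" for x d
        using lo[OF that(1)] that(2) unfolding low_quot_def by blast
      show "E \<subseteq> U" using U T(2) by blast
    qed (simp_all add: U)
    \<comment> \<open>The interiors form an open set, as the second covering requires; only the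
      countably many endpoints are lost.\<close>
    define V where "V = (\<Union>i\<in>C1. {fst i<..<snd i})"
    obtain C2 where C2: "countable C2"
      "\<And>i. i \<in> C2 \<Longrightarrow> fst i < snd i \<and> {fst i..snd i} \<subseteq> V \<and> R * (snd i - fst i) < g (snd i) - g (fst i)"
      "disjoint_family_on (\<lambda>i. {fst i..snd i}) C2" "negligible (E \<inter> V - (\<Union>i\<in>C2. {fst i..snd i}))"
    proof (rule Vitali_intervals[of V "E \<inter> V" "\<lambda>a b. R * (b - a) < g b - g a"])
      show "\<exists>a b. a < b \<and> x \<in> {a..b} \<and> b - a < d \<and> R * (b - a) < g b - g a" if "x \<in> E \<inter> V" "0 < d" for x d
        using hi[of x] that unfolding high_quot_def by blast
      show "open V" unfolding V_def by (intro open_UN ballI open_greaterThanLessThan)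
    qed simp_all
    let ?J1 = "\<Union>i\<in>C1. {fst i..snd i}" and ?J2 = "\<Union>i\<in>C2. {fst i..snd i}"
    have J[measurable]: "?J1 \<in> sets borel" "?J2 \<in> sets borel"
      using C1(1) C2(1) by (auto intro!: sets.countable_UN')
    have "E \<subseteq> ?J2 \<union> ((E - ?J1) \<union> (E \<inter> V - ?J2) \<union> (fst ` C1 \<union> snd ` C1))"
    proof
      fix x assume x: "x \<in> E"
      show "x \<in> ?J2 \<union> ((E - ?J1) \<union> (E \<inter> V - ?J2) \<union> (fst ` C1 \<union> snd ` C1))"
      proof (cases "x \<in> ?J1 - V")
        case True
        then obtain i where "i \<in> C1" "x \<in> {fst i..snd i}" "x \<notin> {fst i<..<snd i}" unfolding V_def by blast
        then have "x = fst i \<or> x = snd i" by auto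
        then show ?thesis using \<open>i \<in> C1\<close> by blast
      qed (use x in blast)
    qed
    moreover have cn: "negligible Z" if "countable Z" for Z :: "real set"
      using null_sets_completionI[OF countable_imp_null_set_lborel[OF that]] by (simp add: negligible_iff_null_sets)
    have "negligible ((E - ?J1) \<union> (E \<inter> V - ?J2) \<union> (fst ` C1 \<union> snd ` C1))"
      by (intro negligible_Un C1(4) C2(4) cn countable_image C1(1))
    then have N: "(E - ?J1) \<union> (E \<inter> V - ?J2) \<union> (fst ` C1 \<union> snd ` C1) \<in> null_sets lebesgue" (is "?N \<in> _")
      by (simp add: negligible_iff_null_sets)
    ultimately have "om \<le> outer_measure_of lebesgue (?J2 \<union> ?N)"
      unfolding om_def by (intro outer_measure_of_mono)
    also have "\<dots> = emeasure lebesgue (?J2 \<union> ?N)"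
      using sets.Un[of ?J2 lebesgue ?N] J null_setsD2[OF N] by (intro outer_measure_of_eq) simp
    also have "\<dots> = emeasure lborel ?J2"
      using emeasure_Un_null_set[OF _ N, of ?J2] J by simp
    also have "\<dots> \<le> ennreal (1 / R) * emeasure (interval_measure g) ?J2"
      by (rule emeasure_disjoint_intervals_le[OF C2(1,3)])
         (simp_all, use C2(2) rR in \<open>auto intro!: lborel_le_interval_measure[simplified] intro: less_imp_le\<close>)
    also have "\<dots> \<le> ennreal (1 / R) * emeasure (interval_measure g) ?J1"
    proof (intro mult_left_mono emeasure_mono)
      have "V \<subseteq> ?J1" unfolding V_def by (rule UN_mono) auto
      then show "?J2 \<subseteq> ?J1" using C2(2) by (intro UN_least) (meson subset_trans)
    qed (use J in auto)
    also have "\<dots> \<le> ennreal (1 / R) * (ennreal r * emeasure lborel ?J1)"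
    proof (rule mult_left_mono[OF emeasure_disjoint_intervals_le[OF C1(1,3)]])
      fix i assume i: "i \<in> C1"
      then show "emeasure (interval_measure g) {fst i..snd i} \<le> ennreal r * emeasure lborel {fst i..snd i}"
        using C1(2)[OF i] rR by (simp add: emeasure_interval_g flip: ennreal_mult')
    qed auto
    also have "\<dots> \<le> ennreal (1 / R) * (ennreal r * emeasure lborel U)"
      by (intro mult_left_mono emeasure_mono) (use C1(2) U(1) in auto)
    also have "\<dots> \<le> ennreal (1 / R) * (ennreal r * ennreal (t + e))"
      by (intro mult_left_mono Ule) auto
    also have "\<dots> = ennreal ((r / R) * (t + e))"
      using rR e t by (simp del: ennreal_plus flip: ennreal_mult')
    finally have "ennreal t \<le> ennreal ((r / R) * (t + e))" using t by simp
    then show ?thesis using rR e t by (subst (asm) ennreal_le_iff) auto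
  qed
  have "t \<le> 0"
  proof (rule ccontr)
    assume "\<not> t \<le> 0"
    then have t0: "t > 0" by simp
    \<comment> \<open>Makes r e equal to half of t (R - r), so that the estimate collapses to t (R -
      r) <= 0.\<close>
    define e where "e = t * (R - r) / (2 * r)"
    have "e > 0" using t0 rR by (simp add: e_def)
    from step[OF this] have "t * R \<le> r * (t + e)" using rR by (simp add: field_simps)
    also have "r * e = t * (R - r) / 2" using rR by (simp add: e_def)
    then have "r * (t + e) = r * t + t * (R - r) / 2" by (simp add: distrib_left)
    finally have "t * (R - r) \<le> 0" by (simp add: field_simps)
    then show False using t0 rR by (simp add: mult_le_0_iff)
  qed
  then have "T \<in> null_sets lebesgue" using T t by (simp add: null_sets_def)
  then show ?thesis using T(2) negligible_subset negligible_iff_null_sets by blast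
qed

text \<open>The derivative is the supremum D of the slopes exceeded on arbitrarily short intervals
  at x. Slopes above D are eventually not exceeded by definition; slopes below D are eventually not
  undercut, since otherwise a rational gap would appear.\<close>

lemma differentiable_if_no_gap:
  assumes nh: "\<not> high_quot g R0 x"
    and ng: "\<And>r R. r \<in> \<rat> \<Longrightarrow> R \<in> \<rat> \<Longrightarrow> 0 < r \<Longrightarrow> r < R \<Longrightarrow> \<not> (low_quot g r x \<and> high_quot g R x)"
  shows "\<exists>D\<le>max 0 R0. (g has_real_derivative D) (at x)"
proof -
  have hmono: "high_quot g R x \<Longrightarrow> R' \<le> R \<Longrightarrow> high_quot g R' x" for R R'
    unfolding high_quot_def by (smt (verit) mult_right_mono)
  \<comment> \<open>The element 0 makes the set nonempty and D nonnegative, in accordance with g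
    being increasing.\<close>
  define A where "A = insert 0 {R. high_quot g R x}"
  have up: "R \<le> max 0 R0" if "R \<in> A" for R
    using that hmono[of R R0] nh unfolding A_def by force
  have bdd: "bdd_above A" using up unfolding bdd_above_def by blast
  define D where "D = Sup A"
  have D0: "0 \<le> D" "D \<le> max 0 R0" unfolding D_def using bdd up
    by (auto intro!: cSup_upper cSup_least simp: A_def)
  have key: "\<exists>d>0. \<forall>a b. a < b \<longrightarrow> x \<in> {a..b} \<longrightarrow> b - a < d \<longrightarrow> \<bar>(g b - g a) / (b - a) - D\<bar> \<le> e" if e: "e > 0" for e
  proof -
    have "\<not> high_quot g (D + e) x"
    proof
      assume "high_quot g (D + e) x"
      then have "D + e \<le> D" unfolding D_def using bdd by (intro cSup_upper) (auto simp: A_def)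
      then show False using e by simp
    qed
    then obtain d1 where d1: "d1 > 0" and "\<not> (\<exists>a b. a < b \<and> x \<in> {a..b} \<and> b - a < d1 \<and> (D + e) * (b - a) < g b - g a)"
      unfolding high_quot_def by blast
    then have d1': "\<And>a b. a < b \<Longrightarrow> x \<in> {a..b} \<Longrightarrow> b - a < d1 \<Longrightarrow> g b - g a \<le> (D + e) * (b - a)"
      by (meson not_less)
    have "\<exists>d2>0. \<forall>a b. a < b \<longrightarrow> x \<in> {a..b} \<longrightarrow> b - a < d2 \<longrightarrow> (D - e) * (b - a) \<le> g b - g a"
    proof (cases "D - e \<le> 0")
      case True
      have "(D - e) * (b - a) \<le> g b - g a" if "a < b" for a b
      proof -
        have "(D - e) * (b - a) \<le> 0" using True that by (intro mult_nonpos_nonneg) auto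
        also have "0 \<le> g b - g a" using g_mono that by (simp add: mono_def)
        finally show ?thesis .
      qed
      then show ?thesis by (intro exI[of _ 1]) auto
    next
      case False
      have "D - e < Sup A" using e by (simp add: D_def)
      then obtain R1 where R1: "R1 \<in> A" "D - e < R1" using less_cSup_iff[of A "D - e"] bdd unfolding A_def by blast
      \<comment> \<open>Two rationals between D - e and R1: the upper one is exceeded on arbitrarily
        short intervals, so by the absence of a gap the lower one is eventually not
        undercut.\<close>
      obtain R where R: "R \<in> \<rat>" "D - e < R" "R < R1" using Rats_dense_in_real[OF R1(2)] by blast
      obtain r where r: "r \<in> \<rat>" "D - e < r" "r < R" using Rats_dense_in_real[OF R(2)] by blast
      have "high_quot g R1 x" using R1 False by (auto simp: A_def)
      then have "high_quot g R x" using hmono R by fastforce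
      then have "\<not> low_quot g r x" using ng[OF r(1) R(1)] r False by force
      then obtain d2 where d2: "d2 > 0" and "\<not> (\<exists>a b. a < b \<and> x \<in> {a..b} \<and> b - a < d2 \<and> g b - g a < r * (b - a))"
        unfolding low_quot_def by blast
      then have d2': "\<And>a b. a < b \<Longrightarrow> x \<in> {a..b} \<Longrightarrow> b - a < d2 \<Longrightarrow> r * (b - a) \<le> g b - g a"
        by (meson not_less)
      have "(D - e) * (b - a) \<le> g b - g a" if "a < b" "x \<in> {a..b}" "b - a < d2" for a b
        using d2'[OF that] mult_right_mono[of "D - e" r "b - a"] r that by linarith
      then show ?thesis using d2 by blast
    qed
    then obtain d2 where d2: "d2 > 0" "\<And>a b. a < b \<Longrightarrow> x \<in> {a..b} \<Longrightarrow> b - a < d2 \<Longrightarrow> (D - e) * (b - a) \<le> g b - g a"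
      by blast
    have "\<bar>(g b - g a) / (b - a) - D\<bar> \<le> e" if ab: "a < b" "x \<in> {a..b}" "b - a < min d1 d2" for a b
    proof -
      have "(g b - g a) / (b - a) \<le> D + e" using d1'[of a b] ab by (subst pos_divide_le_eq) auto
      moreover have "D - e \<le> (g b - g a) / (b - a)" using d2(2)[of a b] ab by (subst pos_le_divide_eq) auto
      ultimately show ?thesis by linarith
    qed
    then show ?thesis using d1 d2(1) by (intro exI[of _ "min d1 d2"]) auto
  qed
  have "(\<lambda>h. (g (x + h) - g x) / h) \<midarrow>0\<rightarrow> D"
  proof (rule LIM_I)
    fix e :: real assume e: "e > 0"
    then have "e / 2 > 0" by simp
    then obtain d where d: "d > 0" "\<And>a b. a < b \<Longrightarrow> x \<in> {a..b} \<Longrightarrow> b - a < d \<Longrightarrow> \<bar>(g b - g a) / (b - a) - D\<bar> \<le> e / 2"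
      using key[of "e / 2"] by blast
    have "norm ((g (x + h) - g x) / h - D) < e" if h: "h \<noteq> 0" "norm (h - 0) < d" for h
    proof (cases "h > 0")
      case True
      then show ?thesis using d(2)[of x "x + h"] h e by simp
    next
      case False
      have "(g x - g (x + h)) / (- h) = (g (x + h) - g x) / h"
        using minus_divide_divide[of "g (x + h) - g x" h] by simp
      then show ?thesis using d(2)[of "x + h" x] h e False by simp
    qed
    then show "\<exists>d>0. \<forall>h. h \<noteq> 0 \<and> norm (h - 0) < d \<longrightarrow> norm ((g (x + h) - g x) / h - D) < e" using d(1) by blast
  qed
  then have "(g has_real_derivative D) (at x)" by (simp add: DERIV_def)
  then show ?thesis using D0 by blast
qed

text \<open>Let R < m. At almost every point there are arbitrarily short intervals of slope above R:
  otherwise, off the null set of gaps, g would be differentiable there with derivative at most R <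
  m. A disjoint Vitali family of such intervals fills (p, q) up to a null set, and its increments
  add up to at most g q - g p. Finally R tends to m.\<close>

lemma mono_increment_ge_deriv:
  assumes pq: "p < q" and m: "0 < m"
    and ae: "AE x in lebesgue. x \<in> {p<..<q} \<longrightarrow> (\<forall>D. (g has_real_derivative D) (at x) \<longrightarrow> m \<le> D)"
  shows "m * (q - p) \<le> g q - g p"
proof -
  have "R * (q - p) \<le> g q - g p" if R: "0 < R" "R < m" for R
  proof -
    define B where "B = {x \<in> {p<..<q}. \<exists>D<m. (g has_real_derivative D) (at x)}"
    have "negligible B"
    proof -
      have "AE x in lebesgue. x \<notin> B" using ae by eventually_elim (auto simp: B_def)
      then have "B \<in> null_sets lebesgue" using completion.null_sets_iff_AE by force
      then show ?thesis by (simp add: negligible_iff_null_sets)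
    qed
    define G where "G s = {x \<in> {p<..<q}. low_quot g (fst s) x \<and> high_quot g (snd s) x}" for s
    define Q where "Q = {s \<in> \<rat> \<times> \<rat>. 0 < fst s \<and> fst s < (snd s :: real)}"
    have "negligible (\<Union>s\<in>Q. G s)"
    proof (rule negligible_countable_Union)
      have "countable (\<rat> \<times> \<rat> :: (real \<times> real) set)" by (simp add: countable_rat)
      then have "countable Q" unfolding Q_def by (rule countable_subset[rotated]) auto
      then show "countable (G ` Q)" by blast
      fix X assume "X \<in> G ` Q"
      then obtain s where s: "s \<in> Q" "X = G s" by blast
      have "negligible (G s)"
        by (rule negligible_quot_gap[of "fst s" "snd s" _ p q]) (use s(1) in \<open>auto simp: G_def Q_def\<close>)
      then show "negligible X" using s by simp
    qed
    define S where "S = {x \<in> {p<..<q}. high_quot g R x}"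
    have cov: "{p<..<q} \<subseteq> S \<union> (B \<union> (\<Union>s\<in>Q. G s))"
    proof
      fix x assume x: "x \<in> {p<..<q}"
      show "x \<in> S \<union> (B \<union> (\<Union>s\<in>Q. G s))"
      proof (rule ccontr)
        assume n: "x \<notin> S \<union> (B \<union> (\<Union>s\<in>Q. G s))"
        have "\<not> high_quot g R x" using n x by (auto simp: S_def)
        moreover have "\<not> (low_quot g r x \<and> high_quot g R' x)" if "r \<in> \<rat>" "R' \<in> \<rat>" "0 < r" "r < R'" for r R'
        proof
          assume "low_quot g r x \<and> high_quot g R' x"
          then have "x \<in> G (r, R')" "(r, R') \<in> Q" using that x by (auto simp: G_def Q_def)
          then show False using n by blast
        qed
        ultimately obtain D where "D \<le> max 0 R" "(g has_real_derivative D) (at x)"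
          using differentiable_if_no_gap by blast
        then have "x \<in> B" using x R by (auto simp: B_def intro!: exI[of _ D])
        then show False using n by blast
      qed
    qed
    obtain C where C: "countable C"
      "\<And>i. i \<in> C \<Longrightarrow> fst i < snd i \<and> {fst i..snd i} \<subseteq> {p<..<q} \<and> R * (snd i - fst i) < g (snd i) - g (fst i)"
      "disjoint_family_on (\<lambda>i. {fst i..snd i}) C" "negligible (S - (\<Union>i\<in>C. {fst i..snd i}))"
    proof (rule Vitali_intervals[of "{p<..<q}" S "\<lambda>a b. R * (b - a) < g b - g a"])
      show "\<exists>a b. a < b \<and> x \<in> {a..b} \<and> b - a < d \<and> R * (b - a) < g b - g a" if "x \<in> S" "0 < d" for x d
        using that unfolding S_def high_quot_def by blast
    qed (simp_all add: S_def subset_eq)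
    let ?J = "\<Union>i\<in>C. {fst i..snd i}"
    have J: "?J \<in> sets borel" using C(1) by (auto intro!: sets.countable_UN')
    have N: "(S - ?J) \<union> (B \<union> (\<Union>s\<in>Q. G s)) \<in> null_sets lebesgue" (is "?N \<in> _")
      using C(4) \<open>negligible B\<close> \<open>negligible (\<Union>s\<in>Q. G s)\<close> by (simp flip: negligible_iff_null_sets)
    have "ennreal (q - p) = emeasure lebesgue {p<..<q}" using pq by simp
    also have "\<dots> \<le> emeasure lebesgue (?J \<union> ?N)"
    proof (rule emeasure_mono)
      show "?J \<union> ?N \<in> sets lebesgue" using sets.Un[of ?J lebesgue ?N] J null_setsD2[OF N] by simp
    qed (use cov in blast)
    also have "\<dots> = emeasure lborel ?J"
      using emeasure_Un_null_set[OF _ N, of ?J] J by simp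
    also have "\<dots> \<le> ennreal (1 / R) * emeasure (interval_measure g) ?J"
      by (rule emeasure_disjoint_intervals_le[OF C(1,3)])
         (simp_all, use C(2) R in \<open>auto intro!: lborel_le_interval_measure[simplified] intro: less_imp_le\<close>)
    also have "\<dots> \<le> ennreal (1 / R) * emeasure (interval_measure g) {p..q}"
    proof (intro mult_left_mono emeasure_mono UN_least)
      have "{p<..<q} \<subseteq> {p..q}" by auto
      then show "{fst i..snd i} \<subseteq> {p..q}" if "i \<in> C" for i using C(2)[OF that] by blast
    qed auto
    also have "\<dots> = ennreal ((1 / R) * (g q - g p))"
      using pq R by (simp add: emeasure_interval_g flip: ennreal_mult')
    finally have "q - p \<le> (1 / R) * (g q - g p)"
      using pq R g_mono by (subst (asm) ennreal_le_iff) (auto simp: mono_def)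
    then show ?thesis using R by (simp add: field_simps)
  qed
  note R_bound = this
  show ?thesis
  proof (rule field_le_mult_one_interval)
    fix z :: real assume z: "0 < z" "z < 1"
    show "z * (m * (q - p)) \<le> g q - g p" using R_bound[of "z * m"] z m by (simp add: mult.assoc)
  qed
qed

end

section \<open>Application to memory kernels\<close>

lemma abs_cont_on_continuous:
  assumes "abs_cont_on {a..b} f" shows "continuous_on {a..b} f"
  unfolding continuous_on_iff
proof (intro ballI allI impI)
  fix x e :: real assume x: "x \<in> {a..b}" and "e > 0"
  then obtain d where d: "d > 0" and *: "\<forall>(n::nat) (u::nat \<Rightarrow> real) v. (\<forall>i<n. u i \<le> v i \<and> {u i..v i} \<subseteq> {a..b}) \<and>
        (\<forall>i<n. \<forall>j<n. i \<noteq> j \<longrightarrow> v i \<le> u j \<or> v j \<le> u i) \<and> (\<Sum>i<n. v i - u i) < d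
        \<longrightarrow> (\<Sum>i<n. \<bar>f (v i) - f (u i)\<bar>) < e"
    using assms[unfolded abs_cont_on_def, rule_format, OF \<open>e > 0\<close>] by blast
  have "dist (f y) (f x) < e" if y: "y \<in> {a..b}" "dist y x < d" for y
  proof (cases "x \<le> y")
    case True
    then show ?thesis using *[rule_format, of 1 "\<lambda>_. x" "\<lambda>_. y"] x y by (auto simp: dist_real_def)
  next
    case False
    then show ?thesis using *[rule_format, of 1 "\<lambda>_. y" "\<lambda>_. x"] x y by (auto simp: dist_real_def abs_minus_commute)
  qed
  then show "\<exists>d>0. \<forall>x'\<in>{a..b}. dist x' x < d \<longrightarrow> dist (f x') (f x) < e" using d by blast
qed

text \<open>On an interval [p, q] the a.e. inequality integrates to \<mu> q (1 + \<delta> (q - p))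
  <= \<mu> p. Over n equal pieces of [s, t] this gives \<mu> t (1 + \<delta> (t - s)/n)^n <= \<mu>
  s, and the limit in n produces the exponential.\<close>

lemma kernel_decay:
  assumes "kernel \<mu>"
  obtains \<delta> where "\<delta> > 0" "\<And>s t. 0 < s \<Longrightarrow> s \<le> t \<Longrightarrow> \<mu> t \<le> \<mu> s * exp (- \<delta> * (t - s))"
proof -
  have pos: "\<And>s. s > 0 \<Longrightarrow> \<mu> s > 0" and dec: "\<And>s t. 0 < s \<Longrightarrow> s \<le> t \<Longrightarrow> \<mu> t \<le> \<mu> s"
    and ac: "\<And>a b. 0 < a \<Longrightarrow> abs_cont_on {a..b} \<mu>" using assms unfolding kernel_def by auto
  obtain \<delta> where \<delta>: "\<delta> > 0" and ae: "AE s in Hl. deriv \<mu> s + \<delta> * \<mu> s \<le> 0"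
    using assms unfolding kernel_def by auto
  have one: "\<mu> q * (1 + \<delta> * (q - p)) \<le> \<mu> p" if pq: "0 < p" "p < q" for p q
  proof -
    \<comment> \<open>Clamping the argument to [p, q] makes -\<mu> increasing and continuous on the
      whole line, as the differentiation lemmas ask, without any change inside the interval.\<close>
    define g where "g x = - \<mu> (max p (min q x))" for x
    have m: "mono g" unfolding g_def mono_def using pq by (auto intro!: dec)
    have c: "continuous_on UNIV g" unfolding g_def
      by (intro continuous_on_minus continuous_on_compose2[OF abs_cont_on_continuous[OF ac[OF pq(1), of q]]] continuous_intros)
         (use pq in auto)
    have ae': "AE x in lebesgue. x \<in> {0<..} \<longrightarrow> deriv \<mu> x + \<delta> * \<mu> x \<le> 0"
      using ae by (subst (asm) AE_restrict_space_iff) auto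
    have "\<delta> * \<mu> q * (q - p) \<le> g q - g p"
    proof (rule mono_increment_ge_deriv[OF m c pq(2)])
      show "0 < \<delta> * \<mu> q" using \<delta> pos[of q] pq by simp
      \<comment> \<open>Where g is not differentiable this is vacuous, so the unspecified value of
        \<open>deriv \<mu>\<close> at such points does no harm.\<close>
      show "AE x in lebesgue. x \<in> {p<..<q} \<longrightarrow> (\<forall>D. (g has_real_derivative D) (at x) \<longrightarrow> \<delta> * \<mu> q \<le> D)"
        using ae'
      proof eventually_elim
        case (elim x)
        show ?case
        proof (intro impI allI)
          fix D assume x: "x \<in> {p<..<q}" and D: "(g has_real_derivative D) (at x)"
          have "((\<lambda>x. - g x) has_real_derivative - D) (at x)" using D by (rule DERIV_minus)
          then have "(\<mu> has_real_derivative - D) (at x)"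
            by (rule has_field_derivative_transform_within_open[of _ _ _ "{p<..<q}"]) (use x in \<open>auto simp: g_def\<close>)
          then have "deriv \<mu> x = - D" by (rule DERIV_imp_deriv)
          then have "\<delta> * \<mu> x \<le> D" using elim x pq by auto
          moreover have "\<delta> * \<mu> q \<le> \<delta> * \<mu> x" using \<delta> dec[of x q] x pq by (intro mult_left_mono) auto
          ultimately show "\<delta> * \<mu> q \<le> D" by simp
        qed
      qed
    qed
    also have "g q - g p = \<mu> p - \<mu> q" using pq by (simp add: g_def)
    finally show ?thesis by (simp add: algebra_simps)
  qed
  have iter: "\<mu> (s + real n * h) * (1 + \<delta> * h) ^ n \<le> \<mu> s" if sh: "0 < s" "0 < h" for s h n
  proof (induction n)
    case (Suc n)
    have "\<mu> (s + real (Suc n) * h) * (1 + \<delta> * h) \<le> \<mu> (s + real n * h)"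
      using one[of "s + real n * h" "s + real (Suc n) * h"] sh by (simp add: algebra_simps add_pos_nonneg)
    then have "\<mu> (s + real (Suc n) * h) * (1 + \<delta> * h) * (1 + \<delta> * h) ^ n \<le> \<mu> (s + real n * h) * (1 + \<delta> * h) ^ n"
      using sh \<delta> by (intro mult_right_mono) auto
    then show ?case using Suc by (simp add: mult.assoc)
  qed simp
  have "\<mu> t \<le> \<mu> s * exp (- \<delta> * (t - s))" if st: "0 < s" "s \<le> t" for s t
  proof (cases "s = t")
    case False
    have ev: "\<forall>\<^sub>F n in sequentially. \<mu> t * (1 + \<delta> * (t - s) / real n) ^ n \<le> \<mu> s"
      using eventually_gt_at_top[of 0]
    proof eventually_elim
      case (elim n)
      then show ?case using iter[of s "(t - s) / real n" n] st False by (simp add: field_simps)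
    qed
    have "(\<lambda>n. \<mu> t * (1 + \<delta> * (t - s) / real n) ^ n) \<longlonglongrightarrow> \<mu> t * exp (\<delta> * (t - s))"
      by (intro tendsto_mult_left tendsto_exp_limit_sequentially)
    from tendsto_upperbound[OF this ev] have "\<mu> t * exp (\<delta> * (t - s)) \<le> \<mu> s" by simp
    then have "\<mu> t * exp (\<delta> * (t - s)) * exp (- \<delta> * (t - s)) \<le> \<mu> s * exp (- \<delta> * (t - s))"
      by (rule mult_right_mono) simp
    moreover have "exp (\<delta> * (t - s)) * exp (- \<delta> * (t - s)) = 1" by (simp flip: exp_add)
    ultimately show ?thesis by (simp only: mult.assoc mult_1_right)
  qed simp
  with \<delta> show ?thesis by (rule that)
qed

section \<open>Weak derivatives on the half-line\<close>

lemma integrable_lebesgue_on_subset: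
  fixes f :: "'a::euclidean_space \<Rightarrow> 'b::euclidean_space"
  assumes "integrable (lebesgue_on S) f" "T \<subseteq> S" "S \<in> sets lebesgue" "T \<in> sets lebesgue"
  shows "integrable (lebesgue_on T) f"
proof -
  have S: "S \<inter> space lebesgue \<in> sets lebesgue" "T \<inter> space lebesgue \<in> sets lebesgue" using assms by auto
  have "integrable lebesgue (\<lambda>x. indicator S x *\<^sub>R f x)"
    by (rule integrable_restrict_space[OF S(1), THEN iffD1, OF assms(1)])
  then have "integrable lebesgue (\<lambda>x. indicator T x *\<^sub>R (indicator S x *\<^sub>R f x))"
    by (rule integrable_mult_indicator[OF assms(4)])
  moreover have "(\<lambda>x. indicator T x *\<^sub>R (indicator S x *\<^sub>R f x)) = (\<lambda>x. indicator T x *\<^sub>R f x)"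
    using assms by (auto simp: indicator_def fun_eq_iff)
  ultimately have "integrable lebesgue (\<lambda>x. indicator T x *\<^sub>R f x)" by simp
  then show ?thesis by (rule integrable_restrict_space[OF S(2), THEN iffD2])
qed

lemma AE_lebesgue_on_subset:
  assumes "AE x in lebesgue_on S. P x" "T \<subseteq> S" "S \<in> sets lebesgue" "T \<in> sets lebesgue"
  shows "AE x in lebesgue_on T. P x"
  using assms by (auto simp: AE_restrict_space_iff elim!: eventually_mono)

lemma AE_Hl_if_Om:
  assumes "\<And>L. L > 0 \<Longrightarrow> AE s in Om L. P s"
  shows "AE s in Hl. P s"
proof -
  have "AE s in lebesgue. \<forall>n. s \<in> {0<..<real (Suc n)} \<longrightarrow> P s"
    unfolding AE_all_countable
  proof
    fix n
    have "AE s in Om (real (Suc n)). P s" by (rule assms) simp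
    then show "AE s in lebesgue. s \<in> {0<..<real (Suc n)} \<longrightarrow> P s"
      by (subst (asm) AE_restrict_space_iff) auto
  qed
  then have "AE s in lebesgue. s \<in> {0<..} \<longrightarrow> P s"
  proof eventually_elim
    case (elim s)
    obtain n where "s < real n" using reals_Archimedean2 by blast
    then have "s < real (Suc n)" by simp
    then show ?case using elim by auto
  qed
  then show ?thesis by (subst AE_restrict_space_iff) auto
qed

lemma integral_lebesgue_on_eq_if_vanish:
  fixes f :: "'a::euclidean_space \<Rightarrow> 'b::euclidean_space"
  assumes "T \<subseteq> S" "S \<in> sets lebesgue" "T \<in> sets lebesgue" "\<And>x. x \<in> S - T \<Longrightarrow> f x = 0"
  shows "integral\<^sup>L (lebesgue_on S) f = integral\<^sup>L (lebesgue_on T) f"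
    "integrable (lebesgue_on S) f \<longleftrightarrow> integrable (lebesgue_on T) f"
proof -
  have "(\<lambda>x. indicator S x *\<^sub>R f x) = (\<lambda>x. indicator T x *\<^sub>R f x)"
    using assms by (auto simp: indicator_def fun_eq_iff)
  then show "integral\<^sup>L (lebesgue_on S) f = integral\<^sup>L (lebesgue_on T) f"
    "integrable (lebesgue_on S) f \<longleftrightarrow> integrable (lebesgue_on T) f"
    using assms by (simp_all add: integral_restrict_space integrable_restrict_space)
qed

lemma integral_Om_as_indicator:
  fixes f :: "real \<Rightarrow> 'b::euclidean_space"
  assumes "s \<le> L"
  shows "integral\<^sup>L (Om s) f = integral\<^sup>L (Om L) (\<lambda>t. indicator {0<..<s} t *\<^sub>R f t)"
proof -
  have "integral\<^sup>L (Om L) (\<lambda>t. indicator {0<..<s} t *\<^sub>R f t) = integral\<^sup>L (Om s) (\<lambda>t. indicator {0<..<s} t *\<^sub>R f t)"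
    by (rule integral_lebesgue_on_eq_if_vanish) (use assms in auto)
  also have "\<dots> = integral\<^sup>L (Om s) f"
    by (rule Bochner_Integration.integral_cong) auto
  finally show ?thesis by simp
qed

lemma integral_Om_as_indicator_Hl:
  fixes f :: "real \<Rightarrow> 'b::euclidean_space"
  shows "integral\<^sup>L (Om s) f = integral\<^sup>L Hl (\<lambda>t. indicator {0<..<s} t *\<^sub>R f t)"
proof -
  have "integral\<^sup>L Hl (\<lambda>t. indicator {0<..<s} t *\<^sub>R f t) = integral\<^sup>L (Om s) (\<lambda>t. indicator {0<..<s} t *\<^sub>R f t)"
    by (rule integral_lebesgue_on_eq_if_vanish) auto
  also have "\<dots> = integral\<^sup>L (Om s) f"
    by (rule Bochner_Integration.integral_cong) auto
  finally show ?thesis by simp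
qed

lemma integral_Om_mono:
  fixes f :: "real \<Rightarrow> real"
  assumes "integrable (Om L) f" "s \<le> L" "\<And>t. 0 \<le> f t"
  shows "integral\<^sup>L (Om s) f \<le> integral\<^sup>L (Om L) f"
  unfolding integral_Om_as_indicator[OF assms(2)]
proof (rule integral_mono)
  have "{0<..<s} \<in> sets (Om L)" using assms(2) by (subst sets_restrict_space_iff) auto
  then show "integrable (Om L) (\<lambda>t. indicator {0<..<s} t *\<^sub>R f t)"
    by (rule integrable_mult_indicator) (rule assms)
  show "indicator {0<..<s} t *\<^sub>R f t \<le> f t" for t using assms(3)[of t] by (auto simp: indicator_def)
qed (rule assms)

lemma integral_Om_mono_Hl:
  fixes f :: "real \<Rightarrow> real"
  assumes "integrable Hl f" "\<And>t. 0 \<le> f t"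
  shows "integral\<^sup>L (Om s) f \<le> integral\<^sup>L Hl f"
  unfolding integral_Om_as_indicator_Hl
proof (rule integral_mono)
  have "{0<..<s} \<in> sets Hl" by (subst sets_restrict_space_iff) auto
  then show "integrable Hl (\<lambda>t. indicator {0<..<s} t *\<^sub>R f t)"
    by (rule integrable_mult_indicator) (rule assms)
  show "indicator {0<..<s} t *\<^sub>R f t \<le> f t" for t using assms(2)[of t] by (auto simp: indicator_def)
qed (rule assms)

lemma sigma_finite_Hl: "sigma_finite_measure Hl"
proof
  let ?A = "range (\<lambda>n. {0<..<real (Suc n)})"
  have "\<Union>?A = {0<..}"
  proof (intro equalityI subsetI)
    fix s :: real assume s: "s \<in> {0<..}"
    obtain n where "s < real n" using reals_Archimedean2 by blast
    then have "s \<in> {0<..<real (Suc n)}" using s by simp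
    then show "s \<in> \<Union>?A" by blast
  qed auto
  moreover have "emeasure Hl {0<..<real (Suc n)} = ennreal (real (Suc n))" for n
    by (subst emeasure_restrict_space) (auto simp del: of_nat_Suc)
  then have "\<forall>a\<in>?A. emeasure Hl a \<noteq> \<infinity>" by (auto simp del: of_nat_Suc)
  moreover have "?A \<subseteq> sets Hl" by (auto simp: sets_restrict_space_iff)
  ultimately show "\<exists>A. countable A \<and> A \<subseteq> sets Hl \<and> \<Union> A = space Hl \<and> (\<forall>a\<in>A. emeasure Hl a \<noteq> \<infinity>)"
    by (intro exI[of _ ?A]) (simp del: of_nat_Suc)
qed

section \<open>Antiderivatives, exponential factors and their weak derivatives\<close>

lemma ident_measurable_lebesgue_on [measurable]: "(\<lambda>x. x) \<in> borel_measurable (lebesgue_on S)"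
  using id_borel_measurable_lebesgue_on[of S] by (simp add: id_def)

lemma measurable_triangle_indicator [measurable]:
  fixes S T :: "real set"
  shows
  "(\<lambda>z. indicator {0<..<fst z} (snd z) :: real) \<in> borel_measurable (lebesgue_on S \<Otimes>\<^sub>M lebesgue_on T)"
proof -
  have [measurable]: "fst \<in> borel_measurable (lebesgue_on S \<Otimes>\<^sub>M lebesgue_on T)" "snd \<in> borel_measurable (lebesgue_on S \<Otimes>\<^sub>M lebesgue_on T)"
    using measurable_compose[OF measurable_fst ident_measurable_lebesgue_on] measurable_compose[OF measurable_snd ident_measurable_lebesgue_on] by auto
  have eq: "(\<lambda>z. indicator {0<..<fst z} (snd z) :: real) = indicator {z. 0 < snd z \<and> snd z < fst z}"
    by (auto simp: indicator_def fun_eq_iff)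
  have "(indicator {z. 0 < snd z \<and> snd z < fst z} :: real \<times> real \<Rightarrow> real) \<in> borel_measurable (lebesgue_on S \<Otimes>\<^sub>M lebesgue_on T)"
    by (intro borel_measurable_indicator') measurable
  then show ?thesis unfolding eq .
qed

text \<open>The upper limit enters through the indicator of a triangle, which is jointly measurable;
  the rest is measurability of parameter integrals.\<close>

lemma borel_measurable_antideriv:
  fixes f :: "real \<Rightarrow> 'b::euclidean_space"
  assumes [measurable]: "f \<in> borel_measurable Hl"
  shows "(\<lambda>s. integral\<^sup>L (Om s) f) \<in> borel_measurable Hl"
proof -
  interpret sigma_finite_measure Hl by (rule sigma_finite_Hl)
  have [measurable]: "(\<lambda>z. f (snd z)) \<in> borel_measurable (Hl \<Otimes>\<^sub>M Hl)" by measurable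
  have "(\<lambda>s. integral\<^sup>L Hl (\<lambda>t. indicator {0<..<s} t *\<^sub>R f t)) \<in> borel_measurable Hl"
  proof (rule borel_measurable_lebesgue_integral)
    have "(\<lambda>z. indicator {0<..<fst z} (snd z) *\<^sub>R f (snd z)) \<in> borel_measurable (Hl \<Otimes>\<^sub>M Hl)"
      by measurable
    then show "(\<lambda>(s, t). indicator {0<..<s} t *\<^sub>R f t) \<in> borel_measurable (Hl \<Otimes>\<^sub>M Hl)"
      by (simp add: case_prod_beta')
  qed
  then show ?thesis by (simp add: integral_Om_as_indicator_Hl)
qed

text \<open>Cauchy-Schwarz on (0, s). The factor s is what later yields the zero trace of the memory
  at s = 0.\<close>

lemma antideriv_bound:
  assumes "L2 s g" "0 \<le> s"
  shows "(cmod (integral\<^sup>L (Om s) g))\<^sup>2 \<le> s * integral\<^sup>L (Om s) (\<lambda>x. (cmod (g x))\<^sup>2)"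
proof -
  have "cmod (integral\<^sup>L (Om s) g) \<le> integral\<^sup>L (Om s) (\<lambda>x. cmod (g x))" by (rule integral_norm_bound)
  also have "\<dots> \<le> sqrt s * L2n s g" using L1_le_L2[OF assms(1)] assms(2) by (simp add: measure_restrict_space)
  finally have "(cmod (integral\<^sup>L (Om s) g))\<^sup>2 \<le> (sqrt s * L2n s g)\<^sup>2" by (intro power_mono) auto
  then show ?thesis using assms(2) by (simp add: power_mult_distrib L2n_sq)
qed

lemma L2_antideriv:
  assumes g: "L2 L g" and L: "0 < L"
  shows "L2 L (\<lambda>s. integral\<^sup>L (Om s) g)"
proof (rule L2_bounded)
  interpret finite_measure "Om L" by (rule finite_measure_Om)
  have [measurable]: "g \<in> borel_measurable (Om L)" using g by (simp add: L2_def)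
  have [measurable]: "(\<lambda>z. g (snd z)) \<in> borel_measurable (Om L \<Otimes>\<^sub>M Om L)" by measurable
  have "(\<lambda>s. integral\<^sup>L (Om L) (\<lambda>t. indicator {0<..<s} t *\<^sub>R g t)) \<in> borel_measurable (Om L)"
  proof (rule borel_measurable_lebesgue_integral)
    have "(\<lambda>z. indicator {0<..<fst z} (snd z) *\<^sub>R g (snd z)) \<in> borel_measurable (Om L \<Otimes>\<^sub>M Om L)"
      by measurable
    then show "(\<lambda>(s, t). indicator {0<..<s} t *\<^sub>R g t) \<in> borel_measurable (Om L \<Otimes>\<^sub>M Om L)"
      by (simp add: case_prod_beta')
  qed
  then show "(\<lambda>s. integral\<^sup>L (Om s) g) \<in> borel_measurable (Om L)"
    by (subst measurable_lebesgue_cong[where g="\<lambda>s. integral\<^sup>L (Om L) (\<lambda>t. indicator {0<..<s} t *\<^sub>R g t)"])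
       (auto intro: integral_Om_as_indicator)
  fix s assume s: "s \<in> {0<..<L}"
  have "cmod (integral\<^sup>L (Om s) g) \<le> integral\<^sup>L (Om s) (\<lambda>x. cmod (g x))" by (rule integral_norm_bound)
  also have "\<dots> \<le> integral\<^sup>L (Om L) (\<lambda>x. cmod (g x))"
    by (rule integral_Om_mono) (use s L2_integrable[OF g] in auto)
  finally show "cmod (integral\<^sup>L (Om s) g) \<le> integral\<^sup>L (Om L) (\<lambda>x. cmod (g x))" .
qed

text \<open>Exchange the integrals over the triangle t < s: the inner integral of the derivative of
  the test function over (t, L) is minus its value at t.\<close>

lemma weak_deriv_antideriv:
  assumes L: "0 < L" and g: "L2 L g"
  shows "weak_deriv L (\<lambda>s. integral\<^sup>L (Om s) g) g"
  unfolding weak_deriv_def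
proof (intro allI impI)
  fix \<phi> assume \<phi>: "test_fun {0<..<L} \<phi>"
  interpret finite_measure "Om L" by (rule finite_measure_Om)
  interpret P: pair_sigma_finite "Om L" "Om L" ..
  obtain B where B: "\<And>x. \<bar>deriv \<phi> x\<bar> \<le> B" using test_fun_bounded[OF test_fun_deriv[OF \<phi>]] by blast
  have B0: "0 \<le> B" using B[of 0] by simp
  note dc = smooth_fun_continuous[OF smooth_fun_deriv[OF test_fun_smooth[OF \<phi>]]]
  have [measurable]: "g \<in> borel_measurable (Om L)" using g by (simp add: L2_def)
  have [measurable]: "deriv \<phi> \<in> borel_measurable (Om L)"
    by (intro continuous_imp_measurable_on_sets_lebesgue dc) auto
  define f where "f s t = indicator {0<..<s} t *\<^sub>R (g t * of_real (deriv \<phi> s))" for s t :: real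
  have [measurable]: "(\<lambda>z. g (snd z)) \<in> borel_measurable (Om L \<Otimes>\<^sub>M Om L)"
     "(\<lambda>z. deriv \<phi> (fst z)) \<in> borel_measurable (Om L \<Otimes>\<^sub>M Om L)" by measurable
  have fm: "(\<lambda>(s, t). f s t) \<in> borel_measurable (Om L \<Otimes>\<^sub>M Om L)"
  proof -
    have "(\<lambda>z. indicator {0<..<fst z} (snd z) *\<^sub>R (g (snd z) * of_real (deriv \<phi> (fst z)))) \<in> borel_measurable (Om L \<Otimes>\<^sub>M Om L)"
      by measurable
    then show ?thesis by (simp add: f_def case_prod_beta')
  qed
  have fB: "norm (f s t) \<le> B * cmod (g t)" for s t
  proof -
    have "cmod (g t) * \<bar>deriv \<phi> s\<bar> \<le> B * cmod (g t)" using mult_left_mono[OF B[of s] norm_ge_zero[of "g t"]] by (simp add: mult.commute)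
    moreover have "0 \<le> B * cmod (g t)" using B0 by simp
    ultimately show ?thesis by (auto simp: f_def indicator_def norm_mult)
  qed
  have gi: "integrable (Om L) (\<lambda>t. B * cmod (g t))" using L2_integrable[OF g] by auto
  have fi: "integrable (Om L) (\<lambda>t. f s t)" if "s \<in> {0<..<L}" for s
  proof (rule Bochner_Integration.integrable_bound[OF gi])
    show "f s \<in> borel_measurable (Om L)" unfolding f_def by measurable
    show "AE x in Om L. norm (f s x) \<le> norm (B * cmod (g x))"
      by (rule AE_I2) (use fB in \<open>auto intro: order_trans[OF _ abs_ge_self]\<close>)
  qed
  have int: "integrable (Om L \<Otimes>\<^sub>M Om L) (\<lambda>(s, t). f s t)"
  proof (rule P.Fubini_integrable[OF fm])
    show "integrable (Om L) (\<lambda>s. integral\<^sup>L (Om L) (\<lambda>t. norm (case (s, t) of (s, t) \<Rightarrow> f s t)))"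
    proof (rule integrable_const_bound[where B="integral\<^sup>L (Om L) (\<lambda>t. B * cmod (g t))"])
      show "(\<lambda>s. integral\<^sup>L (Om L) (\<lambda>t. norm (case (s, t) of (s, t) \<Rightarrow> f s t))) \<in> borel_measurable (Om L)"
        using fm by (intro borel_measurable_lebesgue_integral) (simp add: case_prod_beta')
      show "AE s in Om L. norm (integral\<^sup>L (Om L) (\<lambda>t. norm (case (s, t) of (s, t) \<Rightarrow> f s t))) \<le> integral\<^sup>L (Om L) (\<lambda>t. B * cmod (g t))"
      proof (rule AE_I2)
        fix s assume "s \<in> space (Om L)"
        then have "integral\<^sup>L (Om L) (\<lambda>t. norm (f s t)) \<le> integral\<^sup>L (Om L) (\<lambda>t. B * cmod (g t))"
          by (intro integral_mono gi fB integrable_norm fi) simp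
        then show "norm (integral\<^sup>L (Om L) (\<lambda>t. norm (case (s, t) of (s, t) \<Rightarrow> f s t))) \<le> integral\<^sup>L (Om L) (\<lambda>t. B * cmod (g t))"
          by (simp only: case_prod_conv real_norm_def abs_of_nonneg[OF Bochner_Integration.integral_nonneg[OF norm_ge_zero]])
      qed
    qed
    show "AE s in Om L. integrable (Om L) (\<lambda>t. case (s, t) of (s, t) \<Rightarrow> f s t)"
      by (rule AE_I2) (use fi in auto)
  qed
  have inner: "integral\<^sup>L (Om L) (\<lambda>s. f s t) = - (g t * of_real (\<phi> t))" if t: "t \<in> {0<..<L}" for t
  proof -
    have "integral\<^sup>L (Om L) (\<lambda>s. f s t) = integral\<^sup>L (lebesgue_on {t<..<L}) (\<lambda>s. f s t)"
      by (rule integral_lebesgue_on_eq_if_vanish) (use t in \<open>auto simp: f_def\<close>)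
    also have "\<dots> = integral\<^sup>L (lebesgue_on {t<..<L}) (\<lambda>s. g t * of_real (deriv \<phi> s))"
      by (rule Bochner_Integration.integral_cong) (use t in \<open>auto simp: f_def\<close>)
    also have "\<dots> = g t * of_real (\<phi> L) - g t * of_real (\<phi> t)"
    proof (rule integral_Ioo_FTC)
      show "((\<lambda>s. g t * of_real (\<phi> s)) has_vector_derivative g t * of_real (deriv \<phi> x)) (at x)" for x
        using has_vector_derivative_mult_right[OF smooth_fun_vector_derivative[OF test_fun_smooth[OF \<phi>]]] .
    qed (use t in \<open>auto intro!: continuous_intros dc\<close>)
    finally show ?thesis using test_fun_ends[OF \<phi>] by simp
  qed
  have "(CLINT x|Om L. integral\<^sup>L (Om x) g * of_real (deriv \<phi> x)) = integral\<^sup>L (Om L) (\<lambda>s. integral\<^sup>L (Om L) (\<lambda>t. f s t))"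
  proof (rule Bochner_Integration.integral_cong)
    fix s assume "s \<in> space (Om L)"
    then have "integral\<^sup>L (Om s) g = integral\<^sup>L (Om L) (\<lambda>t. indicator {0<..<s} t *\<^sub>R g t)"
      by (intro integral_Om_as_indicator) auto
    then show "integral\<^sup>L (Om s) g * of_real (deriv \<phi> s) = integral\<^sup>L (Om L) (\<lambda>t. f s t)"
      by (simp add: f_def flip: integral_mult_left_zero)
  qed simp
  also have "\<dots> = integral\<^sup>L (Om L) (\<lambda>t. integral\<^sup>L (Om L) (\<lambda>s. f s t))"
    by (rule P.Fubini_integral[OF int, symmetric])
  also have "\<dots> = integral\<^sup>L (Om L) (\<lambda>t. - (g t * of_real (\<phi> t)))"
    by (rule Bochner_Integration.integral_cong) (use inner in auto)
  finally show "(CLINT x|Om L. integral\<^sup>L (Om x) g * of_real (deriv \<phi> x)) = - (CLINT x|Om L. g x * of_real (\<phi> x))"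
    by simp
qed

lemma cis_exp: "exp (\<i> * of_real b * of_real s) = of_real (cos (b * s)) + \<i> * of_real (sin (b * s))"
  by (simp add: exp_Euler mult.assoc flip: of_real_mult cos_of_real sin_of_real)

lemma cmod_cis_exp: "cmod (exp (\<i> * of_real b * of_real s)) = 1"
  using norm_exp_i_times[of "b * s"] by (simp add: mult.assoc)

lemma L2_exp_mult: assumes "L2 L f" shows "L2 L (\<lambda>s. exp (\<i> * of_real b * of_real s) * f s)"
  unfolding L2_def
proof
  have [measurable]: "f \<in> borel_measurable (Om L)" using assms by (simp add: L2_def)
  have [measurable]: "(\<lambda>s. exp (\<i> * of_real b * of_real s)) \<in> borel_measurable (Om L)"
    by (intro continuous_imp_measurable_on_sets_lebesgue continuous_intros) auto
  show "(\<lambda>s. exp (\<i> * of_real b * of_real s) * f s) \<in> borel_measurable (Om L)" by measurable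
  show "integrable (Om L) (\<lambda>x. (cmod (exp (\<i> * of_real b * of_real x) * f x))\<^sup>2)"
    using assms by (simp add: norm_mult cmod_cis_exp L2_def)
qed

text \<open>The exponential is moved to the test function. Test functions are real, so the cosine
  and sine parts of the exponential are treated separately and recombined.\<close>

lemma weak_deriv_exp_mult:
  assumes f: "L2 L f" and g: "L2 L g" and w: "weak_deriv L f g"
  shows "weak_deriv L (\<lambda>s. exp (\<i> * of_real b * of_real s) * f s)
     (\<lambda>s. exp (\<i> * of_real b * of_real s) * (g s + \<i> * of_real b * f s))"
  unfolding weak_deriv_def
proof (intro allI impI)
  fix \<phi> assume \<phi>: "test_fun {0<..<L} \<phi>"
  note sm = test_fun_smooth[OF \<phi>]
  let ?c = "\<lambda>x. cos (b * x)" and ?s = "\<lambda>x. sin (b * x)"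
  have smc: "smooth_fun ?c" "smooth_fun ?s" using smooth_fun_cos[of 1 b] smooth_fun_sin[of 1 b] by simp_all
  have int: "integrable (Om L) (\<lambda>x. h x * of_real (u x))" if "L2 L h" "smooth_fun u" for h u
    using L2i_integrable[OF that(1) L2_of_real_smooth[OF that(2)]] by simp
  have tc: "test_fun {0<..<L} (\<lambda>x. \<phi> x * ?c x)" "test_fun {0<..<L} (\<lambda>x. \<phi> x * ?s x)"
    by (intro test_fun_mult \<phi> smc)+
  have dc: "deriv (\<lambda>x. \<phi> x * ?c x) x = deriv \<phi> x * ?c x - b * (\<phi> x * ?s x)" for x
    by (rule DERIV_imp_deriv) (auto intro!: derivative_eq_intros smooth_fun_DERIV[OF sm])
  have ds: "deriv (\<lambda>x. \<phi> x * ?s x) x = deriv \<phi> x * ?s x + b * (\<phi> x * ?c x)" for x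
    by (rule DERIV_imp_deriv) (auto intro!: derivative_eq_intros smooth_fun_DERIV[OF sm])
  note smm = smooth_fun_mult[OF sm smc(1)] smooth_fun_mult[OF sm smc(2)]
    smooth_fun_mult[OF smooth_fun_deriv[OF sm] smc(1)] smooth_fun_mult[OF smooth_fun_deriv[OF sm] smc(2)]
  let ?I = "\<lambda>h u. integral\<^sup>L (Om L) (\<lambda>x. h x * of_real (u x))"
  have 1: "?I f (\<lambda>x. deriv \<phi> x * ?c x) - of_real b * ?I f (\<lambda>x. \<phi> x * ?s x) = - ?I g (\<lambda>x. \<phi> x * ?c x)"
  proof -
    have "?I f (\<lambda>x. deriv \<phi> x * ?c x) - of_real b * ?I f (\<lambda>x. \<phi> x * ?s x) = ?I f (deriv (\<lambda>x. \<phi> x * ?c x))"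
      unfolding dc integral_mult_right_zero[symmetric]
      by (subst Bochner_Integration.integral_diff[symmetric])
         (use int[OF f smm(3)] int[OF f smm(2)] in \<open>auto simp: algebra_simps\<close>)
    also have "\<dots> = - ?I g (\<lambda>x. \<phi> x * ?c x)" using w tc(1) unfolding weak_deriv_def by blast
    finally show ?thesis .
  qed
  have 2: "?I f (\<lambda>x. deriv \<phi> x * ?s x) + of_real b * ?I f (\<lambda>x. \<phi> x * ?c x) = - ?I g (\<lambda>x. \<phi> x * ?s x)"
  proof -
    have "?I f (\<lambda>x. deriv \<phi> x * ?s x) + of_real b * ?I f (\<lambda>x. \<phi> x * ?c x) = ?I f (deriv (\<lambda>x. \<phi> x * ?s x))"
      unfolding ds integral_mult_right_zero[symmetric]
      by (subst Bochner_Integration.integral_add[symmetric])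
         (use int[OF f smm(4)] int[OF f smm(1)] in \<open>auto simp: algebra_simps\<close>)
    also have "\<dots> = - ?I g (\<lambda>x. \<phi> x * ?s x)" using w tc(2) unfolding weak_deriv_def by blast
    finally show ?thesis .
  qed
  have L: "(CLINT x|Om L. exp (\<i> * of_real b * of_real x) * f x * of_real (deriv \<phi> x))
      = ?I f (\<lambda>x. deriv \<phi> x * ?c x) + \<i> * ?I f (\<lambda>x. deriv \<phi> x * ?s x)"
    unfolding cis_exp integral_mult_right_zero[symmetric]
    by (subst Bochner_Integration.integral_add[symmetric])
       (use int[OF f smm(3)] int[OF f smm(4)] in \<open>auto simp: algebra_simps\<close>)
  have Ic: "(CLINT x|Om L. exp (\<i> * of_real b * of_real x) * h x * of_real (\<phi> x))
      = ?I h (\<lambda>x. \<phi> x * ?c x) + \<i> * ?I h (\<lambda>x. \<phi> x * ?s x)" if h: "L2 L h" for h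
    unfolding cis_exp integral_mult_right_zero[symmetric]
    by (subst Bochner_Integration.integral_add[symmetric])
       (use int[OF h smm(1)] int[OF h smm(2)] in \<open>auto simp: algebra_simps\<close>)
  have R: "(CLINT x|Om L. exp (\<i> * of_real b * of_real x) * (g x + \<i> * of_real b * f x) * of_real (\<phi> x))
      = (?I g (\<lambda>x. \<phi> x * ?c x) + \<i> * ?I g (\<lambda>x. \<phi> x * ?s x)) + \<i> * of_real b * (?I f (\<lambda>x. \<phi> x * ?c x) + \<i> * ?I f (\<lambda>x. \<phi> x * ?s x))"
  proof -
    have "(CLINT x|Om L. exp (\<i> * of_real b * of_real x) * (g x + \<i> * of_real b * f x) * of_real (\<phi> x))
      = (CLINT x|Om L. exp (\<i> * of_real b * of_real x) * g x * of_real (\<phi> x) + \<i> * of_real b * (exp (\<i> * of_real b * of_real x) * f x * of_real (\<phi> x)))"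
      by (simp only: distrib_left distrib_right mult_ac)
    also have "\<dots> = (CLINT x|Om L. exp (\<i> * of_real b * of_real x) * g x * of_real (\<phi> x))
        + (CLINT x|Om L. \<i> * of_real b * (exp (\<i> * of_real b * of_real x) * f x * of_real (\<phi> x)))"
      by (intro Bochner_Integration.integral_add integrable_mult_right int L2_exp_mult f g sm)
    also have "(CLINT x|Om L. \<i> * of_real b * (exp (\<i> * of_real b * of_real x) * f x * of_real (\<phi> x)))
       = \<i> * of_real b * (CLINT x|Om L. exp (\<i> * of_real b * of_real x) * f x * of_real (\<phi> x))"
      by (rule integral_mult_right_zero)
    finally show ?thesis unfolding Ic[OF g] Ic[OF f] .
  qed
  have e1: "?I f (\<lambda>x. deriv \<phi> x * ?c x) = of_real b * ?I f (\<lambda>x. \<phi> x * ?s x) - ?I g (\<lambda>x. \<phi> x * ?c x)"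
    using 1 by (simp add: algebra_simps)
  have e2: "?I f (\<lambda>x. deriv \<phi> x * ?s x) = - of_real b * ?I f (\<lambda>x. \<phi> x * ?c x) - ?I g (\<lambda>x. \<phi> x * ?s x)"
    using 2 by (simp add: algebra_simps eq_neg_iff_add_eq_0)
  show "(CLINT x|Om L. exp (\<i> * of_real b * of_real x) * f x * of_real (deriv \<phi> x))
      = - (CLINT x|Om L. exp (\<i> * of_real b * of_real x) * (g x + \<i> * of_real b * f x) * of_real (\<phi> x))"
    unfolding L R e1 e2 by (simp add: algebra_simps)
qed

lemma weak_deriv_cong_AE:
  assumes "weak_deriv L f g" "L2 L f" "L2 L g" "AE x in Om L. f x = f' x" "AE x in Om L. g x = g' x"
  shows "weak_deriv L f' g'"
  unfolding weak_deriv_def L2i_of_real[symmetric]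
proof (intro allI impI)
  fix \<phi> assume \<phi>: "test_fun {0<..<L} \<phi>"
  have "L2i L f (\<lambda>x. of_real (deriv \<phi> x)) = - L2i L g (\<lambda>x. of_real (\<phi> x))"
    using assms(1) \<phi> unfolding weak_deriv_def L2i_of_real by blast
  moreover have "L2i L f (\<lambda>x. of_real (deriv \<phi> x)) = L2i L f' (\<lambda>x. of_real (deriv \<phi> x))"
    by (intro L2i_cong_AE assms L2_of_real_smooth smooth_fun_deriv test_fun_smooth[OF \<phi>]) simp
  moreover have "L2i L g (\<lambda>x. of_real (\<phi> x)) = L2i L g' (\<lambda>x. of_real (\<phi> x))"
    by (intro L2i_cong_AE assms L2_of_real_smooth test_fun_smooth[OF \<phi>]) simp
  ultimately show "L2i L f' (\<lambda>x. of_real (deriv \<phi> x)) = - L2i L g' (\<lambda>x. of_real (\<phi> x))" by simp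
qed

lemma weak_deriv_diff:
  assumes "weak_deriv L f g" "weak_deriv L f' g'" "L2 L f" "L2 L g" "L2 L f'" "L2 L g'"
  shows "weak_deriv L (\<lambda>x. f x - f' x) (\<lambda>x. g x - g' x)"
  unfolding weak_deriv_def L2i_of_real[symmetric]
proof (intro allI impI)
  fix \<phi> assume \<phi>: "test_fun {0<..<L} \<phi>"
  have "L2i L f (\<lambda>x. of_real (deriv \<phi> x)) = - L2i L g (\<lambda>x. of_real (\<phi> x))"
     "L2i L f' (\<lambda>x. of_real (deriv \<phi> x)) = - L2i L g' (\<lambda>x. of_real (\<phi> x))"
    using assms(1,2) \<phi> unfolding weak_deriv_def L2i_of_real by blast+
  then show "L2i L (\<lambda>x. f x - f' x) (\<lambda>x. of_real (deriv \<phi> x)) = - L2i L (\<lambda>x. g x - g' x) (\<lambda>x. of_real (\<phi> x))"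
    using assms by (simp add: L2i_diff_left L2_of_real_smooth smooth_fun_deriv test_fun_smooth[OF \<phi>])
qed

text \<open>By \<open>weak_deriv_sinc\<close> all cosine coefficients of positive index vanish, so
  only the constant mode is left.\<close>

lemma weak_deriv_0_const:
  assumes L: "0 < L" and f: "L2 L f" and w: "weak_deriv L f (\<lambda>x. 0)"
  shows "\<exists>C. AE x in Om L. f x = C"
proof -
  have z: "cosc L f n = 0" if "n > 0" for n
    using weak_deriv_sinc[OF L f L2_0 w, of n] freq_pos[OF L that] by (simp add: sinc_def)
  define C where "C = cosc L f 0 * cosb L 0 0"
  interpret onsys L "cosb L" "\<lambda>n. True" by (rule onsys_cosb[OF L])
  have "AE x in Om L. f x = cosc L f 0 * cosb L 0 x"
    by (rule cosc_eq_AE[OF L f]) (use z in \<open>auto intro!: L2_cmult L2_cosb simp: cosc_cmult, auto simp: cosc_def orth\<close>)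
  then show ?thesis by (intro exI[of _ C]) (auto simp: C_def cosb_def)
qed

section \<open>Scalar weak derivatives on the half-line and the scalar memory equation\<close>

definition hwd :: "(real \<Rightarrow> complex) \<Rightarrow> (real \<Rightarrow> complex) \<Rightarrow> bool" where
  "hwd f g \<longleftrightarrow> (\<forall>\<phi>. test_fun {0<..} \<phi> \<longrightarrow>
     integral\<^sup>L Hl (\<lambda>s. f s * of_real (deriv \<phi> s)) = - integral\<^sup>L Hl (\<lambda>s. g s * of_real (\<phi> s)))"

lemma integral_Hl_test:
  assumes "test_fun {0<..<L} \<phi>"
  shows "integral\<^sup>L Hl (\<lambda>s. f s * of_real (\<phi> s)) = integral\<^sup>L (Om L) (\<lambda>s. (f s :: complex) * of_real (\<phi> s))"
  by (rule integral_lebesgue_on_eq_if_vanish) (use test_fun_outside[OF assms] in auto)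

text \<open>Every test function on the half-line has its support in some (0, L). The Fourier
  arguments for bounded intervals thus apply on the time axis as well.\<close>

lemma hwd_iff: "hwd f g \<longleftrightarrow> (\<forall>L>0. weak_deriv L f g)"
proof
  assume h: "hwd f g"
  show "\<forall>L>0. weak_deriv L f g" unfolding weak_deriv_def
  proof (intro allI impI)
    fix L \<phi> assume \<phi>: "test_fun {0<..<L} \<phi>"
    have "test_fun {0<..} \<phi>" by (rule test_fun_mono[OF \<phi>]) auto
    then show "(CLINT x|Om L. f x * of_real (deriv \<phi> x)) = - (CLINT x|Om L. g x * of_real (\<phi> x))"
      using h unfolding hwd_def integral_Hl_test[OF \<phi>, symmetric] integral_Hl_test[OF test_fun_deriv[OF \<phi>], symmetric] by blast
  qed
next
  assume w: "\<forall>L>0. weak_deriv L f g"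
  show "hwd f g" unfolding hwd_def
  proof (intro allI impI)
    fix \<phi> assume "test_fun {0<..} \<phi>"
    then obtain L where L: "L > 0" "test_fun {0<..<L} \<phi>" by (rule test_fun_half_line)
    then show "(CLINT s|Hl. f s * of_real (deriv \<phi> s)) = - (CLINT s|Hl. g s * of_real (\<phi> s))"
      using w unfolding weak_deriv_def integral_Hl_test[OF L(2)] integral_Hl_test[OF test_fun_deriv[OF L(2)]] by blast
  qed
qed

text \<open>Duhamel's formula for u' + \<i> b u = f with u(0) = 0.\<close>

definition mem_E :: "real \<Rightarrow> (real \<Rightarrow> complex) \<Rightarrow> real \<Rightarrow> complex" where
  "mem_E b f s = exp (\<i> * of_real (- b) * of_real s) * integral\<^sup>L (Om s) (\<lambda>t. exp (\<i> * of_real b * of_real t) * f t)"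

lemma exp_cancel: "exp (\<i> * of_real (- b) * of_real s) * exp (\<i> * of_real b * of_real s) = 1"
  "exp (\<i> * of_real b * of_real s) * exp (\<i> * of_real (- b) * of_real s) = 1"
  by (simp_all add: exp_minus)

lemma hwd_mem_E:
  assumes f: "\<And>L. L > 0 \<Longrightarrow> L2 L f"
  shows "hwd (mem_E b f) (\<lambda>s. f s - \<i> * of_real b * mem_E b f s)"
  unfolding hwd_iff
proof (intro allI impI)
  fix L :: real assume L: "L > 0"
  let ?g = "\<lambda>t. exp (\<i> * of_real b * of_real t) * f t"
  have g: "L2 L ?g" by (intro L2_exp_mult f L)
  have "weak_deriv L (\<lambda>s. exp (\<i> * of_real (- b) * of_real s) * integral\<^sup>L (Om s) ?g)
     (\<lambda>s. exp (\<i> * of_real (- b) * of_real s) * (?g s + \<i> * of_real (- b) * integral\<^sup>L (Om s) ?g))"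
    by (intro weak_deriv_exp_mult weak_deriv_antideriv L2_antideriv g L)
  moreover have "exp (\<i> * of_real (- b) * of_real s) * (?g s + \<i> * of_real (- b) * integral\<^sup>L (Om s) ?g) = f s - \<i> * of_real b * mem_E b f s" for s
    using exp_cancel(1)[of b s] unfolding mem_E_def by (simp add: algebra_simps)
  ultimately show "weak_deriv L (mem_E b f) (\<lambda>s. f s - \<i> * of_real b * mem_E b f s)"
    by (simp add: mem_E_def[abs_def])
qed

lemma mem_E_bound:
  assumes "L2 s f" "0 \<le> s"
  shows "(cmod (mem_E b f s))\<^sup>2 \<le> s * integral\<^sup>L (Om s) (\<lambda>t. (cmod (f t))\<^sup>2)"
  using antideriv_bound[OF L2_exp_mult[OF assms(1), of b] assms(2)]
  by (simp add: mem_E_def norm_mult cmod_cis_exp del: of_real_minus)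

text \<open>After multiplication by exp(\<i> b s), f and the Duhamel integral have the same weak
  derivative, hence differ by a constant C on (0, L). Both become small near 0, f in the a.e. sense
  and the integral by \<open>antideriv_bound\<close>, so C = 0.\<close>

lemma hwd_unique:
  assumes f: "\<And>L. L > 0 \<Longrightarrow> L2 L f" and g: "\<And>L. L > 0 \<Longrightarrow> L2 L g" and h: "\<And>L. L > 0 \<Longrightarrow> L2 L h"
    and w: "hwd f g" and eq: "AE s in Hl. g s = h s - \<i> * of_real b * f s"
    and lim: "\<And>e. e > 0 \<Longrightarrow> \<exists>d>0. AE s in Hl. s < d \<longrightarrow> cmod (f s) < e"
  shows "AE s in Hl. f s = mem_E b h s"
proof (rule AE_Hl_if_Om)
  fix L :: real assume L: "L > 0"
  let ?e = "\<lambda>s. exp (\<i> * of_real b * of_real s)"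
  let ?H = "\<lambda>s. integral\<^sup>L (Om s) (\<lambda>t. ?e t * h t)"
  have eqL: "AE s in Om L. g s = h s - \<i> * of_real b * f s"
    by (rule AE_lebesgue_on_subset[OF eq]) auto
  have Lfg: "L2 L (\<lambda>s. g s + \<i> * of_real b * f s)" by (intro L2_add L2_cmult f g L)
  have 1: "weak_deriv L (\<lambda>s. ?e s * f s) (\<lambda>s. ?e s * h s)"
    by (rule weak_deriv_cong_AE[OF weak_deriv_exp_mult[of L f g b]])
       (use f g w eqL L in \<open>auto simp: hwd_iff intro!: L2_exp_mult Lfg\<close>)
  have 2: "weak_deriv L ?H (\<lambda>s. ?e s * h s)"
    by (intro weak_deriv_antideriv L2_exp_mult h L)
  note Ls = L2_exp_mult[OF f[OF L], of b] L2_exp_mult[OF h[OF L], of b]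
    L2_antideriv[OF L2_exp_mult[OF h[OF L], of b] L]
  have "weak_deriv L (\<lambda>s. ?e s * f s - ?H s) (\<lambda>s. ?e s * h s - ?e s * h s)"
    by (intro weak_deriv_diff 1 2 Ls)
  then obtain C where C: "AE s in Om L. ?e s * f s - ?H s = C"
    using weak_deriv_0_const[OF L L2_diff[OF Ls(1,3)]] by auto
  have "cmod C \<le> 2 * e" if e: "e > 0" for e
  proof -
    obtain d where d: "d > 0" "AE s in Hl. s < d \<longrightarrow> cmod (f s) < e" using lim[OF e] by blast
    define K where "K = integral\<^sup>L (Om L) (\<lambda>t. (cmod (h t))\<^sup>2)"
    have K: "K \<ge> 0" by (simp add: K_def)
    have HK: "(cmod (?H s))\<^sup>2 \<le> s * K" if s: "s \<in> {0<..<L}" for s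
    proof -
      have "(cmod (?H s))\<^sup>2 \<le> s * integral\<^sup>L (Om s) (\<lambda>t. (cmod (?e t * h t))\<^sup>2)"
        by (rule antideriv_bound) (use s in \<open>auto intro: L2_exp_mult h\<close>)
      also have "integral\<^sup>L (Om s) (\<lambda>t. (cmod (?e t * h t))\<^sup>2) = integral\<^sup>L (Om s) (\<lambda>t. (cmod (h t))\<^sup>2)"
        by (simp add: norm_mult cmod_cis_exp)
      also have "\<dots> \<le> K" unfolding K_def
        by (rule integral_Om_mono) (use h[OF L] s in \<open>auto simp: L2_def\<close>)
      finally show ?thesis using s by simp
    qed
    \<comment> \<open>On (0, r) both f (a.e.) and the integral, whose square is at most s K, are
      bounded by e.\<close>
    define r where "r = min (min d L) (e\<^sup>2 / (K + 1))"
    have r: "r > 0" using d L e K by (simp add: r_def)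
    have "AE s in Om r. cmod (f s) < e \<and> ?e s * f s - ?H s = C"
    proof -
      have "AE s in Om r. s < d \<longrightarrow> cmod (f s) < e" by (rule AE_lebesgue_on_subset[OF d(2)]) auto
      moreover have "AE s in Om r. ?e s * f s - ?H s = C"
        by (rule AE_lebesgue_on_subset[OF C]) (auto simp: r_def)
      moreover have "AE s in Om r. s < d" by (rule AE_I2) (auto simp: r_def)
      ultimately show ?thesis by eventually_elim auto
    qed
    \<comment> \<open>Since (0, r) has positive measure, an a.e. statement on it holds at some
      point.\<close>
    moreover have "\<not> (AE s in Om r. False)"
    proof
      assume "AE s in Om r. False"
      then have "emeasure (Om r) (space (Om r)) = 0" by (simp only: eventually_False ae_filter_eq_bot_iff)
      then show False using r by (simp add: emeasure_restrict_space)
    qed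
    ultimately obtain s where s: "s \<in> {0<..<r}" "cmod (f s) < e" "?e s * f s - ?H s = C"
      by (smt (verit) AE_cong space_lebesgue_on eventually_mono)
    have "(cmod (?H s))\<^sup>2 \<le> e\<^sup>2"
    proof -
      have "(cmod (?H s))\<^sup>2 \<le> s * K" using HK[of s] s by (auto simp: r_def)
      also have "\<dots> \<le> (e\<^sup>2 / (K + 1)) * K" using s K by (intro mult_right_mono) (auto simp: r_def)
      also have "\<dots> \<le> e\<^sup>2" using K by (simp add: field_simps)
      finally show ?thesis .
    qed
    then have "cmod (?H s) \<le> e" using e by (intro power2_le_imp_le[of "cmod (?H s)" e]) auto
    moreover have "cmod C \<le> cmod (?e s * f s) + cmod (?H s)" unfolding s(3)[symmetric] by (rule norm_triangle_ineq4)
    ultimately show ?thesis using s(2) by (simp add: norm_mult cmod_cis_exp)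
  qed
  then have "cmod C \<le> e" if "e > 0" for e using that[THEN half_gt_zero] by fastforce
  then have C0: "C = 0" using field_le_epsilon[of "cmod C" 0] by simp
  show "AE s in Om L. f s = mem_E b h s"
    using C unfolding C0
  proof eventually_elim
    case (elim s)
    then have "?e s * f s = ?H s" by simp
    then have "exp (\<i> * of_real (- b) * of_real s) * (?e s * f s) = mem_E b h s" by (simp add: mem_E_def)
    then show ?case by (simp only: mult.assoc[symmetric] exp_cancel mult_1)
  qed
qed

text \<open>On every (0, L) the sine coefficients of a weak derivative are dictated by f.\<close>

lemma hwd_deriv_unique:
  assumes f: "\<And>L. L > 0 \<Longrightarrow> L2 L f" and g: "\<And>L. L > 0 \<Longrightarrow> L2 L g" and h: "\<And>L. L > 0 \<Longrightarrow> L2 L h"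
    and w: "hwd f g" "hwd f h"
  shows "AE s in Hl. g s = h s"
proof (rule AE_Hl_if_Om)
  fix L :: real assume L: "L > 0"
  have "sinc L g n = sinc L h n" for n
    using weak_deriv_sinc[OF L f[OF L] g[OF L]] weak_deriv_sinc[OF L f[OF L] h[OF L]] w L by (simp add: hwd_iff)
  then show "AE s in Om L. g s = h s" by (intro sinc_eq_AE L g h)
qed

section \<open>Scalar memory spaces\<close>

lemma integral_Ioo_combine:
  fixes f :: "real \<Rightarrow> real"
  assumes "a \<le> b" "b \<le> c" and f: "integrable (lebesgue_on {a<..<c}) f"
  shows "integral\<^sup>L (lebesgue_on {a<..<c}) f = integral\<^sup>L (lebesgue_on {a<..<b}) f + integral\<^sup>L (lebesgue_on {b<..<c}) f"
proof -
  have i: "integrable (lebesgue_on {a<..<b}) f" "integrable (lebesgue_on {b<..<c}) f"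
    by (rule integrable_lebesgue_on_subset[OF f]; use assms in auto)+
  have "f integrable_on {a..c}"
    using integrable_on_lebesgue_on[OF f] by (simp add: integrable_on_open_interval_real)
  from Henstock_Kurzweil_Integration.integral_combine[OF assms(1,2) this]
  show ?thesis using f i
    by (simp add: lebesgue_integral_eq_integral integral_open_interval_real)
qed

lemma integrable_mult_continuous:
  fixes f :: "real \<Rightarrow> real"
  assumes f: "integrable (lebesgue_on {a<..<b}) f" and c: "continuous_on {a..b} c"
  shows "integrable (lebesgue_on {a<..<b}) (\<lambda>x. c x * f x)"
proof -
  obtain B where B: "\<forall>x\<in>{a..b}. norm (c x) \<le> B"
    using compact_imp_bounded[OF compact_continuous_image[OF c compact_Icc]] unfolding bounded_iff by auto
  have [measurable]: "c \<in> borel_measurable (lebesgue_on {a<..<b})"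
    by (intro continuous_imp_measurable_on_sets_lebesgue continuous_on_subset[OF c]) auto
  show ?thesis
  proof (rule Bochner_Integration.integrable_bound[where f="\<lambda>x. B * f x"])
    show "integrable (lebesgue_on {a<..<b}) (\<lambda>x. B * f x)" using f by auto
    show "AE x in lebesgue_on {a<..<b}. norm (c x * f x) \<le> norm (B * f x)"
    proof (rule AE_I2)
      fix x assume "x \<in> space (lebesgue_on {a<..<b})"
      then have "norm (c x) \<le> B" using B by simp
      then have "\<bar>c x\<bar> \<le> \<bar>B\<bar>" by simp
      then show "norm (c x * f x) \<le> norm (B * f x)" by (simp add: abs_mult mult_right_mono)
    qed
  qed (use f in auto)
qed

text \<open>The differential inequality in \<open>kernel\<close> enters here in integrated form,
  supplied by \<open>kernel_decay\<close>.\<close>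

locale mem_kernel =
  fixes mu :: "real \<Rightarrow> real" and d :: real
  assumes mu_pos: "\<And>s. 0 < s \<Longrightarrow> 0 < mu s"
    and d_pos: "0 < d"
    and mu_decay: "\<And>s t. 0 < s \<Longrightarrow> s \<le> t \<Longrightarrow> mu t \<le> mu s * exp (- d * (t - s))"
    and mu_int: "integrable Hl mu"
begin

lemma mu_meas [measurable]: "mu \<in> borel_measurable Hl" using mu_int by auto

lemma mu_nonneg: "0 < s \<Longrightarrow> 0 \<le> mu s" using mu_pos by (simp add: less_imp_le)

lemma mu_dec: assumes "0 < s" "s \<le> t" shows "mu t \<le> mu s"
proof -
  have "mu t \<le> mu s * exp (- d * (t - s))" by (rule mu_decay[OF assms])
  also have "\<dots> \<le> mu s * 1" using assms d_pos mu_pos[of s] by (intro mult_left_mono) auto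
  finally show ?thesis by simp
qed

lemma mu_strict_dec: assumes "0 < s" "s < t" shows "mu t < mu s"
proof -
  have "mu t \<le> mu s * exp (- d * (t - s))" using mu_decay assms by auto
  also have "\<dots> < mu s * 1" using assms d_pos mu_pos[of s] by (intro mult_strict_left_mono) auto
  finally show ?thesis by simp
qed

text \<open>The scalar counterpart of the memory space, one copy for each sine mode. The companion
  \<open>LMn\<close> is the square of its norm, not the norm.\<close>

definition LM :: "(real \<Rightarrow> complex) \<Rightarrow> bool" where
  "LM f \<longleftrightarrow> f \<in> borel_measurable Hl \<and> integrable Hl (\<lambda>s. mu s * (cmod (f s))\<^sup>2)"

definition LMn :: "(real \<Rightarrow> complex) \<Rightarrow> real" where
  "LMn f = integral\<^sup>L Hl (\<lambda>s. mu s * (cmod (f s))\<^sup>2)"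

lemma LMn_nonneg: "0 \<le> LMn f"
  unfolding LMn_def by (rule integral_nonneg_AE, rule AE_I2) (use mu_nonneg in auto)

lemma LM_bound:
  assumes [measurable]: "f \<in> borel_measurable Hl" and g: "integrable Hl g" and "\<And>s. 0 < s \<Longrightarrow> mu s * (cmod (f s))\<^sup>2 \<le> g s"
  shows "LM f" "LMn f \<le> integral\<^sup>L Hl g"
proof -
  have n: "0 \<le> mu s * (cmod (f s))\<^sup>2" if "0 < s" for s using mu_pos[OF that] by simp
  show "LM f" unfolding LM_def
  proof (intro conjI Bochner_Integration.integrable_bound[OF g] AE_I2)
    fix s assume "s \<in> space Hl"
    then show "norm (mu s * (cmod (f s))\<^sup>2) \<le> norm (g s)" using assms(3)[of s] n[of s] by auto
  qed measurable
  then show "LMn f \<le> integral\<^sup>L Hl g" unfolding LMn_def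
    by (intro integral_mono g) (use assms(3) in \<open>auto simp: LM_def\<close>)
qed

lemma LM_add: assumes "LM f" "LM g" shows "LM (\<lambda>s. f s + g s)" "LMn (\<lambda>s. f s + g s) \<le> 2 * LMn f + 2 * LMn g"
proof -
  have i: "integrable Hl (\<lambda>s. 2 * (mu s * (cmod (f s))\<^sup>2) + 2 * (mu s * (cmod (g s))\<^sup>2))"
    and [measurable]: "f \<in> borel_measurable Hl" "g \<in> borel_measurable Hl"
    using assms by (auto simp: LM_def)
  have le: "mu s * (cmod (f s + g s))\<^sup>2 \<le> 2 * (mu s * (cmod (f s))\<^sup>2) + 2 * (mu s * (cmod (g s))\<^sup>2)" if "0 < s" for s
    using mult_left_mono[OF cmod_add_sq[of "f s" "g s"] less_imp_le[OF mu_pos[OF that]]] by (simp add: algebra_simps)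
  show "LM (\<lambda>s. f s + g s)" by (rule LM_bound(1)[OF _ i le]) measurable
  have "LMn (\<lambda>s. f s + g s) \<le> integral\<^sup>L Hl (\<lambda>s. 2 * (mu s * (cmod (f s))\<^sup>2) + 2 * (mu s * (cmod (g s))\<^sup>2))"
    by (rule LM_bound(2)[OF _ i le]) measurable
  also have "\<dots> = 2 * LMn f + 2 * LMn g" using assms by (simp add: LM_def LMn_def)
  finally show "LMn (\<lambda>s. f s + g s) \<le> 2 * LMn f + 2 * LMn g" .
qed

lemma LM_cmult: assumes "LM f" shows "LM (\<lambda>s. c * f s)" "LMn (\<lambda>s. c * f s) = (cmod c)\<^sup>2 * LMn f"
proof -
  have eq: "(\<lambda>s. mu s * (cmod (c * f s))\<^sup>2) = (\<lambda>s. (cmod c)\<^sup>2 * (mu s * (cmod (f s))\<^sup>2))"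
    by (auto simp: norm_mult power_mult_distrib)
  show "LM (\<lambda>s. c * f s)" "LMn (\<lambda>s. c * f s) = (cmod c)\<^sup>2 * LMn f"
    using assms unfolding LM_def LMn_def eq by auto
qed

lemma LM_diff: assumes "LM f" "LM g" shows "LM (\<lambda>s. f s - g s)"
  using LM_add(1)[OF assms(1) LM_cmult(1)[OF assms(2), of "-1"]] by simp

lemma LM_const: "LM (\<lambda>s. c)" "LMn (\<lambda>s. c) = (cmod c)\<^sup>2 * integral\<^sup>L Hl mu"
  using mu_int by (auto simp: LM_def LMn_def)

lemma LM_cong_AE:
  assumes "LM f" "AE s in Hl. f s = g s" shows "LM g" "LMn g = LMn f"
proof -
  have [measurable]: "f \<in> borel_measurable Hl" using assms by (simp add: LM_def)
  have [measurable]: "g \<in> borel_measurable Hl" by (rule borel_measurable_lebesgue_on_AE[OF _ assms(2)]) auto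
  have ae: "AE s in Hl. mu s * (cmod (f s))\<^sup>2 = mu s * (cmod (g s))\<^sup>2" using assms(2) by eventually_elim simp
  have "integrable Hl (\<lambda>s. mu s * (cmod (g s))\<^sup>2)"
    by (rule iffD1[OF integrable_cong_AE[OF _ _ ae]]) (use assms in \<open>auto simp: LM_def\<close>)
  then show "LM g" by (simp add: LM_def)
  show "LMn g = LMn f" unfolding LMn_def by (rule integral_cong_AE) (use ae in auto)
qed

text \<open>On (0, L) the decreasing weight is at least \<open>mu L\<close>, which is
  positive.\<close>

lemma LM_L2: assumes "LM f" "0 < L" shows "L2 L f"
proof (rule L2_bound)
  have m: "f \<in> borel_measurable Hl" using assms by (simp add: LM_def)
  show "f \<in> borel_measurable (Om L)" by (rule measurable_restrict_mono[OF m]) auto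
  have "integrable Hl (\<lambda>s. 1 / mu L * (mu s * (cmod (f s))\<^sup>2))" using assms by (auto simp: LM_def)
  then show "integrable (Om L) (\<lambda>s. 1 / mu L * (mu s * (cmod (f s))\<^sup>2))"
    by (rule integrable_lebesgue_on_subset) auto
  show "(cmod (f s))\<^sup>2 \<le> 1 / mu L * (mu s * (cmod (f s))\<^sup>2)" if "s \<in> {0<..<L}" for s
    using mult_right_mono[OF mu_dec[of s L] zero_le_power2[of "cmod (f s)"]] that mu_pos[OF assms(2)]
    by (simp add: field_simps)
qed

lemma LM_Om_le:
  assumes "LM f" "0 < L"
  shows "integral\<^sup>L (Om L) (\<lambda>t. (cmod (f t))\<^sup>2) \<le> LMn f / mu L"
proof -
  have i: "integrable Hl (\<lambda>s. 1 / mu L * (mu s * (cmod (f s))\<^sup>2))" using assms by (auto simp: LM_def)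
  have i2: "integrable (Om L) (\<lambda>s. 1 / mu L * (mu s * (cmod (f s))\<^sup>2))"
    by (rule integrable_lebesgue_on_subset[OF i]) auto
  have "integral\<^sup>L (Om L) (\<lambda>t. (cmod (f t))\<^sup>2) \<le> integral\<^sup>L (Om L) (\<lambda>s. 1 / mu L * (mu s * (cmod (f s))\<^sup>2))"
  proof (rule integral_mono[OF _ i2])
    show "integrable (Om L) (\<lambda>t. (cmod (f t))\<^sup>2)" using LM_L2[OF assms] by (simp add: L2_def)
    show "(cmod (f s))\<^sup>2 \<le> 1 / mu L * (mu s * (cmod (f s))\<^sup>2)" if "s \<in> space (Om L)" for s
      using mult_right_mono[OF mu_dec[of s L] zero_le_power2[of "cmod (f s)"]] that mu_pos[OF assms(2)]
      by (simp add: field_simps)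
  qed
  also have "\<dots> = integral\<^sup>L (Om L) (\<lambda>s. \<bar>1 / mu L * (mu s * (cmod (f s))\<^sup>2)\<bar>)"
    by (rule Bochner_Integration.integral_cong) (use mu_pos assms(2) in \<open>auto simp: abs_mult less_imp_le\<close>)
  also have "\<dots> \<le> integral\<^sup>L Hl (\<lambda>s. \<bar>1 / mu L * (mu s * (cmod (f s))\<^sup>2)\<bar>)"
    by (rule integral_Om_mono_Hl) (use integrable_abs[OF i] in simp_all)
  also have "\<dots> = integral\<^sup>L Hl (\<lambda>s. 1 / mu L * (mu s * (cmod (f s))\<^sup>2))"
    by (rule Bochner_Integration.integral_cong) (use mu_pos assms(2) in \<open>auto simp: abs_mult less_imp_le\<close>)
  also have "\<dots> = LMn f / mu L" by (simp add: LMn_def)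
  finally show ?thesis .
qed

text \<open>Cauchy-Schwarz for the measure with density \<open>mu\<close>, written for Lebesgue
  measure with a factor sqrt (mu s) in each entry.\<close>

lemma LM_weighted_integral:
  assumes "LM f"
  shows "integrable Hl (\<lambda>s. of_real (mu s) * f s)"
    "(cmod (integral\<^sup>L Hl (\<lambda>s. of_real (mu s) * f s)))\<^sup>2 \<le> integral\<^sup>L Hl mu * LMn f"
proof -
  have [measurable]: "f \<in> borel_measurable Hl" using assms by (simp add: LM_def)
  have e1: "(sqrt (mu s))\<^sup>2 = mu s" and e2: "(sqrt (mu s) * cmod (f s))\<^sup>2 = mu s * (cmod (f s))\<^sup>2"
    and e3: "\<bar>sqrt (mu s) * (sqrt (mu s) * cmod (f s))\<bar> = mu s * cmod (f s)" if "s \<in> space Hl" for s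
    using mu_pos[of s] that by (auto simp: power_mult_distrib abs_mult simp flip: mult.assoc)
  have i1: "integrable Hl (\<lambda>s. (sqrt (mu s))\<^sup>2)"
    using mu_int by (subst Bochner_Integration.integrable_cong[OF refl e1]) auto
  have i2: "integrable Hl (\<lambda>s. (sqrt (mu s) * cmod (f s))\<^sup>2)"
    using assms by (subst Bochner_Integration.integrable_cong[OF refl e2]) (auto simp: LM_def)
  have "integrable Hl (\<lambda>s. \<bar>sqrt (mu s) * (sqrt (mu s) * cmod (f s))\<bar>)"
    by (intro integrable_abs integrable_mult_square i1 i2) measurable
  then have i: "integrable Hl (\<lambda>s. mu s * cmod (f s))"
    by (subst (asm) Bochner_Integration.integrable_cong[OF refl e3]) auto
  show "integrable Hl (\<lambda>s. of_real (mu s) * f s)"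
    by (rule Bochner_Integration.integrable_bound[OF i]) (auto simp: norm_mult)
  have "cmod (integral\<^sup>L Hl (\<lambda>s. of_real (mu s) * f s)) \<le> integral\<^sup>L Hl (\<lambda>s. cmod (of_real (mu s) * f s))"
    by (rule integral_norm_bound)
  also have "\<dots> = integral\<^sup>L Hl (\<lambda>s. \<bar>sqrt (mu s) * (sqrt (mu s) * cmod (f s))\<bar>)"
    by (rule Bochner_Integration.integral_cong[OF refl]) (use e3 mu_nonneg in \<open>auto simp: norm_mult\<close>)
  finally have "(cmod (integral\<^sup>L Hl (\<lambda>s. of_real (mu s) * f s)))\<^sup>2 \<le> (integral\<^sup>L Hl (\<lambda>s. \<bar>sqrt (mu s) * (sqrt (mu s) * cmod (f s))\<bar>))\<^sup>2"
    by (intro power_mono) auto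
  also have "\<dots> \<le> integral\<^sup>L Hl (\<lambda>s. (sqrt (mu s))\<^sup>2) * integral\<^sup>L Hl (\<lambda>s. (sqrt (mu s) * cmod (f s))\<^sup>2)"
    by (rule Cauchy_Schwarz_integral[OF _ _ i1 i2]) measurable
  also have "integral\<^sup>L Hl (\<lambda>s. (sqrt (mu s))\<^sup>2) = integral\<^sup>L Hl mu"
    by (rule Bochner_Integration.integral_cong[OF refl e1])
  also have "integral\<^sup>L Hl (\<lambda>s. (sqrt (mu s) * cmod (f s))\<^sup>2) = LMn f"
    unfolding LMn_def by (rule Bochner_Integration.integral_cong[OF refl e2])
  finally show "(cmod (integral\<^sup>L Hl (\<lambda>s. of_real (mu s) * f s)))\<^sup>2 \<le> integral\<^sup>L Hl mu * LMn f" .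
qed

section \<open>Boundedness of the scalar solution operator\<close>

lemma measurable_mem_E: assumes "f \<in> borel_measurable Hl" shows "mem_E b f \<in> borel_measurable Hl"
proof -
  have [measurable]: "(\<lambda>s. exp (\<i> * of_real b * of_real s)) \<in> borel_measurable Hl" for b
    by (intro continuous_imp_measurable_on_sets_lebesgue continuous_intros) auto
  have [measurable]: "f \<in> borel_measurable Hl" by fact
  have [measurable]: "(\<lambda>s. integral\<^sup>L (Om s) (\<lambda>t. exp (\<i> * of_real b * of_real t) * f t)) \<in> borel_measurable Hl"
    by (intro borel_measurable_antideriv) measurable
  show ?thesis unfolding mem_E_def[abs_def] by measurable
qed

text \<open>Cauchy-Schwarz after inserting exp(-d (s-t)/4) and its inverse. The square of the first
  factor integrates to at most 2/d. The square of the second carries the growth exp(d (s-t)/2),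
  which the kernel decay exp(-d (s-t)) turns into exp(-d (s-t)/2) while replacing
  \<open>mu s\<close> by \<open>mu t\<close>.\<close>

lemma mem_E_pointwise:
  assumes f: "LM f" and s: "0 < s"
  shows "mu s * (cmod (mem_E b f s))\<^sup>2 \<le> 2 / d * integral\<^sup>L (Om s) (\<lambda>t. exp (- d * (s - t) / 2) * (mu t * (cmod (f t))\<^sup>2))"
    "integrable (Om s) (\<lambda>t. exp (- d * (s - t) / 2) * (mu t * (cmod (f t))\<^sup>2))"
proof -
  note L = LM_L2[OF f s]
  have [measurable]: "f \<in> borel_measurable (Om s)" using L by (simp add: L2_def)
  have f2: "integrable (Om s) (\<lambda>t. (cmod (f t))\<^sup>2)" using L by (simp add: L2_def)
  have mf: "integrable (Om s) (\<lambda>t. mu t * (cmod (f t))\<^sup>2)"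
    by (rule integrable_lebesgue_on_subset[of "{0<..}"]) (use f in \<open>auto simp: LM_def\<close>)
  show i3: "integrable (Om s) (\<lambda>t. exp (- d * (s - t) / 2) * (mu t * (cmod (f t))\<^sup>2))"
    by (rule integrable_mult_continuous[OF mf]) (intro continuous_intros, auto)
  let ?u = "\<lambda>t. exp (- d * (s - t) / 4)" and ?v = "\<lambda>t. exp (d * (s - t) / 4) * cmod (f t)"
  have [measurable]: "?u \<in> borel_measurable (Om s)" "(\<lambda>t. exp (d * (s - t) / 4)) \<in> borel_measurable (Om s)"
    by (intro continuous_imp_measurable_on_sets_lebesgue continuous_intros; auto)+
  have u2: "(?u t)\<^sup>2 = exp (- d * (s - t) / 2)" for t by (simp add: power2_eq_square flip: exp_add)
  have v2: "(?v t)\<^sup>2 = exp (d * (s - t) / 2) * (cmod (f t))\<^sup>2" for t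
    by (simp add: power_mult_distrib) (simp add: power2_eq_square flip: exp_add)
  have iu: "integrable (Om s) (\<lambda>t. (?u t)\<^sup>2)" unfolding u2 by (intro integrable_Om_continuous continuous_intros) auto
  have iv: "integrable (Om s) (\<lambda>t. (?v t)\<^sup>2)" unfolding v2
    by (rule integrable_mult_continuous[OF f2]) (intro continuous_intros, auto)
  have "cmod (mem_E b f s) \<le> integral\<^sup>L (Om s) (\<lambda>t. cmod (exp (\<i> * of_real b * of_real t) * f t))"
    unfolding mem_E_def norm_mult[of "exp (\<i> * of_real (- b) * of_real s)"] cmod_cis_exp mult_1 by (rule integral_norm_bound)
  also have "\<dots> = integral\<^sup>L (Om s) (\<lambda>t. \<bar>?u t * ?v t\<bar>)"
    by (rule Bochner_Integration.integral_cong) (auto simp: norm_mult cmod_cis_exp abs_mult simp flip: exp_add mult.assoc)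
  finally have "(cmod (mem_E b f s))\<^sup>2 \<le> (integral\<^sup>L (Om s) (\<lambda>t. \<bar>?u t * ?v t\<bar>))\<^sup>2" by (intro power_mono) auto
  also have "\<dots> \<le> integral\<^sup>L (Om s) (\<lambda>t. (?u t)\<^sup>2) * integral\<^sup>L (Om s) (\<lambda>t. (?v t)\<^sup>2)"
    by (rule Cauchy_Schwarz_integral[OF _ _ iu iv]) measurable
  also have "integral\<^sup>L (Om s) (\<lambda>t. (?u t)\<^sup>2) = 2 / d * exp (- d * (s - s) / 2) - 2 / d * exp (- d * (s - 0) / 2)"
    unfolding u2
    by (rule integral_Om_FTC[where F="\<lambda>t. 2 / d * exp (- d * (s - t) / 2)"])
       (use s d_pos in \<open>auto intro!: derivative_eq_intros continuous_intros simp flip: has_real_derivative_iff_has_vector_derivative\<close>)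
  also have "\<dots> \<le> 2 / d" using d_pos by simp
  finally have "(cmod (mem_E b f s))\<^sup>2 \<le> 2 / d * integral\<^sup>L (Om s) (\<lambda>t. (?v t)\<^sup>2)"
    by (simp add: mult_right_mono)
  then have "mu s * (cmod (mem_E b f s))\<^sup>2 \<le> mu s * (2 / d * integral\<^sup>L (Om s) (\<lambda>t. (?v t)\<^sup>2))"
    using mu_pos[OF s] by (intro mult_left_mono) auto
  also have "\<dots> = 2 / d * integral\<^sup>L (Om s) (\<lambda>t. mu s * (?v t)\<^sup>2)" by simp
  also have "\<dots> \<le> 2 / d * integral\<^sup>L (Om s) (\<lambda>t. exp (- d * (s - t) / 2) * (mu t * (cmod (f t))\<^sup>2))"
  proof (intro mult_left_mono integral_mono i3)
    show "integrable (Om s) (\<lambda>t. mu s * (?v t)\<^sup>2)" using iv by (intro integrable_mult_right)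
    fix t assume t: "t \<in> space (Om s)"
    have "mu s * exp (d * (s - t) / 2) \<le> (mu t * exp (- d * (s - t))) * exp (d * (s - t) / 2)"
      using mu_decay[of t s] t by (intro mult_right_mono) auto
    also have "\<dots> = mu t * exp (- d * (s - t) / 2)" by (simp add: mult.assoc flip: exp_add)
    finally show "mu s * (?v t)\<^sup>2 \<le> exp (- d * (s - t) / 2) * (mu t * (cmod (f t))\<^sup>2)"
      unfolding v2 using mult_right_mono[OF _ zero_le_power2[of "cmod (f t)"]] by (fastforce simp: mult_ac)
  qed (use d_pos in auto)
  finally show "mu s * (cmod (mem_E b f s))\<^sup>2 \<le> 2 / d * integral\<^sup>L (Om s) (\<lambda>t. exp (- d * (s - t) / 2) * (mu t * (cmod (f t))\<^sup>2))" .
qed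

lemma nn_integral_exp_tail:
  assumes "0 \<le> t"
  shows "(\<integral>\<^sup>+s. ennreal (indicator {0<..<s} t * exp (- d * (s - t) / 2)) \<partial>Hl) \<le> ennreal (2 / d)"
proof -
  have "(\<integral>\<^sup>+s. ennreal (indicator {0<..<s} t * exp (- d * (s - t) / 2)) \<partial>Hl)
     \<le> (\<integral>\<^sup>+s. ennreal (exp (- d * (s - t) / 2)) * indicator {t..} s \<partial>lebesgue)"
    by (subst nn_integral_restrict_space) (auto intro!: nn_integral_mono simp: indicator_def)
  also have "\<dots> = (\<integral>\<^sup>+s. ennreal (exp (- d * (s - t) / 2)) * indicator {t..} s \<partial>lborel)"
    by (rule nn_integral_completion)
  also have "\<dots> = ennreal (0 - (- (2 / d) * exp (- d * (t - t) / 2)))"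
  proof (rule nn_integral_FTC_atLeast[where F="\<lambda>s. - (2 / d) * exp (- d * (s - t) / 2)" and T=0])
    show "((\<lambda>s. - (2 / d) * exp (- d * (s - t) / 2)) has_real_derivative exp (- d * (s - t) / 2)) (at s)" for s
      using d_pos by (auto intro!: derivative_eq_intros)
    have "((\<lambda>s. - (2 / d) * exp (- (d / 2 * (s - t)))) \<longlongrightarrow> - (2 / d) * 0) at_top"
    proof (intro tendsto_mult tendsto_const)
      have "filterlim (\<lambda>s. d / 2 * (- t + s)) at_top at_top"
        using d_pos by (intro filterlim_tendsto_pos_mult_at_top[OF tendsto_const] filterlim_tendsto_add_at_top[OF tendsto_const filterlim_ident]) auto
      then have "filterlim (\<lambda>s. - (d / 2 * (s - t))) at_bot at_top" by (simp add: filterlim_uminus_at_bot)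
      then show "((\<lambda>s. exp (- (d / 2 * (s - t)))) \<longlongrightarrow> 0) at_top"
        by (rule filterlim_compose[OF exp_at_bot])
    qed
    then show "((\<lambda>s. - (2 / d) * exp (- d * (s - t) / 2)) \<longlongrightarrow> 0) at_top" by simp
  qed auto
  finally show ?thesis by simp
qed

text \<open>Integrate the pointwise bound over s and exchange the integrals: the remaining
  exponential tail is again at most 2/d, the second factor of the constant. The bound involves
  neither b nor any mode index, so it can be summed over modes.\<close>

lemma LM_mem_E:
  assumes f: "LM f"
  shows "LM (mem_E b f)" "LMn (mem_E b f) \<le> (2 / d)\<^sup>2 * LMn f"
proof -
  interpret sigma_finite_measure Hl by (rule sigma_finite_Hl)
  interpret P: pair_sigma_finite Hl Hl ..
  have fm[measurable]: "f \<in> borel_measurable Hl" using f by (simp add: LM_def)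
  have m[measurable]: "mem_E b f \<in> borel_measurable Hl" by (rule measurable_mem_E) fact
  define K where "K s t = indicator {0<..<s} t * exp (- d * (s - t) / 2) * (mu t * (cmod (f t))\<^sup>2)" for s t :: real
  have [measurable]: "(\<lambda>z. exp (- d * (fst z - snd z) / 2)) \<in> borel_measurable (Hl \<Otimes>\<^sub>M Hl)"
  proof -
    have [measurable]: "fst \<in> borel_measurable (Hl \<Otimes>\<^sub>M Hl)" "snd \<in> borel_measurable (Hl \<Otimes>\<^sub>M Hl)"
      using measurable_compose[OF measurable_fst ident_measurable_lebesgue_on] measurable_compose[OF measurable_snd ident_measurable_lebesgue_on] by auto
    show ?thesis by measurable
  qed
  have [measurable]: "(\<lambda>z. mu (snd z) * (cmod (f (snd z)))\<^sup>2) \<in> borel_measurable (Hl \<Otimes>\<^sub>M Hl)" by measurable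
  have Km: "(\<lambda>(s, t). ennreal (K s t)) \<in> borel_measurable (Hl \<Otimes>\<^sub>M Hl)"
  proof -
    have "(\<lambda>z. ennreal (indicator {0<..<fst z} (snd z) * exp (- d * (fst z - snd z) / 2) * (mu (snd z) * (cmod (f (snd z)))\<^sup>2))) \<in> borel_measurable (Hl \<Otimes>\<^sub>M Hl)"
      by measurable
    then show ?thesis by (simp add: K_def case_prod_beta')
  qed
  have pt: "ennreal (mu s * (cmod (mem_E b f s))\<^sup>2) \<le> ennreal (2 / d) * (\<integral>\<^sup>+t. ennreal (K s t) \<partial>Hl)" if s: "s \<in> space Hl" for s
  proof -
    have s0: "0 < s" using s by simp
    let ?q = "\<lambda>t. exp (- d * (s - t) / 2) * (mu t * (cmod (f t))\<^sup>2)"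
    have Kq: "integral\<^sup>L (Om s) ?q = integral\<^sup>L Hl (K s)"
      unfolding integral_Om_as_indicator_Hl by (simp add: K_def[abs_def] mult_ac)
    have "integrable Hl (\<lambda>t. K s t) \<longleftrightarrow> integrable (Om s) (\<lambda>t. K s t)"
      by (rule integral_lebesgue_on_eq_if_vanish) (auto simp: K_def)
    also have "\<dots> \<longleftrightarrow> integrable (Om s) ?q"
      by (rule Bochner_Integration.integrable_cong) (auto simp: K_def)
    finally have Ki: "integrable Hl (K s)" using mem_E_pointwise(2)[OF f s0] by simp
    have K0: "AE t in Hl. 0 \<le> K s t"
      by (rule AE_I2) (use mu_nonneg in \<open>auto simp: K_def intro!: mult_nonneg_nonneg\<close>)
    have "ennreal (mu s * (cmod (mem_E b f s))\<^sup>2) \<le> ennreal (2 / d * integral\<^sup>L Hl (K s))"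
      using mem_E_pointwise(1)[OF f s0, of b] unfolding Kq by (rule ennreal_leI)
    also have "\<dots> = ennreal (2 / d) * ennreal (integral\<^sup>L Hl (K s))"
      using d_pos by (intro ennreal_mult' ) auto
    also have "ennreal (integral\<^sup>L Hl (K s)) = (\<integral>\<^sup>+t. ennreal (K s t) \<partial>Hl)"
      using nn_integral_eq_integral[OF Ki K0] by simp
    finally show ?thesis .
  qed
  have "(\<integral>\<^sup>+s. ennreal (mu s * (cmod (mem_E b f s))\<^sup>2) \<partial>Hl) \<le> (\<integral>\<^sup>+s. ennreal (2 / d) * (\<integral>\<^sup>+t. ennreal (K s t) \<partial>Hl) \<partial>Hl)"
    by (rule nn_integral_mono) (rule pt)
  also have "\<dots> = ennreal (2 / d) * (\<integral>\<^sup>+s. (\<integral>\<^sup>+t. ennreal (K s t) \<partial>Hl) \<partial>Hl)"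
    using borel_measurable_nn_integral[OF Km] by (intro nn_integral_cmult) simp
  also have "(\<integral>\<^sup>+s. (\<integral>\<^sup>+t. ennreal (K s t) \<partial>Hl) \<partial>Hl) = (\<integral>\<^sup>+t. (\<integral>\<^sup>+s. ennreal (K s t) \<partial>Hl) \<partial>Hl)"
    by (rule P.Fubini'[symmetric]) (rule Km)
  also have "\<dots> \<le> (\<integral>\<^sup>+t. ennreal (2 / d) * ennreal (mu t * (cmod (f t))\<^sup>2) \<partial>Hl)"
  proof (rule nn_integral_mono)
    fix t assume "t \<in> space Hl"
    then have t: "0 \<le> t" "0 < mu t" using mu_pos by auto
    have meas: "(\<lambda>s. ennreal (indicator {0<..<s} t * exp (- d * (s - t) / 2))) \<in> borel_measurable Hl"
    proof -
      have "(\<lambda>s. indicator {0<..<s} t :: real) = indicator (if 0 < t then {t<..} else {})" by (auto simp: indicator_def fun_eq_iff)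
      then have [measurable]: "(\<lambda>s. indicator {0<..<s} t :: real) \<in> borel_measurable Hl" by (auto simp: sets_restrict_space_iff borel_measurable_indicator_iff)
      show ?thesis by measurable
    qed
    have "(\<integral>\<^sup>+s. ennreal (K s t) \<partial>Hl) = (\<integral>\<^sup>+s. ennreal (mu t * (cmod (f t))\<^sup>2) * ennreal (indicator {0<..<s} t * exp (- d * (s - t) / 2)) \<partial>Hl)"
      by (rule nn_integral_cong) (use t in \<open>simp add: K_def mult_ac flip: ennreal_mult'\<close>)
    also have "\<dots> = ennreal (mu t * (cmod (f t))\<^sup>2) * (\<integral>\<^sup>+s. ennreal (indicator {0<..<s} t * exp (- d * (s - t) / 2)) \<partial>Hl)"
      by (rule nn_integral_cmult[OF meas])
    also have "\<dots> \<le> ennreal (mu t * (cmod (f t))\<^sup>2) * ennreal (2 / d)"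
      by (intro mult_left_mono nn_integral_exp_tail t) auto
    finally show "(\<integral>\<^sup>+s. ennreal (K s t) \<partial>Hl) \<le> ennreal (2 / d) * ennreal (mu t * (cmod (f t))\<^sup>2)" by (simp add: mult.commute)
  qed
  also have "(\<integral>\<^sup>+t. ennreal (2 / d) * ennreal (mu t * (cmod (f t))\<^sup>2) \<partial>Hl) = ennreal (2 / d) * (\<integral>\<^sup>+t. ennreal (mu t * (cmod (f t))\<^sup>2) \<partial>Hl)"
    by (rule nn_integral_cmult) measurable
  also have "(\<integral>\<^sup>+t. ennreal (mu t * (cmod (f t))\<^sup>2) \<partial>Hl) = ennreal (LMn f)"
    unfolding LMn_def by (rule nn_integral_eq_integral) (use f mu_nonneg in \<open>auto simp: LM_def intro!: AE_I2 mult_nonneg_nonneg\<close>)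
  also have "ennreal (2 / d) * (ennreal (2 / d) * ennreal (LMn f)) = ennreal ((2 / d)\<^sup>2 * LMn f)"
    using d_pos LMn_nonneg[of f] by (simp add: power2_eq_square mult.assoc flip: ennreal_mult')
  finally have fin: "(\<integral>\<^sup>+s. ennreal (mu s * (cmod (mem_E b f s))\<^sup>2) \<partial>Hl) \<le> ennreal ((2 / d)\<^sup>2 * LMn f)"
    by (simp add: mult_left_mono)
  have nn: "AE s in Hl. 0 \<le> mu s * (cmod (mem_E b f s))\<^sup>2"
    by (rule AE_I2) (use mu_nonneg in auto)
  have int: "integrable Hl (\<lambda>s. mu s * (cmod (mem_E b f s))\<^sup>2)"
    by (rule integrableI_nonneg[OF _ nn]) (use fin in \<open>auto simp: le_less_trans\<close>)
  then show "LM (mem_E b f)" by (simp add: LM_def)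
  have "ennreal (LMn (mem_E b f)) \<le> ennreal ((2 / d)\<^sup>2 * LMn f)"
    using fin nn_integral_eq_integral[OF int nn] by (simp add: LMn_def)
  then show "LMn (mem_E b f) \<le> (2 / d)\<^sup>2 * LMn f" using LMn_nonneg[of f] by (subst (asm) ennreal_le_iff) auto
qed

lemma mem_E_linear:
  assumes "LM f" "LM g" "0 < s"
  shows "mem_E b (\<lambda>t. c * f t + g t) s = c * mem_E b f s + mem_E b g s"
proof -
  let ?e = "\<lambda>t. exp (\<i> * of_real b * of_real t)"
  have i: "integrable (Om s) (\<lambda>t. ?e t * f t)" "integrable (Om s) (\<lambda>t. ?e t * g t)"
    by (intro L2_integrable L2_exp_mult LM_L2 assms)+
  have "(\<lambda>t. ?e t * (c * f t + g t)) = (\<lambda>t. c * (?e t * f t) + ?e t * g t)" by (auto simp: algebra_simps)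
  then have "integral\<^sup>L (Om s) (\<lambda>t. ?e t * (c * f t + g t)) = c * integral\<^sup>L (Om s) (\<lambda>t. ?e t * f t) + integral\<^sup>L (Om s) (\<lambda>t. ?e t * g t)"
    using i by (simp add: Bochner_Integration.integral_add)
  then show ?thesis unfolding mem_E_def by (simp add: algebra_simps)
qed

text \<open>On each period \<open>mu s * sin (b * s) \<ge> mu m * sin (b * s)\<close> for the midpoint \<open>m\<close>, and the right-hand side has integral zero.\<close>
lemma sin_integral_pos:
  assumes b: "0 < b" and int: "integrable Hl (\<lambda>s. mu s * sin (b * s))"
  shows "0 < integral\<^sup>L Hl (\<lambda>s. mu s * sin (b * s))"
proof -
  define T where "T = 2 * pi / b"
  have T: "T > 0" "b * T = 2 * pi" using b by (auto simp: T_def)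
  define F where "F s = mu s * sin (b * s)" for s
  define m where "m k = real k * T + T / 2" for k
  have m0: "m k > 0" for k using T by (simp add: m_def add_nonneg_pos)
  define A where "A k = {real k * T <..< real k * T + T}" for k :: nat
  have per: "sin (b * s) = sin (b * (s - real k * T))" for s k
  proof -
    have "b * s = b * (s - real k * T) + of_int (int k) * (2 * pi)" using T(2) by (simp add: algebra_simps)
    then show ?thesis by (metis sin_cos_eq_iff sin_add sin_int_2pin cos_int_2pin mult_1_right mult_zero_right add_0_right mult.commute)
  qed
  have G: "0 \<le> (mu s - mu (m k)) * sin (b * s)" if s: "s \<in> A k" for s k
  proof (cases "s \<le> m k")
    case True
    have "0 \<le> b * (s - real k * T)" using b s by (auto simp: A_def)
    moreover have "b * (s - real k * T) \<le> pi"
      using True mult_left_mono[of "s - real k * T" "T / 2" b] b T(2) by (simp add: m_def)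
    ultimately have "0 \<le> sin (b * s)" unfolding per[of s k] by (rule sin_ge_zero)
    moreover have "0 < s" using s T by (auto simp: A_def intro: le_less_trans[rotated])
    ultimately show ?thesis using mu_dec[of s "m k"] True by simp
  next
    case False
    have "b * (s - real k * T) - pi \<ge> 0" using False mult_left_mono[of "T / 2" "s - real k * T" b] b T(2) by (simp add: m_def)
    moreover have "b * (s - real k * T) - pi \<le> pi" using s mult_left_mono[of "s - real k * T" T b] b T(2) by (auto simp: A_def)
    ultimately have "0 \<le> sin (b * (s - real k * T) - pi)" by (rule sin_ge_zero)
    then have "sin (b * s) \<le> 0" unfolding per[of s k] by (simp add: sin_diff)
    moreover have "mu s - mu (m k) \<le> 0" using mu_dec[of "m k" s] False m0[of k] by simp
    ultimately show ?thesis by (simp add: mult_nonpos_nonpos)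
  qed
  have Ai: "integrable (lebesgue_on (A k)) F" for k
    by (rule integrable_lebesgue_on_subset[of "{0<..}"])
       (use int T in \<open>auto simp: F_def[abs_def] A_def intro: le_less_trans[rotated]\<close>)
  have si: "integrable (lebesgue_on (A k)) (\<lambda>s. c * sin (b * s))" for c k
    unfolding A_def by (intro integrable_Ioo_continuous continuous_intros)
  have s0: "integral\<^sup>L (lebesgue_on (A k)) (\<lambda>s. sin (b * s)) = 0" for k
  proof -
    have "integral\<^sup>L (lebesgue_on (A k)) (\<lambda>s. sin (b * s)) = - cos (b * (real k * T + T)) / b - (- cos (b * (real k * T)) / b)"
      unfolding A_def
      by (rule integral_Ioo_FTC[where F="\<lambda>s. - cos (b * s) / b"])
         (use b T in \<open>auto intro!: derivative_eq_intros continuous_intros simp flip: has_real_derivative_iff_has_vector_derivative\<close>)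
    also have "b * (real k * T + T) = b * (real k * T) + 2 * pi" using T(2) by (simp add: algebra_simps)
    finally show ?thesis by simp
  qed
  have AG: "integral\<^sup>L (lebesgue_on (A k)) F = integral\<^sup>L (lebesgue_on (A k)) (\<lambda>s. (mu s - mu (m k)) * sin (b * s))" for k
  proof -
    have "integral\<^sup>L (lebesgue_on (A k)) (\<lambda>s. F s - mu (m k) * sin (b * s)) = integral\<^sup>L (lebesgue_on (A k)) F"
      using Ai[of k] si[of k "mu (m k)"] s0[of k] by (simp add: Bochner_Integration.integral_diff)
    then show ?thesis by (simp add: F_def left_diff_distrib)
  qed
  have Anon: "0 \<le> integral\<^sup>L (lebesgue_on (A k)) F" for k
    unfolding AG by (rule integral_nonneg_AE, rule AE_I2) (use G in auto)
  \<comment> \<open>Strictness comes from the first half-period alone, where \<open>mu\<close> lies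
    strictly above its value at the midpoint of the period and the sine is positive.\<close>
  have A0: "0 < integral\<^sup>L (lebesgue_on (A 0)) F"
  proof (rule ccontr)
    let ?G = "\<lambda>s. (mu s - mu (m 0)) * sin (b * s)"
    assume "\<not> 0 < integral\<^sup>L (lebesgue_on (A 0)) F"
    then have z: "integral\<^sup>L (lebesgue_on (A 0)) ?G = 0" using Anon[of 0] AG[of 0] by simp
    have gi: "integrable (lebesgue_on (A 0)) ?G"
      using Bochner_Integration.integrable_diff[OF Ai[of 0] si[of 0 "mu (m 0)"]] by (simp add: F_def left_diff_distrib)
    have "AE s in lebesgue_on (A 0). ?G s = 0"
      using z integral_nonneg_eq_0_iff_AE[OF gi AE_I2] G by simp
    then have "AE s in lebesgue_on {0<..<T/2}. ?G s = 0"
      by (rule AE_lebesgue_on_subset) (use T in \<open>auto simp: A_def\<close>)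
    moreover have "AE s in lebesgue_on {0<..<T/2}. ?G s \<noteq> 0"
    proof (rule AE_I2)
      fix s assume "s \<in> space (lebesgue_on {0<..<T/2})"
      then have s: "0 < s" "s < T/2" by auto
      have "b * s < pi" using mult_strict_left_mono[OF s(2) b] T(2) by simp
      then have "0 < sin (b * s)" using s b by (intro sin_gt_zero) auto
      moreover have "mu (m 0) < mu s" using mu_strict_dec[of s "m 0"] s by (simp add: m_def)
      ultimately show "?G s \<noteq> 0" by simp
    qed
    ultimately have "AE s in Om (T/2). False" by eventually_elim auto
    then have "emeasure (Om (T/2)) (space (Om (T/2))) = 0" by (simp only: eventually_False ae_filter_eq_bot_iff)
    then show False using T by (simp add: emeasure_restrict_space)
  qed
  define I where "I n = integral\<^sup>L (Om (real n * T)) F" for n :: nat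
  have IS: "I (Suc n) = I n + integral\<^sup>L (lebesgue_on (A n)) F" for n
    unfolding I_def A_def
  proof -
    have e: "real (Suc n) * T = real n * T + T" by (simp add: algebra_simps)
    show "integral\<^sup>L (Om (real (Suc n) * T)) F = integral\<^sup>L (Om (real n * T)) F + integral\<^sup>L (lebesgue_on {real n * T<..<real n * T + T}) F"
      unfolding e
    proof (rule integral_Ioo_combine)
      show "integrable (Om (real n * T + T)) F"
        by (rule integrable_lebesgue_on_subset[of "{0<..}"]) (use int in \<open>auto simp: F_def[abs_def]\<close>)
    qed (use T in auto)
  qed
  have I1: "I (Suc n) \<ge> integral\<^sup>L (lebesgue_on (A 0)) F" for n
  proof (induction n)
    case 0
    have "I 0 = 0" by (simp add: I_def)
    then show ?case using IS[of 0] by simp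
  next
    case (Suc n)
    then show ?case using IS[of "Suc n"] Anon[of "Suc n"] by linarith
  qed
  have Im: "(\<lambda>n. indicator {0<..<real n * T} s *\<^sub>R F s) \<longlonglongrightarrow> F s" if "0 < s" for s
  proof (rule tendsto_eventually)
    obtain N where N: "s / T < real N" using reals_Archimedean2 by blast
    show "\<forall>\<^sub>F n in sequentially. indicator {0<..<real n * T} s *\<^sub>R F s = F s"
    proof (rule eventually_sequentiallyI[of N])
      fix n assume "N \<le> n"
      then have "s / T < real n" using N by linarith
      then have "s < real n * T" using T by (simp add: field_simps)
      then show "indicator {0<..<real n * T} s *\<^sub>R F s = F s" using that by simp
    qed
  qed
  have "(\<lambda>n. integral\<^sup>L Hl (\<lambda>s. indicator {0<..<real n * T} s *\<^sub>R F s)) \<longlonglongrightarrow> integral\<^sup>L Hl F"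
  proof (rule integral_dominated_convergence[where w="\<lambda>s. \<bar>F s\<bar>"])
    show "integrable Hl (\<lambda>s. \<bar>F s\<bar>)" using int by (auto simp: F_def)
    show Fm: "F \<in> borel_measurable Hl" using int by (auto simp: F_def[abs_def])
    show "(\<lambda>s. indicator {0<..<real n * T} s *\<^sub>R F s) \<in> borel_measurable Hl" for n
      by (intro borel_measurable_scaleR Fm borel_measurable_indicator) (auto simp: sets_restrict_space_iff)
    show "AE s in Hl. (\<lambda>n. indicator {0<..<real n * T} s *\<^sub>R F s) \<longlonglongrightarrow> F s"
      by (rule AE_I2) (use Im in auto)
    show "AE s in Hl. norm (indicator {0<..<real n * T} s *\<^sub>R F s) \<le> \<bar>F s\<bar>" for n
      by (rule AE_I2) (auto simp: indicator_def)
  qed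
  then have "I \<longlonglongrightarrow> integral\<^sup>L Hl F" by (simp add: I_def[abs_def] integral_Om_as_indicator_Hl)
  then have "(\<lambda>n. I (Suc n)) \<longlonglongrightarrow> integral\<^sup>L Hl F" by (rule LIMSEQ_Suc)
  then have "integral\<^sup>L (lebesgue_on (A 0)) F \<le> integral\<^sup>L Hl F"
    by (rule tendsto_lowerbound) (use I1 in auto)
  then show ?thesis using A0 by (simp add: F_def[abs_def])
qed

section \<open>The memory coefficient and the sign of its real part\<close>

lemma Re_mem_E_1:
  assumes "0 < s" shows "Re (mem_E b (\<lambda>t. 1) s) = (if b = 0 then s else sin (\<bar>b\<bar> * s) / \<bar>b\<bar>)"
proof (cases "b = 0")
  case True
  have "integral\<^sup>L (Om s) (\<lambda>t. 1 :: complex) = of_real s - of_real 0"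
    by (rule integral_Om_FTC[where F="of_real"]) (use assms in \<open>auto intro!: derivative_eq_intros\<close>)
  then show ?thesis using True assms by (simp add: mem_E_def)
next
  case False
  have "integral\<^sup>L (Om s) (\<lambda>t. exp (\<i> * of_real b * of_real t)) = exp (\<i> * of_real b * of_real s) / (\<i> * of_real b) - exp (\<i> * of_real b * of_real 0) / (\<i> * of_real b)"
  proof (rule integral_Om_FTC)
    show "((\<lambda>t. exp (\<i> * of_real b * of_real t) / (\<i> * of_real b)) has_vector_derivative exp (\<i> * of_real b * of_real x)) (at x)" for x
    proof -
      have "((\<lambda>z. exp (\<i> * of_real b * z) / (\<i> * of_real b)) has_field_derivative exp (\<i> * of_real b * of_real x)) (at (of_real x))"
        using False by (auto intro!: derivative_eq_intros)
      from has_vector_derivative_real_field[OF this] show ?thesis .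
    qed
  qed (use assms in \<open>auto intro!: continuous_intros\<close>)
  then have "mem_E b (\<lambda>t. 1) s = (1 - exp (\<i> * of_real (- b) * of_real s)) / (\<i> * of_real b)"
    using exp_cancel(1)[of b s] unfolding mem_E_def mult_1_right by (simp only: diff_divide_distrib[symmetric] times_divide_eq_right right_diff_distrib of_real_0 mult_zero_right exp_zero mult_1_right)
  also have "\<dots> = (1 - (of_real (cos (- b * s)) + \<i> * of_real (sin (- b * s)))) / (\<i> * of_real b)"
    unfolding cis_exp ..
  also have "Re \<dots> = sin (b * s) / b" using False by (simp add: complex_eq_iff Re_divide power2_eq_square)
  also have "\<dots> = sin (\<bar>b\<bar> * s) / \<bar>b\<bar>" by (auto simp: abs_if)
  finally show ?thesis using False by simp
qed

text \<open>The weighted integral of the memory generated by a unit temperature that is constant in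
  s: the number called c in the overview.\<close>

definition kc :: "real \<Rightarrow> complex" where
  "kc b = integral\<^sup>L Hl (\<lambda>s. of_real (mu s) * mem_E b (\<lambda>t. 1) s)"

text \<open>The real part is the integral of \<open>mu s\<close> times s for b = 0, and of
  \<open>mu s\<close> times sin(|b| s)/|b| otherwise, where \<open>sin_integral_pos\<close> applies.
  It is the dissipation constant of the memory term in each mode.\<close>

lemma Re_kc_pos: "0 < Re (kc b)"
proof -
  have int: "integrable Hl (\<lambda>s. of_real (mu s) * mem_E b (\<lambda>t. 1) s)"
    by (intro LM_weighted_integral LM_mem_E LM_const)
  have Re: "Re (kc b) = integral\<^sup>L Hl (\<lambda>s. mu s * Re (mem_E b (\<lambda>t. 1) s))"
    unfolding kc_def by (subst integral_Re[OF int, symmetric]) simp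
  have intRe: "integrable Hl (\<lambda>s. mu s * Re (mem_E b (\<lambda>t. 1) s))"
    using integrable_Re[OF int] by simp
  show ?thesis
  proof (cases "b = 0")
    case True
    have eq: "mu s * Re (mem_E b (\<lambda>t. 1) s) = mu s * s" if "s \<in> space Hl" for s
      using that True by (simp add: Re_mem_E_1)
    have i: "integrable Hl (\<lambda>s. mu s * s)" using intRe by (subst (asm) Bochner_Integration.integrable_cong[OF refl eq]) auto
    have R: "Re (kc b) = integral\<^sup>L Hl (\<lambda>s. mu s * s)"
      unfolding Re by (rule Bochner_Integration.integral_cong[OF refl eq])
    have nn: "AE s in Hl. 0 \<le> mu s * s" by (rule AE_I2) (use mu_nonneg in auto)
    have "integral\<^sup>L Hl (\<lambda>s. mu s * s) \<noteq> 0"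
    proof
      assume "integral\<^sup>L Hl (\<lambda>s. mu s * s) = 0"
      then have "AE s in Hl. mu s * s = 0" using integral_nonneg_eq_0_iff_AE[OF i nn] by simp
      moreover have "AE s in Hl. mu s * s \<noteq> 0"
      proof (rule AE_I2)
        fix s assume "s \<in> space Hl"
        then show "mu s * s \<noteq> 0" using mu_pos[of s] by simp
      qed
      ultimately have "AE s in Hl. False" by eventually_elim auto
      then have "AE s in Om 1. False" by (rule AE_lebesgue_on_subset) auto
      then have "emeasure (Om 1) (space (Om 1)) = 0" by (simp only: eventually_False ae_filter_eq_bot_iff)
      then show False by (simp add: emeasure_restrict_space)
    qed
    moreover have "0 \<le> integral\<^sup>L Hl (\<lambda>s. mu s * s)" using nn by (rule integral_nonneg_AE)
    ultimately show ?thesis unfolding R by simp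
  next
    case False
    have eq: "mu s * Re (mem_E b (\<lambda>t. 1) s) = 1 / \<bar>b\<bar> * (mu s * sin (\<bar>b\<bar> * s))" if "s \<in> space Hl" for s
      using that False by (simp add: Re_mem_E_1)
    have i1: "integrable Hl (\<lambda>s. 1 / \<bar>b\<bar> * (mu s * sin (\<bar>b\<bar> * s)))"
      using intRe by (subst (asm) Bochner_Integration.integrable_cong[OF refl eq]) auto
    have i: "integrable Hl (\<lambda>s. mu s * sin (\<bar>b\<bar> * s))"
      using integrable_mult_right[OF i1, of "\<bar>b\<bar>"] False by simp
    have "Re (kc b) = integral\<^sup>L Hl (\<lambda>s. 1 / \<bar>b\<bar> * (mu s * sin (\<bar>b\<bar> * s)))"
      unfolding Re by (rule Bochner_Integration.integral_cong[OF refl eq])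
    also have "\<dots> = 1 / \<bar>b\<bar> * integral\<^sup>L Hl (\<lambda>s. mu s * sin (\<bar>b\<bar> * s))" by (rule integral_mult_right_zero)
    finally show ?thesis using sin_integral_pos[OF _ i] False by simp
  qed
qed

end

lemma mem_kernel_if_kernel:
  assumes "kernel \<mu>" obtains \<delta> where "mem_kernel \<mu> \<delta>"
proof -
  obtain \<delta> where "\<delta> > 0" "\<And>s t. 0 < s \<Longrightarrow> s \<le> t \<Longrightarrow> \<mu> t \<le> \<mu> s * exp (- \<delta> * (t - s))"
    using kernel_decay[OF assms] by blast
  moreover have "\<And>s. 0 < s \<Longrightarrow> 0 < \<mu> s" "integrable Hl \<mu>" using assms unfolding kernel_def by blast+
  ultimately have "mem_kernel \<mu> \<delta>" by (simp add: mem_kernel_def)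
  then show ?thesis by (rule that)
qed

section \<open>The mode systems\<close>

type_synonym c5 = "complex \<times> complex \<times> complex \<times> complex \<times> complex"

text \<open>An O-relation with one constant for all indices. The index sets below may contain
  solutions, data and frequencies together, so that constants come out uniform in all of them
  without being tracked.\<close>

definition dominated :: "'i set \<Rightarrow> ('i \<Rightarrow> real) \<Rightarrow> ('i \<Rightarrow> real) \<Rightarrow> bool" where
  "dominated A f g \<longleftrightarrow> (\<exists>C\<ge>0. \<forall>i\<in>A. f i \<le> C * g i)"

lemma dominated_add:
  assumes "dominated A f h" "dominated A g h" shows "dominated A (\<lambda>i. f i + g i) h"
proof -
  obtain C D where "C \<ge> 0" "D \<ge> 0" "\<And>i. i \<in> A \<Longrightarrow> f i \<le> C * h i" "\<And>i. i \<in> A \<Longrightarrow> g i \<le> D * h i"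
    using assms unfolding dominated_def by blast
  then show ?thesis unfolding dominated_def by (intro exI[of _ "C + D"]) (auto simp: distrib_right intro: add_mono)
qed

lemma dominated_scale:
  assumes "dominated A f h" "0 \<le> c" shows "dominated A (\<lambda>i. c * f i) h"
proof -
  obtain C where "C \<ge> 0" "\<And>i. i \<in> A \<Longrightarrow> f i \<le> C * h i" using assms unfolding dominated_def by blast
  then show ?thesis unfolding dominated_def using assms(2)
    by (intro exI[of _ "c * C"]) (auto simp: mult.assoc intro: mult_left_mono)
qed

lemma dominated_le:
  assumes "dominated A g h" "\<And>i. i \<in> A \<Longrightarrow> f i \<le> g i" shows "dominated A f h"
  using assms unfolding dominated_def by (meson order_trans)

lemma dominated_trans:
  assumes "dominated A f g" "dominated A g h" shows "dominated A f h"
proof -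
  obtain C D where C: "C \<ge> 0" "\<And>i. i \<in> A \<Longrightarrow> f i \<le> C * g i" and D: "D \<ge> 0" "\<And>i. i \<in> A \<Longrightarrow> g i \<le> D * h i"
    using assms unfolding dominated_def by blast
  have "f i \<le> C * D * h i" if "i \<in> A" for i
    using C(2)[OF that] mult_left_mono[OF D(2)[OF that] C(1)] by (simp add: mult.assoc)
  then show ?thesis unfolding dominated_def using C(1) D(1) by (intro exI[of _ "C * D"]) auto
qed

lemma dominatedI:
  assumes "0 < c" "\<And>i. i \<in> A \<Longrightarrow> c * f i \<le> g i" shows "dominated A f g"
  unfolding dominated_def using assms by (intro exI[of _ "1 / c"]) (auto simp: field_simps)

lemma dominated_norm_add:
  assumes "dominated A (\<lambda>i. cmod (f i)) h" "dominated A (\<lambda>i. cmod (g i)) h" shows "dominated A (\<lambda>i. cmod (f i + g i)) h"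
  by (rule dominated_le[OF dominated_add[OF assms] norm_triangle_ineq])

lemma dominated_norm_diff:
  assumes "dominated A (\<lambda>i. cmod (f i)) h" "dominated A (\<lambda>i. cmod (g i)) h" shows "dominated A (\<lambda>i. cmod (f i - g i)) h"
  by (rule dominated_le[OF dominated_add[OF assms] norm_triangle_ineq4])

lemma dominated_norm_cmult: "dominated A (\<lambda>i. cmod (f i)) h \<Longrightarrow> dominated A (\<lambda>i. cmod (c * f i)) h"
  unfolding norm_mult by (rule dominated_scale) simp_all

lemma dominated_sq_add:
  assumes "dominated A (\<lambda>i. (cmod (f i))\<^sup>2) h" "dominated A (\<lambda>i. (cmod (g i))\<^sup>2) h" shows "dominated A (\<lambda>i. (cmod (f i + g i))\<^sup>2) h"
  by (rule dominated_le[OF dominated_add[OF assms(1)[THEN dominated_scale] assms(2)[THEN dominated_scale]] cmod_add_sq]) auto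

lemma dominated_sq_cmult: "dominated A (\<lambda>i. (cmod (f i))\<^sup>2) h \<Longrightarrow> dominated A (\<lambda>i. (cmod (c * f i))\<^sup>2) h"
  unfolding norm_mult power_mult_distrib by (rule dominated_scale) simp_all

lemma dominated_sq_diff:
  assumes "dominated A (\<lambda>i. (cmod (f i))\<^sup>2) h" "dominated A (\<lambda>i. (cmod (g i))\<^sup>2) h" shows "dominated A (\<lambda>i. (cmod (f i - g i))\<^sup>2) h"
  using dominated_sq_add[OF assms(1) dominated_sq_cmult[OF assms(2), of "-1"]] by simp

lemma norm_c5_sq: "(norm (p, q, r, t, x))\<^sup>2 = (cmod p)\<^sup>2 + (cmod q)\<^sup>2 + (cmod r)\<^sup>2 + (cmod t)\<^sup>2 + (cmod x)\<^sup>2"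
  for p q r t x :: complex by (simp add: norm_Pair)

lemma norm_c5_ge:
  fixes p q r t x :: complex
  shows "cmod p \<le> norm (p, q, r, t, x)" "cmod q \<le> norm (p, q, r, t, x)" "cmod r \<le> norm (p, q, r, t, x)"
    "cmod t \<le> norm (p, q, r, t, x)" "cmod x \<le> norm (p, q, r, t, x)"
  by (rule power2_le_imp_le; simp add: norm_c5_sq)+

lemma norm_c5_le:
  fixes p q r t x :: complex
  shows "norm (p, q, r, t, x) \<le> cmod p + cmod q + cmod r + cmod t + cmod x"
  using norm_Pair_le[of p "(q, r, t, x)"] norm_Pair_le[of q "(r, t, x)"] norm_Pair_le[of r "(t, x)"] norm_Pair_le[of t x]
  by linarith

text \<open>The parameters c and e stand for \<open>kc\<close> of the two kernels; the mode analysis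
  works with their positive real parts.\<close>

locale bresse_mode =
  fixes \<rho>1 \<rho>2 \<rho>3 k k0 b \<omega> l \<gamma> \<beta> :: real and c e :: complex
  assumes pos: "0 < \<rho>1" "0 < \<rho>2" "0 < \<rho>3" "0 < k" "0 < k0" "0 < b" "0 < \<omega>" "0 < l" "0 < \<gamma>"
    and c_pos: "0 < Re c" and e_pos: "0 < Re e"
begin

text \<open>\<open>M1\<close> to \<open>M5\<close> are the equations left after the velocities have
  been eliminated by P = \<i> \<beta> p - f1 and its analogues and each equation has been multiplied
  by its density. The unknowns p, q, r, t, x are the coefficients of \<open>cphi\<close>,
  \<open>cpsi\<close>, \<open>cw\<close>, \<open>cth\<close>, \<open>cxi\<close>.\<close>

definition M1 :: "real \<Rightarrow> complex \<Rightarrow> complex \<Rightarrow> complex \<Rightarrow> complex \<Rightarrow> complex" where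
  "M1 a p q r x = - of_real (\<rho>1 * \<beta>\<^sup>2) * p + of_real (k * a) * (of_real a * p + q + of_real l * r)
     + of_real (l * k0) * (of_real a * r + of_real l * p) + of_real (l * \<gamma>) * x"
definition M2 :: "real \<Rightarrow> complex \<Rightarrow> complex \<Rightarrow> complex \<Rightarrow> complex \<Rightarrow> complex" where
  "M2 a p q r t = - of_real (\<rho>2 * \<beta>\<^sup>2) * q + of_real (b * a\<^sup>2) * q + of_real k * (of_real a * p + q + of_real l * r)
     + of_real (\<gamma> * a) * t"
definition M3 :: "real \<Rightarrow> complex \<Rightarrow> complex \<Rightarrow> complex \<Rightarrow> complex \<Rightarrow> complex" where
  "M3 a p q r x = - of_real (\<rho>1 * \<beta>\<^sup>2) * r + of_real (k0 * a) * (of_real a * r + of_real l * p)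
     + of_real (l * k) * (of_real a * p + q + of_real l * r) + of_real (\<gamma> * a) * x"
definition M4 :: "real \<Rightarrow> complex \<Rightarrow> complex \<Rightarrow> complex" where
  "M4 a q t = \<i> * of_real (\<beta> * \<rho>3) * t + of_real (\<omega> * a\<^sup>2) * c * t - \<i> * of_real (\<gamma> * \<beta> * a) * q"
definition M5 :: "real \<Rightarrow> complex \<Rightarrow> complex \<Rightarrow> complex \<Rightarrow> complex" where
  "M5 a p r x = \<i> * of_real (\<beta> * \<rho>3) * x + of_real (\<omega> * a\<^sup>2) * e * x - \<i> * of_real (\<gamma> * \<beta>) * (of_real a * r + of_real l * p)"

definition Mop :: "real \<Rightarrow> c5 \<Rightarrow> c5" where
  "Mop a v = (case v of (p, q, r, t, x) \<Rightarrow> (M1 a p q r x, M2 a p q r t, M3 a p q r x, M4 a q t, M5 a p r x))"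

lemma linear_Mop: "linear (Mop a)"
  by (rule linearI)
     (auto simp: Mop_def M1_def M2_def M3_def M4_def M5_def scaleR_conv_of_real algebra_simps)

lemma cmod_sq_mult_cnj: "z * cnj z = of_real ((cmod z)\<^sup>2)"
  by (rule complex_norm_square[symmetric])

text \<open>Testing the equations with the unknowns, the thermo-elastic coupling terms are purely reactive, so that
  the real part isolates the dissipation of the two memory terms.\<close>
lemma Mop_dissipative:
  assumes a: "0 < a" and z: "Mop a (p, q, r, t, x) = 0"
  shows "t = 0" "x = 0"
    "k * (cmod (of_real a * p + q + of_real l * r))\<^sup>2 + b * a\<^sup>2 * (cmod q)\<^sup>2 + k0 * (cmod (of_real a * r + of_real l * p))\<^sup>2
      = \<rho>1 * \<beta>\<^sup>2 * (cmod p)\<^sup>2 + \<rho>2 * \<beta>\<^sup>2 * (cmod q)\<^sup>2 + \<rho>1 * \<beta>\<^sup>2 * (cmod r)\<^sup>2"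
proof -
  define S where "S = of_real a * p + q + of_real l * r"
  define R where "R = of_real a * r + of_real l * p"
  have m: "M1 a p q r x = 0" "M2 a p q r t = 0" "M3 a p q r x = 0" "M4 a q t = 0" "M5 a p r x = 0"
    using z by (auto simp: Mop_def zero_prod_def)
  define Q where "Q = k * (cmod S)\<^sup>2 + b * a\<^sup>2 * (cmod q)\<^sup>2 + k0 * (cmod R)\<^sup>2
      - \<rho>1 * \<beta>\<^sup>2 * (cmod p)\<^sup>2 - \<rho>2 * \<beta>\<^sup>2 * (cmod q)\<^sup>2 - \<rho>1 * \<beta>\<^sup>2 * (cmod r)\<^sup>2"
  define Z where "Z = of_real a * t * cnj q + x * cnj R"
  have "M1 a p q r x * cnj p + M2 a p q r t * cnj q + M3 a p q r x * cnj r
      = of_real k * (S * cnj S) + of_real (b * a\<^sup>2) * (q * cnj q) + of_real k0 * (R * cnj R)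
        - of_real (\<rho>1 * \<beta>\<^sup>2) * (p * cnj p) - of_real (\<rho>2 * \<beta>\<^sup>2) * (q * cnj q) - of_real (\<rho>1 * \<beta>\<^sup>2) * (r * cnj r)
        + of_real \<gamma> * Z"
    unfolding M1_def M2_def M3_def S_def R_def Z_def by (simp add: algebra_simps)
  also have "\<dots> = of_real Q + of_real \<gamma> * Z"
    unfolding cmod_sq_mult_cnj Q_def by (simp del: of_real_power)
  finally have QZ: "of_real Q + of_real \<gamma> * Z = 0" using m by simp
  \<comment> \<open>Q is real, hence so is Z. The coupling in the temperature equations, \<i> times
    a real multiple of cnj Z, then has no real part.\<close>
  then have ImZ: "Im Z = 0" using pos by (auto simp: complex_eq_iff)
  have "M4 a q t * cnj t + M5 a p r x * cnj x
     = \<i> * of_real (\<beta> * \<rho>3) * (t * cnj t) + \<i> * of_real (\<beta> * \<rho>3) * (x * cnj x)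
       + of_real (\<omega> * a\<^sup>2) * c * (t * cnj t) + of_real (\<omega> * a\<^sup>2) * e * (x * cnj x)
       - \<i> * of_real (\<gamma> * \<beta>) * cnj Z"
    unfolding M4_def M5_def Z_def R_def by (simp add: algebra_simps)
  then have "Re (\<i> * of_real (\<beta> * \<rho>3) * of_real ((cmod t)\<^sup>2) + \<i> * of_real (\<beta> * \<rho>3) * of_real ((cmod x)\<^sup>2)
       + of_real (\<omega> * a\<^sup>2) * c * of_real ((cmod t)\<^sup>2) + of_real (\<omega> * a\<^sup>2) * e * of_real ((cmod x)\<^sup>2)
       - \<i> * of_real (\<gamma> * \<beta>) * cnj Z) = 0"
    using m unfolding cmod_sq_mult_cnj by simp
  then have "\<omega> * a\<^sup>2 * Re c * (cmod t)\<^sup>2 + \<omega> * a\<^sup>2 * Re e * (cmod x)\<^sup>2 = 0"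
    using ImZ by (simp del: of_real_power)
  moreover have "0 \<le> \<omega> * a\<^sup>2 * Re c * (cmod t)\<^sup>2" "0 \<le> \<omega> * a\<^sup>2 * Re e * (cmod x)\<^sup>2"
    using pos a c_pos e_pos by auto
  ultimately have "\<omega> * a\<^sup>2 * Re c * (cmod t)\<^sup>2 = 0" "\<omega> * a\<^sup>2 * Re e * (cmod x)\<^sup>2 = 0" by linarith+
  then show tx: "t = 0" "x = 0" using pos a c_pos e_pos by auto
  have "of_real Q = (0::complex)" using QZ tx by (simp add: Z_def)
  then have "Q = 0" by simp
  then show "k * (cmod (of_real a * p + q + of_real l * r))\<^sup>2 + b * a\<^sup>2 * (cmod q)\<^sup>2 + k0 * (cmod (of_real a * r + of_real l * p))\<^sup>2
      = \<rho>1 * \<beta>\<^sup>2 * (cmod p)\<^sup>2 + \<rho>2 * \<beta>\<^sup>2 * (cmod q)\<^sup>2 + \<rho>1 * \<beta>\<^sup>2 * (cmod r)\<^sup>2"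
    unfolding Q_def S_def R_def by simp
qed

text \<open>Cramer's rule with determinant a^2 - l^2: a = l is the resonance at which rigid
  solutions exist.\<close>

lemma two_by_two_zero:
  assumes "0 < a" "a \<noteq> l" "of_real a * p + of_real l * r = (0::complex)" "of_real a * r + of_real l * p = 0"
  shows "p = 0" "r = 0"
proof -
  have "of_real (a\<^sup>2 - l\<^sup>2) * p = of_real a * (of_real a * p + of_real l * r) - of_real l * (of_real a * r + of_real l * p)"
    "of_real (a\<^sup>2 - l\<^sup>2) * r = of_real a * (of_real a * r + of_real l * p) - of_real l * (of_real a * p + of_real l * r)"
    by (simp_all add: algebra_simps power2_eq_square)
  then have "of_real (a\<^sup>2 - l\<^sup>2) * p = 0" "of_real (a\<^sup>2 - l\<^sup>2) * r = 0" using assms by simp_all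
  moreover have "a\<^sup>2 - l\<^sup>2 \<noteq> 0" using assms pos by (simp add: power2_eq_iff)
  then have "complex_of_real (a\<^sup>2 - l\<^sup>2) \<noteq> 0" using of_real_eq_0_iff by blast
  ultimately show "p = 0" "r = 0" by auto
qed

text \<open>For \<beta> = 0 the temperature equations are decoupled from the displacements, and the
  strains vanish by the energy identity. Otherwise \<open>M4\<close> gives q = 0, \<open>M5\<close>
  the second strain, and \<open>M2\<close> then the first one.\<close>

lemma Mop_inj: assumes a: "0 < a" "a \<noteq> l" shows "inj (Mop a)"
  unfolding linear_injective_0[OF linear_Mop]
proof (intro allI impI)
  fix v assume z: "Mop a v = 0"
  obtain p q r t x where v: "v = (p, q, r, t, x)" by (cases v)
  note D = Mop_dissipative[OF a(1) z[unfolded v]]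
  have m: "M2 a p q r t = 0" "M4 a q t = 0" "M5 a p r x = 0"
    using z by (auto simp: v Mop_def zero_prod_def)
  have qs: "q = 0 \<and> of_real a * r + of_real l * p = 0 \<and> of_real a * p + q + of_real l * r = 0"
  proof (cases "\<beta> = 0")
    case True
    have "k * (cmod (of_real a * p + q + of_real l * r))\<^sup>2 + b * a\<^sup>2 * (cmod q)\<^sup>2 + k0 * (cmod (of_real a * r + of_real l * p))\<^sup>2 = 0"
      using D(3) True by simp
    moreover have "0 \<le> k * (cmod (of_real a * p + q + of_real l * r))\<^sup>2" "0 \<le> b * a\<^sup>2 * (cmod q)\<^sup>2"
      "0 \<le> k0 * (cmod (of_real a * r + of_real l * p))\<^sup>2" using pos by auto
    ultimately have "k * (cmod (of_real a * p + q + of_real l * r))\<^sup>2 = 0" "b * a\<^sup>2 * (cmod q)\<^sup>2 = 0" "k0 * (cmod (of_real a * r + of_real l * p))\<^sup>2 = 0"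
      by linarith+
    then show ?thesis using pos a by simp
  next
    case False
    have q: "q = 0" using m(2) D(1) False pos a by (simp add: M4_def)
    have R: "of_real a * r + of_real l * p = 0" using m(3) D(2) False pos by (simp add: M5_def)
    have "of_real a * p + q + of_real l * r = 0" using m(1) D(1) q pos by (simp add: M2_def)
    then show ?thesis using q R by simp
  qed
  then have "of_real a * p + of_real l * r = 0" "of_real a * r + of_real l * p = 0" by auto
  from two_by_two_zero[OF a this] show "v = 0" using qs D(1,2) by (simp add: v zero_prod_def)
qed

lemma Mop_surj: assumes a: "0 < a" "a \<noteq> l" shows "\<exists>v. Mop a v = y"
  using linear_injective_imp_surjective[OF linear_Mop Mop_inj[OF a]] unfolding surj_def by metis

lemma Mop_bounded_below: assumes a: "0 < a" "a \<noteq> l" shows "\<exists>C\<ge>0. \<forall>v. a\<^sup>2 * norm v \<le> C * norm (Mop a v)"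
proof -
  obtain B where B: "B > 0" "\<And>v. B * norm v \<le> norm (Mop a v)"
    using linear_inj_bounded_below_pos[OF linear_Mop Mop_inj[OF a]] by blast
  have "a\<^sup>2 * norm v \<le> (a\<^sup>2 / B) * norm (Mop a v)" for v
    using mult_left_mono[OF B(2)[of v], of "a\<^sup>2 / B"] B(1) by simp
  then show ?thesis using B(1) by (intro exI[of _ "a\<^sup>2 / B"]) auto
qed

text \<open>After division by \<open>a\<^sup>2\<close> the system tends to a nonsingular diagonal one as \<open>a\<close> grows.\<close>
lemma Mop_bounded_below_large: "\<exists>A C. C \<ge> 0 \<and> (\<forall>a\<ge>A. \<forall>v. a\<^sup>2 * norm v \<le> C * norm (Mop a v))"
proof -
  \<comment> \<open>Pairs of a frequency and a vector, so that domination delivers one constant for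
    all of them.\<close>
  define I :: "(real \<times> c5) set" where "I = {(a, v). 1 \<le> a}"
  define a where "a i = fst i" for i :: "real \<times> c5"
  define p where "p i = fst (snd i)" for i :: "real \<times> c5"
  define q where "q i = fst (snd (snd i))" for i :: "real \<times> c5"
  define r where "r i = fst (snd (snd (snd i)))" for i :: "real \<times> c5"
  define t where "t i = fst (snd (snd (snd (snd i))))" for i :: "real \<times> c5"
  define x where "x i = snd (snd (snd (snd (snd i))))" for i :: "real \<times> c5"
  \<comment> \<open>Each equation contains one term of order a^2; all its other terms are of order
    at most a times the vector and are absorbed in \<open>h\<close>.\<close>
  define h where "h i = norm (Mop (a i) (snd i)) + a i * norm (snd i)" for i
  have v: "snd i = (p i, q i, r i, t i, x i)" for i by (simp add: p_def q_def r_def t_def x_def)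
  have a1: "1 \<le> a i" if "i \<in> I" for i using that by (auto simp: I_def a_def)
  have le_v: "cmod (z i) \<le> norm (snd i)" if "z \<in> {p, q, r, t, x}" for z i
    unfolding v using that norm_c5_ge by auto
  have z: "dominated I (\<lambda>i. cmod (of_real (a i) * z i)) h" "dominated I (\<lambda>i. cmod (z i)) h" if m: "z \<in> {p, q, r, t, x}" for z
  proof -
    have 1: "cmod (of_real (a i) * z i) \<le> h i" if "i \<in> I" for i
      using mult_left_mono[OF le_v[OF m, of i], of "a i"] a1[OF that] by (simp add: h_def norm_mult add_increasing)
    have 2: "cmod (z i) \<le> cmod (of_real (a i) * z i)" if "i \<in> I" for i
      using mult_right_mono[OF a1[OF that] norm_ge_zero[of "z i"]] a1[OF that] by (simp add: norm_mult)
    show "dominated I (\<lambda>i. cmod (of_real (a i) * z i)) h" "dominated I (\<lambda>i. cmod (z i)) h"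
      by (rule dominatedI[of 1]; use 1 2 order_trans[OF 2 1] in simp)+
  qed
  have Mle: "cmod z \<le> norm (Mop (a i) (snd i)) + a i * norm (snd i)"
    if "cmod z \<le> norm (M1 (a i) (p i) (q i) (r i) (x i), M2 (a i) (p i) (q i) (r i) (t i), M3 (a i) (p i) (q i) (r i) (x i), M4 (a i) (q i) (t i), M5 (a i) (p i) (r i) (x i))"
      "i \<in> I" for z i
    using that a1[of i] by (simp add: Mop_def v add_increasing2)
  have M: "dominated I (\<lambda>i. cmod (M1 (a i) (p i) (q i) (r i) (x i))) h" "dominated I (\<lambda>i. cmod (M2 (a i) (p i) (q i) (r i) (t i))) h"
    "dominated I (\<lambda>i. cmod (M3 (a i) (p i) (q i) (r i) (x i))) h" "dominated I (\<lambda>i. cmod (M4 (a i) (q i) (t i))) h"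
    "dominated I (\<lambda>i. cmod (M5 (a i) (p i) (r i) (x i))) h"
    by (rule dominatedI[of 1], simp, unfold mult_1 h_def, rule Mle, rule norm_c5_ge, assumption)+
  note rules = dominated_norm_add dominated_norm_diff dominated_norm_cmult M z
  have n: "c \<noteq> 0" "e \<noteq> 0" "k \<noteq> 0" "k0 \<noteq> 0" "b \<noteq> 0" "\<omega> \<noteq> 0" using pos c_pos e_pos by auto
  have "dominated I (\<lambda>i. cmod (1 / of_real k * (M1 (a i) (p i) (q i) (r i) (x i) - (of_real (- (\<rho>1 * \<beta>\<^sup>2)) * p i + of_real k * (of_real (a i) * q i)
      + of_real (k * l) * (of_real (a i) * r i) + of_real (l * k0) * (of_real (a i) * r i) + of_real (l * k0 * l) * p i + of_real (l * \<gamma>) * x i)))) h"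
    by (intro rules) simp_all
  then have 1: "dominated I (\<lambda>i. cmod (of_real ((a i)\<^sup>2) * p i)) h"
    using n by (simp add: M1_def field_simps power2_eq_square)
  have "dominated I (\<lambda>i. cmod (1 / of_real b * (M2 (a i) (p i) (q i) (r i) (t i) - (of_real (- (\<rho>2 * \<beta>\<^sup>2)) * q i + of_real k * (of_real (a i) * p i)
      + of_real k * q i + of_real (k * l) * r i + of_real \<gamma> * (of_real (a i) * t i))))) h"
    by (intro rules) simp_all
  then have 2: "dominated I (\<lambda>i. cmod (of_real ((a i)\<^sup>2) * q i)) h"
    using n by (simp add: M2_def field_simps power2_eq_square)
  have "dominated I (\<lambda>i. cmod (1 / of_real k0 * (M3 (a i) (p i) (q i) (r i) (x i) - (of_real (- (\<rho>1 * \<beta>\<^sup>2)) * r i + of_real (k0 * l) * (of_real (a i) * p i)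
      + of_real (l * k) * (of_real (a i) * p i) + of_real (l * k) * q i + of_real (l * k * l) * r i + of_real \<gamma> * (of_real (a i) * x i))))) h"
    by (intro rules) simp_all
  then have 3: "dominated I (\<lambda>i. cmod (of_real ((a i)\<^sup>2) * r i)) h"
    using n by (simp add: M3_def field_simps power2_eq_square)
  have "dominated I (\<lambda>i. cmod (1 / (of_real \<omega> * c) * (M4 (a i) (q i) (t i) - (\<i> * of_real (\<beta> * \<rho>3) * t i - \<i> * of_real (\<gamma> * \<beta>) * (of_real (a i) * q i))))) h"
    by (intro rules) simp_all
  then have 4: "dominated I (\<lambda>i. cmod (of_real ((a i)\<^sup>2) * t i)) h"
    using n by (simp add: M4_def field_simps power2_eq_square)
  have "dominated I (\<lambda>i. cmod (1 / (of_real \<omega> * e) * (M5 (a i) (p i) (r i) (x i) - (\<i> * of_real (\<beta> * \<rho>3) * x i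
      - \<i> * of_real (\<gamma> * \<beta>) * (of_real (a i) * r i) - \<i> * of_real (\<gamma> * \<beta> * l) * p i)))) h"
    by (intro rules) simp_all
  then have 5: "dominated I (\<lambda>i. cmod (of_real ((a i)\<^sup>2) * x i)) h"
    using n by (simp add: M5_def field_simps power2_eq_square)
  have "dominated I (\<lambda>i. (a i)\<^sup>2 * norm (snd i)) h"
  proof (rule dominated_le[OF dominated_add[OF dominated_add[OF dominated_add[OF dominated_add[OF 1 2] 3] 4] 5]])
    fix i assume "i \<in> I"
    show "(a i)\<^sup>2 * norm (snd i) \<le> cmod (of_real ((a i)\<^sup>2) * p i) + cmod (of_real ((a i)\<^sup>2) * q i) + cmod (of_real ((a i)\<^sup>2) * r i)
        + cmod (of_real ((a i)\<^sup>2) * t i) + cmod (of_real ((a i)\<^sup>2) * x i)"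
      unfolding norm_mult norm_of_real v distrib_left[symmetric] abs_power2 by (intro mult_left_mono norm_c5_le) simp
  qed
  then obtain C where C: "C \<ge> 0" "\<forall>i\<in>I. (a i)\<^sup>2 * norm (snd i) \<le> C * h i" unfolding dominated_def by blast
  have "a\<^sup>2 * norm v \<le> 2 * C * norm (Mop a v)" if a: "max 1 (2 * C) \<le> a" for a v
  proof -
    \<comment> \<open>For a >= 2 C the term C a |v| coming from \<open>h\<close> is at most half of
      a^2 |v| and moves to the left.\<close>
    have "2 * C * (a * norm v) \<le> a * (a * norm v)" using a by (intro mult_right_mono) auto
    moreover have "a\<^sup>2 * norm v \<le> C * (norm (Mop a v) + a * norm v)"
      using bspec[OF C(2), of "(a, v)"] a by (simp add: I_def a_def h_def)
    ultimately show ?thesis by (simp add: power2_eq_square algebra_simps)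
  qed
  then show ?thesis using C(1) by (intro exI[of _ "max 1 (2 * C)"] exI[of _ "2 * C"]) auto
qed

end

section \<open>Uniformity over all frequencies\<close>

lemma freq_ge_1: assumes "0 < ell" "0 < n" shows "freq ell 1 \<le> freq ell n"
  using assms unfolding freq_def by (intro divide_right_mono mult_right_mono) auto

lemma freq_eventually_ge: assumes "0 < ell" shows "\<exists>N. \<forall>n\<ge>N. A \<le> freq ell n"
proof -
  obtain N where N: "A * ell / pi < real N" using reals_Archimedean2 by blast
  have "A \<le> freq ell n" if "N \<le> n" for n
  proof -
    have "A * ell / pi < real n" using N that by linarith
    then show ?thesis using assms by (simp add: freq_def field_simps)
  qed
  then show ?thesis by blast
qed

text \<open>Only finitely many frequencies lie below the threshold A; their constants are summed and
  added to the one for large frequencies.\<close>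

lemma uniform_freq_bound:
  fixes P :: "real \<Rightarrow> real \<Rightarrow> bool"
  assumes ell: "0 < ell" and single: "\<And>n. 0 < n \<Longrightarrow> \<exists>C\<ge>0. P C (freq ell n)"
    and large: "\<exists>A C. 0 \<le> C \<and> (\<forall>a\<ge>A. P C a)" and mono: "\<And>C C' a. P C a \<Longrightarrow> C \<le> C' \<Longrightarrow> P C' a"
  shows "\<exists>C\<ge>0. \<forall>n>0. P C (freq ell n)"
proof -
  obtain A C where C: "0 \<le> C" "\<And>a. A \<le> a \<Longrightarrow> P C a" using large by blast
  obtain N where N: "\<And>n. N \<le> n \<Longrightarrow> A \<le> freq ell n" using freq_eventually_ge[OF ell] by blast
  obtain c where c: "\<And>n. 0 < n \<Longrightarrow> 0 \<le> c n \<and> P (c n) (freq ell n)" using single by metis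
  define D where "D = C + (\<Sum>n\<in>{1..<N}. c n)"
  have s0: "0 \<le> (\<Sum>n\<in>{1..<N}. c n)" using c by (intro sum_nonneg) auto
  have "P D (freq ell n)" if n: "0 < n" for n
  proof (cases "n < N")
    case True
    have "c n \<le> (\<Sum>n\<in>{1..<N}. c n)" by (rule member_le_sum) (use True n c in auto)
    then show ?thesis using c[OF n] C(1) mono unfolding D_def by (meson add_increasing)
  next
    case False
    then show ?thesis using C(2) N s0 mono[of C _ D] unfolding D_def by simp
  qed
  then show ?thesis using C(1) s0 by (intro exI[of _ D]) (auto simp: D_def)
qed

locale bresse = bresse_mode +
  fixes ell :: real
  assumes ell: "0 < ell" and nonres: "\<And>n::nat. 0 < n \<Longrightarrow> l * ell \<noteq> real n * pi"
begin

lemma freq_ne_l: "0 < n \<Longrightarrow> freq ell n \<noteq> l"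
  using nonres[of n] ell by (auto simp: freq_def field_simps)

lemma Mop_uniform: "\<exists>C\<ge>0. \<forall>n>0. \<forall>v. (freq ell n)\<^sup>2 * norm v \<le> C * norm (Mop (freq ell n) v)"
proof (rule uniform_freq_bound[OF ell, of "\<lambda>C a. \<forall>v. a\<^sup>2 * norm v \<le> C * norm (Mop a v)"])
  show "\<exists>C\<ge>0. \<forall>v. (freq ell n)\<^sup>2 * norm v \<le> C * norm (Mop (freq ell n) v)" if "0 < n" for n
    using Mop_bounded_below[OF freq_pos[OF ell that] freq_ne_l[OF that]] .
  show "\<exists>A C. 0 \<le> C \<and> (\<forall>a\<ge>A. \<forall>v. a\<^sup>2 * norm v \<le> C * norm (Mop a v))" using Mop_bounded_below_large by blast
  show "\<forall>v. a\<^sup>2 * norm v \<le> C' * norm (Mop a v)" if "\<forall>v. a\<^sup>2 * norm v \<le> C * norm (Mop a v)" "C \<le> C'" for C C' a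
    using that by (meson mult_right_mono norm_ge_zero order_trans)
qed

text \<open>With the strains S = a p + q + l r and R = a r + l p, Cramer's rule reads (a^2 - l^2) p
  = a (S - q) - l R, and symmetrically for r. The quotient (a^2 + a l) / |a^2 - l^2| is bounded over
  the frequencies, because none of them equals l and it tends to 1. The strain energy therefore
  controls the full gradients.\<close>

lemma elastic_coercive:
  "\<exists>C\<ge>0. \<forall>n>0. \<forall>p q r. (freq ell n)\<^sup>2 * ((cmod p)\<^sup>2 + (cmod q)\<^sup>2 + (cmod r)\<^sup>2)
     \<le> C * (k * (cmod (of_real (freq ell n) * p + q + of_real l * r))\<^sup>2 + b * (freq ell n)\<^sup>2 * (cmod q)\<^sup>2
        + k0 * (cmod (of_real (freq ell n) * r + of_real l * p))\<^sup>2)"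
proof -
  have "\<exists>C\<ge>0. \<forall>n>0. (freq ell n)\<^sup>2 + \<bar>freq ell n\<bar> * l \<le> C * \<bar>(freq ell n)\<^sup>2 - l\<^sup>2\<bar>"
  proof (rule uniform_freq_bound[OF ell, of "\<lambda>C a. a\<^sup>2 + \<bar>a\<bar> * l \<le> C * \<bar>a\<^sup>2 - l\<^sup>2\<bar>"])
    fix n :: nat assume n: "0 < n"
    let ?a = "freq ell n"
    have "?a\<^sup>2 - l\<^sup>2 \<noteq> 0" using freq_ne_l[OF n] freq_pos[OF ell n] pos by (simp add: power2_eq_iff)
    then show "\<exists>C\<ge>0. ?a\<^sup>2 + \<bar>?a\<bar> * l \<le> C * \<bar>?a\<^sup>2 - l\<^sup>2\<bar>"
      using pos by (intro exI[of _ "(?a\<^sup>2 + \<bar>?a\<bar> * l) / \<bar>?a\<^sup>2 - l\<^sup>2\<bar>"]) auto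
  next
    have "a\<^sup>2 + \<bar>a\<bar> * l \<le> 2 * \<bar>a\<^sup>2 - l\<^sup>2\<bar>" if "2 * l \<le> a" for a
    proof -
      have "a * (2 * l) \<le> a * a" using that pos by (intro mult_left_mono) auto
      moreover have "(2 * l) * (2 * l) \<le> a * a" by (rule mult_mono) (use that pos in auto)
      ultimately have "a\<^sup>2 + a * l \<le> 2 * (a\<^sup>2 - l\<^sup>2)" by (simp add: power2_eq_square)
      moreover have "\<bar>a\<bar> = a" using that pos by simp
      moreover have "a\<^sup>2 - l\<^sup>2 \<le> \<bar>a\<^sup>2 - l\<^sup>2\<bar>" by (rule abs_ge_self)
      ultimately show ?thesis by simp
    qed
    then show "\<exists>A C. 0 \<le> C \<and> (\<forall>a\<ge>A. a\<^sup>2 + \<bar>a\<bar> * l \<le> C * \<bar>a\<^sup>2 - l\<^sup>2\<bar>)"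
      by (intro exI[of _ "2 * l"] exI[of _ 2]) auto
    show "a\<^sup>2 + \<bar>a\<bar> * l \<le> C' * \<bar>a\<^sup>2 - l\<^sup>2\<bar>" if "a\<^sup>2 + \<bar>a\<bar> * l \<le> C * \<bar>a\<^sup>2 - l\<^sup>2\<bar>" "C \<le> C'" for C C' a
      using that by (meson mult_right_mono abs_ge_zero order_trans)
  qed
  then obtain Q where Q: "Q \<ge> 0" "\<And>n. 0 < n \<Longrightarrow> (freq ell n)\<^sup>2 + \<bar>freq ell n\<bar> * l \<le> Q * \<bar>(freq ell n)\<^sup>2 - l\<^sup>2\<bar>" by blast
  define a1 where "a1 = freq ell 1"
  have a1: "a1 > 0" using freq_pos[OF ell, of 1] by (simp add: a1_def)
  \<comment> \<open>p and r contribute 3 Q^2 T each, where T is the sum of the squares of S, q and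
    R; the three inverse coefficients bound T by the energy. The last summand is the direct bound of
    a^2 |q|^2.\<close>
  define C where "C = 6 * Q\<^sup>2 * (1 / k + 1 / (b * a1\<^sup>2) + 1 / k0) + 1 / b"
  have "(freq ell n)\<^sup>2 * ((cmod p)\<^sup>2 + (cmod q)\<^sup>2 + (cmod r)\<^sup>2)
     \<le> C * (k * (cmod (of_real (freq ell n) * p + q + of_real l * r))\<^sup>2 + b * (freq ell n)\<^sup>2 * (cmod q)\<^sup>2
        + k0 * (cmod (of_real (freq ell n) * r + of_real l * p))\<^sup>2)" if n: "0 < n" for n p q r
  proof -
    define a where "a = freq ell n"
    have a: "a > 0" "a1 \<le> a" using freq_pos[OF ell n] freq_ge_1[OF ell n] by (auto simp: a_def a1_def)
    have Qa: "a * a \<le> Q * \<bar>a\<^sup>2 - l\<^sup>2\<bar>" "a * l \<le> Q * \<bar>a\<^sup>2 - l\<^sup>2\<bar>"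
    proof -
      have "0 \<le> a * l" "0 \<le> a * a" using a pos by auto
      moreover have "a * a + a * l \<le> Q * \<bar>a\<^sup>2 - l\<^sup>2\<bar>" using Q(2)[OF n] a unfolding a_def[symmetric] by (simp add: power2_eq_square)
      ultimately show "a * a \<le> Q * \<bar>a\<^sup>2 - l\<^sup>2\<bar>" "a * l \<le> Q * \<bar>a\<^sup>2 - l\<^sup>2\<bar>" by linarith+
    qed
    have ne: "\<bar>a\<^sup>2 - l\<^sup>2\<bar> > 0" using freq_ne_l[OF n] a pos unfolding a_def by (simp add: power2_eq_iff)
    define S where "S = of_real a * p + q + of_real l * r"
    define R where "R = of_real a * r + of_real l * p"
    have half: "a * cmod z \<le> Q * (cmod u + cmod v)"
      if "of_real (a\<^sup>2 - l\<^sup>2) * z = of_real \<alpha> * u - of_real \<alpha>' * v" "(\<alpha> = a \<and> \<alpha>' = l)" for z u v \<alpha> \<alpha>'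
    proof -
      have "\<bar>a\<^sup>2 - l\<^sup>2\<bar> * (a * cmod z) = a * cmod (of_real (a\<^sup>2 - l\<^sup>2) * z)" by (simp only: norm_mult norm_of_real mult_ac)
      also have "\<dots> \<le> a * (cmod (of_real \<alpha> * u) + cmod (of_real \<alpha>' * v))"
        unfolding that(1) using a by (intro mult_left_mono norm_triangle_ineq4) auto
      also have "\<dots> = (a * a) * cmod u + (a * l) * cmod v" using that(2) a pos by (simp add: norm_mult distrib_left mult.assoc)
      also have "\<dots> \<le> (Q * \<bar>a\<^sup>2 - l\<^sup>2\<bar>) * cmod u + (Q * \<bar>a\<^sup>2 - l\<^sup>2\<bar>) * cmod v"
        by (intro add_mono mult_right_mono Qa) auto
      also have "\<dots> = \<bar>a\<^sup>2 - l\<^sup>2\<bar> * (Q * (cmod u + cmod v))" by (simp only: distrib_left distrib_right mult_ac)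
      finally show ?thesis using ne by (rule mult_left_le_imp_le)
    qed
    have p: "a * cmod p \<le> Q * (cmod (S - q) + cmod R)"
      by (rule half[of p a "S - q" l R]) (auto simp: S_def R_def algebra_simps power2_eq_square)
    have r: "a * cmod r \<le> Q * (cmod R + cmod (S - q))"
      by (rule half[of r a R l "S - q"]) (auto simp: S_def R_def algebra_simps power2_eq_square)
    define T where "T = (cmod S)\<^sup>2 + (cmod q)\<^sup>2 + (cmod R)\<^sup>2"
    have sq: "(a * cmod z)\<^sup>2 \<le> 3 * Q\<^sup>2 * T" if "a * cmod z \<le> Q * (cmod (S - q) + cmod R)" for z
    proof -
      have "a * cmod z \<le> Q * (cmod S + cmod q + cmod R)"
        using that Q(1) norm_triangle_ineq4[of S q] by (meson add_mono_thms_linordered_semiring(3) mult_left_mono order_trans)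
      then have "(a * cmod z)\<^sup>2 \<le> (Q * (cmod S + cmod q + cmod R))\<^sup>2" using a by (intro power_mono) auto
      also have "\<dots> = Q\<^sup>2 * (cmod S + cmod q + cmod R)\<^sup>2" by (rule power_mult_distrib)
      also have "\<dots> \<le> Q\<^sup>2 * (3 * T)"
      proof (rule mult_left_mono)
        have "(u + v + w)\<^sup>2 \<le> 3 * (u\<^sup>2 + v\<^sup>2 + w\<^sup>2)" for u v w :: real
          using zero_le_power2[of "u - v"] zero_le_power2[of "u - w"] zero_le_power2[of "v - w"]
          by (simp add: power2_eq_square algebra_simps)
        then show "(cmod S + cmod q + cmod R)\<^sup>2 \<le> 3 * T" unfolding T_def .
      qed simp
      finally show ?thesis by (simp add: mult_ac)
    qed
    define E where "E = k * (cmod S)\<^sup>2 + b * a\<^sup>2 * (cmod q)\<^sup>2 + k0 * (cmod R)\<^sup>2"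
    have e: "0 \<le> k * (cmod S)\<^sup>2" "0 \<le> b * a\<^sup>2 * (cmod q)\<^sup>2" "0 \<le> k0 * (cmod R)\<^sup>2" using pos by auto
    then have E: "k * (cmod S)\<^sup>2 \<le> E" "b * a\<^sup>2 * (cmod q)\<^sup>2 \<le> E" "k0 * (cmod R)\<^sup>2 \<le> E" unfolding E_def by linarith+
    have "a1\<^sup>2 \<le> a\<^sup>2" using a a1 by (intro power_mono) auto
    then have "b * a1\<^sup>2 * (cmod q)\<^sup>2 \<le> b * a\<^sup>2 * (cmod q)\<^sup>2" using pos by (intro mult_right_mono mult_left_mono) auto
    then have "b * a1\<^sup>2 * (cmod q)\<^sup>2 \<le> E" using E by linarith
    then have T: "(cmod S)\<^sup>2 \<le> 1 / k * E" "(cmod q)\<^sup>2 \<le> 1 / (b * a1\<^sup>2) * E" "(cmod R)\<^sup>2 \<le> 1 / k0 * E"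
      using E pos a1 by (simp_all add: field_simps)
    have q: "a\<^sup>2 * (cmod q)\<^sup>2 \<le> 1 / b * E" using E pos by (simp add: field_simps)
    have "T \<le> (1 / k + 1 / (b * a1\<^sup>2) + 1 / k0) * E" unfolding T_def distrib_right using T by linarith
    then have T': "6 * Q\<^sup>2 * T \<le> 6 * Q\<^sup>2 * ((1 / k + 1 / (b * a1\<^sup>2) + 1 / k0) * E)" by (intro mult_left_mono) auto
    have "(a * cmod p)\<^sup>2 \<le> 3 * Q\<^sup>2 * T" "(a * cmod r)\<^sup>2 \<le> 3 * Q\<^sup>2 * T" using sq[OF p] sq[of r] r by (simp_all add: add.commute)
    then have "a\<^sup>2 * ((cmod p)\<^sup>2 + (cmod q)\<^sup>2 + (cmod r)\<^sup>2) \<le> 6 * Q\<^sup>2 * T + 1 / b * E"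
      using q unfolding power_mult_distrib distrib_left by linarith
    also have "\<dots> \<le> C * E" using T' unfolding C_def distrib_right[of _ "1 / b" E] by (simp only: mult.assoc add_mono_thms_linordered_semiring(3))
    finally show ?thesis unfolding E_def S_def R_def a_def .
  qed
  moreover have "C \<ge> 0" unfolding C_def using pos a1 by (intro add_nonneg_nonneg mult_nonneg_nonneg) auto
  ultimately show ?thesis by blast
qed

text \<open>The data \<open>f8\<close> and \<open>f10\<close> of the memory equations enter only through \<open>IE\<close> and \<open>JE\<close>,
  the weighted integrals of the memory generated by them alone.\<close>
definition mode_rhs :: "real \<Rightarrow> complex \<Rightarrow> complex \<Rightarrow> complex \<Rightarrow> complex \<Rightarrow> complex \<Rightarrow> complex \<Rightarrow> complex \<Rightarrow> complex \<Rightarrow> complex \<Rightarrow> complex \<Rightarrow> c5" where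
  "mode_rhs a f1 f2 f3 f4 f5 f6 f7 f9 IE JE =
     (of_real \<rho>1 * (f2 + \<i> * of_real \<beta> * f1), of_real \<rho>2 * (f4 + \<i> * of_real \<beta> * f3), of_real \<rho>1 * (f6 + \<i> * of_real \<beta> * f5),
      of_real \<rho>3 * f7 - of_real (\<omega> * a\<^sup>2) * IE - of_real (\<gamma> * a) * f3,
      of_real \<rho>3 * f9 - of_real (\<omega> * a\<^sup>2) * JE - of_real \<gamma> * (of_real a * f5 + of_real l * f1))"

text \<open>The estimate a^2 |v| <= C |Y| is divided by a, so Y/a has to be bounded. The
  displacement data that carry a factor a in Y are controlled in the gradient norm anyway, and a^2
  \<open>IE\<close>, a^2 \<open>JE\<close> lose one power of a, which leaves their gradient
  norms.\<close>

lemma mode_estimate: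
  fixes n :: "'i \<Rightarrow> nat" and f1 f2 f3 f4 f5 f6 f7 f9 IE JE :: "'i \<Rightarrow> complex"
  defines "a \<equiv> \<lambda>i. freq ell (n i)"
  assumes n: "\<And>i. i \<in> A \<Longrightarrow> 0 < n i"
    and v: "\<And>i. i \<in> A \<Longrightarrow> Mop (a i) (v i) = mode_rhs (a i) (f1 i) (f2 i) (f3 i) (f4 i) (f5 i) (f6 i) (f7 i) (f9 i) (IE i) (JE i)"
    and f_a: "\<And>f. f \<in> {f1, f3, f5, IE, JE} \<Longrightarrow> dominated A (\<lambda>i. (cmod (of_real (a i) * f i))\<^sup>2) h"
    and f: "\<And>f. f \<in> {f2, f4, f6, f7, f9} \<Longrightarrow> dominated A (\<lambda>i. (cmod (f i))\<^sup>2) h"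
  shows "dominated A (\<lambda>i. (a i)\<^sup>2 * (norm (v i))\<^sup>2) h"
proof -
  obtain C where C: "C \<ge> 0" "\<And>n v. 0 < n \<Longrightarrow> (freq ell n)\<^sup>2 * norm v \<le> C * norm (Mop (freq ell n) v)"
    using Mop_uniform by blast
  have a0: "0 < a i" if "i \<in> A" for i unfolding a_def by (rule freq_pos[OF ell n[OF that]])
  have d: "dominated A (\<lambda>i. (cmod (f i / of_real (a i)))\<^sup>2) h" if "dominated A (\<lambda>i. (cmod (f i))\<^sup>2) h" for f
  proof (rule dominated_trans[OF _ that], rule dominatedI)
    show "0 < (freq ell 1)\<^sup>2" using freq_pos[OF ell, of 1] by simp
    fix i assume i: "i \<in> A"
    have "(freq ell 1)\<^sup>2 \<le> (a i)\<^sup>2" using freq_ge_1[OF ell n[OF i]] freq_nonneg[OF ell] unfolding a_def by (intro power_mono) auto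
    then have "(freq ell 1)\<^sup>2 * (cmod (f i))\<^sup>2 \<le> (a i)\<^sup>2 * (cmod (f i))\<^sup>2" by (rule mult_right_mono) simp
    then show "(freq ell 1)\<^sup>2 * (cmod (f i / of_real (a i)))\<^sup>2 \<le> (cmod (f i))\<^sup>2"
      using a0[OF i] by (simp add: norm_divide power_divide field_simps)
  qed
  have f0: "dominated A (\<lambda>i. (cmod (f i))\<^sup>2) h" if "f \<in> {f1, f3, f5, IE, JE}" for f
    by (rule dominated_le[OF d[OF f_a[OF that]]]) (use a0 in force)
  note rules = dominated_sq_add dominated_sq_diff dominated_sq_cmult d f f_a f0
  define Y where "Y i = mode_rhs (a i) (f1 i) (f2 i) (f3 i) (f4 i) (f5 i) (f6 i) (f7 i) (f9 i) (IE i) (JE i)" for i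
  have 1: "dominated A (\<lambda>i. (cmod (of_real \<rho>1 * (f2 i / of_real (a i) + \<i> * of_real \<beta> * (f1 i / of_real (a i)))))\<^sup>2) h"
    "dominated A (\<lambda>i. (cmod (of_real \<rho>2 * (f4 i / of_real (a i) + \<i> * of_real \<beta> * (f3 i / of_real (a i)))))\<^sup>2) h"
    "dominated A (\<lambda>i. (cmod (of_real \<rho>1 * (f6 i / of_real (a i) + \<i> * of_real \<beta> * (f5 i / of_real (a i)))))\<^sup>2) h"
    "dominated A (\<lambda>i. (cmod (of_real \<rho>3 * (f7 i / of_real (a i)) - of_real \<omega> * (of_real (a i) * IE i) - of_real \<gamma> * f3 i))\<^sup>2) h"
    "dominated A (\<lambda>i. (cmod (of_real \<rho>3 * (f9 i / of_real (a i)) - of_real \<omega> * (of_real (a i) * JE i)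
       - of_real \<gamma> * (f5 i + of_real l * (f1 i / of_real (a i)))))\<^sup>2) h"
    by (intro rules; simp)+
  have "dominated A (\<lambda>i. (norm (Y i))\<^sup>2 / (a i)\<^sup>2) h"
  proof (rule dominated_le[OF dominated_add[OF dominated_add[OF dominated_add[OF dominated_add[OF 1(1,2)] 1(3)] 1(4)] 1(5)]])
    fix i assume "i \<in> A"
    note a0[OF this]
    then have "(norm (Y i))\<^sup>2 / (a i)\<^sup>2 = (cmod (of_real \<rho>1 * (f2 i + \<i> * of_real \<beta> * f1 i) / of_real (a i)))\<^sup>2
      + (cmod (of_real \<rho>2 * (f4 i + \<i> * of_real \<beta> * f3 i) / of_real (a i)))\<^sup>2
      + (cmod (of_real \<rho>1 * (f6 i + \<i> * of_real \<beta> * f5 i) / of_real (a i)))\<^sup>2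
      + (cmod ((of_real \<rho>3 * f7 i - of_real (\<omega> * (a i)\<^sup>2) * IE i - of_real (\<gamma> * a i) * f3 i) / of_real (a i)))\<^sup>2
      + (cmod ((of_real \<rho>3 * f9 i - of_real (\<omega> * (a i)\<^sup>2) * JE i - of_real \<gamma> * (of_real (a i) * f5 i + of_real l * f1 i)) / of_real (a i)))\<^sup>2"
      unfolding Y_def mode_rhs_def norm_c5_sq norm_divide power_divide norm_of_real power2_abs by (simp only: add_divide_distrib)
    also have "\<dots> = (cmod (of_real \<rho>1 * (f2 i / of_real (a i) + \<i> * of_real \<beta> * (f1 i / of_real (a i)))))\<^sup>2
      + (cmod (of_real \<rho>2 * (f4 i / of_real (a i) + \<i> * of_real \<beta> * (f3 i / of_real (a i)))))\<^sup>2
      + (cmod (of_real \<rho>1 * (f6 i / of_real (a i) + \<i> * of_real \<beta> * (f5 i / of_real (a i)))))\<^sup>2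
      + (cmod (of_real \<rho>3 * (f7 i / of_real (a i)) - of_real \<omega> * (of_real (a i) * IE i) - of_real \<gamma> * f3 i))\<^sup>2
      + (cmod (of_real \<rho>3 * (f9 i / of_real (a i)) - of_real \<omega> * (of_real (a i) * JE i) - of_real \<gamma> * (f5 i + of_real l * (f1 i / of_real (a i)))))\<^sup>2"
      using \<open>0 < a i\<close> by (intro arg_cong2[where f="(+)"] arg_cong[where f="\<lambda>z. (cmod z)\<^sup>2"]) (simp_all add: field_simps power2_eq_square)
    finally show "(norm (Y i))\<^sup>2 / (a i)\<^sup>2 \<le> \<dots>" by (rule eq_refl)
  qed
  from dominated_scale[OF this, of "C\<^sup>2"] show ?thesis
  proof (rule dominated_le)
    fix i assume i: "i \<in> A"
    have "((a i)\<^sup>2 * norm (v i))\<^sup>2 \<le> (C * norm (Y i))\<^sup>2"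
      using C(2)[OF n[OF i], of "v i"] v[OF i] unfolding Y_def a_def by (intro power_mono) auto
    then show "(a i)\<^sup>2 * (norm (v i))\<^sup>2 \<le> C\<^sup>2 * ((norm (Y i))\<^sup>2 / (a i)\<^sup>2)"
      using a0[OF i] by (simp add: field_simps power2_eq_square)
  qed simp
qed

end

section \<open>Memory spaces in terms of modes\<close>

lemma sqs_abs_prod_summable:
  assumes "summable (\<lambda>n. (x n)\<^sup>2)" "summable (\<lambda>n. (y n :: real)\<^sup>2)"
  shows "summable (\<lambda>n. \<bar>x n\<bar> * \<bar>y n\<bar>)"
proof (rule summable_comparison_test')
  show "summable (\<lambda>n. (x n)\<^sup>2 + (y n)\<^sup>2)" using assms by (rule summable_add)
  show "norm (\<bar>x n\<bar> * \<bar>y n\<bar>) \<le> (x n)\<^sup>2 + (y n)\<^sup>2" for n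
  proof -
    have "2 * (\<bar>x n\<bar> * \<bar>y n\<bar>) \<le> (x n)\<^sup>2 + (y n)\<^sup>2"
      using sum_squares_bound[of "\<bar>x n\<bar>" "\<bar>y n\<bar>"] by (simp add: mult.assoc)
    moreover have "0 \<le> \<bar>x n\<bar> * \<bar>y n\<bar>" by simp
    ultimately have "\<bar>x n\<bar> * \<bar>y n\<bar> \<le> (x n)\<^sup>2 + (y n)\<^sup>2" by linarith
    then show ?thesis by (simp add: abs_mult)
  qed
qed

locale mem_space = mem_kernel +
  fixes ell :: real
  assumes ell: "0 < ell"
begin

lemma Mem_H10: "Mem ell mu \<eta> \<Longrightarrow> AE s in Hl. H10 ell (\<eta> s)" by (simp add: Mem_def)

lemma freq_mult_cmod_sinc_le:
  assumes "H10 ell f" shows "(freq ell n)\<^sup>2 * (cmod (sinc ell f n))\<^sup>2 \<le> (L2n ell (dx ell f))\<^sup>2"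
proof -
  note s = L2n_dx_sums[OF ell assms]
  have "(\<Sum>i\<in>{n}. (freq ell i)\<^sup>2 * (cmod (sinc ell f i))\<^sup>2) \<le> (\<Sum>i. (freq ell i)\<^sup>2 * (cmod (sinc ell f i))\<^sup>2)"
    by (rule sum_le_suminf) (use s in \<open>auto simp: sums_iff\<close>)
  then show ?thesis using s by (simp add: sums_iff)
qed

lemma Mem_sinc_measurable:
  assumes "Mem ell mu \<eta>" shows "(\<lambda>s. sinc ell (\<eta> s) n) \<in> borel_measurable Hl"
proof (cases "n = 0")
  case False
  then have a: "freq ell n > 0" using freq_pos[OF ell] by simp
  have "(\<lambda>s. L2i ell (dx ell (\<eta> s)) (cosb ell n)) \<in> borel_measurable Hl"
    using assms L2_cosb unfolding Mem_def by blast
  then have "(\<lambda>s. L2i ell (dx ell (\<eta> s)) (cosb ell n) / of_real (freq ell n)) \<in> borel_measurable Hl" by measurable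
  moreover have "AE s in Hl. L2i ell (dx ell (\<eta> s)) (cosb ell n) / of_real (freq ell n) = sinc ell (\<eta> s) n"
    using Mem_H10[OF assms]
  proof eventually_elim
    case (elim s)
    then show ?case using cosc_dx[OF ell elim, of n] a by (simp add: cosc_def)
  qed
  ultimately show ?thesis by (rule borel_measurable_lebesgue_on_AE) simp
qed simp

lemma Mem_LM:
  assumes "Mem ell mu \<eta>" shows "LM (\<lambda>s. sinc ell (\<eta> s) n)"
proof (cases "n = 0")
  case False
  then have a: "freq ell n > 0" using freq_pos[OF ell] by simp
  note [measurable] = Mem_sinc_measurable[OF assms]
  have i: "integrable Hl (\<lambda>s. 1 / (freq ell n)\<^sup>2 * (mu s * (L2n ell (dx ell (\<eta> s)))\<^sup>2))"
    using assms by (auto simp: Mem_def)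
  have "integrable Hl (\<lambda>s. mu s * (cmod (sinc ell (\<eta> s) n))\<^sup>2)"
  proof (rule Bochner_Integration.integrable_bound[OF i])
    show "AE s in Hl. norm (mu s * (cmod (sinc ell (\<eta> s) n))\<^sup>2) \<le> norm (1 / (freq ell n)\<^sup>2 * (mu s * (L2n ell (dx ell (\<eta> s)))\<^sup>2))"
      using Mem_H10[OF assms] AE_space
    proof eventually_elim
      case (elim s)
      have m: "0 \<le> mu s" using elim mu_nonneg by simp
      have "(cmod (sinc ell (\<eta> s) n))\<^sup>2 \<le> 1 / (freq ell n)\<^sup>2 * (L2n ell (dx ell (\<eta> s)))\<^sup>2"
        using freq_mult_cmod_sinc_le[OF elim(1), of n] a by (simp add: field_simps)
      from mult_left_mono[OF this m] show ?case using m by (simp add: mult_ac)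
    qed
  qed measurable
  then show ?thesis unfolding LM_def by simp
qed (use LM_const(1)[of 0] in simp)

text \<open>Parseval for the gradient at almost every s, integrated term by term; the terms are
  nonnegative and their partial sums stay below the integral of the total.\<close>

lemma Mem_sums:
  assumes "Mem ell mu \<eta>"
  shows "(\<lambda>n. (freq ell n)\<^sup>2 * LMn (\<lambda>s. sinc ell (\<eta> s) n)) sums Memn2 ell mu \<eta>"
proof -
  define g where "g n s = (freq ell n)\<^sup>2 * (mu s * (cmod (sinc ell (\<eta> s) n))\<^sup>2)" for n s
  have gi: "integrable Hl (g n)" for n using Mem_LM[OF assms, of n] by (auto simp: g_def[abs_def] LM_def)
  have gI: "integral\<^sup>L Hl (g n) = (freq ell n)\<^sup>2 * LMn (\<lambda>s. sinc ell (\<eta> s) n)" for n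
    by (simp add: g_def[abs_def] LMn_def)
  have g0: "0 \<le> g n s" if "s \<in> space Hl" for n s using mu_nonneg that by (simp add: g_def)
  have gs: "AE s in Hl. (\<lambda>n. g n s) sums (mu s * (L2n ell (dx ell (\<eta> s)))\<^sup>2)"
    using Mem_H10[OF assms]
  proof eventually_elim
    case (elim s)
    from sums_mult[OF L2n_dx_sums[OF ell elim], of "mu s"] show ?case by (simp add: g_def mult_ac)
  qed
  have int: "integrable Hl (\<lambda>s. mu s * (L2n ell (dx ell (\<eta> s)))\<^sup>2)" using assms by (simp add: Mem_def)
  have part: "(\<Sum>n<N. integral\<^sup>L Hl (g n)) \<le> integral\<^sup>L Hl (\<lambda>s. mu s * (L2n ell (dx ell (\<eta> s)))\<^sup>2)" for N
  proof -
    have "(\<Sum>n<N. integral\<^sup>L Hl (g n)) = integral\<^sup>L Hl (\<lambda>s. \<Sum>n<N. g n s)"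
      by (rule Bochner_Integration.integral_sum[symmetric]) (rule gi)
    also have "\<dots> \<le> integral\<^sup>L Hl (\<lambda>s. mu s * (L2n ell (dx ell (\<eta> s)))\<^sup>2)"
    proof (rule integral_mono_AE[OF _ int])
      show "AE s in Hl. (\<Sum>n<N. g n s) \<le> mu s * (L2n ell (dx ell (\<eta> s)))\<^sup>2"
        using gs AE_space
      proof eventually_elim
        case (elim s)
        have "(\<Sum>n<N. g n s) \<le> (\<Sum>n. g n s)" by (rule sum_le_suminf) (use elim g0 in \<open>auto simp: sums_iff\<close>)
        then show ?case using elim by (simp add: sums_iff)
      qed
    qed (use gi in auto)
    finally show ?thesis .
  qed
  have gnorm: "(LINT s|Hl. norm (g n s)) = integral\<^sup>L Hl (g n)" for n
    by (rule Bochner_Integration.integral_cong) (use g0 in auto)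
  have "(\<lambda>n. integral\<^sup>L Hl (g n)) sums integral\<^sup>L Hl (\<lambda>s. \<Sum>n. g n s)"
  proof (rule sums_integral[OF gi])
    show "AE s in Hl. summable (\<lambda>n. norm (g n s))"
      using gs AE_space by eventually_elim (use g0 in \<open>auto simp: sums_iff\<close>)
    show "summable (\<lambda>n. LINT s|Hl. norm (g n s))" unfolding gnorm
    proof (rule summableI_nonneg_bounded[OF _ part])
      show "0 \<le> integral\<^sup>L Hl (g n)" for n by (rule integral_nonneg_AE, rule AE_I2) (use g0 in auto)
    qed
  qed
  moreover have "integral\<^sup>L Hl (\<lambda>s. \<Sum>n. g n s) = Memn2 ell mu \<eta>"
    unfolding Memn2_def
  proof (rule integral_cong_AE)
    show "AE s in Hl. (\<Sum>n. g n s) = mu s * (L2n ell (dx ell (\<eta> s)))\<^sup>2"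
      using gs by eventually_elim (simp add: sums_iff)
    show "(\<lambda>s. \<Sum>n. g n s) \<in> borel_measurable Hl" using gi by (intro borel_measurable_suminf) auto
  qed (use int in auto)
  ultimately show ?thesis unfolding gI by simp
qed

text \<open>The inverse of the mode decomposition. The integral of the sum is finite, so at almost
  every s the coefficients belong to a function in \<open>H10\<close>, which is then chosen. The
  choice at each s does not spoil weak measurability, since the pairings are series in the
  measurable coefficients.\<close>

lemma Mem_of_modes:
  assumes c0: "\<And>s. c s 0 = 0" and LMc: "\<And>n. LM (\<lambda>s. c s n)" and sm: "summable (\<lambda>n. (freq ell n)\<^sup>2 * LMn (\<lambda>s. c s n))"
  shows "\<exists>\<eta>. Mem ell mu \<eta> \<and> (AE s in Hl. \<forall>n. sinc ell (\<eta> s) n = c s n)"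
proof -
  define g where "g n s = (freq ell n)\<^sup>2 * (mu s * (cmod (c s n))\<^sup>2)" for n s
  have [measurable]: "(\<lambda>s. c s n) \<in> borel_measurable Hl" for n using LMc by (simp add: LM_def)
  have gm[measurable]: "g n \<in> borel_measurable Hl" for n unfolding g_def by measurable
  have gi: "integrable Hl (g n)" for n using LMc[of n] by (auto simp: g_def[abs_def] LM_def)
  have gI: "integral\<^sup>L Hl (g n) = (freq ell n)\<^sup>2 * LMn (\<lambda>s. c s n)" for n
    by (simp add: g_def[abs_def] LMn_def)
  have g0: "0 \<le> g n s" if "s \<in> space Hl" for n s using mu_nonneg that by (simp add: g_def)
  have fin: "(\<integral>\<^sup>+s. (\<Sum>n. ennreal (g n s)) \<partial>Hl) < \<infinity>"
  proof -
    have "(\<integral>\<^sup>+s. (\<Sum>n. ennreal (g n s)) \<partial>Hl) = (\<Sum>n. (\<integral>\<^sup>+s. ennreal (g n s) \<partial>Hl))"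
      by (rule nn_integral_suminf) measurable
    also have "\<dots> = (\<Sum>n. ennreal (integral\<^sup>L Hl (g n)))"
      by (intro arg_cong[of _ _ suminf] ext nn_integral_eq_integral gi AE_I2 g0)
    also have "\<dots> < \<infinity>" unfolding gI using sm LMn_nonneg by (subst suminf_ennreal_eq) (auto simp: summable_sums)
    finally show ?thesis .
  qed
  have sumg: "AE s in Hl. summable (\<lambda>n. g n s)"
  proof -
    have "AE s in Hl. (\<Sum>n. ennreal (g n s)) \<noteq> \<infinity>"
      by (rule nn_integral_PInf_AE) (use fin in auto)
    then show ?thesis using AE_space
    proof eventually_elim
      case (elim s)
      show ?case by (rule summable_suminf_not_top) (use elim g0 in auto)
    qed
  qed
  have sq: "sqs (\<lambda>n. of_real (freq ell n) * c s n)" if "0 < s" "summable (\<lambda>n. g n s)" for s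
  proof -
    have "summable (\<lambda>n. (1 / mu s) * g n s)" using that(2) by (rule summable_mult)
    then show ?thesis using mu_pos[OF that(1)] by (simp add: sqs_def g_def norm_mult power_mult_distrib)
  qed
  define \<eta> where "\<eta> s = (SOME f. H10 ell f \<and> (\<forall>n. sinc ell f n = c s n))" for s
  have ex: "H10 ell (\<eta> s) \<and> (\<forall>n. sinc ell (\<eta> s) n = c s n)" if s: "0 < s" "summable (\<lambda>n. g n s)" for s
  proof -
    have "sqs (\<lambda>n. c s n)"
    proof (rule sqs_bound)
      show "summable (\<lambda>n. 1 / (freq ell 1)\<^sup>2 * (cmod (of_real (freq ell n) * c s n))\<^sup>2)"
        using sq[OF s] by (intro summable_mult) (simp add: sqs_def)
      fix n
      show "(cmod (c s n))\<^sup>2 \<le> 1 / (freq ell 1)\<^sup>2 * (cmod (of_real (freq ell n) * c s n))\<^sup>2"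
      proof (cases "n = 0")
        case False
        have f1: "0 < freq ell 1" using freq_pos[OF ell] by simp
        have "(freq ell 1)\<^sup>2 \<le> (freq ell n)\<^sup>2" using freq_ge_1[OF ell] False f1 by (intro power_mono) auto
        then have "(freq ell 1)\<^sup>2 * (cmod (c s n))\<^sup>2 \<le> (freq ell n)\<^sup>2 * (cmod (c s n))\<^sup>2" by (rule mult_right_mono) simp
        then show ?thesis using f1 by (simp add: norm_mult power_mult_distrib field_simps)
      qed (simp add: c0)
    qed
    then obtain f where f: "L2 ell f" "\<And>n. sinc ell f n = c s n"
      using sinc_Riesz_Fischer[OF ell, of "c s"] c0 by auto
    then have "H10 ell f" using sq[OF s] by (simp add: H10_iff[OF ell])
    then have "\<exists>f. H10 ell f \<and> (\<forall>n. sinc ell f n = c s n)" using f by blast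
    then show ?thesis unfolding \<eta>_def by (rule someI_ex)
  qed
  have ae: "AE s in Hl. 0 < s \<and> summable (\<lambda>n. g n s)" using sumg AE_space by eventually_elim simp
  have aeH: "AE s in Hl. H10 ell (\<eta> s)" using ae by eventually_elim (use ex in blast)
  have aec: "AE s in Hl. \<forall>n. sinc ell (\<eta> s) n = c s n" using ae by eventually_elim (use ex in blast)
  have "Mem ell mu \<eta>" unfolding Mem_def
  proof (intro conjI allI impI aeH)
    fix h assume h: "L2 ell h"
    have "(\<lambda>s. \<Sum>n. of_real (freq ell n) * c s n * cnj (cosc ell h n)) \<in> borel_measurable Hl"
      by (intro borel_measurable_suminf) measurable
    moreover have "AE s in Hl. (\<Sum>n. of_real (freq ell n) * c s n * cnj (cosc ell h n)) = L2i ell (dx ell (\<eta> s)) h"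
      using aeH aec
    proof eventually_elim
      case (elim s)
      have "(\<lambda>n. cosc ell (dx ell (\<eta> s)) n * cnj (cosc ell h n)) sums L2i ell (dx ell (\<eta> s)) h"
        by (intro cosc_parseval_inner ell H10_L2_dx elim h)
      then show ?case using elim by (simp add: cosc_dx[OF ell elim(1)] sums_iff)
    qed
    ultimately show "(\<lambda>s. L2i ell (dx ell (\<eta> s)) h) \<in> borel_measurable Hl"
      by (rule borel_measurable_lebesgue_on_AE) simp
  next
    have aes: "AE s in Hl. (\<Sum>n. g n s) = mu s * (L2n ell (dx ell (\<eta> s)))\<^sup>2"
      using aeH aec
    proof eventually_elim
      case (elim s)
      from sums_mult[OF L2n_dx_sums[OF ell elim(1)], of "mu s"] show ?case
        using elim by (simp add: g_def mult_ac sums_iff)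
    qed
    have "integrable Hl (\<lambda>s. \<Sum>n. g n s)"
    proof (rule integrable_suminf[OF gi])
      show "AE s in Hl. summable (\<lambda>n. norm (g n s))" using ae by eventually_elim (use g0 in auto)
      have "(LINT s|Hl. norm (g n s)) = integral\<^sup>L Hl (g n)" for n
        by (rule Bochner_Integration.integral_cong) (use g0 in auto)
      then show "summable (\<lambda>n. LINT s|Hl. norm (g n s))" using sm by (simp add: gI)
    qed
    moreover have "(\<lambda>s. mu s * (L2n ell (dx ell (\<eta> s)))\<^sup>2) \<in> borel_measurable Hl"
      by (rule borel_measurable_lebesgue_on_AE[OF _ aes]) (auto intro!: borel_measurable_suminf)
    ultimately show "integrable Hl (\<lambda>s. mu s * (L2n ell (dx ell (\<eta> s)))\<^sup>2)"
      using integrable_cong_AE[OF _ _ aes] by auto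
  qed
  then show ?thesis using aec by blast
qed

text \<open>One statement for two uses: \<psi> is \<open>mu\<close> itself for the memory integral,
  and a test function or its derivative for \<open>sderiv\<close>. The bound by a multiple of
  \<open>mu\<close>, with Cauchy-Schwarz first in s and then in n, justifies integration term by
  term.\<close>

lemma Mem_pairing:
  assumes \<eta>: "Mem ell mu \<eta>" and v: "H10 ell v"
    and \<psi>[measurable]: "\<psi> \<in> borel_measurable Hl" and C: "\<And>s. 0 < s \<Longrightarrow> \<bar>\<psi> s\<bar> \<le> C * mu s"
  shows "(\<lambda>n. of_real ((freq ell n)\<^sup>2) * cnj (sinc ell v n) * integral\<^sup>L Hl (\<lambda>s. sinc ell (\<eta> s) n * of_real (\<psi> s)))
     sums integral\<^sup>L Hl (\<lambda>s. L2i ell (dx ell (\<eta> s)) (dx ell v) * of_real (\<psi> s))"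
proof -
  have C0: "0 \<le> C * mu 1" using C[of 1] by simp
  then have C0: "0 \<le> C" using mu_pos[of 1] by (simp add: zero_le_mult_iff)
  note [measurable] = Mem_sinc_measurable[OF \<eta>]
  let ?a = "\<lambda>n. freq ell n"
  define f where "f n s = of_real ((?a n)\<^sup>2) * cnj (sinc ell v n) * (sinc ell (\<eta> s) n * of_real (\<psi> s))" for n s
  have wi: "integrable Hl (\<lambda>s. mu s * cmod (sinc ell (\<eta> s) n))" for n
  proof -
    have "integrable Hl (\<lambda>s. cmod (of_real (mu s) * sinc ell (\<eta> s) n))"
      using LM_weighted_integral(1)[OF Mem_LM[OF \<eta>, of n]] by auto
    then show ?thesis
      by (rule iffD1[OF Bochner_Integration.integrable_cong, rotated -1]) (auto simp: norm_mult mu_nonneg)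
  qed
  have fb: "norm (f n s) \<le> (?a n)\<^sup>2 * cmod (sinc ell v n) * (C * (mu s * cmod (sinc ell (\<eta> s) n)))" if "s \<in> space Hl" for n s
  proof -
    have "cmod (sinc ell (\<eta> s) n) * \<bar>\<psi> s\<bar> \<le> cmod (sinc ell (\<eta> s) n) * (C * mu s)"
      using C[of s] that by (intro mult_left_mono) auto
    then have "cmod (sinc ell (\<eta> s) n * of_real (\<psi> s)) \<le> C * (mu s * cmod (sinc ell (\<eta> s) n))" by (simp add: norm_mult mult_ac)
    then have "(?a n)\<^sup>2 * cmod (sinc ell v n) * cmod (sinc ell (\<eta> s) n * of_real (\<psi> s)) \<le> (?a n)\<^sup>2 * cmod (sinc ell v n) * (C * (mu s * cmod (sinc ell (\<eta> s) n)))"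
      by (intro mult_left_mono) auto
    then show ?thesis unfolding f_def norm_mult[of "_ * cnj _"] by (simp add: norm_mult norm_power)
  qed
  have bi: "integrable Hl (\<lambda>s. (?a n)\<^sup>2 * cmod (sinc ell v n) * (C * (mu s * cmod (sinc ell (\<eta> s) n))))" for n
    using wi[of n] by auto
  have fi: "integrable Hl (f n)" for n
  proof (rule Bochner_Integration.integrable_bound[OF bi[of n]])
    show "f n \<in> borel_measurable Hl" unfolding f_def by measurable
    show "AE s in Hl. norm (f n s) \<le> norm ((?a n)\<^sup>2 * cmod (sinc ell v n) * (C * (mu s * cmod (sinc ell (\<eta> s) n))))"
      by (rule AE_I2) (use fb in \<open>auto intro: order_trans[OF _ abs_ge_self]\<close>)
  qed
  have fs: "AE s in Hl. (\<lambda>n. f n s) sums (L2i ell (dx ell (\<eta> s)) (dx ell v) * of_real (\<psi> s))"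
    using Mem_H10[OF \<eta>]
  proof eventually_elim
    case (elim s)
    from sums_mult2[OF L2i_dx_sums[OF ell elim v], of "of_real (\<psi> s)"] show ?case
      by (simp add: f_def mult_ac)
  qed
  have m0: "0 \<le> integral\<^sup>L Hl mu" by (rule integral_nonneg_AE, rule AE_I2) (use mu_nonneg in auto)
  have nb: "(LINT s|Hl. norm (f n s)) \<le> C * sqrt (integral\<^sup>L Hl mu) * (\<bar>?a n * cmod (sinc ell v n)\<bar> * \<bar>?a n * sqrt (LMn (\<lambda>s. sinc ell (\<eta> s) n))\<bar>)" for n
  proof -
    have LMabs: "LM (\<lambda>s. of_real (cmod (sinc ell (\<eta> s) n)))" "LMn (\<lambda>s. of_real (cmod (sinc ell (\<eta> s) n))) = LMn (\<lambda>s. sinc ell (\<eta> s) n)"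
      using Mem_LM[OF \<eta>, of n] by (auto simp: LM_def LMn_def)
    have "(LINT s|Hl. mu s * cmod (sinc ell (\<eta> s) n)) = cmod (integral\<^sup>L Hl (\<lambda>s. of_real (mu s) * of_real (cmod (sinc ell (\<eta> s) n))))"
    proof -
      have "integral\<^sup>L Hl (\<lambda>s. of_real (mu s) * of_real (cmod (sinc ell (\<eta> s) n))) = (of_real (LINT s|Hl. mu s * cmod (sinc ell (\<eta> s) n)) :: complex)"
        unfolding integral_complex_of_real[symmetric] by simp
      moreover have "0 \<le> (LINT s|Hl. mu s * cmod (sinc ell (\<eta> s) n))"
        by (rule integral_nonneg_AE, rule AE_I2) (use mu_nonneg in auto)
      ultimately show ?thesis by simp
    qed
    also have "\<dots> \<le> sqrt (integral\<^sup>L Hl mu * LMn (\<lambda>s. sinc ell (\<eta> s) n))"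
      using LM_weighted_integral(2)[OF LMabs(1)] unfolding LMabs(2) by (rule real_le_rsqrt)
    finally have w: "(LINT s|Hl. mu s * cmod (sinc ell (\<eta> s) n)) \<le> sqrt (integral\<^sup>L Hl mu) * sqrt (LMn (\<lambda>s. sinc ell (\<eta> s) n))"
      by (simp add: real_sqrt_mult)
    have "(LINT s|Hl. norm (f n s)) \<le> (LINT s|Hl. (?a n)\<^sup>2 * cmod (sinc ell v n) * (C * (mu s * cmod (sinc ell (\<eta> s) n))))"
      using fi by (intro integral_mono bi fb) auto
    also have "\<dots> = (?a n)\<^sup>2 * cmod (sinc ell v n) * (C * (LINT s|Hl. mu s * cmod (sinc ell (\<eta> s) n)))" by simp
    also have "\<dots> \<le> (?a n)\<^sup>2 * cmod (sinc ell v n) * (C * (sqrt (integral\<^sup>L Hl mu) * sqrt (LMn (\<lambda>s. sinc ell (\<eta> s) n))))"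
      using w C0 by (intro mult_left_mono) auto
    also have "\<dots> = C * sqrt (integral\<^sup>L Hl mu) * (\<bar>?a n * cmod (sinc ell v n)\<bar> * \<bar>?a n * sqrt (LMn (\<lambda>s. sinc ell (\<eta> s) n))\<bar>)"
      using freq_nonneg[OF ell, of n] LMn_nonneg by (simp add: abs_mult power2_eq_square)
    finally show ?thesis .
  qed
  have sm: "summable (\<lambda>n. LINT s|Hl. norm (f n s))"
  proof (rule summable_comparison_test')
    have "summable (\<lambda>n. (?a n * cmod (sinc ell v n))\<^sup>2)"
      using L2n_dx_sums[OF ell v] by (simp add: power_mult_distrib sums_iff)
    moreover have "summable (\<lambda>n. (?a n * sqrt (LMn (\<lambda>s. sinc ell (\<eta> s) n)))\<^sup>2)"
      using Mem_sums[OF \<eta>] LMn_nonneg by (simp add: power_mult_distrib sums_iff)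
    ultimately show "summable (\<lambda>n. C * sqrt (integral\<^sup>L Hl mu) * (\<bar>?a n * cmod (sinc ell v n)\<bar> * \<bar>?a n * sqrt (LMn (\<lambda>s. sinc ell (\<eta> s) n))\<bar>))"
      by (intro summable_mult sqs_abs_prod_summable)
    show "norm (LINT s|Hl. norm (f n s)) \<le> C * sqrt (integral\<^sup>L Hl mu) * (\<bar>?a n * cmod (sinc ell v n)\<bar> * \<bar>?a n * sqrt (LMn (\<lambda>s. sinc ell (\<eta> s) n))\<bar>)" for n
      using nb[of n] by simp
  qed
  have AEs: "AE s in Hl. summable (\<lambda>n. norm (f n s))"
    using Mem_H10[OF \<eta>]
  proof eventually_elim
    case (elim s)
    have "summable (\<lambda>n. \<bar>?a n * cmod (sinc ell v n)\<bar> * \<bar>?a n * cmod (sinc ell (\<eta> s) n)\<bar>)"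
      by (rule sqs_abs_prod_summable) (use L2n_dx_sums[OF ell v] L2n_dx_sums[OF ell elim] in \<open>simp_all add: power_mult_distrib sums_iff\<close>)
    from summable_mult[OF this, of "\<bar>\<psi> s\<bar>"] show ?case
      using freq_nonneg[OF ell] by (simp add: f_def norm_mult norm_power abs_mult power2_eq_square mult_ac)
  qed
  have "(\<lambda>n. integral\<^sup>L Hl (f n)) sums integral\<^sup>L Hl (\<lambda>s. \<Sum>n. f n s)"
    by (rule sums_integral[OF fi AEs sm])
  moreover have "integral\<^sup>L Hl (\<lambda>s. \<Sum>n. f n s) = integral\<^sup>L Hl (\<lambda>s. L2i ell (dx ell (\<eta> s)) (dx ell v) * of_real (\<psi> s))"
  proof (rule integral_cong_AE)
    show "AE s in Hl. (\<Sum>n. f n s) = L2i ell (dx ell (\<eta> s)) (dx ell v) * of_real (\<psi> s)"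
      using fs by eventually_elim (simp add: sums_iff)
    show "(\<lambda>s. \<Sum>n. f n s) \<in> borel_measurable Hl" using fi by (intro borel_measurable_suminf) auto
    have [measurable]: "(\<lambda>s. L2i ell (dx ell (\<eta> s)) (dx ell v)) \<in> borel_measurable Hl"
      using \<eta> H10_L2_dx[OF v] unfolding Mem_def by blast
    show "(\<lambda>s. L2i ell (dx ell (\<eta> s)) (dx ell v) * of_real (\<psi> s)) \<in> borel_measurable Hl" by measurable
  qed
  ultimately show ?thesis by (simp add: f_def[abs_def])
qed

lemma Mem_pairing_sinb:
  assumes \<eta>: "Mem ell mu \<eta>" and \<psi>: "\<psi> \<in> borel_measurable Hl" and C: "\<And>s. 0 < s \<Longrightarrow> \<bar>\<psi> s\<bar> \<le> C * mu s"
  shows "integral\<^sup>L Hl (\<lambda>s. L2i ell (dx ell (\<eta> s)) (dx ell (sinb ell n)) * of_real (\<psi> s))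
     = of_real ((freq ell n)\<^sup>2) * integral\<^sup>L Hl (\<lambda>s. sinc ell (\<eta> s) n * of_real (\<psi> s))"
proof -
  let ?f = "\<lambda>m. of_real ((freq ell m)\<^sup>2) * cnj (sinc ell (sinb ell n) m) * integral\<^sup>L Hl (\<lambda>s. sinc ell (\<eta> s) m * of_real (\<psi> s))"
  have "?f sums (\<Sum>m\<in>{n}. ?f m)" by (rule sums_finite) (auto simp: sinc_sinb[OF ell])
  then have A: "?f sums ?f n" by simp
  have "?f n = integral\<^sup>L Hl (\<lambda>s. L2i ell (dx ell (\<eta> s)) (dx ell (sinb ell n)) * of_real (\<psi> s))"
    by (rule sums_unique2[OF A Mem_pairing[OF \<eta> H10_sinb[OF ell] \<psi> C]])
  then show ?thesis by (cases "n = 0") (auto simp: sinc_sinb[OF ell])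
qed

lemma sinc_memint_bound:
  assumes \<eta>: "Mem ell mu \<eta>"
  shows "(cmod (of_real (freq ell n) * integral\<^sup>L Hl (\<lambda>s. of_real (mu s) * sinc ell (\<eta> s) n)))\<^sup>2
     \<le> integral\<^sup>L Hl mu * ((freq ell n)\<^sup>2 * LMn (\<lambda>s. sinc ell (\<eta> s) n))"
  using mult_left_mono[OF LM_weighted_integral(2)[OF Mem_LM[OF \<eta>, of n]], of "(freq ell n)\<^sup>2"]
  by (simp add: norm_mult power_mult_distrib mult_ac)

text \<open>The weight is at least \<open>freq ell 1\<close> except at index 0, where it vanishes;
  hence the separate condition there.\<close>

lemma sqs_of_freq_sqs:
  assumes "sqs (\<lambda>n. of_real (freq ell n) * c n)" "c 0 = 0" shows "sqs c"
proof (rule sqs_bound)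
  show "summable (\<lambda>n. 1 / (freq ell 1)\<^sup>2 * (cmod (of_real (freq ell n) * c n))\<^sup>2)"
    using assms(1) by (intro summable_mult) (simp add: sqs_def)
  fix n
  show "(cmod (c n))\<^sup>2 \<le> 1 / (freq ell 1)\<^sup>2 * (cmod (of_real (freq ell n) * c n))\<^sup>2"
  proof (cases "n = 0")
    case False
    have f1: "0 < freq ell 1" using freq_pos[OF ell] by simp
    have "(freq ell 1)\<^sup>2 \<le> (freq ell n)\<^sup>2" using freq_ge_1[OF ell] False f1 by (intro power_mono) auto
    then have "(freq ell 1)\<^sup>2 * (cmod (c n))\<^sup>2 \<le> (freq ell n)\<^sup>2 * (cmod (c n))\<^sup>2" by (rule mult_right_mono) simp
    then show ?thesis using f1 by (simp add: norm_mult power_mult_distrib field_simps)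
  qed (simp add: assms(2))
qed

text \<open>Riesz-Fischer provides a function with the integrated coefficients, and it satisfies the
  defining property, so the choice in \<open>memint\<close> is a genuine one. Testing with sines
  shows that the chosen function has these coefficients.\<close>

lemma memint_modes:
  assumes \<eta>: "Mem ell mu \<eta>"
  shows "H10 ell (memint ell mu \<eta>)" "sinc ell (memint ell mu \<eta>) n = integral\<^sup>L Hl (\<lambda>s. of_real (mu s) * sinc ell (\<eta> s) n)"
proof -
  define I where "I n = integral\<^sup>L Hl (\<lambda>s. of_real (mu s) * sinc ell (\<eta> s) n)" for n
  have "sqs (\<lambda>n. of_real (freq ell n) * I n)"
  proof (rule sqs_bound)
    show "summable (\<lambda>n. integral\<^sup>L Hl mu * ((freq ell n)\<^sup>2 * LMn (\<lambda>s. sinc ell (\<eta> s) n)))"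
      using Mem_sums[OF \<eta>] by (intro summable_mult) (simp add: sums_iff)
  qed (use sinc_memint_bound[OF \<eta>] in \<open>auto simp: I_def\<close>)
  note sq = this
  have I0: "I 0 = 0" by (simp add: I_def)
  obtain J where J: "L2 ell J" "\<And>n. sinc ell J n = I n"
    using sinc_Riesz_Fischer[OF ell sqs_of_freq_sqs[OF sq I0] I0] by blast
  have HJ: "H10 ell J" using J sq by (simp add: H10_iff[OF ell])
  define P where "P K \<longleftrightarrow> H10 ell K \<and> (\<forall>v. H10 ell v \<longrightarrow> L2i ell (dx ell K) (dx ell v)
        = integral\<^sup>L Hl (\<lambda>s. of_real (mu s) * L2i ell (dx ell (\<eta> s)) (dx ell v)))" for K
  have mu1: "\<bar>mu s\<bar> \<le> 1 * mu s" if "0 < s" for s using mu_nonneg[OF that] by simp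
  have "P J" unfolding P_def
  proof (intro conjI allI impI HJ)
    fix v assume v: "H10 ell v"
    have 1: "(\<lambda>n. of_real ((freq ell n)\<^sup>2) * cnj (sinc ell v n) * integral\<^sup>L Hl (\<lambda>s. sinc ell (\<eta> s) n * of_real (mu s)))
       sums integral\<^sup>L Hl (\<lambda>s. L2i ell (dx ell (\<eta> s)) (dx ell v) * of_real (mu s))"
      by (rule Mem_pairing[OF \<eta> v mu_meas mu1])
    have 2: "(\<lambda>n. of_real ((freq ell n)\<^sup>2) * cnj (sinc ell v n) * integral\<^sup>L Hl (\<lambda>s. sinc ell (\<eta> s) n * of_real (mu s))) sums L2i ell (dx ell J) (dx ell v)"
      using L2i_dx_sums[OF ell HJ v] by (simp add: J I_def mult_ac)
    have "L2i ell (dx ell J) (dx ell v) = integral\<^sup>L Hl (\<lambda>s. L2i ell (dx ell (\<eta> s)) (dx ell v) * of_real (mu s))"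
      by (rule sums_unique2[OF 2 1])
    then show "L2i ell (dx ell J) (dx ell v) = integral\<^sup>L Hl (\<lambda>s. of_real (mu s) * L2i ell (dx ell (\<eta> s)) (dx ell v))"
      by (simp add: mult.commute)
  qed
  then have "P (SOME K. P K)" by (rule someI[where P=P])
  then have P: "P (memint ell mu \<eta>)" by (simp add: memint_def P_def)
  then show H: "H10 ell (memint ell mu \<eta>)" by (simp add: P_def)
  show "sinc ell (memint ell mu \<eta>) n = integral\<^sup>L Hl (\<lambda>s. of_real (mu s) * sinc ell (\<eta> s) n)"
  proof (cases "n = 0")
    case False
    have "of_real ((freq ell n)\<^sup>2) * sinc ell (memint ell mu \<eta>) n = L2i ell (dx ell (memint ell mu \<eta>)) (dx ell (sinb ell n))"
      by (rule L2i_dx_sinb[OF ell H, symmetric])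
    also have "\<dots> = integral\<^sup>L Hl (\<lambda>s. L2i ell (dx ell (\<eta> s)) (dx ell (sinb ell n)) * of_real (mu s))"
      using P H10_sinb[OF ell, of n] by (simp add: P_def mult.commute)
    also have "\<dots> = of_real ((freq ell n)\<^sup>2) * integral\<^sup>L Hl (\<lambda>s. sinc ell (\<eta> s) n * of_real (mu s))"
      by (rule Mem_pairing_sinb[OF \<eta> mu_meas mu1])
    finally show ?thesis using freq_pos[OF ell, of n] False by (simp add: mult.commute)
  qed simp
qed

text \<open>The support lies in some (0, L), where \<open>mu\<close> is at least
  \<open>mu L\<close>.\<close>

lemma test_fun_weight:
  assumes "test_fun {0<..} \<phi>"
  shows "\<exists>C. \<forall>s>0. \<bar>\<phi> s\<bar> \<le> C * mu s" "\<phi> \<in> borel_measurable Hl"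
proof -
  obtain L where L: "L > 0" "test_fun {0<..<L} \<phi>" using test_fun_half_line[OF assms] by blast
  obtain B where B: "\<And>x. \<bar>\<phi> x\<bar> \<le> B" using test_fun_bounded[OF assms] by blast
  have B0: "0 \<le> B" using B[of 0] by simp
  have "\<bar>\<phi> s\<bar> \<le> (B / mu L) * mu s" if s: "0 < s" for s
  proof (cases "s < L")
    case True
    have "B * mu L \<le> B * mu s" using mu_dec[of s L] s True B0 by (intro mult_left_mono) auto
    then have "B \<le> (B / mu L) * mu s" using mu_pos[OF L(1)] by (simp add: field_simps)
    then show ?thesis using B[of s] by linarith
  next
    case False
    then have "\<phi> s = 0" using test_fun_outside[OF L(2)] by simp
    then show ?thesis using B0 mu_nonneg[OF s] mu_pos[OF L(1)] by simp
  qed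
  then show "\<exists>C. \<forall>s>0. \<bar>\<phi> s\<bar> \<le> C * mu s" by blast
  show "\<phi> \<in> borel_measurable Hl"
    by (intro continuous_imp_measurable_on_sets_lebesgue smooth_fun_continuous test_fun_smooth[OF assms]) auto
qed

text \<open>Testing with single sines gives the scalar statements; conversely a general test vector
  is summed over its modes by \<open>Mem_pairing\<close>.\<close>

lemma sderiv_iff:
  assumes \<eta>: "Mem ell mu \<eta>" and \<eta>': "Mem ell mu \<eta>'"
  shows "sderiv ell \<eta> \<eta>' \<longleftrightarrow> (\<forall>n. hwd (\<lambda>s. sinc ell (\<eta> s) n) (\<lambda>s. sinc ell (\<eta>' s) n))"
proof
  assume sd: "sderiv ell \<eta> \<eta>'"
  show "\<forall>n. hwd (\<lambda>s. sinc ell (\<eta> s) n) (\<lambda>s. sinc ell (\<eta>' s) n)"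
    unfolding hwd_def
  proof (intro allI impI)
    fix n \<phi> assume \<phi>: "test_fun {0<..} \<phi>"
    note \<phi>' = test_fun_deriv[OF \<phi>]
    obtain C where C: "\<And>s. 0 < s \<Longrightarrow> \<bar>\<phi> s\<bar> \<le> C * mu s" using test_fun_weight(1)[OF \<phi>] by blast
    obtain C' where C': "\<And>s. 0 < s \<Longrightarrow> \<bar>deriv \<phi> s\<bar> \<le> C' * mu s" using test_fun_weight(1)[OF \<phi>'] by blast
    show "(CLINT s|Hl. sinc ell (\<eta> s) n * of_real (deriv \<phi> s)) = - (CLINT s|Hl. sinc ell (\<eta>' s) n * of_real (\<phi> s))"
    proof (cases "n = 0")
      case False
      have E: "integral\<^sup>L Hl (\<lambda>s. L2i ell (dx ell (\<eta> s)) (dx ell (sinb ell n)) * of_real (deriv \<phi> s))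
          = - integral\<^sup>L Hl (\<lambda>s. L2i ell (dx ell (\<eta>' s)) (dx ell (sinb ell n)) * of_real (\<phi> s))"
        using sd \<phi> H10_sinb[OF ell, of n] unfolding sderiv_def by blast
      have "of_real ((freq ell n)\<^sup>2) * (CLINT s|Hl. sinc ell (\<eta> s) n * of_real (deriv \<phi> s))
          = - (of_real ((freq ell n)\<^sup>2) * (CLINT s|Hl. sinc ell (\<eta>' s) n * of_real (\<phi> s)))"
      proof -
        note p1 = Mem_pairing_sinb[OF \<eta> test_fun_weight(2)[OF \<phi>'] C', where n=n]
        note p2 = Mem_pairing_sinb[OF \<eta>' test_fun_weight(2)[OF \<phi>] C, where n=n]
        show ?thesis by (rule trans[OF p1[symmetric] trans[OF E arg_cong[OF p2, of uminus]]])
      qed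
      then have e: "of_real ((freq ell n)\<^sup>2) * (CLINT s|Hl. sinc ell (\<eta> s) n * of_real (deriv \<phi> s))
          = of_real ((freq ell n)\<^sup>2) * (- (CLINT s|Hl. sinc ell (\<eta>' s) n * of_real (\<phi> s)))"
        by (simp only: mult_minus_right)
      have ne: "complex_of_real ((freq ell n)\<^sup>2) \<noteq> 0" using freq_pos[OF ell, of n] False by simp
      show ?thesis by (rule mult_left_cancel[OF ne, THEN iffD1, OF e])
    qed simp
  qed
next
  assume h: "\<forall>n. hwd (\<lambda>s. sinc ell (\<eta> s) n) (\<lambda>s. sinc ell (\<eta>' s) n)"
  show "sderiv ell \<eta> \<eta>'" unfolding sderiv_def
  proof (intro allI impI)
    fix \<phi> v assume A: "test_fun {0<..} \<phi> \<and> H10 ell v"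
    then have \<phi>: "test_fun {0<..} \<phi>" and v: "H10 ell v" by auto
    note \<phi>' = test_fun_deriv[OF \<phi>]
    obtain C where C: "\<And>s. 0 < s \<Longrightarrow> \<bar>\<phi> s\<bar> \<le> C * mu s" using test_fun_weight(1)[OF \<phi>] by blast
    obtain C' where C': "\<And>s. 0 < s \<Longrightarrow> \<bar>deriv \<phi> s\<bar> \<le> C' * mu s" using test_fun_weight(1)[OF \<phi>'] by blast
    note 1 = Mem_pairing[OF \<eta> v test_fun_weight(2)[OF \<phi>'] C']
    note 2 = sums_minus[OF Mem_pairing[OF \<eta>' v test_fun_weight(2)[OF \<phi>] C]]
    have e: "(CLINT s|Hl. sinc ell (\<eta> s) n * of_real (deriv \<phi> s)) = - (CLINT s|Hl. sinc ell (\<eta>' s) n * of_real (\<phi> s))" for n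
      using h \<phi> unfolding hwd_def by blast
    show "(CLINT s|Hl. L2i ell (dx ell (\<eta> s)) (dx ell v) * of_real (deriv \<phi> s)) = - (CLINT s|Hl. L2i ell (dx ell (\<eta>' s)) (dx ell v) * of_real (\<phi> s))"
      using sums_unique2[OF 1[unfolded e mult_minus_right] 2] .
  qed
qed

end

section \<open>Independence of representatives\<close>

lemma weak_deriv_cong_left:
  assumes "L2 ell f" "AE x in Om ell. f x = f' x" shows "weak_deriv ell f g \<longleftrightarrow> weak_deriv ell f' g"
proof -
  have "L2i ell f (\<lambda>x. of_real (deriv \<phi> x)) = L2i ell f' (\<lambda>x. of_real (deriv \<phi> x))" if "test_fun {0<..<ell} \<phi>" for \<phi>
    by (intro L2i_cong_AE assms L2_of_real_smooth smooth_fun_deriv test_fun_smooth[OF that]) simp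
  then show ?thesis unfolding weak_deriv_def L2i_of_real[symmetric] by simp
qed

text \<open>An equality everywhere and not only a.e.: both choices are made by the same description
  from the same set of weak derivatives.\<close>

lemma dx_cong_AE:
  assumes "L2 ell f" "AE x in Om ell. f x = f' x" shows "dx ell f = dx ell f'"
  unfolding dx_def weak_deriv_cong_left[OF assms] ..

lemma H10_cong_AE:
  assumes "0 < ell" "H10 ell f" "AE x in Om ell. f x = f' x" shows "H10 ell f'"
  using assms sinc_cong_AE[OF assms(3) H10_L2[OF assms(2)]] L2_cong_AE[OF H10_L2[OF assms(2)] assms(3)]
  by (simp add: H10_iff)

lemma H10_lin: assumes "0 < ell" "H10 ell f" "H10 ell g" shows "H10 ell (\<lambda>x. c * f x + g x)"
proof -
  have "sqs (\<lambda>n. c * (of_real (freq ell n) * sinc ell f n) + of_real (freq ell n) * sinc ell g n)"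
    using assms by (intro sqs_add sqs_cmult) (auto simp: H10_iff)
  then have "sqs (\<lambda>n. of_real (freq ell n) * sinc ell (\<lambda>x. c * f x + g x) n)"
    using H10_L2[OF assms(2)] H10_L2[OF assms(3)] by (simp add: sinc_add sinc_cmult L2_cmult algebra_simps)
  then show ?thesis
    using H10_L2[OF assms(2)] H10_L2[OF assms(3)] by (simp add: H10_iff[OF assms(1)] L2_add L2_cmult)
qed

lemma hwd_cong_AE:
  assumes "hwd f g" "\<And>L. L > 0 \<Longrightarrow> L2 L f" "\<And>L. L > 0 \<Longrightarrow> L2 L g"
    "AE s in Hl. f s = f' s" "AE s in Hl. g s = g' s"
  shows "hwd f' g'"
  unfolding hwd_iff
proof (intro allI impI)
  fix L :: real assume L: "L > 0"
  have ae: "AE s in Om L. f s = f' s" "AE s in Om L. g s = g' s"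
    subgoal by (rule AE_lebesgue_on_subset[OF assms(4)]) auto
    subgoal by (rule AE_lebesgue_on_subset[OF assms(5)]) auto
    done
  have "weak_deriv L f g" using assms(1) L unfolding hwd_iff by blast
  from weak_deriv_cong_AE[OF this assms(2)[OF L] assms(3)[OF L] ae] show "weak_deriv L f' g'" .
qed

section \<open>The vector-valued memory equation\<close>

context mem_space
begin

lemma Mem_cong_AE:
  assumes \<eta>: "Mem ell mu \<eta>" and ae: "AE s in Hl. AE x in Om ell. \<eta> s x = \<eta>' s x"
  shows "Mem ell mu \<eta>'" "Memn2 ell mu \<eta>' = Memn2 ell mu \<eta>"
proof -
  have H: "AE s in Hl. H10 ell (\<eta>' s) \<and> dx ell (\<eta>' s) = dx ell (\<eta> s)"
    using Mem_H10[OF \<eta>] ae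
    by eventually_elim (auto intro: H10_cong_AE[OF ell] dx_cong_AE[symmetric] H10_L2)
  have int: "integrable Hl (\<lambda>s. mu s * (L2n ell (dx ell (\<eta> s)))\<^sup>2)" using \<eta> by (simp add: Mem_def)
  have aen: "AE s in Hl. mu s * (L2n ell (dx ell (\<eta> s)))\<^sup>2 = mu s * (L2n ell (dx ell (\<eta>' s)))\<^sup>2"
    using H by eventually_elim simp
  have [measurable]: "(\<lambda>s. mu s * (L2n ell (dx ell (\<eta>' s)))\<^sup>2) \<in> borel_measurable Hl"
    by (rule borel_measurable_lebesgue_on_AE[OF _ aen]) (use int in auto)
  show "Memn2 ell mu \<eta>' = Memn2 ell mu \<eta>"
    unfolding Memn2_def by (rule integral_cong_AE) (use int aen in auto)
  show "Mem ell mu \<eta>'" unfolding Mem_def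
  proof (intro conjI allI impI)
    show "AE s in Hl. H10 ell (\<eta>' s)" using H by eventually_elim simp
    show "integrable Hl (\<lambda>s. mu s * (L2n ell (dx ell (\<eta>' s)))\<^sup>2)"
      using integrable_cong_AE[OF _ _ aen] int by auto
    fix g assume "L2 ell g"
    then have "(\<lambda>s. L2i ell (dx ell (\<eta> s)) g) \<in> borel_measurable Hl" using \<eta> by (simp add: Mem_def)
    moreover have "AE s in Hl. L2i ell (dx ell (\<eta> s)) g = L2i ell (dx ell (\<eta>' s)) g" using H by eventually_elim simp
    ultimately show "(\<lambda>s. L2i ell (dx ell (\<eta>' s)) g) \<in> borel_measurable Hl"
      by (rule borel_measurable_lebesgue_on_AE) simp
  qed
qed

lemma Mem_const: assumes "H10 ell \<theta>" shows "Mem ell mu (\<lambda>s. \<theta>)"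
  using assms mu_int by (simp add: Mem_def)

text \<open>\<open>dx\<close> of a combination is a fresh choice, so the combination is rebuilt from
  its modes by \<open>Mem_of_modes\<close> and identified with the pointwise one a.e.\<close>

lemma Mem_lin:
  assumes "Mem ell mu \<eta>" "Mem ell mu \<zeta>"
  shows "Mem ell mu (\<lambda>s x. c * \<eta> s x + \<zeta> s x)"
proof -
  let ?c = "\<lambda>s n. c * sinc ell (\<eta> s) n + sinc ell (\<zeta> s) n"
  have LMc: "LM (\<lambda>s. ?c s n)" for n by (intro LM_add LM_cmult Mem_LM assms)
  have "summable (\<lambda>n. (freq ell n)\<^sup>2 * LMn (\<lambda>s. ?c s n))"
  proof (rule summable_comparison_test')
    show "summable (\<lambda>n. 2 * (cmod c)\<^sup>2 * ((freq ell n)\<^sup>2 * LMn (\<lambda>s. sinc ell (\<eta> s) n)) + 2 * ((freq ell n)\<^sup>2 * LMn (\<lambda>s. sinc ell (\<zeta> s) n)))"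
      using Mem_sums[OF assms(1)] Mem_sums[OF assms(2)] by (intro summable_add summable_mult) (auto simp: sums_iff)
    fix n
    have "LMn (\<lambda>s. ?c s n) \<le> 2 * ((cmod c)\<^sup>2 * LMn (\<lambda>s. sinc ell (\<eta> s) n)) + 2 * LMn (\<lambda>s. sinc ell (\<zeta> s) n)"
      using LM_add(2)[OF LM_cmult(1)[OF Mem_LM[OF assms(1)]] Mem_LM[OF assms(2)]] by (simp add: LM_cmult(2)[OF Mem_LM[OF assms(1)]])
    from mult_left_mono[OF this zero_le_power2[of "freq ell n"]]
    show "norm ((freq ell n)\<^sup>2 * LMn (\<lambda>s. ?c s n)) \<le> 2 * (cmod c)\<^sup>2 * ((freq ell n)\<^sup>2 * LMn (\<lambda>s. sinc ell (\<eta> s) n)) + 2 * ((freq ell n)\<^sup>2 * LMn (\<lambda>s. sinc ell (\<zeta> s) n))"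
      using LMn_nonneg by (simp add: abs_mult algebra_simps)
  qed
  from Mem_of_modes[OF _ LMc this] obtain \<kappa> where \<kappa>: "Mem ell mu \<kappa>" "AE s in Hl. \<forall>n. sinc ell (\<kappa> s) n = ?c s n" by auto
  have "AE s in Hl. AE x in Om ell. \<kappa> s x = c * \<eta> s x + \<zeta> s x"
    using Mem_H10[OF \<kappa>(1)] Mem_H10[OF assms(1)] Mem_H10[OF assms(2)] \<kappa>(2)
  proof eventually_elim
    case (elim s)
    note L = H10_L2[OF elim(1)] H10_L2[OF elim(2)] H10_L2[OF elim(3)]
    show ?case by (rule sinc_eq_AE[OF ell]) (use L elim(4) in \<open>auto intro: L2_add L2_cmult simp: sinc_add sinc_cmult L2_cmult\<close>)
  qed
  from Mem_cong_AE(1)[OF \<kappa>(1) this] show ?thesis .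
qed

lemma DT_Top:
  assumes "DT ell mu \<eta>"
  obtains \<eta>' where "Mem ell mu \<eta>'" "sderiv ell \<eta> \<eta>'" "Top ell mu \<eta> = (\<lambda>s x. - \<eta>' s x)"
proof -
  have "\<exists>\<eta>'. Mem ell mu \<eta>' \<and> sderiv ell \<eta> \<eta>'" using assms by (simp add: DT_def)
  from someI_ex[OF this] show ?thesis by (intro that[of "SOME \<eta>'. Mem ell mu \<eta>' \<and> sderiv ell \<eta> \<eta>'"]) (auto simp: Top_def)
qed

lemma DT_Mem: "DT ell mu \<eta> \<Longrightarrow> Mem ell mu \<eta>" by (simp add: DT_def)

lemma Mem_shift:
  assumes "DT ell mu \<eta>" "H10 ell \<theta>"
  shows "Mem ell mu (\<lambda>s x. c * \<eta> s x - (Top ell mu \<eta> s x + \<theta> x))"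
proof -
  obtain \<eta>' where \<eta>': "Mem ell mu \<eta>'" "sderiv ell \<eta> \<eta>'" "Top ell mu \<eta> = (\<lambda>s x. - \<eta>' s x)" by (rule DT_Top[OF assms(1)])
  have "Mem ell mu (\<lambda>s x. c * \<eta> s x + ((-1) * \<theta> x + \<eta>' s x))"
    by (intro Mem_lin DT_Mem assms Mem_const \<eta>')
  then show ?thesis by (simp add: \<eta>'(3) algebra_simps)
qed

lemma DT_lim:
  assumes "DT ell mu \<eta>" "0 < e"
  shows "\<exists>\<delta>>0. AE s in Hl. s < \<delta> \<longrightarrow> cmod (sinc ell (\<eta> s) n) < e"
proof (cases "n = 0")
  case True
  then show ?thesis using assms(2) by (intro exI[of _ 1]) auto
next
  case False
  then have a: "0 < freq ell n" using freq_pos[OF ell] by simp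
  have "0 < e * freq ell n" using a assms by simp
  then obtain \<delta> where \<delta>: "\<delta> > 0" "AE s in Hl. s < \<delta> \<longrightarrow> L2n ell (dx ell (\<eta> s)) < e * freq ell n"
    using assms(1) unfolding DT_def by blast
  have "AE s in Hl. s < \<delta> \<longrightarrow> cmod (sinc ell (\<eta> s) n) < e"
    using \<delta>(2) Mem_H10[OF DT_Mem[OF assms(1)]]
  proof eventually_elim
    case (elim s)
    have "(freq ell n * cmod (sinc ell (\<eta> s) n))\<^sup>2 \<le> (L2n ell (dx ell (\<eta> s)))\<^sup>2"
      using freq_mult_cmod_sinc_le[OF elim(2), of n] by (simp add: power_mult_distrib)
    then have "freq ell n * cmod (sinc ell (\<eta> s) n) \<le> L2n ell (dx ell (\<eta> s))" by (rule power2_le_imp_le) simp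
    show ?case
    proof
      assume "s < \<delta>"
      then have "freq ell n * cmod (sinc ell (\<eta> s) n) < freq ell n * e"
        using elim(1) \<open>freq ell n * cmod (sinc ell (\<eta> s) n) \<le> _\<close> by (simp add: mult.commute)
      then show "cmod (sinc ell (\<eta> s) n) < e" using a by simp
    qed
  qed
  then show ?thesis using \<delta>(1) by blast
qed

text \<open>In each sine mode the equation reads u' + \<i> \<beta> u = source with zero trace, which
  \<open>hwd_unique\<close> settles. Every solution is thus given by Duhamel's formula.\<close>

lemma memory_unique:
  assumes \<eta>: "DT ell mu \<eta>" and F: "Mem ell mu F" and \<theta>: "H10 ell \<theta>"
    and eq: "AE s in Hl. AE x in Om ell. \<i> * of_real \<beta> * \<eta> s x - (Top ell mu \<eta> s x + \<theta> x) = F s x"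
  shows "AE s in Hl. sinc ell (\<eta> s) n = mem_E \<beta> (\<lambda>t. sinc ell \<theta> n + sinc ell (F t) n) s"
proof -
  obtain \<eta>' where \<eta>': "Mem ell mu \<eta>'" "sderiv ell \<eta> \<eta>'" "Top ell mu \<eta> = (\<lambda>s x. - \<eta>' s x)" by (rule DT_Top[OF \<eta>])
  have "AE s in Hl. sinc ell (\<eta>' s) n = (sinc ell \<theta> n + sinc ell (F s) n) - \<i> * of_real \<beta> * sinc ell (\<eta> s) n"
    using eq Mem_H10[OF F] Mem_H10[OF DT_Mem[OF \<eta>]] Mem_H10[OF \<eta>'(1)]
  proof eventually_elim
    case (elim s)
    note L = H10_L2[OF elim(2)] H10_L2[OF elim(3)] H10_L2[OF elim(4)] H10_L2[OF \<theta>]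
    have "AE x in Om ell. \<eta>' s x = (\<theta> x + F s x) - (\<i> * of_real \<beta>) * \<eta> s x"
      using elim(1) by eventually_elim (auto simp: \<eta>'(3) algebra_simps)
    from sinc_cong_AE[OF this L(3), of n] show ?case
      using L by (simp add: sinc_diff sinc_add sinc_cmult L2_add L2_cmult)
  qed
  then show ?thesis
    by (rule hwd_unique[where g="\<lambda>s. sinc ell (\<eta>' s) n", rotated 4])
       (use \<eta>' \<eta> F sderiv_iff[OF DT_Mem[OF \<eta>] \<eta>'(1)] in \<open>auto intro!: LM_L2 Mem_LM LM_add LM_const DT_Mem DT_lim\<close>)
qed

text \<open>Duhamel's formula in each mode. The constants in \<open>LM_mem_E\<close> are the same
  for all modes, so the solutions and their s-derivatives assemble to elements of the memory space;
  the zero trace comes from \<open>mem_E_bound\<close>.\<close>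

lemma memory_solve:
  assumes F: "Mem ell mu F" and \<theta>: "H10 ell \<theta>"
  shows "\<exists>\<eta>. DT ell mu \<eta> \<and> (AE s in Hl. AE x in Om ell. \<i> * of_real \<beta> * \<eta> s x - (Top ell mu \<eta> s x + \<theta> x) = F s x)"
proof -
  define h where "h n t = sinc ell \<theta> n + sinc ell (F t) n" for n t
  define c where "c s n = mem_E \<beta> (h n) s" for s n
  define c' where "c' s n = h n s - \<i> * of_real \<beta> * c s n" for s n
  have LMh: "LM (h n)" for n unfolding h_def by (intro LM_add LM_const Mem_LM F)
  have LMc: "LM (\<lambda>s. c s n)" for n using LM_mem_E(1)[OF LMh[of n], of \<beta>] by (simp add: c_def)
  have LMc': "LM (\<lambda>s. c' s n)" for n unfolding c'_def by (intro LM_diff LMh LM_cmult LMc)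
  have h0: "h 0 = (\<lambda>t. 0)" by (simp add: h_def fun_eq_iff)
  have c0: "c s 0 = 0" "c' s 0 = 0" for s by (simp_all add: c_def c'_def h0 mem_E_def)
  have sh: "summable (\<lambda>n. (freq ell n)\<^sup>2 * LMn (h n))"
  proof (rule summable_comparison_test')
    show "summable (\<lambda>n. 2 * integral\<^sup>L Hl mu * ((freq ell n)\<^sup>2 * (cmod (sinc ell \<theta> n))\<^sup>2) + 2 * ((freq ell n)\<^sup>2 * LMn (\<lambda>s. sinc ell (F s) n)))"
      using L2n_dx_sums[OF ell \<theta>] Mem_sums[OF F] by (intro summable_add summable_mult) (auto simp: sums_iff)
    fix n
    have "LMn (h n) \<le> 2 * ((cmod (sinc ell \<theta> n))\<^sup>2 * integral\<^sup>L Hl mu) + 2 * LMn (\<lambda>s. sinc ell (F s) n)"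
      using LM_add(2)[OF LM_const(1)[of "sinc ell \<theta> n"] Mem_LM[OF F, of n]] by (simp add: h_def[abs_def] LM_const(2))
    from mult_left_mono[OF this zero_le_power2[of "freq ell n"]]
    show "norm ((freq ell n)\<^sup>2 * LMn (h n)) \<le> 2 * integral\<^sup>L Hl mu * ((freq ell n)\<^sup>2 * (cmod (sinc ell \<theta> n))\<^sup>2) + 2 * ((freq ell n)\<^sup>2 * LMn (\<lambda>s. sinc ell (F s) n))"
      using LMn_nonneg by (simp add: abs_mult algebra_simps)
  qed
  have sc: "summable (\<lambda>n. (freq ell n)\<^sup>2 * LMn (\<lambda>s. c s n))"
  proof (rule summable_comparison_test')
    show "summable (\<lambda>n. (2 / d)\<^sup>2 * ((freq ell n)\<^sup>2 * LMn (h n)))" using sh by (rule summable_mult)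
    fix n
    have "LMn (\<lambda>s. c s n) \<le> (2 / d)\<^sup>2 * LMn (h n)" using LM_mem_E(2)[OF LMh[of n], of \<beta>] by (simp add: c_def)
    from mult_left_mono[OF this zero_le_power2[of "freq ell n"]]
    show "norm ((freq ell n)\<^sup>2 * LMn (\<lambda>s. c s n)) \<le> (2 / d)\<^sup>2 * ((freq ell n)\<^sup>2 * LMn (h n))"
      using LMn_nonneg by (simp add: abs_mult mult_ac)
  qed
  have sc': "summable (\<lambda>n. (freq ell n)\<^sup>2 * LMn (\<lambda>s. c' s n))"
  proof (rule summable_comparison_test')
    show "summable (\<lambda>n. 2 * ((freq ell n)\<^sup>2 * LMn (h n)) + 2 * \<beta>\<^sup>2 * ((freq ell n)\<^sup>2 * LMn (\<lambda>s. c s n)))"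
      by (intro summable_add summable_mult sh sc)
    fix n
    have "LMn (\<lambda>s. h n s + (- (\<i> * of_real \<beta>)) * c s n) \<le> 2 * LMn (h n) + 2 * LMn (\<lambda>s. (- (\<i> * of_real \<beta>)) * c s n)"
      by (rule LM_add(2)[OF LMh LM_cmult(1)[OF LMc]])
    then have "LMn (\<lambda>s. c' s n) \<le> 2 * LMn (h n) + 2 * (\<beta>\<^sup>2 * LMn (\<lambda>s. c s n))"
      unfolding LM_cmult(2)[OF LMc] by (simp add: c'_def norm_mult)
    from mult_left_mono[OF this zero_le_power2[of "freq ell n"]]
    show "norm ((freq ell n)\<^sup>2 * LMn (\<lambda>s. c' s n)) \<le> 2 * ((freq ell n)\<^sup>2 * LMn (h n)) + 2 * \<beta>\<^sup>2 * ((freq ell n)\<^sup>2 * LMn (\<lambda>s. c s n))"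
      using LMn_nonneg by (simp add: abs_mult algebra_simps)
  qed
  obtain \<eta> where \<eta>: "Mem ell mu \<eta>" "AE s in Hl. \<forall>n. sinc ell (\<eta> s) n = c s n"
    using Mem_of_modes[OF c0(1) LMc sc] by blast
  obtain \<eta>1 where \<eta>1: "Mem ell mu \<eta>1" "AE s in Hl. \<forall>n. sinc ell (\<eta>1 s) n = c' s n"
    using Mem_of_modes[OF c0(2) LMc' sc'] by blast
  have hw: "hwd (\<lambda>s. sinc ell (\<eta> s) n) (\<lambda>s. c' s n)" for n
  proof (rule hwd_cong_AE)
    show "hwd (\<lambda>s. c s n) (\<lambda>s. c' s n)"
      using hwd_mem_E[of "h n" \<beta>] LM_L2[OF LMh] by (simp add: c_def c'_def)
    show "AE s in Hl. c s n = sinc ell (\<eta> s) n" using \<eta>(2) by eventually_elim simp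
  qed (use LM_L2[OF LMc] LM_L2[OF LMc'] in auto)
  have "hwd (\<lambda>s. sinc ell (\<eta> s) n) (\<lambda>s. sinc ell (\<eta>1 s) n)" for n
  proof (rule hwd_cong_AE[OF hw])
    show "AE s in Hl. c' s n = sinc ell (\<eta>1 s) n" using \<eta>1(2) by eventually_elim simp
  qed (use LM_L2[OF Mem_LM[OF \<eta>(1)]] LM_L2[OF LMc'] in auto)
  then have sd: "sderiv ell \<eta> \<eta>1" by (simp add: sderiv_iff[OF \<eta>(1) \<eta>1(1)])
  have lim: "\<exists>\<delta>>0. AE s in Hl. s < \<delta> \<longrightarrow> L2n ell (dx ell (\<eta> s)) < \<epsilon>" if \<epsilon>: "\<epsilon> > 0" for \<epsilon>
  proof -
    define K where "K = (\<Sum>n. (freq ell n)\<^sup>2 * LMn (h n))"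
    have K: "0 \<le> K" unfolding K_def by (intro suminf_nonneg sh) (use LMn_nonneg in simp)
    \<comment> \<open>The factor s stems from Cauchy-Schwarz in \<open>mem_E_bound\<close>, and
      \<open>mu s\<close> is at least \<open>mu 1\<close> for s < 1, so the estimate tends to 0
      uniformly in the modes.\<close>
    have bound: "(L2n ell (dx ell (\<eta> s)))\<^sup>2 \<le> s / mu 1 * K"
      if s: "0 < s" "s < 1" "H10 ell (\<eta> s)" "\<forall>n. sinc ell (\<eta> s) n = c s n" for s
    proof (rule sums_le[OF _ L2n_dx_sums[OF ell s(3)]])
      show "(\<lambda>n. s / mu 1 * ((freq ell n)\<^sup>2 * LMn (h n))) sums (s / mu 1 * K)"
        unfolding K_def using sh by (intro sums_mult summable_sums)
      fix n
      have "(cmod (c s n))\<^sup>2 \<le> s * integral\<^sup>L (Om s) (\<lambda>t. (cmod (h n t))\<^sup>2)"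
        unfolding c_def by (rule mem_E_bound) (use s LM_L2[OF LMh] in auto)
      also have "\<dots> \<le> s * (LMn (h n) / mu s)" by (intro mult_left_mono LM_Om_le LMh s) (use s in auto)
      also have "\<dots> \<le> s * (LMn (h n) / mu 1)"
        using s mu_dec[of s 1] mu_pos[of 1] LMn_nonneg by (intro mult_left_mono divide_left_mono) (auto intro: mult_pos_pos mu_pos)
      finally show "(freq ell n)\<^sup>2 * (cmod (sinc ell (\<eta> s) n))\<^sup>2 \<le> s / mu 1 * ((freq ell n)\<^sup>2 * LMn (h n))"
        using s(4) mult_left_mono[of "(cmod (c s n))\<^sup>2" _ "(freq ell n)\<^sup>2"] by (fastforce simp: mult_ac)
    qed
    \<comment> \<open>Makes s (K + 1) / mu 1 smaller than \<epsilon>^2; K + 1 in place of K keeps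
      the quotient meaningful for K = 0.\<close>
    define \<delta> where "\<delta> = min 1 (\<epsilon>\<^sup>2 * mu 1 / (K + 1))"
    have \<delta>0: "\<delta> > 0" using \<epsilon> mu_pos[of 1] K by (simp add: \<delta>_def)
    have "AE s in Hl. s < \<delta> \<longrightarrow> L2n ell (dx ell (\<eta> s)) < \<epsilon>"
      using Mem_H10[OF \<eta>(1)] \<eta>(2) AE_space
    proof eventually_elim
      case (elim s)
      show ?case
      proof
        assume s: "s < \<delta>"
        have s0: "0 < s" using elim by simp
        have "(L2n ell (dx ell (\<eta> s)))\<^sup>2 \<le> s / mu 1 * K" by (rule bound) (use s0 s elim in \<open>auto simp: \<delta>_def\<close>)
        also have "\<dots> \<le> s / mu 1 * (K + 1)" using s0 mu_pos[of 1] by (intro mult_left_mono) auto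
        also have "\<dots> < \<epsilon>\<^sup>2" using s K mu_pos[of 1] by (simp add: \<delta>_def field_simps)
        finally show "L2n ell (dx ell (\<eta> s)) < \<epsilon>" by (rule power2_less_imp_less) (use \<epsilon> in simp)
      qed
    qed
    then show ?thesis using \<delta>0 by blast
  qed
  have DT: "DT ell mu \<eta>" unfolding DT_def using \<eta>(1) \<eta>1(1) sd lim by blast
  obtain \<eta>' where \<eta>': "Mem ell mu \<eta>'" "sderiv ell \<eta> \<eta>'" "Top ell mu \<eta> = (\<lambda>s x. - \<eta>' s x)" by (rule DT_Top[OF DT])
  \<comment> \<open>\<open>Top\<close> may have chosen another s-derivative than the one
    constructed; in each mode the two agree a.e.\<close>
  have "AE s in Hl. \<forall>n. sinc ell (\<eta>' s) n = c' s n"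
    unfolding AE_all_countable
  proof
    fix n
    show "AE s in Hl. sinc ell (\<eta>' s) n = c' s n"
      by (rule hwd_deriv_unique[OF _ _ _ _ hw])
         (use \<eta>' sderiv_iff[OF \<eta>(1) \<eta>'(1)] \<eta>(1) in \<open>auto intro!: LM_L2 Mem_LM LMc'\<close>)
  qed
  then have "AE s in Hl. AE x in Om ell. \<i> * of_real \<beta> * \<eta> s x - (Top ell mu \<eta> s x + \<theta> x) = F s x"
    using Mem_H10[OF \<eta>(1)] Mem_H10[OF \<eta>'(1)] Mem_H10[OF F] \<eta>(2)
  proof eventually_elim
    case (elim s)
    note L = H10_L2[OF elim(2)] H10_L2[OF elim(3)] H10_L2[OF elim(4)] H10_L2[OF \<theta>]
    have "AE x in Om ell. (\<i> * of_real \<beta>) * \<eta> s x + (\<eta>' s x - \<theta> x) = F s x"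
      by (rule sinc_eq_AE[OF ell])
         (use L elim in \<open>auto intro!: L2_add L2_cmult L2_diff simp: sinc_add sinc_diff sinc_cmult L2_cmult L2_diff c'_def h_def\<close>)
    then show ?case by eventually_elim (simp add: \<eta>'(3) algebra_simps)
  qed
  with DT show ?thesis by blast
qed

end

section \<open>The resolvent equation\<close>

text \<open>Integrability and the coefficient sequence are bundled so that the coefficients of a
  compound expression can be derived by structural rules.\<close>

definition has_sinc :: "real \<Rightarrow> (real \<Rightarrow> complex) \<Rightarrow> (nat \<Rightarrow> complex) \<Rightarrow> bool" where
  "has_sinc ell f c \<longleftrightarrow> L2 ell f \<and> sinc ell f = c"

definition has_cosc :: "real \<Rightarrow> (real \<Rightarrow> complex) \<Rightarrow> (nat \<Rightarrow> complex) \<Rightarrow> bool" where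
  "has_cosc ell f c \<longleftrightarrow> L2 ell f \<and> cosc ell f = c"

lemma has_sinc_add: "has_sinc ell f c \<Longrightarrow> has_sinc ell g d \<Longrightarrow> has_sinc ell (\<lambda>x. f x + g x) (\<lambda>n. c n + d n)"
  and has_sinc_diff: "has_sinc ell f c \<Longrightarrow> has_sinc ell g d \<Longrightarrow> has_sinc ell (\<lambda>x. f x - g x) (\<lambda>n. c n - d n)"
  and has_sinc_cmult: "has_sinc ell f c \<Longrightarrow> has_sinc ell (\<lambda>x. z * f x) (\<lambda>n. z * c n)"
  by (auto simp: has_sinc_def L2_add L2_diff L2_cmult sinc_add sinc_diff sinc_cmult)

lemma has_cosc_add: "has_cosc ell f c \<Longrightarrow> has_cosc ell g d \<Longrightarrow> has_cosc ell (\<lambda>x. f x + g x) (\<lambda>n. c n + d n)"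
  and has_cosc_diff: "has_cosc ell f c \<Longrightarrow> has_cosc ell g d \<Longrightarrow> has_cosc ell (\<lambda>x. f x - g x) (\<lambda>n. c n - d n)"
  and has_cosc_cmult: "has_cosc ell f c \<Longrightarrow> has_cosc ell (\<lambda>x. z * f x) (\<lambda>n. z * c n)"
  by (auto simp: has_cosc_def L2_add L2_diff L2_cmult cosc_add cosc_diff cosc_cmult)

lemma has_cosc_dx: "0 < ell \<Longrightarrow> H10 ell f \<Longrightarrow> has_cosc ell (dx ell f) (\<lambda>n. of_real (freq ell n) * sinc ell f n)"
  by (auto simp: has_cosc_def H10_L2_dx cosc_dx)

lemma has_sinc_dx: "0 < ell \<Longrightarrow> H1 ell f \<Longrightarrow> has_sinc ell (dx ell f) (\<lambda>n. - of_real (freq ell n) * cosc ell f n)"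
  by (auto simp: has_sinc_def H1_dx sinc_dx)

lemma has_sinc_L2: "L2 ell f \<Longrightarrow> has_sinc ell f (sinc ell f)" by (simp add: has_sinc_def)
lemma has_cosc_L2: "L2 ell f \<Longrightarrow> has_cosc ell f (cosc ell f)" by (simp add: has_cosc_def)

lemma H1_lin: assumes "0 < ell" "H1 ell f" "H1 ell g" shows "H1 ell (\<lambda>x. c * f x + g x)"
proof -
  have "sqs (\<lambda>n. c * (of_real (freq ell n) * cosc ell f n) + of_real (freq ell n) * cosc ell g n)"
    using assms by (intro sqs_add sqs_cmult) (auto simp: H1_iff)
  then have "sqs (\<lambda>n. of_real (freq ell n) * cosc ell (\<lambda>x. c * f x + g x) n)"
    using H1_L2[OF assms(2)] H1_L2[OF assms(3)] by (simp add: cosc_add cosc_cmult L2_cmult algebra_simps)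
  then show ?thesis
    using H1_L2[OF assms(2)] H1_L2[OF assms(3)] by (simp add: H1_iff[OF assms(1)] L2_add L2_cmult)
qed

locale thermo = M: mem_space mu dm ell + N: mem_space nu dn ell
  for mu dm nu dn ell +
  fixes \<rho>1 \<rho>2 \<rho>3 k k0 b \<omega> l \<gamma> \<beta> :: real
  assumes tpos: "0 < \<rho>1" "0 < \<rho>2" "0 < \<rho>3" "0 < k" "0 < k0" "0 < b" "0 < \<omega>" "0 < l" "0 < \<gamma>"
    and tnonres: "\<And>n::nat. 0 < n \<Longrightarrow> l * ell \<noteq> real n * pi"
begin

sublocale B: bresse \<rho>1 \<rho>2 \<rho>3 k k0 b \<omega> l \<gamma> \<beta> "M.kc \<beta>" "N.kc \<beta>" ell
  by unfold_locales (use tpos tnonres M.ell M.Re_kc_pos N.Re_kc_pos in auto)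

definition sh :: "state \<Rightarrow> state" where
  "sh U = shiftA ell \<rho>1 \<rho>2 \<rho>3 k k0 b \<omega> l \<gamma> mu nu (\<i> * of_real \<beta>) U"

text \<open>The coefficients of the eight components other than the memories, written in the shape
  in which the operator produces them; I and J are the coefficients of the two memory
  integrals.\<close>

definition mode_sys :: "real \<Rightarrow> complex \<Rightarrow> complex \<Rightarrow> complex \<Rightarrow> complex \<Rightarrow> complex \<Rightarrow> complex \<Rightarrow> complex \<Rightarrow> complex \<Rightarrow> complex \<Rightarrow> complex
    \<Rightarrow> complex \<Rightarrow> complex \<Rightarrow> complex \<Rightarrow> complex \<Rightarrow> complex \<Rightarrow> complex \<Rightarrow> complex \<Rightarrow> complex \<Rightarrow> bool" where
  "mode_sys a p P q Q w W t x I J f1 f2 f3 f4 f5 f6 f7 f9 \<longleftrightarrow>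
    \<i> * of_real \<beta> * p - P = f1 \<and> \<i> * of_real \<beta> * q - Q = f3 \<and> \<i> * of_real \<beta> * w - W = f5 \<and>
    \<i> * of_real \<beta> * P - (of_real (k/\<rho>1) * (- of_real a * (of_real a * p + q + of_real l * w))
       + of_real (l*k0/\<rho>1) * (- of_real a * w - of_real l * p) - of_real (l*\<gamma>/\<rho>1) * x) = f2 \<and>
    \<i> * of_real \<beta> * Q - (of_real (b/\<rho>2) * (of_real a * (- of_real a * q))
       - of_real (k/\<rho>2) * (of_real a * p + q + of_real l * w) - of_real (\<gamma>/\<rho>2) * (of_real a * t)) = f4 \<and>
    \<i> * of_real \<beta> * W - (of_real (k0/\<rho>1) * (of_real a * (- of_real a * w - of_real l * p))
       - of_real (l*k/\<rho>1) * (of_real a * p + q + of_real l * w) - of_real (\<gamma>/\<rho>1) * (of_real a * x)) = f6 \<and>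
    \<i> * of_real \<beta> * t - (of_real (\<omega>/\<rho>3) * (- of_real a * (of_real a * I)) - of_real (\<gamma>/\<rho>3) * (- of_real a * Q)) = f7 \<and>
    \<i> * of_real \<beta> * x - (of_real (\<omega>/\<rho>3) * (- of_real a * (of_real a * J)) - of_real (\<gamma>/\<rho>3) * (- of_real a * W - of_real l * P)) = f9"

text \<open>The assumptions are the solved memory equations. The first three equations eliminate the
  velocities, after which the other five agree with \<open>Mop\<close> up to the density
  factors.\<close>

lemma mode_sys_iff:
  assumes "I = M.kc \<beta> * t + IE" "J = N.kc \<beta> * x + JE"
  shows "mode_sys a p P q Q w W t x I J f1 f2 f3 f4 f5 f6 f7 f9 \<longleftrightarrow>
     P = \<i> * of_real \<beta> * p - f1 \<and> Q = \<i> * of_real \<beta> * q - f3 \<and> W = \<i> * of_real \<beta> * w - f5 \<and>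
     B.Mop a (p, q, w, t, x) = B.mode_rhs a f1 f2 f3 f4 f5 f6 f7 f9 IE JE"
proof -
  have n: "complex_of_real \<rho>1 \<noteq> 0" "complex_of_real \<rho>2 \<noteq> 0" "complex_of_real \<rho>3 \<noteq> 0" using tpos by auto
  have n': "\<rho>1 \<noteq> 0" "\<rho>2 \<noteq> 0" "\<rho>3 \<noteq> 0" using tpos by auto
  have ii: "\<i> * (\<i> * z) = - z" for z :: complex by (simp add: mult.assoc[symmetric])
  \<comment> \<open>Two equations are equivalent when their residuals differ by a nonzero factor; it
    remains to check a polynomial identity for each.\<close>
  have iff: "L = f \<longleftrightarrow> M = r" if "\<rho> \<noteq> 0" "\<rho> * L - \<rho> * f = M - r" for \<rho> L f M r :: complex
    using that by (metis eq_iff_diff_eq_0 mult_cancel_left)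
  show ?thesis
    unfolding mode_sys_def B.Mop_def B.mode_rhs_def prod.case prod.inject
  proof (intro conj_cong)
    show "\<i> * of_real \<beta> * p - P = f1 \<longleftrightarrow> P = \<i> * of_real \<beta> * p - f1" "\<i> * of_real \<beta> * q - Q = f3 \<longleftrightarrow> Q = \<i> * of_real \<beta> * q - f3"
      "\<i> * of_real \<beta> * w - W = f5 \<longleftrightarrow> W = \<i> * of_real \<beta> * w - f5" by (auto simp: algebra_simps)
  qed ((rule iff[OF n(1)], hypsubst, simp (no_asm) add: assms n' B.M1_def field_simps power2_eq_square ii),
    (rule iff[OF n(2)], hypsubst, simp (no_asm) add: assms n' B.M2_def field_simps power2_eq_square ii),
    (rule iff[OF n(1)], hypsubst, simp (no_asm) add: assms n' B.M3_def field_simps power2_eq_square ii),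
    (rule iff[OF n(3)], hypsubst, simp (no_asm) add: assms n' B.M4_def field_simps power2_eq_square ii),
    (rule iff[OF n(3)], hypsubst, simp (no_asm) add: assms n' B.M5_def field_simps power2_eq_square ii))
qed

text \<open>Differentiating a sine series requires \<open>H10\<close>, differentiating a cosine
  series only \<open>H1\<close>; the conditions in \<open>DA\<close> are distributed in just this
  way.\<close>

lemma sh_modes:
  assumes D: "DA ell mu nu U"
  defines "a \<equiv> \<lambda>n. complex_of_real (freq ell n)"
  defines "p \<equiv> sinc ell (cphi U)" and "P \<equiv> sinc ell (cPhi U)" and "q \<equiv> cosc ell (cpsi U)" and "Q \<equiv> cosc ell (cPsi U)"
    and "w \<equiv> cosc ell (cw U)" and "W \<equiv> cosc ell (cW U)" and "t \<equiv> sinc ell (cth U)" and "x \<equiv> sinc ell (cxi U)"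
    and "I \<equiv> sinc ell (memint ell mu (ceta U))" and "J \<equiv> sinc ell (memint ell nu (czeta U))"
  shows "has_sinc ell (cphi (sh U)) (\<lambda>n. \<i> * of_real \<beta> * p n - P n)"
    "has_sinc ell (cPhi (sh U)) (\<lambda>n. \<i> * of_real \<beta> * P n - (of_real (k/\<rho>1) * (- a n * (a n * p n + q n + of_real l * w n))
       + of_real (l*k0/\<rho>1) * (- a n * w n - of_real l * p n) - of_real (l*\<gamma>/\<rho>1) * x n))"
    "has_cosc ell (cpsi (sh U)) (\<lambda>n. \<i> * of_real \<beta> * q n - Q n)"
    "has_cosc ell (cPsi (sh U)) (\<lambda>n. \<i> * of_real \<beta> * Q n - (of_real (b/\<rho>2) * (a n * (- a n * q n))
       - of_real (k/\<rho>2) * (a n * p n + q n + of_real l * w n) - of_real (\<gamma>/\<rho>2) * (a n * t n)))"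
    "has_cosc ell (cw (sh U)) (\<lambda>n. \<i> * of_real \<beta> * w n - W n)"
    "has_cosc ell (cW (sh U)) (\<lambda>n. \<i> * of_real \<beta> * W n - (of_real (k0/\<rho>1) * (a n * (- a n * w n - of_real l * p n))
       - of_real (l*k/\<rho>1) * (a n * p n + q n + of_real l * w n) - of_real (\<gamma>/\<rho>1) * (a n * x n)))"
    "has_sinc ell (cth (sh U)) (\<lambda>n. \<i> * of_real \<beta> * t n - (of_real (\<omega>/\<rho>3) * (- a n * (a n * I n)) - of_real (\<gamma>/\<rho>3) * (- a n * Q n)))"
    "has_sinc ell (cxi (sh U)) (\<lambda>n. \<i> * of_real \<beta> * x n - (of_real (\<omega>/\<rho>3) * (- a n * (a n * J n)) - of_real (\<gamma>/\<rho>3) * (- a n * W n - of_real l * P n)))"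
    "Mem ell mu (ceta (sh U))" "Mem ell nu (czeta (sh U))"
proof -
  note ell = M.ell
  have D': "H10 ell (cphi U)" "H1 ell (dx ell (cphi U))" "H10 ell (cPhi U)" "H10 ell (dx ell (cpsi U))" "H10 ell (dx ell (cw U))"
    "H1 ell (cpsi U)" "H1 ell (cw U)" "H1 ell (cPsi U)" "H1 ell (cW U)" "H10 ell (cth U)" "H10 ell (cxi U)"
    "H1 ell (dx ell (memint ell mu (ceta U)))" "H1 ell (dx ell (memint ell nu (czeta U)))"
    "Mem ell mu (ceta U)" "Mem ell nu (czeta U)" "DT ell mu (ceta U)" "DT ell nu (czeta U)"
    using D unfolding DA_def inH_def H1s_def H2_def by blast+
  define S where "S = (\<lambda>x. dx ell (cphi U) x + cpsi U x + of_real l * cw U x)"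
  define R where "R = (\<lambda>x. dx ell (cw U) x - of_real l * cphi U x)"
  note L = H10_L2[OF D'(1)] H10_L2[OF D'(3)] H1_L2[OF D'(6)] H1_L2[OF D'(7)] H1_L2[OF D'(8)] H1_L2[OF D'(9)] H10_L2[OF D'(10)] H10_L2[OF D'(11)]
  have s: "has_sinc ell (cphi U) p" "has_sinc ell (cPhi U) P" "has_sinc ell (cth U) t" "has_sinc ell (cxi U) x"
    unfolding p_def P_def t_def x_def by (intro has_sinc_L2 L)+
  have c: "has_cosc ell (cpsi U) q" "has_cosc ell (cPsi U) Q" "has_cosc ell (cw U) w" "has_cosc ell (cW U) W"
    unfolding q_def Q_def w_def W_def by (intro has_cosc_L2 L)+
  have dphi: "has_cosc ell (dx ell (cphi U)) (\<lambda>n. a n * p n)" unfolding a_def p_def by (rule has_cosc_dx[OF ell D'(1)])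
  have dw: "has_sinc ell (dx ell (cw U)) (\<lambda>n. - a n * w n)" unfolding a_def w_def by (rule has_sinc_dx[OF ell D'(7)])
  have dth: "has_cosc ell (dx ell (cth U)) (\<lambda>n. a n * t n)" unfolding a_def t_def by (rule has_cosc_dx[OF ell D'(10)])
  have dxi: "has_cosc ell (dx ell (cxi U)) (\<lambda>n. a n * x n)" unfolding a_def x_def by (rule has_cosc_dx[OF ell D'(11)])
  have dPsi: "has_sinc ell (dx ell (cPsi U)) (\<lambda>n. - a n * Q n)" unfolding a_def Q_def by (rule has_sinc_dx[OF ell D'(8)])
  have dW: "has_sinc ell (dx ell (cW U)) (\<lambda>n. - a n * W n)" unfolding a_def W_def by (rule has_sinc_dx[OF ell D'(9)])
  have cS: "has_cosc ell S (\<lambda>n. a n * p n + q n + of_real l * w n)"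
    unfolding S_def by (intro has_cosc_add has_cosc_cmult c dphi)
  have sR: "has_sinc ell R (\<lambda>n. - a n * w n - of_real l * p n)"
    unfolding R_def by (intro has_sinc_diff has_sinc_cmult s dw)
  \<comment> \<open>The two strains fall into different classes: S is a cosine series in
    \<open>H1\<close>, while R is a sine series in \<open>H10\<close>, since \<open>cphi\<close> and
    the derivative of \<open>cw\<close> both vanish at the ends.\<close>
  have "H1 ell (\<lambda>x. of_real l * cw U x + (1 * dx ell (cphi U) x + cpsi U x))" by (intro H1_lin ell D')
  then have HS: "H1 ell S" by (simp add: S_def add_ac)
  have "H10 ell (\<lambda>x. - of_real l * cphi U x + dx ell (cw U) x)" by (intro H10_lin ell D')
  then have HR: "H10 ell R" by (simp add: R_def)
  have eqS: "cosc ell S = (\<lambda>n. a n * p n + q n + of_real l * w n)" and eqR: "sinc ell R = (\<lambda>n. - a n * w n - of_real l * p n)"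
    using cS sR by (auto simp: has_cosc_def has_sinc_def)
  have dS: "has_sinc ell (dx ell S) (\<lambda>n. - a n * (a n * p n + q n + of_real l * w n))"
    using has_sinc_dx[OF ell HS] unfolding eqS a_def .
  have dR: "has_cosc ell (dx ell R) (\<lambda>n. a n * (- a n * w n - of_real l * p n))"
    using has_cosc_dx[OF ell HR] unfolding eqR a_def .
  have ddpsi: "has_cosc ell (dx ell (dx ell (cpsi U))) (\<lambda>n. a n * (- a n * q n))"
    using has_cosc_dx[OF ell D'(4)] by (simp only: sinc_dx[OF ell D'(6)] a_def q_def)
  have ddI: "has_sinc ell (dx ell (dx ell (memint ell mu (ceta U)))) (\<lambda>n. - a n * (a n * I n))"
    using has_sinc_dx[OF ell D'(12)] by (simp only: cosc_dx[OF ell M.memint_modes(1)[OF D'(14)]] a_def I_def)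
  have ddJ: "has_sinc ell (dx ell (dx ell (memint ell nu (czeta U)))) (\<lambda>n. - a n * (a n * J n))"
    using has_sinc_dx[OF ell D'(13)] by (simp only: cosc_dx[OF ell N.memint_modes(1)[OF D'(15)]] a_def J_def)
  have sel: "cphi (sh U) = (\<lambda>x. \<i> * of_real \<beta> * cphi U x - cPhi U x)"
    "cPhi (sh U) = (\<lambda>x. \<i> * of_real \<beta> * cPhi U x - (of_real (k/\<rho>1) * dx ell S x + of_real (l*k0/\<rho>1) * R x - of_real (l*\<gamma>/\<rho>1) * cxi U x))"
    "cpsi (sh U) = (\<lambda>x. \<i> * of_real \<beta> * cpsi U x - cPsi U x)"
    "cPsi (sh U) = (\<lambda>x. \<i> * of_real \<beta> * cPsi U x - (of_real (b/\<rho>2) * dx ell (dx ell (cpsi U)) x - of_real (k/\<rho>2) * S x - of_real (\<gamma>/\<rho>2) * dx ell (cth U) x))"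
    "cw (sh U) = (\<lambda>x. \<i> * of_real \<beta> * cw U x - cW U x)"
    "cW (sh U) = (\<lambda>x. \<i> * of_real \<beta> * cW U x - (of_real (k0/\<rho>1) * dx ell R x - of_real (l*k/\<rho>1) * S x - of_real (\<gamma>/\<rho>1) * dx ell (cxi U) x))"
    "cth (sh U) = (\<lambda>x. \<i> * of_real \<beta> * cth U x - (of_real (\<omega>/\<rho>3) * dx ell (dx ell (memint ell mu (ceta U))) x - of_real (\<gamma>/\<rho>3) * dx ell (cPsi U) x))"
    "cxi (sh U) = (\<lambda>x. \<i> * of_real \<beta> * cxi U x - (of_real (\<omega>/\<rho>3) * dx ell (dx ell (memint ell nu (czeta U))) x - of_real (\<gamma>/\<rho>3) * (dx ell (cW U) x - of_real l * cPhi U x)))"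
    "ceta (sh U) = (\<lambda>s x. \<i> * of_real \<beta> * ceta U s x - (Top ell mu (ceta U) s x + cth U x))"
    "czeta (sh U) = (\<lambda>s x. \<i> * of_real \<beta> * czeta U s x - (Top ell nu (czeta U) s x + cxi U x))"
    unfolding sh_def shiftA_def Aop_def Let_def S_def R_def by simp_all
  show "has_sinc ell (cphi (sh U)) (\<lambda>n. \<i> * of_real \<beta> * p n - P n)"
    unfolding sel by (intro has_sinc_diff has_sinc_cmult s)
  show "has_sinc ell (cPhi (sh U)) (\<lambda>n. \<i> * of_real \<beta> * P n - (of_real (k/\<rho>1) * (- a n * (a n * p n + q n + of_real l * w n))
       + of_real (l*k0/\<rho>1) * (- a n * w n - of_real l * p n) - of_real (l*\<gamma>/\<rho>1) * x n))"
    unfolding sel by (rule has_sinc_diff has_sinc_add has_sinc_cmult dS sR s)+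
  show "has_cosc ell (cpsi (sh U)) (\<lambda>n. \<i> * of_real \<beta> * q n - Q n)"
    unfolding sel by (intro has_cosc_diff has_cosc_cmult c)
  show "has_cosc ell (cPsi (sh U)) (\<lambda>n. \<i> * of_real \<beta> * Q n - (of_real (b/\<rho>2) * (a n * (- a n * q n))
       - of_real (k/\<rho>2) * (a n * p n + q n + of_real l * w n) - of_real (\<gamma>/\<rho>2) * (a n * t n)))"
    unfolding sel by (rule ddpsi cS c dth | rule has_cosc_diff has_cosc_cmult)+
  show "has_cosc ell (cw (sh U)) (\<lambda>n. \<i> * of_real \<beta> * w n - W n)"
    unfolding sel by (intro has_cosc_diff has_cosc_cmult c)
  show "has_cosc ell (cW (sh U)) (\<lambda>n. \<i> * of_real \<beta> * W n - (of_real (k0/\<rho>1) * (a n * (- a n * w n - of_real l * p n))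
       - of_real (l*k/\<rho>1) * (a n * p n + q n + of_real l * w n) - of_real (\<gamma>/\<rho>1) * (a n * x n)))"
    unfolding sel by (rule dR cS c dxi | rule has_cosc_diff has_cosc_cmult)+
  show "has_sinc ell (cth (sh U)) (\<lambda>n. \<i> * of_real \<beta> * t n - (of_real (\<omega>/\<rho>3) * (- a n * (a n * I n)) - of_real (\<gamma>/\<rho>3) * (- a n * Q n)))"
    unfolding sel by (rule ddI dPsi s | rule has_sinc_diff has_sinc_cmult)+
  show "has_sinc ell (cxi (sh U)) (\<lambda>n. \<i> * of_real \<beta> * x n - (of_real (\<omega>/\<rho>3) * (- a n * (a n * J n)) - of_real (\<gamma>/\<rho>3) * (- a n * W n - of_real l * P n)))"
    unfolding sel by (rule ddJ dW s | rule has_sinc_diff has_sinc_cmult)+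
  show "Mem ell mu (ceta (sh U))" "Mem ell nu (czeta (sh U))"
    unfolding sel by (rule M.Mem_shift[OF D'(16) D'(10)], rule N.Mem_shift[OF D'(17) D'(11)])
qed

end

context mem_space
begin

definition Emode :: "real \<Rightarrow> (real \<Rightarrow> real \<Rightarrow> complex) \<Rightarrow> nat \<Rightarrow> complex" where
  "Emode \<beta> F n = integral\<^sup>L Hl (\<lambda>s. of_real (mu s) * mem_E \<beta> (\<lambda>t. sinc ell (F t) n) s)"

lemma Emode_bound:
  assumes "Mem ell mu F"
  shows "(cmod (Emode \<beta> F n))\<^sup>2 \<le> integral\<^sup>L Hl mu * (2 / d)\<^sup>2 * LMn (\<lambda>s. sinc ell (F s) n)"
proof -
  have i: "0 \<le> integral\<^sup>L Hl mu" using mu_nonneg by (intro integral_nonneg_AE AE_I2) auto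
  have "(cmod (Emode \<beta> F n))\<^sup>2 \<le> integral\<^sup>L Hl mu * LMn (mem_E \<beta> (\<lambda>t. sinc ell (F t) n))"
    unfolding Emode_def by (rule LM_weighted_integral(2)[OF LM_mem_E(1)[OF Mem_LM[OF assms]]])
  also have "\<dots> \<le> integral\<^sup>L Hl mu * ((2 / d)\<^sup>2 * LMn (\<lambda>s. sinc ell (F s) n))"
    by (rule mult_left_mono[OF LM_mem_E(2)[OF Mem_LM[OF assms]] i])
  finally show ?thesis by (simp only: mult.assoc)
qed

text \<open>The source is a coefficient constant in s plus the data, and linearity of
  \<open>mem_E\<close> separates their effects. The second claim bounds the memory itself, which is
  a component of the state norm and not determined by its weighted integral.\<close>

lemma memint_split:
  assumes \<eta>: "DT ell mu \<eta>" and F: "Mem ell mu F" and \<theta>: "H10 ell \<theta>"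
    and eq: "AE s in Hl. AE x in Om ell. \<i> * of_real \<beta> * \<eta> s x - (Top ell mu \<eta> s x + \<theta> x) = F s x"
  shows "sinc ell (memint ell mu \<eta>) n = kc \<beta> * sinc ell \<theta> n + Emode \<beta> F n"
    and "LMn (\<lambda>s. sinc ell (\<eta> s) n) \<le> (2 / d)\<^sup>2 * (2 * ((cmod (sinc ell \<theta> n))\<^sup>2 * integral\<^sup>L Hl mu) + 2 * LMn (\<lambda>s. sinc ell (F s) n))"
proof -
  note u = memory_unique[OF assms, of n]
  have LF: "LM (\<lambda>t. sinc ell (F t) n)" by (rule Mem_LM[OF F])
  have L\<eta>: "LM (\<lambda>s. sinc ell (\<eta> s) n)" by (rule Mem_LM[OF DT_Mem[OF \<eta>]])
  have L1: "LM (mem_E \<beta> (\<lambda>t. 1))" by (rule LM_mem_E(1)[OF LM_const(1)])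
  have "AE s in Hl. sinc ell (\<eta> s) n = sinc ell \<theta> n * mem_E \<beta> (\<lambda>t. 1) s + mem_E \<beta> (\<lambda>t. sinc ell (F t) n) s"
    using u AE_space
  proof eventually_elim
    case (elim s)
    have s0: "0 < s" using elim(2) by simp
    show ?case using elim(1) mem_E_linear[OF LM_const(1)[of 1] LF s0, of \<beta> "sinc ell \<theta> n"] by simp
  qed
  then have ae: "AE s in Hl. of_real (mu s) * sinc ell (\<eta> s) n
      = sinc ell \<theta> n * (of_real (mu s) * mem_E \<beta> (\<lambda>t. 1) s) + of_real (mu s) * mem_E \<beta> (\<lambda>t. sinc ell (F t) n) s"
    by eventually_elim (simp add: algebra_simps)
  note i = LM_weighted_integral(1)[OF L1] LM_weighted_integral(1)[OF LM_mem_E(1)[OF LF, of \<beta>]] LM_weighted_integral(1)[OF L\<eta>]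
  have "sinc ell (memint ell mu \<eta>) n = integral\<^sup>L Hl (\<lambda>s. of_real (mu s) * sinc ell (\<eta> s) n)"
    by (rule memint_modes(2)[OF DT_Mem[OF \<eta>]])
  also have "\<dots> = integral\<^sup>L Hl (\<lambda>s. sinc ell \<theta> n * (of_real (mu s) * mem_E \<beta> (\<lambda>t. 1) s) + of_real (mu s) * mem_E \<beta> (\<lambda>t. sinc ell (F t) n) s)"
    by (rule integral_cong_AE[OF borel_measurable_integrable borel_measurable_integrable ae])
       (intro i Bochner_Integration.integrable_add integrable_mult_right)+
  also have "\<dots> = sinc ell \<theta> n * kc \<beta> + Emode \<beta> F n"
    unfolding kc_def Emode_def Bochner_Integration.integral_add[OF integrable_mult_right[OF i(1)] i(2)] by simp
  finally show "sinc ell (memint ell mu \<eta>) n = kc \<beta> * sinc ell \<theta> n + Emode \<beta> F n" by (simp add: mult.commute)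
  have "LMn (\<lambda>s. sinc ell (\<eta> s) n) = LMn (mem_E \<beta> (\<lambda>t. sinc ell \<theta> n + sinc ell (F t) n))"
    by (rule LM_cong_AE(2)[OF L\<eta> u, symmetric])
  also have "\<dots> \<le> (2 / d)\<^sup>2 * LMn (\<lambda>t. sinc ell \<theta> n + sinc ell (F t) n)"
    by (rule LM_mem_E(2)[OF LM_add(1)[OF LM_const(1) LF]])
  also have "\<dots> \<le> (2 / d)\<^sup>2 * (2 * ((cmod (sinc ell \<theta> n))\<^sup>2 * integral\<^sup>L Hl mu) + 2 * LMn (\<lambda>s. sinc ell (F s) n))"
    using LM_add(2)[OF LM_const(1)[of "sinc ell \<theta> n"] LF] by (intro mult_left_mono) (simp_all only: LM_const(2) zero_le_power2)
  finally show "LMn (\<lambda>s. sinc ell (\<eta> s) n) \<le> (2 / d)\<^sup>2 * (2 * ((cmod (sinc ell \<theta> n))\<^sup>2 * integral\<^sup>L Hl mu) + 2 * LMn (\<lambda>s. sinc ell (F s) n))" .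
qed

end

section \<open>From the resolvent equation to the mode equations and back\<close>

lemma has_sinc_AE:
  assumes "0 < ell" "has_sinc ell f c" "has_sinc ell g c" shows "AE x in Om ell. f x = g x"
  by (rule sinc_eq_AE[OF assms(1)]) (use assms in \<open>auto simp: has_sinc_def\<close>)

lemma has_cosc_AE:
  assumes "0 < ell" "has_cosc ell f c" "has_cosc ell g c" shows "AE x in Om ell. f x = g x"
  by (rule cosc_eq_AE[OF assms(1)]) (use assms in \<open>auto simp: has_cosc_def\<close>)

lemma has_sinc_unique:
  assumes "has_sinc ell f c" "has_sinc ell g d" "AE x in Om ell. f x = g x" shows "c n = d n"
  using sinc_cong_AE[OF assms(3), of n] assms by (auto simp: has_sinc_def)

lemma has_cosc_unique:
  assumes "has_cosc ell f c" "has_cosc ell g d" "AE x in Om ell. f x = g x" shows "c n = d n"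
  using cosc_cong_AE[OF assms(3), of n] assms by (auto simp: has_cosc_def)

context thermo
begin

abbreviation inHs :: "state \<Rightarrow> bool" where "inHs \<equiv> inH ell mu nu"
abbreviation DAs :: "state \<Rightarrow> bool" where "DAs \<equiv> DA ell mu nu"

definition rhs :: "state \<Rightarrow> nat \<Rightarrow> c5" where
  "rhs F n = B.mode_rhs (freq ell n) (sinc ell (cphi F) n) (sinc ell (cPhi F) n) (cosc ell (cpsi F) n) (cosc ell (cPsi F) n)
     (cosc ell (cw F) n) (cosc ell (cW F) n) (sinc ell (cth F) n) (sinc ell (cxi F) n)
     (M.Emode \<beta> (ceta F) n) (N.Emode \<beta> (czeta F) n)"

definition mode_vec :: "state \<Rightarrow> nat \<Rightarrow> c5" where
  "mode_vec U n = (sinc ell (cphi U) n, cosc ell (cpsi U) n, cosc ell (cw U) n, sinc ell (cth U) n, sinc ell (cxi U) n)"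

definition mode_eqs :: "state \<Rightarrow> state \<Rightarrow> nat \<Rightarrow> bool" where
  "mode_eqs U F n \<longleftrightarrow>
     sinc ell (cPhi U) n = \<i> * of_real \<beta> * sinc ell (cphi U) n - sinc ell (cphi F) n \<and>
     cosc ell (cPsi U) n = \<i> * of_real \<beta> * cosc ell (cpsi U) n - cosc ell (cpsi F) n \<and>
     cosc ell (cW U) n = \<i> * of_real \<beta> * cosc ell (cw U) n - cosc ell (cw F) n \<and>
     B.Mop (freq ell n) (mode_vec U n) = rhs F n"

lemma eqH_iff:
  "eqH ell u v \<longleftrightarrow>
     (AE x in Om ell. cphi u x = cphi v x) \<and> (AE x in Om ell. cPhi u x = cPhi v x) \<and>
     (AE x in Om ell. cpsi u x = cpsi v x) \<and> (AE x in Om ell. cPsi u x = cPsi v x) \<and>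
     (AE x in Om ell. cw u x = cw v x) \<and> (AE x in Om ell. cW u x = cW v x) \<and>
     (AE x in Om ell. cth u x = cth v x) \<and> (AE x in Om ell. cxi u x = cxi v x) \<and>
     (AE s in Hl. AE x in Om ell. ceta u s x = ceta v s x) \<and>
     (AE s in Hl. AE x in Om ell. czeta u s x = czeta v s x)"
  unfolding eqH_def by (simp add: AE_conj_iff conj_ac)

lemma sh_eta: "ceta (sh U) = (\<lambda>s x. \<i> * of_real \<beta> * ceta U s x - (Top ell mu (ceta U) s x + cth U x))"
  "czeta (sh U) = (\<lambda>s x. \<i> * of_real \<beta> * czeta U s x - (Top ell nu (czeta U) s x + cxi U x))"
  unfolding sh_def shiftA_def Aop_def Let_def by simp_all

lemma inHs_parts:
  assumes "inHs F"
  shows "H10 ell (cphi F)" "L2 ell (cPhi F)" "H1 ell (cpsi F)" "L2 ell (cPsi F)" "H1 ell (cw F)" "L2 ell (cW F)"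
    "L2 ell (cth F)" "L2 ell (cxi F)" "Mem ell mu (ceta F)" "Mem ell nu (czeta F)"
    "cosc ell (cpsi F) 0 = 0" "cosc ell (cPsi F) 0 = 0" "cosc ell (cw F) 0 = 0" "cosc ell (cW F) 0 = 0"
    "L2 ell (cphi F)" "L2 ell (cpsi F)" "L2 ell (cw F)"
  using assms unfolding inH_def H1s_def L2s_iff[OF M.ell] by (auto simp: H10_L2)

lemma DAs_parts:
  assumes "DAs U"
  shows "inHs U" "H10 ell (cth U)" "H10 ell (cxi U)" "DT ell mu (ceta U)" "DT ell nu (czeta U)"
    "H10 ell (cPhi U)" "H1 ell (cPsi U)" "H1 ell (cW U)"
  using assms unfolding DA_def by auto

lemma memory_modes:
  assumes "DAs U" "inHs F"
    "AE s in Hl. AE x in Om ell. ceta (sh U) s x = ceta F s x" "AE s in Hl. AE x in Om ell. czeta (sh U) s x = czeta F s x"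
  shows "sinc ell (memint ell mu (ceta U)) n = M.kc \<beta> * sinc ell (cth U) n + M.Emode \<beta> (ceta F) n"
    "sinc ell (memint ell nu (czeta U)) n = N.kc \<beta> * sinc ell (cxi U) n + N.Emode \<beta> (czeta F) n"
  using M.memint_split(1)[OF DAs_parts(4)[OF assms(1)] inHs_parts(9)[OF assms(2)] DAs_parts(2)[OF assms(1)] assms(3)[unfolded sh_eta]]
    N.memint_split(1)[OF DAs_parts(5)[OF assms(1)] inHs_parts(10)[OF assms(2)] DAs_parts(3)[OF assms(1)] assms(4)[unfolded sh_eta]]
  by blast+

lemma mode_eqs_if_eqH:
  assumes U: "DAs U" and F: "inHs F" and eq: "eqH ell (sh U) F"
  shows "mode_eqs U F n"
proof -
  note e = eq[unfolded eqH_iff]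
  note s = sh_modes[OF U]
  note L = inHs_parts[OF F]
  note m = has_sinc_unique[OF s(1) has_sinc_L2[OF L(15)] conjunct1[OF e], of n]
    has_sinc_unique[OF s(2) has_sinc_L2[OF L(2)], of n]
    has_cosc_unique[OF s(3) has_cosc_L2[OF L(16)], of n]
    has_cosc_unique[OF s(4) has_cosc_L2[OF L(4)], of n]
    has_cosc_unique[OF s(5) has_cosc_L2[OF L(17)], of n]
    has_cosc_unique[OF s(6) has_cosc_L2[OF L(6)], of n]
    has_sinc_unique[OF s(7) has_sinc_L2[OF L(7)], of n]
    has_sinc_unique[OF s(8) has_sinc_L2[OF L(8)], of n]
  have "mode_sys (freq ell n) (sinc ell (cphi U) n) (sinc ell (cPhi U) n) (cosc ell (cpsi U) n) (cosc ell (cPsi U) n)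
      (cosc ell (cw U) n) (cosc ell (cW U) n) (sinc ell (cth U) n) (sinc ell (cxi U) n)
      (sinc ell (memint ell mu (ceta U)) n) (sinc ell (memint ell nu (czeta U)) n)
      (sinc ell (cphi F) n) (sinc ell (cPhi F) n) (cosc ell (cpsi F) n) (cosc ell (cPsi F) n)
      (cosc ell (cw F) n) (cosc ell (cW F) n) (sinc ell (cth F) n) (sinc ell (cxi F) n)"
    unfolding mode_sys_def by (intro conjI m) (use e in blast)+
  then show ?thesis
    unfolding mode_sys_iff[OF memory_modes[OF U F conjunct1[OF conjunct2[OF conjunct2[OF conjunct2[OF conjunct2[OF conjunct2[OF conjunct2[OF conjunct2[OF conjunct2[OF e]]]]]]]]]
       conjunct2[OF conjunct2[OF conjunct2[OF conjunct2[OF conjunct2[OF conjunct2[OF conjunct2[OF conjunct2[OF conjunct2[OF e]]]]]]]]]]]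
      mode_eqs_def rhs_def mode_vec_def .
qed

lemma eqH_if_mode_eqs:
  assumes U: "DAs U" and F: "inHs F"
    and ae: "AE s in Hl. AE x in Om ell. ceta (sh U) s x = ceta F s x" "AE s in Hl. AE x in Om ell. czeta (sh U) s x = czeta F s x"
    and eq: "\<And>n. 0 < n \<Longrightarrow> mode_eqs U F n"
  shows "eqH ell (sh U) F"
proof -
  note s = sh_modes[OF U]
  note L = inHs_parts[OF F]
  note L' = inHs_parts[OF DAs_parts(1)[OF U]]
  have ms: "mode_sys (freq ell n) (sinc ell (cphi U) n) (sinc ell (cPhi U) n) (cosc ell (cpsi U) n) (cosc ell (cPsi U) n)
      (cosc ell (cw U) n) (cosc ell (cW U) n) (sinc ell (cth U) n) (sinc ell (cxi U) n)
      (sinc ell (memint ell mu (ceta U)) n) (sinc ell (memint ell nu (czeta U)) n)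
      (sinc ell (cphi F) n) (sinc ell (cPhi F) n) (cosc ell (cpsi F) n) (cosc ell (cPsi F) n)
      (cosc ell (cw F) n) (cosc ell (cW F) n) (sinc ell (cth F) n) (sinc ell (cxi F) n)" for n
  proof (cases "n = 0")
    case True
    then show ?thesis unfolding mode_sys_def by (simp add: L(11-14) L'(11-14))
  next
    case False
    then have "mode_eqs U F n" using eq by simp
    then show ?thesis unfolding mode_sys_iff[OF memory_modes[OF U F ae]] mode_eqs_def rhs_def mode_vec_def .
  qed
  note m = ms[unfolded mode_sys_def]
  show ?thesis unfolding eqH_iff
  proof (intro conjI ae)
    have "has_sinc ell (cphi (sh U)) (\<lambda>n. sinc ell (cphi F) n)" using s(1) by (simp only: m)
    from has_sinc_AE[OF M.ell this has_sinc_L2[OF L(15)]] show "AE x in Om ell. cphi (sh U) x = cphi F x" .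
    have "has_sinc ell (cPhi (sh U)) (\<lambda>n. sinc ell (cPhi F) n)" using s(2) by (simp only: m)
    from has_sinc_AE[OF M.ell this has_sinc_L2[OF L(2)]] show "AE x in Om ell. cPhi (sh U) x = cPhi F x" .
    have "has_sinc ell (cth (sh U)) (\<lambda>n. sinc ell (cth F) n)" using s(7) by (simp only: m)
    from has_sinc_AE[OF M.ell this has_sinc_L2[OF L(7)]] show "AE x in Om ell. cth (sh U) x = cth F x" .
    have "has_sinc ell (cxi (sh U)) (\<lambda>n. sinc ell (cxi F) n)" using s(8) by (simp only: m)
    from has_sinc_AE[OF M.ell this has_sinc_L2[OF L(8)]] show "AE x in Om ell. cxi (sh U) x = cxi F x" .
    have "has_cosc ell (cpsi (sh U)) (\<lambda>n. cosc ell (cpsi F) n)" using s(3) by (simp only: m)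
    from has_cosc_AE[OF M.ell this has_cosc_L2[OF L(16)]] show "AE x in Om ell. cpsi (sh U) x = cpsi F x" .
    have "has_cosc ell (cPsi (sh U)) (\<lambda>n. cosc ell (cPsi F) n)" using s(4) by (simp only: m)
    from has_cosc_AE[OF M.ell this has_cosc_L2[OF L(4)]] show "AE x in Om ell. cPsi (sh U) x = cPsi F x" .
    have "has_cosc ell (cw (sh U)) (\<lambda>n. cosc ell (cw F) n)" using s(5) by (simp only: m)
    from has_cosc_AE[OF M.ell this has_cosc_L2[OF L(17)]] show "AE x in Om ell. cw (sh U) x = cw F x" .
    have "has_cosc ell (cW (sh U)) (\<lambda>n. cosc ell (cW F) n)" using s(6) by (simp only: m)
    from has_cosc_AE[OF M.ell this has_cosc_L2[OF L(6)]] show "AE x in Om ell. cW (sh U) x = cW F x" .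
  qed
qed

text \<open>\<open>sh U\<close> itself serves as the data in the uniqueness and norm statements, so
  it has to lie in the state space. The zero means are the formulas of \<open>sh_modes\<close> at
  frequency 0.\<close>

lemma inHs_sh: assumes U: "DAs U" shows "inHs (sh U)"
proof -
  note s = sh_modes[OF U]
  note L' = inHs_parts[OF DAs_parts(1)[OF U]] DAs_parts[OF U]
  \<comment> \<open>The added 0 brings the difference into the form that the lemmas on linear
    combinations expect.\<close>
  have "H10 ell (\<lambda>x. \<i> * of_real \<beta> * cphi U x + (-1 * cPhi U x + 0))"
    "H1 ell (\<lambda>x. \<i> * of_real \<beta> * cpsi U x + (-1 * cPsi U x + 0))" "H1 ell (\<lambda>x. \<i> * of_real \<beta> * cw U x + (-1 * cW U x + 0))"
    by (intro H10_lin H1_lin M.ell L'; simp add: H10_iff H1_iff M.ell sqs_def sinc_def cosc_def L2i_def)+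
  then have h: "H10 ell (cphi (sh U))" "H1 ell (cpsi (sh U))" "H1 ell (cw (sh U))"
    unfolding sh_def shiftA_def Aop_def Let_def by simp_all
  have z: "cosc ell (cpsi (sh U)) 0 = 0" "cosc ell (cPsi (sh U)) 0 = 0" "cosc ell (cw (sh U)) 0 = 0" "cosc ell (cW (sh U)) 0 = 0"
    using s(3-6) by (auto simp: has_cosc_def L'(11-14))
  show ?thesis unfolding inH_def H1s_def L2s_iff[OF M.ell]
    using h z s H1_L2[OF h(2)] H1_L2[OF h(3)] by (auto simp: has_sinc_def has_cosc_def)
qed

end

section \<open>The energy of a mode and the a priori bound\<close>

lemma sum_of_ten_ge:
  fixes x1 x2 x3 x4 x5 x6 x7 x8 x9 x10 :: real
  assumes "0 \<le> x1" "0 \<le> x2" "0 \<le> x3" "0 \<le> x4" "0 \<le> x5" "0 \<le> x6" "0 \<le> x7" "0 \<le> x8" "0 \<le> x9" "0 \<le> x10"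
  shows "x1 + x3 + x5 \<le> x1 + x2 + x3 + x4 + x5 + x6 + x7 + x8 + x9 + x10" "x2 \<le> x1 + x2 + x3 + x4 + x5 + x6 + x7 + x8 + x9 + x10" "x4 \<le> x1 + x2 + x3 + x4 + x5 + x6 + x7 + x8 + x9 + x10"
    "x6 \<le> x1 + x2 + x3 + x4 + x5 + x6 + x7 + x8 + x9 + x10" "x7 \<le> x1 + x2 + x3 + x4 + x5 + x6 + x7 + x8 + x9 + x10" "x9 \<le> x1 + x2 + x3 + x4 + x5 + x6 + x7 + x8 + x9 + x10"
    "x8 \<le> x1 + x2 + x3 + x4 + x5 + x6 + x7 + x8 + x9 + x10" "x10 \<le> x1 + x2 + x3 + x4 + x5 + x6 + x7 + x8 + x9 + x10"
  using assms by simp_all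

context thermo
begin

text \<open>The share of one mode in the squared state norm, obtained by Parseval in each
  component.\<close>

definition modeE :: "state \<Rightarrow> nat \<Rightarrow> real" where
  "modeE u n =
     k * (cmod (of_real (freq ell n) * sinc ell (cphi u) n + cosc ell (cpsi u) n + of_real l * cosc ell (cw u) n))\<^sup>2
   + \<rho>1 * (cmod (sinc ell (cPhi u) n))\<^sup>2
   + b * (cmod (- of_real (freq ell n) * cosc ell (cpsi u) n))\<^sup>2
   + \<rho>2 * (cmod (cosc ell (cPsi u) n))\<^sup>2
   + k0 * (cmod (- of_real (freq ell n) * cosc ell (cw u) n - of_real l * sinc ell (cphi u) n))\<^sup>2
   + \<rho>1 * (cmod (cosc ell (cW u) n))\<^sup>2
   + \<rho>3 * (cmod (sinc ell (cth u) n))\<^sup>2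
   + \<omega> * ((freq ell n)\<^sup>2 * M.LMn (\<lambda>s. sinc ell (ceta u s) n))
   + \<rho>3 * (cmod (sinc ell (cxi u) n))\<^sup>2
   + \<omega> * ((freq ell n)\<^sup>2 * N.LMn (\<lambda>s. sinc ell (czeta u s) n))"

lemma modeE_nonneg: "0 \<le> modeE u n"
  unfolding modeE_def using tpos M.LMn_nonneg N.LMn_nonneg by (intro add_nonneg_nonneg mult_nonneg_nonneg) (auto intro: less_imp_le)

lemma modeE_0: assumes "inHs u" shows "modeE u 0 = 0"
  unfolding modeE_def by (simp add: inHs_parts(11-14)[OF assms])

abbreviation Hn :: "state \<Rightarrow> real" where "Hn \<equiv> Hnorm ell \<rho>1 \<rho>2 \<rho>3 k k0 b \<omega> l mu nu"

lemma Hnorm_sums: assumes "inHs u" shows "modeE u sums (Hn u)\<^sup>2"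
proof -
  note L = inHs_parts[OF assms] and ell = M.ell
  have S: "has_cosc ell (\<lambda>x. dx ell (cphi u) x + cpsi u x + of_real l * cw u x)
      (\<lambda>n. of_real (freq ell n) * sinc ell (cphi u) n + cosc ell (cpsi u) n + of_real l * cosc ell (cw u) n)"
    by (intro has_cosc_add has_cosc_cmult has_cosc_L2 has_cosc_dx ell L)
  have R: "has_sinc ell (\<lambda>x. dx ell (cw u) x - of_real l * cphi u x)
      (\<lambda>n. - of_real (freq ell n) * cosc ell (cw u) n - of_real l * sinc ell (cphi u) n)"
    by (intro has_sinc_diff has_sinc_cmult has_sinc_L2 has_sinc_dx ell L)
  note Q = has_sinc_dx[OF ell L(3)]
  have P: "(\<lambda>n. (cmod (c n))\<^sup>2) sums (L2n ell f)\<^sup>2" if "has_sinc ell f c" for f c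
    using sinc_parseval[OF ell] that by (auto simp: has_sinc_def)
  have P': "(\<lambda>n. (cmod (c n))\<^sup>2) sums (L2n ell f)\<^sup>2" if "has_cosc ell f c" for f c
    using cosc_parseval[OF ell] that by (auto simp: has_cosc_def)
  have s: "modeE u sums (
       k * (L2n ell (\<lambda>x. dx ell (cphi u) x + cpsi u x + of_real l * cw u x))\<^sup>2
     + \<rho>1 * (L2n ell (cPhi u))\<^sup>2 + b * (L2n ell (dx ell (cpsi u)))\<^sup>2 + \<rho>2 * (L2n ell (cPsi u))\<^sup>2
     + k0 * (L2n ell (\<lambda>x. dx ell (cw u) x - of_real l * cphi u x))\<^sup>2
     + \<rho>1 * (L2n ell (cW u))\<^sup>2 + \<rho>3 * (L2n ell (cth u))\<^sup>2 + \<omega> * Memn2 ell mu (ceta u)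
     + \<rho>3 * (L2n ell (cxi u))\<^sup>2 + \<omega> * Memn2 ell nu (czeta u))"
    unfolding modeE_def[abs_def]
    by (intro sums_add sums_mult P'[OF S] P[OF R] P[OF Q] P[OF has_sinc_L2] P'[OF has_cosc_L2] M.Mem_sums N.Mem_sums L)
  have "0 \<le> suminf (modeE u)" by (rule suminf_nonneg) (use s modeE_nonneg in \<open>auto simp: sums_iff\<close>)
  then have nn: "0 \<le> k * (L2n ell (\<lambda>x. dx ell (cphi u) x + cpsi u x + of_real l * cw u x))\<^sup>2
     + \<rho>1 * (L2n ell (cPhi u))\<^sup>2 + b * (L2n ell (dx ell (cpsi u)))\<^sup>2 + \<rho>2 * (L2n ell (cPsi u))\<^sup>2
     + k0 * (L2n ell (\<lambda>x. dx ell (cw u) x - of_real l * cphi u x))\<^sup>2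
     + \<rho>1 * (L2n ell (cW u))\<^sup>2 + \<rho>3 * (L2n ell (cth u))\<^sup>2 + \<omega> * Memn2 ell mu (ceta u)
     + \<rho>3 * (L2n ell (cxi u))\<^sup>2 + \<omega> * Memn2 ell nu (czeta u)" using sums_unique[OF s] by (simp only:)
  show ?thesis using s unfolding Hnorm_def real_sqrt_pow2[OF nn] .
qed

lemma modeE_ge:
  fixes F n defines "a \<equiv> freq ell n"
  shows "k * (cmod (of_real a * sinc ell (cphi F) n + cosc ell (cpsi F) n + of_real l * cosc ell (cw F) n))\<^sup>2
      + b * a\<^sup>2 * (cmod (cosc ell (cpsi F) n))\<^sup>2 + k0 * (cmod (of_real a * cosc ell (cw F) n + of_real l * sinc ell (cphi F) n))\<^sup>2 \<le> modeE F n"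
    "\<rho>1 * (cmod (sinc ell (cPhi F) n))\<^sup>2 \<le> modeE F n" "\<rho>2 * (cmod (cosc ell (cPsi F) n))\<^sup>2 \<le> modeE F n"
    "\<rho>1 * (cmod (cosc ell (cW F) n))\<^sup>2 \<le> modeE F n" "\<rho>3 * (cmod (sinc ell (cth F) n))\<^sup>2 \<le> modeE F n"
    "\<rho>3 * (cmod (sinc ell (cxi F) n))\<^sup>2 \<le> modeE F n"
    "\<omega> * (a\<^sup>2 * M.LMn (\<lambda>s. sinc ell (ceta F s) n)) \<le> modeE F n" "\<omega> * (a\<^sup>2 * N.LMn (\<lambda>s. sinc ell (czeta F s) n)) \<le> modeE F n"
proof -
  have 1: "cmod (- of_real a * cosc ell (cw F) n - of_real l * sinc ell (cphi F) n)
      = cmod (of_real a * cosc ell (cw F) n + of_real l * sinc ell (cphi F) n)"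
    by (subst norm_minus_cancel[symmetric]) (simp add: add.commute)
  have 2: "(cmod (- of_real a * cosc ell (cpsi F) n))\<^sup>2 = a\<^sup>2 * (cmod (cosc ell (cpsi F) n))\<^sup>2"
    by (simp add: norm_mult power_mult_distrib)
  have nn: "0 \<le> k * (cmod (of_real a * sinc ell (cphi F) n + cosc ell (cpsi F) n + of_real l * cosc ell (cw F) n))\<^sup>2"
    "0 \<le> \<rho>1 * (cmod (sinc ell (cPhi F) n))\<^sup>2"
    "0 \<le> b * (a\<^sup>2 * (cmod (cosc ell (cpsi F) n))\<^sup>2)"
    "0 \<le> \<rho>2 * (cmod (cosc ell (cPsi F) n))\<^sup>2"
    "0 \<le> k0 * (cmod (of_real a * cosc ell (cw F) n + of_real l * sinc ell (cphi F) n))\<^sup>2"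
    "0 \<le> \<rho>1 * (cmod (cosc ell (cW F) n))\<^sup>2"
    "0 \<le> \<rho>3 * (cmod (sinc ell (cth F) n))\<^sup>2"
    "0 \<le> \<omega> * (a\<^sup>2 * M.LMn (\<lambda>s. sinc ell (ceta F s) n))"
    "0 \<le> \<rho>3 * (cmod (sinc ell (cxi F) n))\<^sup>2"
    "0 \<le> \<omega> * (a\<^sup>2 * N.LMn (\<lambda>s. sinc ell (czeta F s) n))"
    using tpos M.LMn_nonneg N.LMn_nonneg by (simp_all add: zero_le_mult_iff)
  note d = modeE_def[of F n, folded a_def, unfolded 1 2]
  show "k * (cmod (of_real a * sinc ell (cphi F) n + cosc ell (cpsi F) n + of_real l * cosc ell (cw F) n))\<^sup>2
      + b * a\<^sup>2 * (cmod (cosc ell (cpsi F) n))\<^sup>2 + k0 * (cmod (of_real a * cosc ell (cw F) n + of_real l * sinc ell (cphi F) n))\<^sup>2 \<le> modeE F n" unfolding d mult.assoc[of b] by (rule sum_of_ten_ge(1)[OF nn])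
  show "\<rho>1 * (cmod (sinc ell (cPhi F) n))\<^sup>2 \<le> modeE F n" unfolding d by (rule sum_of_ten_ge(2)[OF nn])
  show "\<rho>2 * (cmod (cosc ell (cPsi F) n))\<^sup>2 \<le> modeE F n" unfolding d by (rule sum_of_ten_ge(3)[OF nn])
  show "\<rho>1 * (cmod (cosc ell (cW F) n))\<^sup>2 \<le> modeE F n" unfolding d by (rule sum_of_ten_ge(4)[OF nn])
  show "\<rho>3 * (cmod (sinc ell (cth F) n))\<^sup>2 \<le> modeE F n" unfolding d by (rule sum_of_ten_ge(5)[OF nn])
  show "\<rho>3 * (cmod (sinc ell (cxi F) n))\<^sup>2 \<le> modeE F n" unfolding d by (rule sum_of_ten_ge(6)[OF nn])
  show "\<omega> * (a\<^sup>2 * M.LMn (\<lambda>s. sinc ell (ceta F s) n)) \<le> modeE F n" unfolding d by (rule sum_of_ten_ge(7)[OF nn])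
  show "\<omega> * (a\<^sup>2 * N.LMn (\<lambda>s. sinc ell (czeta F s) n)) \<le> modeE F n" unfolding d by (rule sum_of_ten_ge(8)[OF nn])
qed

text \<open>The state norm contains the displacements \<open>cphi\<close> and \<open>cw\<close> only
  through strains; \<open>elastic_coercive\<close> recovers the gradients of all three displacements
  from them in each mode.\<close>

lemma elastic_dominated:
  fixes F :: "'i \<Rightarrow> state" and n :: "'i \<Rightarrow> nat"
  assumes n: "\<And>i. i \<in> A \<Longrightarrow> 0 < n i"
    and z: "z \<in> {\<lambda>i. sinc ell (cphi (F i)) (n i), \<lambda>i. cosc ell (cpsi (F i)) (n i), \<lambda>i. cosc ell (cw (F i)) (n i)}"
  shows "dominated A (\<lambda>i. (cmod (of_real (freq ell (n i)) * z i))\<^sup>2) (\<lambda>i. modeE (F i) (n i))"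
proof -
  obtain C where C: "C \<ge> 0" "\<forall>n>0. \<forall>p q r. (freq ell n)\<^sup>2 * ((cmod p)\<^sup>2 + (cmod q)\<^sup>2 + (cmod r)\<^sup>2)
     \<le> C * (k * (cmod (of_real (freq ell n) * p + q + of_real l * r))\<^sup>2 + b * (freq ell n)\<^sup>2 * (cmod q)\<^sup>2
        + k0 * (cmod (of_real (freq ell n) * r + of_real l * p))\<^sup>2)"
    using B.elastic_coercive by (elim exE conjE)
  have "(cmod (of_real (freq ell (n i)) * z i))\<^sup>2 \<le> C * modeE (F i) (n i)" if i: "i \<in> A" for i
  proof -
    have "(cmod (of_real (freq ell (n i)) * z i))\<^sup>2 \<le> (freq ell (n i))\<^sup>2 * ((cmod (sinc ell (cphi (F i)) (n i)))\<^sup>2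
        + (cmod (cosc ell (cpsi (F i)) (n i)))\<^sup>2 + (cmod (cosc ell (cw (F i)) (n i)))\<^sup>2)"
      unfolding norm_mult power_mult_distrib norm_of_real power2_abs by (rule mult_left_mono) (use z in auto)
    also have "\<dots> \<le> C * modeE (F i) (n i)"
      by (rule order_trans[OF C(2)[rule_format, OF n[OF i]] mult_left_mono[OF modeE_ge(1) C(1)]])
    finally show ?thesis .
  qed
  then show ?thesis unfolding dominated_def using C(1) by blast
qed

text \<open>The index type is left open because there are two applications: all solutions with their
  data and frequencies at once for the norm bound, and a single F over all frequencies for
  existence.\<close>

lemma rhs_dominated:
  fixes F :: "'i \<Rightarrow> state" and n :: "'i \<Rightarrow> nat"
  assumes n: "\<And>i. i \<in> A \<Longrightarrow> 0 < n i" and F: "\<And>i. i \<in> A \<Longrightarrow> inHs (F i)"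
    and v: "\<And>i. i \<in> A \<Longrightarrow> B.Mop (freq ell (n i)) (v i) = rhs (F i) (n i)"
  shows "dominated A (\<lambda>i. (freq ell (n i))\<^sup>2 * (norm (v i))\<^sup>2) (\<lambda>i. modeE (F i) (n i))" (is "dominated A _ ?h")
proof (rule B.mode_estimate[OF n v[unfolded rhs_def]])
  have im: "0 \<le> integral\<^sup>L Hl mu" "0 \<le> integral\<^sup>L Hl nu" using M.mu_nonneg N.mu_nonneg by (auto intro!: integral_nonneg_AE AE_I2)
  have I: "dominated A (\<lambda>i. (cmod (of_real (freq ell (n i)) * M.Emode \<beta> (ceta (F i)) (n i)))\<^sup>2) ?h"
  proof (rule dominated_le[OF dominated_scale[OF dominatedI[OF tpos(7) modeE_ge(7)]]])
    show "0 \<le> integral\<^sup>L Hl mu * (2 / dm)\<^sup>2" using im by simp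
    fix i assume i: "i \<in> A"
    from mult_left_mono[OF M.Emode_bound[OF inHs_parts(9)[OF F[OF i]], of \<beta> "n i"] zero_le_power2[of "freq ell (n i)"]]
    show "(cmod (of_real (freq ell (n i)) * M.Emode \<beta> (ceta (F i)) (n i)))\<^sup>2
      \<le> integral\<^sup>L Hl mu * (2 / dm)\<^sup>2 * ((freq ell (n i))\<^sup>2 * M.LMn (\<lambda>s. sinc ell (ceta (F i) s) (n i)))"
      by (simp only: mult_ac norm_mult power_mult_distrib norm_of_real power2_abs)
  qed
  have J: "dominated A (\<lambda>i. (cmod (of_real (freq ell (n i)) * N.Emode \<beta> (czeta (F i)) (n i)))\<^sup>2) ?h"
  proof (rule dominated_le[OF dominated_scale[OF dominatedI[OF tpos(7) modeE_ge(8)]]])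
    show "0 \<le> integral\<^sup>L Hl nu * (2 / dn)\<^sup>2" using im by simp
    fix i assume i: "i \<in> A"
    from mult_left_mono[OF N.Emode_bound[OF inHs_parts(10)[OF F[OF i]], of \<beta> "n i"] zero_le_power2[of "freq ell (n i)"]]
    show "(cmod (of_real (freq ell (n i)) * N.Emode \<beta> (czeta (F i)) (n i)))\<^sup>2
      \<le> integral\<^sup>L Hl nu * (2 / dn)\<^sup>2 * ((freq ell (n i))\<^sup>2 * N.LMn (\<lambda>s. sinc ell (czeta (F i) s) (n i)))"
      by (simp only: mult_ac norm_mult power_mult_distrib norm_of_real power2_abs)
  qed
  show "dominated A (\<lambda>i. (cmod (of_real (freq ell (n i)) * f i))\<^sup>2) ?h"
    if "f \<in> {\<lambda>i. sinc ell (cphi (F i)) (n i), \<lambda>i. cosc ell (cpsi (F i)) (n i), \<lambda>i. cosc ell (cw (F i)) (n i),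
      \<lambda>i. M.Emode \<beta> (ceta (F i)) (n i), \<lambda>i. N.Emode \<beta> (czeta (F i)) (n i)}" for f
    using that by (elim insertE emptyE, simp_all only:) (rule I | rule J | (rule elastic_dominated, erule n, simp))+
  show "dominated A (\<lambda>i. (cmod (f i))\<^sup>2) ?h"
    if "f \<in> {\<lambda>i. sinc ell (cPhi (F i)) (n i), \<lambda>i. cosc ell (cPsi (F i)) (n i), \<lambda>i. cosc ell (cW (F i)) (n i),
      \<lambda>i. sinc ell (cth (F i)) (n i), \<lambda>i. sinc ell (cxi (F i)) (n i)}" for f
    using that by (elim insertE emptyE, simp_all only:)
      (rule dominatedI[OF tpos(1) modeE_ge(2)] dominatedI[OF tpos(2) modeE_ge(3)] dominatedI[OF tpos(1) modeE_ge(4)]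
        dominatedI[OF tpos(3) modeE_ge(5)] dominatedI[OF tpos(3) modeE_ge(6)])+
qed

end

context thermo
begin

lemma mode_eqs_Mop: "mode_eqs U F n \<Longrightarrow> B.Mop (freq ell n) (mode_vec U n) = rhs F n"
  unfolding mode_eqs_def by blast

text \<open>Because of the choices in it, \<open>sh\<close> is not manifestly linear, so the
  difference of U and V is never formed. Instead both are solutions for the data
  \<open>sh V\<close>: injectivity of \<open>Mop\<close> determines the coefficients, the first
  three mode equations the velocities, and Duhamel's formula the memories.\<close>

lemma sh_inj:
  assumes U: "DAs U" and V: "DAs V" and eq: "eqH ell (sh U) (sh V)"
  shows "eqH ell U V"
proof -
  note FU = inHs_sh[OF V]
  have ref: "eqH ell (sh V) (sh V)" by (simp add: eqH_def)
  note e = eq[unfolded eqH_iff] ref[unfolded eqH_iff]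
  note L = inHs_parts[OF DAs_parts(1)[OF U]] and L' = inHs_parts[OF DAs_parts(1)[OF V]]
  have m: "mode_vec U n = mode_vec V n \<and> sinc ell (cPhi U) n = sinc ell (cPhi V) n \<and> cosc ell (cPsi U) n = cosc ell (cPsi V) n
     \<and> cosc ell (cW U) n = cosc ell (cW V) n" for n
  proof (cases "n = 0")
    case True
    then show ?thesis by (simp add: mode_vec_def L(11-14) L'(11-14))
  next
    case False
    have u: "mode_eqs U (sh V) n" and v: "mode_eqs V (sh V) n"
      by (rule mode_eqs_if_eqH[OF U FU eq], rule mode_eqs_if_eqH[OF V FU ref])
    have n: "0 < n" using False by simp
    have "B.Mop (freq ell n) (mode_vec U n) = rhs (sh V) n" "B.Mop (freq ell n) (mode_vec V n) = rhs (sh V) n"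
      by (rule mode_eqs_Mop[OF u], rule mode_eqs_Mop[OF v])
    then have "B.Mop (freq ell n) (mode_vec U n) = B.Mop (freq ell n) (mode_vec V n)" by (rule trans[OF _ sym])
    then have "mode_vec U n = mode_vec V n" by (rule injD[OF B.Mop_inj[OF freq_pos[OF M.ell n] B.freq_ne_l[OF n]]])
    then show ?thesis using u v by (simp add: mode_eqs_def mode_vec_def)
  qed
  have eta: "AE s in Hl. AE x in Om ell. ceta U s x = ceta V s x"
  proof -
    have "AE s in Hl. \<forall>n. sinc ell (ceta U s) n = sinc ell (ceta V s) n"
      unfolding AE_all_countable
    proof
      fix n
      have t: "sinc ell (cth U) n = sinc ell (cth V) n" using m[of n] by (simp add: mode_vec_def)
      have "AE s in Hl. sinc ell (ceta U s) n = mem_E \<beta> (\<lambda>t. sinc ell (cth U) n + sinc ell (ceta (sh V) t) n) s"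
        by (rule M.memory_unique[OF DAs_parts(4)[OF U] inHs_parts(9)[OF FU] DAs_parts(2)[OF U]]) (use e(1) in \<open>simp add: sh_eta\<close>)
      moreover have "AE s in Hl. sinc ell (ceta V s) n = mem_E \<beta> (\<lambda>t. sinc ell (cth V) n + sinc ell (ceta (sh V) t) n) s"
        by (rule M.memory_unique[OF DAs_parts(4)[OF V] inHs_parts(9)[OF FU] DAs_parts(2)[OF V]]) (simp add: sh_eta)
      ultimately show "AE s in Hl. sinc ell (ceta U s) n = sinc ell (ceta V s) n" by eventually_elim (simp add: t)
    qed
    then show ?thesis using M.Mem_H10[OF L(9)] M.Mem_H10[OF L'(9)]
      by eventually_elim (rule sinc_eq_AE[OF M.ell]; simp add: H10_L2)
  qed
  have zeta: "AE s in Hl. AE x in Om ell. czeta U s x = czeta V s x"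
  proof -
    have "AE s in Hl. \<forall>n. sinc ell (czeta U s) n = sinc ell (czeta V s) n"
      unfolding AE_all_countable
    proof
      fix n
      have t: "sinc ell (cxi U) n = sinc ell (cxi V) n" using m[of n] by (simp add: mode_vec_def)
      have "AE s in Hl. sinc ell (czeta U s) n = mem_E \<beta> (\<lambda>t. sinc ell (cxi U) n + sinc ell (czeta (sh V) t) n) s"
        by (rule N.memory_unique[OF DAs_parts(5)[OF U] inHs_parts(10)[OF FU] DAs_parts(3)[OF U]]) (use e(1) in \<open>simp add: sh_eta\<close>)
      moreover have "AE s in Hl. sinc ell (czeta V s) n = mem_E \<beta> (\<lambda>t. sinc ell (cxi V) n + sinc ell (czeta (sh V) t) n) s"
        by (rule N.memory_unique[OF DAs_parts(5)[OF V] inHs_parts(10)[OF FU] DAs_parts(3)[OF V]]) (simp add: sh_eta)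
      ultimately show "AE s in Hl. sinc ell (czeta U s) n = sinc ell (czeta V s) n" by eventually_elim (simp add: t)
    qed
    then show ?thesis using N.Mem_H10[OF L(10)] N.Mem_H10[OF L'(10)]
      by eventually_elim (rule sinc_eq_AE[OF M.ell]; simp add: H10_L2)
  qed
  have c: "sinc ell (cphi U) = sinc ell (cphi V)" "cosc ell (cpsi U) = cosc ell (cpsi V)" "cosc ell (cw U) = cosc ell (cw V)"
    "sinc ell (cth U) = sinc ell (cth V)" "sinc ell (cxi U) = sinc ell (cxi V)" "sinc ell (cPhi U) = sinc ell (cPhi V)"
    "cosc ell (cPsi U) = cosc ell (cPsi V)" "cosc ell (cW U) = cosc ell (cW V)"
    using m by (auto simp: mode_vec_def fun_eq_iff)
  show ?thesis unfolding eqH_iff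
    by (intro conjI eta zeta sinc_eq_AE[OF M.ell] cosc_eq_AE[OF M.ell] L L') (simp_all add: c)
qed

text \<open>Domination over triples of solution, data and frequency gives a constant independent of
  all three. The mode estimate bounds the unknowns with weight a and hence the strains; the
  velocities follow from the first three mode equations and the memories from
  \<open>memint_split\<close>.\<close>

lemma modeE_bound:
  "\<exists>C\<ge>0. \<forall>U F n. DAs U \<and> inHs F \<and> eqH ell (sh U) F \<and> 0 < n \<longrightarrow> modeE U n \<le> C * modeE F n"
proof -
  define A where "A = {(U, F, n::nat). DAs U \<and> inHs F \<and> eqH ell (sh U) F \<and> 0 < n}"
  define u where "u i = fst i" for i :: "state \<times> state \<times> nat"
  define f where "f i = fst (snd i)" for i :: "state \<times> state \<times> nat"
  define m where "m i = snd (snd i)" for i :: "state \<times> state \<times> nat"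
  define E where "E i = modeE (f i) (m i)" for i
  define a where "a i = freq ell (m i)" for i
  define p where "p i = sinc ell (cphi (u i)) (m i)" for i
  define q where "q i = cosc ell (cpsi (u i)) (m i)" for i
  define w where "w i = cosc ell (cw (u i)) (m i)" for i
  define t where "t i = sinc ell (cth (u i)) (m i)" for i
  define x where "x i = sinc ell (cxi (u i)) (m i)" for i
  have A: "DAs (u i)" "inHs (f i)" "eqH ell (sh (u i)) (f i)" "0 < m i" if "i \<in> A" for i
    using that unfolding A_def u_def f_def m_def by auto
  have modes: "mode_eqs (u i) (f i) (m i)" if "i \<in> A" for i
    using mode_eqs_if_eqH[OF A(1-3)[OF that]] .
  have 1: "dominated A (\<lambda>i. (a i)\<^sup>2 * (norm (mode_vec (u i) (m i)))\<^sup>2) E"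
    unfolding a_def E_def by (rule rhs_dominated) (use A mode_eqs_Mop[OF modes] in auto)
  have mode_vec: "mode_vec (u i) (m i) = (p i, q i, w i, t i, x i)" for i by (simp add: mode_vec_def p_def q_def w_def t_def x_def)
  have 2: "dominated A (\<lambda>i. (cmod (of_real (a i) * z i))\<^sup>2) E" if z: "z \<in> {p, q, w, t, x}" for z
    unfolding norm_mult power_mult_distrib norm_of_real power2_abs
    by (rule dominated_le[OF 1], rule mult_left_mono) (use z in \<open>auto simp: mode_vec norm_c5_sq\<close>)
  \<comment> \<open>Positive frequencies are at least the first one, so the weight a may be
    dropped.\<close>
  have 3: "dominated A (\<lambda>i. (cmod (z i))\<^sup>2) E" if z: "dominated A (\<lambda>i. (cmod (of_real (a i) * z i))\<^sup>2) E" for z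
  proof (rule dominated_trans[OF _ z], rule dominatedI)
    show "0 < (freq ell 1)\<^sup>2" using freq_pos[OF M.ell, of 1] by simp
    fix i assume i: "i \<in> A"
    have "freq ell 1 \<le> a i" unfolding a_def by (rule freq_ge_1[OF M.ell A(4)[OF i]])
    then have "(freq ell 1)\<^sup>2 \<le> (a i)\<^sup>2" using freq_nonneg[OF M.ell] by (intro power_mono) auto
    from mult_right_mono[OF this zero_le_power2]
    show "(freq ell 1)\<^sup>2 * (cmod (z i))\<^sup>2 \<le> (cmod (of_real (a i) * z i))\<^sup>2"
      unfolding norm_mult power_mult_distrib norm_of_real power2_abs .
  qed
  define f1 where "f1 i = sinc ell (cphi (f i)) (m i)" for i
  define f3 where "f3 i = cosc ell (cpsi (f i)) (m i)" for i
  define f5 where "f5 i = cosc ell (cw (f i)) (m i)" for i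
  have 5: "dominated A (\<lambda>i. (cmod (z i))\<^sup>2) E" if z: "z \<in> {f1, f3, f5}" for z
  proof (rule 3)
    show "dominated A (\<lambda>i. (cmod (of_real (a i) * z i))\<^sup>2) E"
      unfolding a_def E_def by (rule elastic_dominated[OF A(4)]) (use z in \<open>auto simp: f1_def f3_def f5_def\<close>)
  qed
  have vel_dom: "dominated A (\<lambda>i. (cmod (\<i> * of_real \<beta> * y i - z i))\<^sup>2) E"
    if "dominated A (\<lambda>i. (cmod (y i))\<^sup>2) E" "dominated A (\<lambda>i. (cmod (z i))\<^sup>2) E" for y z
    by (intro dominated_sq_diff dominated_sq_cmult that)
  have P: "dominated A (\<lambda>i. (cmod (sinc ell (cPhi (u i)) (m i)))\<^sup>2) E"
    by (rule dominated_le[OF vel_dom[OF 3[OF 2[of p]] 5[of f1]]]) (use modes in \<open>auto simp: mode_eqs_def p_def f1_def\<close>)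
  have Q: "dominated A (\<lambda>i. (cmod (cosc ell (cPsi (u i)) (m i)))\<^sup>2) E"
    by (rule dominated_le[OF vel_dom[OF 3[OF 2[of q]] 5[of f3]]]) (use modes in \<open>auto simp: mode_eqs_def q_def f3_def\<close>)
  have W: "dominated A (\<lambda>i. (cmod (cosc ell (cW (u i)) (m i)))\<^sup>2) E"
    by (rule dominated_le[OF vel_dom[OF 3[OF 2[of w]] 5[of f5]]]) (use modes in \<open>auto simp: mode_eqs_def w_def f5_def\<close>)
  have S: "dominated A (\<lambda>i. (cmod (of_real (a i) * p i + q i + of_real l * w i))\<^sup>2) E"
    by (intro dominated_sq_add dominated_sq_cmult 2 3) simp_all
  have "dominated A (\<lambda>i. (cmod ((-1) * (of_real (a i) * w i) - of_real l * p i))\<^sup>2) E"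
    by (intro dominated_sq_diff dominated_sq_cmult 2 3) simp_all
  then have Rr: "dominated A (\<lambda>i. (cmod (- of_real (a i) * w i - of_real l * p i))\<^sup>2) E" by simp
  have q2: "dominated A (\<lambda>i. (cmod (- of_real (a i) * q i))\<^sup>2) E" using 2[of q] by simp
  have a2: "dominated A (\<lambda>i. (a i)\<^sup>2 * (cmod (z i))\<^sup>2) E" if "z \<in> {p, q, w, t, x}" for z
    using 2[OF that] unfolding norm_mult power_mult_distrib norm_of_real power2_abs .
  have eta: "dominated A (\<lambda>i. (a i)\<^sup>2 * M.LMn (\<lambda>s. sinc ell (ceta (u i) s) (m i))) E"
  proof (rule dominated_le)
    have im: "0 \<le> integral\<^sup>L Hl mu" using M.mu_nonneg by (auto intro!: integral_nonneg_AE AE_I2)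
    have "dominated A (\<lambda>i. (a i)\<^sup>2 * M.LMn (\<lambda>s. sinc ell (ceta (f i) s) (m i))) E"
      by (rule dominatedI[OF tpos(7)]) (use modeE_ge(7) in \<open>simp add: a_def E_def\<close>)
    then show "dominated A (\<lambda>i. (2 / dm)\<^sup>2 * (2 * integral\<^sup>L Hl mu * ((a i)\<^sup>2 * (cmod (t i))\<^sup>2)
        + 2 * ((a i)\<^sup>2 * M.LMn (\<lambda>s. sinc ell (ceta (f i) s) (m i))))) E"
      by (intro dominated_add dominated_scale a2) (use im in auto)
    fix i assume i: "i \<in> A"
    have ae: "AE s in Hl. AE x in Om ell. \<i> * of_real \<beta> * ceta (u i) s x - (Top ell mu (ceta (u i)) s x + cth (u i) x) = ceta (f i) s x"
      using A(3)[OF i] unfolding eqH_iff sh_eta by (elim conjE)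
    note M.memint_split(2)[OF DAs_parts(4)[OF A(1)[OF i]] inHs_parts(9)[OF A(2)[OF i]] DAs_parts(2)[OF A(1)[OF i]] ae, of "m i"]
    from mult_left_mono[OF this zero_le_power2[of "a i"]]
    show "(a i)\<^sup>2 * M.LMn (\<lambda>s. sinc ell (ceta (u i) s) (m i)) \<le> (2 / dm)\<^sup>2 * (2 * integral\<^sup>L Hl mu * ((a i)\<^sup>2 * (cmod (t i))\<^sup>2)
        + 2 * ((a i)\<^sup>2 * M.LMn (\<lambda>s. sinc ell (ceta (f i) s) (m i))))"
      by (simp only: t_def algebra_simps)
  qed
  have zeta: "dominated A (\<lambda>i. (a i)\<^sup>2 * N.LMn (\<lambda>s. sinc ell (czeta (u i) s) (m i))) E"
  proof (rule dominated_le)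
    have im: "0 \<le> integral\<^sup>L Hl nu" using N.mu_nonneg by (auto intro!: integral_nonneg_AE AE_I2)
    have "dominated A (\<lambda>i. (a i)\<^sup>2 * N.LMn (\<lambda>s. sinc ell (czeta (f i) s) (m i))) E"
      by (rule dominatedI[OF tpos(7)]) (use modeE_ge(8) in \<open>simp add: a_def E_def\<close>)
    then show "dominated A (\<lambda>i. (2 / dn)\<^sup>2 * (2 * integral\<^sup>L Hl nu * ((a i)\<^sup>2 * (cmod (x i))\<^sup>2)
        + 2 * ((a i)\<^sup>2 * N.LMn (\<lambda>s. sinc ell (czeta (f i) s) (m i))))) E"
      by (intro dominated_add dominated_scale a2) (use im in auto)
    fix i assume i: "i \<in> A"
    have ae: "AE s in Hl. AE x in Om ell. \<i> * of_real \<beta> * czeta (u i) s x - (Top ell nu (czeta (u i)) s x + cxi (u i) x) = czeta (f i) s x"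
      using A(3)[OF i] unfolding eqH_iff sh_eta by (elim conjE)
    note N.memint_split(2)[OF DAs_parts(5)[OF A(1)[OF i]] inHs_parts(10)[OF A(2)[OF i]] DAs_parts(3)[OF A(1)[OF i]] ae, of "m i"]
    from mult_left_mono[OF this zero_le_power2[of "a i"]]
    show "(a i)\<^sup>2 * N.LMn (\<lambda>s. sinc ell (czeta (u i) s) (m i)) \<le> (2 / dn)\<^sup>2 * (2 * integral\<^sup>L Hl nu * ((a i)\<^sup>2 * (cmod (x i))\<^sup>2)
        + 2 * ((a i)\<^sup>2 * N.LMn (\<lambda>s. sinc ell (czeta (f i) s) (m i))))"
      by (simp only: x_def algebra_simps)
  qed
  have "dominated A (\<lambda>i. modeE (u i) (m i)) E"
    unfolding modeE_def a_def[symmetric] p_def[symmetric] q_def[symmetric] w_def[symmetric] t_def[symmetric] x_def[symmetric]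
    by (intro dominated_add dominated_scale S P q2 Q Rr W 3[OF 2[of t]] eta 3[OF 2[of x]] zeta less_imp_le[OF tpos(1)] less_imp_le[OF tpos(2)]
       less_imp_le[OF tpos(3)] less_imp_le[OF tpos(4)] less_imp_le[OF tpos(5)] less_imp_le[OF tpos(6)] less_imp_le[OF tpos(7)]) simp_all
  then obtain C where C: "C \<ge> 0" "\<forall>i\<in>A. modeE (u i) (m i) \<le> C * E i" unfolding dominated_def by (elim exE conjE)
  have "modeE U n \<le> C * modeE F n" if "DAs U \<and> inHs F \<and> eqH ell (sh U) F \<and> 0 < n" for U F n
    using bspec[OF C(2), of "(U, F, n)"] that by (simp add: A_def u_def m_def f_def E_def)
  then show ?thesis using C(1) by (intro exI[of _ C]) simp
qed

text \<open>The mode energies sum to squared norms, so their constant enters through its square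
  root.\<close>

lemma Hnorm_bound: "\<exists>C. \<forall>U. DAs U \<longrightarrow> Hn U \<le> C * Hn (sh U)"
proof -
  obtain C where C: "C \<ge> 0" "\<forall>U F n. DAs U \<and> inHs F \<and> eqH ell (sh U) F \<and> 0 < n \<longrightarrow> modeE U n \<le> C * modeE F n"
    using modeE_bound by (elim exE conjE)
  have "Hn U \<le> sqrt C * Hn (sh U)" if U: "DAs U" for U
  proof -
    note V = inHs_sh[OF U]
    have "modeE U n \<le> C * modeE (sh U) n" for n
    proof (cases "n = 0")
      case True
      then show ?thesis using modeE_0[OF DAs_parts(1)[OF U]] modeE_0[OF V] by simp
    next
      case False
      then show ?thesis using C(2) U V by (simp add: eqH_def)
    qed
    from sums_le[OF this Hnorm_sums[OF DAs_parts(1)[OF U]] sums_mult[OF Hnorm_sums[OF V]]]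
    have "sqrt ((Hn U)\<^sup>2) \<le> sqrt (C * (Hn (sh U))\<^sup>2)" by (rule real_sqrt_le_mono)
    moreover have "0 \<le> Hn (sh U)"
    proof -
      have "0 \<le> suminf (modeE (sh U))" by (rule suminf_nonneg) (use Hnorm_sums[OF V] modeE_nonneg in \<open>auto simp: sums_iff\<close>)
      show ?thesis unfolding Hnorm_def
        by (intro real_sqrt_ge_zero add_nonneg_nonneg mult_nonneg_nonneg) (use tpos M.mu_nonneg N.mu_nonneg in \<open>auto simp: Memn2_def intro!: integral_nonneg_AE AE_I2 intro: less_imp_le\<close>)
    qed
    ultimately show ?thesis by (simp add: real_sqrt_mult)
  qed
  then show ?thesis by blast
qed

end

section \<open>Existence of solutions and the resolvent set\<close>

context thermo
begin

text \<open>The uniform estimate gives the coefficients with weight a, that is, in the energy space.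
  The domain asks for weight a^2 on displacements and memory integrals; this is gained by solving
  each equation for its leading term.\<close>

lemma exists_solution:
  assumes F: "inHs F" shows "\<exists>U. DAs U \<and> eqH ell (sh U) F"
proof -
  note L = inHs_parts[OF F] and ell = M.ell
  define a where "a n = complex_of_real (freq ell n)" for n
  \<comment> \<open>At n = 0 the vector is set to 0, in accordance with the mean-zero conditions;
    the right-hand side vanishes there too.\<close>
  have "\<exists>v. \<forall>n. (0 < n \<longrightarrow> B.Mop (freq ell n) (v n) = rhs F n) \<and> (n = 0 \<longrightarrow> v n = 0)"
  proof (rule choice, rule allI)
    fix n
    show "\<exists>v. (0 < n \<longrightarrow> B.Mop (freq ell n) v = rhs F n) \<and> (n = 0 \<longrightarrow> v = 0)"
    proof (cases "n = 0")
      case False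
      then have n: "0 < n" by simp
      obtain v where "B.Mop (freq ell n) v = rhs F n" using B.Mop_surj[OF freq_pos[OF ell n] B.freq_ne_l[OF n], of "rhs F n"] by (elim exE)
      then show ?thesis using False by (intro exI[of _ v]) simp
    qed (intro exI[of _ 0], simp)
  qed
  then obtain v where v: "\<And>n. 0 < n \<Longrightarrow> B.Mop (freq ell n) (v n) = rhs F n" "v 0 = 0" by blast
  have r0: "rhs F 0 = 0" by (simp add: rhs_def B.mode_rhs_def L(11-14) zero_prod_def)
  have vM: "B.Mop (freq ell n) (v n) = rhs F n" for n
    by (cases "n = 0") (use v r0 linear_0[OF B.linear_Mop] in auto)
  define p where "p n = fst (v n)" for n
  define q where "q n = fst (snd (v n))" for n
  define w where "w n = fst (snd (snd (v n)))" for n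
  define t where "t n = fst (snd (snd (snd (v n))))" for n
  define x where "x n = snd (snd (snd (snd (v n))))" for n
  have vn: "v n = (p n, q n, w n, t n, x n)" for n by (simp add: p_def q_def w_def t_def x_def)
  have z0: "p 0 = 0" "q 0 = 0" "w 0 = 0" "t 0 = 0" "x 0 = 0" using v(2) by (simp_all add: vn zero_prod_def)
  have sm: "summable (\<lambda>n. (freq ell n)\<^sup>2 * (norm (v n))\<^sup>2)"
  proof -
    have "dominated {0<..} (\<lambda>n. (freq ell n)\<^sup>2 * (norm (v n))\<^sup>2) (modeE F)"
      by (rule rhs_dominated[where n="\<lambda>n. n" and F="\<lambda>n. F"]) (use F vM in auto)
    then obtain C where C: "C \<ge> 0" "\<forall>n\<in>{0<..}. (freq ell n)\<^sup>2 * (norm (v n))\<^sup>2 \<le> C * modeE F n"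
      unfolding dominated_def by (elim exE conjE)
    show ?thesis
    proof (rule summable_comparison_test')
      show "summable (\<lambda>n. C * modeE F n)" by (intro summable_mult sums_summable[OF Hnorm_sums[OF F]])
      show "norm ((freq ell n)\<^sup>2 * (norm (v n))\<^sup>2) \<le> C * modeE F n" for n
        by (cases "n = 0") (use C modeE_nonneg[of F n] in auto)
    qed
  qed
  have sa: "sqs (\<lambda>n. a n * z n)" if "z \<in> {p, q, w, t, x}" for z
    by (rule sqs_bound[OF sm])
       (use that in \<open>auto simp: a_def vn norm_c5_sq norm_mult power_mult_distrib intro!: mult_left_mono\<close>)
  have s: "sqs z" if "z \<in> {p, q, w, t, x}" for z
    by (rule M.sqs_of_freq_sqs) (use sa[OF that] that z0 in \<open>auto simp: a_def\<close>)
  note sa' = sa[of p, simplified] sa[of q, simplified] sa[of w, simplified] sa[of t, simplified] sa[of x, simplified]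
  note s' = s[of p, simplified] s[of q, simplified] s[of w, simplified] s[of t, simplified] s[of x, simplified]
  have sF: "sqs (sinc ell (cphi F))" "sqs (sinc ell (cPhi F))" "sqs (sinc ell (cth F))" "sqs (sinc ell (cxi F))"
    "sqs (cosc ell (cpsi F))" "sqs (cosc ell (cPsi F))" "sqs (cosc ell (cw F))" "sqs (cosc ell (cW F))"
    by (intro sqs_sinc[OF ell] sqs_cosc[OF ell] L)+
  have saF: "sqs (\<lambda>n. a n * sinc ell (cphi F) n)" "sqs (\<lambda>n. a n * cosc ell (cpsi F) n)" "sqs (\<lambda>n. a n * cosc ell (cw F) n)"
    using L(1,3,5) by (simp_all add: a_def H10_iff[OF ell] H1_iff[OF ell])
  define P where "P n = \<i> * of_real \<beta> * p n - sinc ell (cphi F) n" for n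
  define Q where "Q n = \<i> * of_real \<beta> * q n - cosc ell (cpsi F) n" for n
  define W where "W n = \<i> * of_real \<beta> * w n - cosc ell (cw F) n" for n
  have sP: "sqs P" "sqs Q" "sqs W" unfolding P_def Q_def W_def by (intro sqs_diff sqs_cmult s' sF)+
  have saP: "sqs (\<lambda>n. a n * P n)" "sqs (\<lambda>n. a n * Q n)" "sqs (\<lambda>n. a n * W n)"
  proof -
    have "sqs (\<lambda>n. \<i> * of_real \<beta> * (a n * p n) - a n * sinc ell (cphi F) n)"
      "sqs (\<lambda>n. \<i> * of_real \<beta> * (a n * q n) - a n * cosc ell (cpsi F) n)"
      "sqs (\<lambda>n. \<i> * of_real \<beta> * (a n * w n) - a n * cosc ell (cw F) n)"
      by (intro sqs_diff sqs_cmult sa' saF)+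
    then show "sqs (\<lambda>n. a n * P n)" "sqs (\<lambda>n. a n * Q n)" "sqs (\<lambda>n. a n * W n)"
      by (simp_all add: P_def Q_def W_def algebra_simps)
  qed
  have P0: "P 0 = 0" "Q 0 = 0" "W 0 = 0" by (simp_all add: P_def Q_def W_def z0 L(11-14))
  obtain \<phi> where \<phi>: "L2 ell \<phi>" "sinc ell \<phi> = p" using sinc_Riesz_Fischer[OF ell s'(1) z0(1)] by (auto simp: fun_eq_iff)
  obtain \<Phi> where \<Phi>: "L2 ell \<Phi>" "sinc ell \<Phi> = P" using sinc_Riesz_Fischer[OF ell sP(1) P0(1)] by (auto simp: fun_eq_iff)
  obtain \<psi> where \<psi>: "L2 ell \<psi>" "cosc ell \<psi> = q" using cosc_Riesz_Fischer[OF ell s'(2)] by (auto simp: fun_eq_iff)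
  obtain \<Psi> where \<Psi>: "L2 ell \<Psi>" "cosc ell \<Psi> = Q" using cosc_Riesz_Fischer[OF ell sP(2)] by (auto simp: fun_eq_iff)
  obtain y where y: "L2 ell y" "cosc ell y = w" using cosc_Riesz_Fischer[OF ell s'(3)] by (auto simp: fun_eq_iff)
  obtain Y where Y: "L2 ell Y" "cosc ell Y = W" using cosc_Riesz_Fischer[OF ell sP(3)] by (auto simp: fun_eq_iff)
  obtain \<theta> where \<theta>: "L2 ell \<theta>" "sinc ell \<theta> = t" using sinc_Riesz_Fischer[OF ell s'(4) z0(4)] by (auto simp: fun_eq_iff)
  obtain \<xi> where \<xi>: "L2 ell \<xi>" "sinc ell \<xi> = x" using sinc_Riesz_Fischer[OF ell s'(5) z0(5)] by (auto simp: fun_eq_iff)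
  have H: "H10 ell \<phi>" "H10 ell \<Phi>" "H1 ell \<psi>" "H1 ell \<Psi>" "H1 ell y" "H1 ell Y" "H10 ell \<theta>" "H10 ell \<xi>"
    using \<phi> \<Phi> \<psi> \<Psi> y Y \<theta> \<xi> sa' saP by (simp_all add: H10_iff[OF ell] H1_iff[OF ell] a_def)
  obtain \<eta> where \<eta>: "DT ell mu \<eta>" "AE s in Hl. AE x in Om ell. \<i> * of_real \<beta> * \<eta> s x - (Top ell mu \<eta> s x + \<theta> x) = ceta F s x"
    using M.memory_solve[OF L(9) H(7), of \<beta>] by (elim exE conjE)
  obtain \<zeta> where \<zeta>: "DT ell nu \<zeta>" "AE s in Hl. AE x in Om ell. \<i> * of_real \<beta> * \<zeta> s x - (Top ell nu \<zeta> s x + \<xi> x) = czeta F s x"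
    using N.memory_solve[OF L(10) H(8), of \<beta>] by (elim exE conjE)
  note m\<eta> = M.DT_Mem[OF \<eta>(1)] and m\<zeta> = N.DT_Mem[OF \<zeta>(1)]
  have I: "sinc ell (memint ell mu \<eta>) n = M.kc \<beta> * t n + M.Emode \<beta> (ceta F) n" for n
    using M.memint_split(1)[OF \<eta>(1) L(9) H(7) \<eta>(2), of n] unfolding \<theta>(2) .
  have J: "sinc ell (memint ell nu \<zeta>) n = N.kc \<beta> * x n + N.Emode \<beta> (czeta F) n" for n
    using N.memint_split(1)[OF \<zeta>(1) L(10) H(8) \<zeta>(2), of n] unfolding \<xi>(2) .
  have E: "B.M1 (freq ell n) (p n) (q n) (w n) (x n) = of_real \<rho>1 * (sinc ell (cPhi F) n + \<i> * of_real \<beta> * sinc ell (cphi F) n)"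
    "B.M2 (freq ell n) (p n) (q n) (w n) (t n) = of_real \<rho>2 * (cosc ell (cPsi F) n + \<i> * of_real \<beta> * cosc ell (cpsi F) n)"
    "B.M3 (freq ell n) (p n) (q n) (w n) (x n) = of_real \<rho>1 * (cosc ell (cW F) n + \<i> * of_real \<beta> * cosc ell (cw F) n)"
    "B.M4 (freq ell n) (q n) (t n) = of_real \<rho>3 * sinc ell (cth F) n - of_real (\<omega> * (freq ell n)\<^sup>2) * M.Emode \<beta> (ceta F) n
       - of_real (\<gamma> * freq ell n) * cosc ell (cpsi F) n"
    "B.M5 (freq ell n) (p n) (w n) (x n) = of_real \<rho>3 * sinc ell (cxi F) n - of_real (\<omega> * (freq ell n)\<^sup>2) * N.Emode \<beta> (czeta F) n
       - of_real \<gamma> * (of_real (freq ell n) * cosc ell (cw F) n + of_real l * sinc ell (cphi F) n)" for n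
    using vM[of n] unfolding vn B.Mop_def rhs_def B.mode_rhs_def prod.case prod.inject by blast+
  text \<open>The mode equations express the second derivatives through square-summable sequences.\<close>
  have aap: "sqs (\<lambda>n. a n * (a n * p n))"
  proof -
    have "sqs (\<lambda>n. of_real \<rho>1 * (sinc ell (cPhi F) n + \<i> * of_real \<beta> * sinc ell (cphi F) n) + of_real (\<rho>1 * \<beta>\<^sup>2) * p n
        - of_real k * (a n * q n) - of_real (k * l) * (a n * w n)
        - of_real (l * k0) * (a n * w n + of_real l * p n) - of_real (l * \<gamma>) * x n)"
      by (intro sqs_diff sqs_add sqs_cmult sa' s' sF)
    then have "sqs (\<lambda>n. of_real k * (a n * (a n * p n)))"
      unfolding E(1)[symmetric] B.M1_def a_def by (simp add: algebra_simps)
    then show ?thesis using tpos by (simp only: sqs_cmult_iff of_real_eq_0_iff)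
  qed
  have aaq: "sqs (\<lambda>n. a n * (a n * q n))"
  proof -
    have "sqs (\<lambda>n. of_real \<rho>2 * (cosc ell (cPsi F) n + \<i> * of_real \<beta> * cosc ell (cpsi F) n) + of_real (\<rho>2 * \<beta>\<^sup>2) * q n
        - of_real k * (a n * p n + q n + of_real l * w n) - of_real \<gamma> * (a n * t n))"
      by (intro sqs_diff sqs_add sqs_cmult sa' s' sF)
    then have "sqs (\<lambda>n. of_real b * (a n * (a n * q n)))"
      unfolding E(2)[symmetric] B.M2_def a_def by (simp add: algebra_simps power2_eq_square)
    then show ?thesis using tpos by (simp only: sqs_cmult_iff of_real_eq_0_iff)
  qed
  have aaw: "sqs (\<lambda>n. a n * (a n * w n))"
  proof -
    have "sqs (\<lambda>n. of_real \<rho>1 * (cosc ell (cW F) n + \<i> * of_real \<beta> * cosc ell (cw F) n) + of_real (\<rho>1 * \<beta>\<^sup>2) * w n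
        - of_real (k0 * l) * (a n * p n) - of_real (l * k) * (a n * p n + q n + of_real l * w n) - of_real \<gamma> * (a n * x n))"
      by (intro sqs_diff sqs_add sqs_cmult sa' s' sF)
    then have "sqs (\<lambda>n. of_real k0 * (a n * (a n * w n)))"
      unfolding E(3)[symmetric] B.M3_def a_def by (simp add: algebra_simps)
    then show ?thesis using tpos by (simp only: sqs_cmult_iff of_real_eq_0_iff)
  qed
  \<comment> \<open>The equation controls \<open>kc\<close> times t and \<open>Emode\<close> only
    through their sum, which is the coefficient of the memory integral. The extra regularity is thus
    obtained for the memory integral and not for the temperature separately, just as the domain
    demands.\<close>
  have aaI: "sqs (\<lambda>n. a n * (a n * sinc ell (memint ell mu \<eta>) n))"
  proof -
    have "of_real \<omega> * (a n * (a n * sinc ell (memint ell mu \<eta>) n))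
       = of_real \<rho>3 * sinc ell (cth F) n - of_real \<gamma> * (a n * cosc ell (cpsi F) n)
        - \<i> * of_real (\<beta> * \<rho>3) * t n + \<i> * of_real (\<gamma> * \<beta>) * (a n * q n)" for n
      using E(4)[of n] unfolding I B.M4_def a_def by (simp add: algebra_simps power2_eq_square)
    moreover have "sqs (\<lambda>n. of_real \<rho>3 * sinc ell (cth F) n - of_real \<gamma> * (a n * cosc ell (cpsi F) n)
        - \<i> * of_real (\<beta> * \<rho>3) * t n + \<i> * of_real (\<gamma> * \<beta>) * (a n * q n))"
      by (intro sqs_diff sqs_add sqs_cmult sa' s' sF saF)
    ultimately have "sqs (\<lambda>n. of_real \<omega> * (a n * (a n * sinc ell (memint ell mu \<eta>) n)))" by (simp only:)
    then show ?thesis using tpos by (simp only: sqs_cmult_iff of_real_eq_0_iff)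
  qed
  have aaJ: "sqs (\<lambda>n. a n * (a n * sinc ell (memint ell nu \<zeta>) n))"
  proof -
    have "of_real \<omega> * (a n * (a n * sinc ell (memint ell nu \<zeta>) n))
       = of_real \<rho>3 * sinc ell (cxi F) n - of_real \<gamma> * (a n * cosc ell (cw F) n) - of_real (\<gamma> * l) * sinc ell (cphi F) n
        - \<i> * of_real (\<beta> * \<rho>3) * x n + \<i> * of_real (\<gamma> * \<beta>) * (a n * w n) + \<i> * of_real (\<gamma> * \<beta> * l) * p n" for n
      using E(5)[of n] unfolding J B.M5_def a_def by (simp add: algebra_simps power2_eq_square)
    moreover have "sqs (\<lambda>n. of_real \<rho>3 * sinc ell (cxi F) n - of_real \<gamma> * (a n * cosc ell (cw F) n) - of_real (\<gamma> * l) * sinc ell (cphi F) n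
        - \<i> * of_real (\<beta> * \<rho>3) * x n + \<i> * of_real (\<gamma> * \<beta>) * (a n * w n) + \<i> * of_real (\<gamma> * \<beta> * l) * p n)"
      by (intro sqs_diff sqs_add sqs_cmult sa' s' sF saF)
    ultimately have "sqs (\<lambda>n. of_real \<omega> * (a n * (a n * sinc ell (memint ell nu \<zeta>) n)))" by (simp only:)
    then show ?thesis using tpos by (simp only: sqs_cmult_iff of_real_eq_0_iff)
  qed
  have H2: "H2 ell \<phi>" "H10 ell (dx ell \<psi>)" "H10 ell (dx ell y)" "H2 ell (memint ell mu \<eta>)" "H2 ell (memint ell nu \<zeta>)"
    unfolding H2_def
    subgoal using aap H10_H1[OF H(1)] H10_L2_dx[OF H(1)] by (simp add: H1_iff[OF ell, of "dx ell \<phi>"] cosc_dx[OF ell H(1)] \<phi>(2) a_def)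
    subgoal using aaq H1_dx(1)[OF H(3)] by (simp add: H10_iff[OF ell, of "dx ell \<psi>"] sinc_dx[OF ell H(3)] \<psi>(2) a_def sqs_minus_iff)
    subgoal using aaw H1_dx(1)[OF H(5)] by (simp add: H10_iff[OF ell, of "dx ell y"] sinc_dx[OF ell H(5)] y(2) a_def sqs_minus_iff)
    subgoal using aaI H10_H1[OF M.memint_modes(1)[OF m\<eta>]] H10_L2_dx[OF M.memint_modes(1)[OF m\<eta>]]
      by (simp add: H1_iff[OF ell, of "dx ell (memint ell mu \<eta>)"] cosc_dx[OF ell M.memint_modes(1)[OF m\<eta>]] a_def)
    subgoal using aaJ H10_H1[OF N.memint_modes(1)[OF m\<zeta>]] H10_L2_dx[OF N.memint_modes(1)[OF m\<zeta>]]
      by (simp add: H1_iff[OF ell, of "dx ell (memint ell nu \<zeta>)"] cosc_dx[OF ell N.memint_modes(1)[OF m\<zeta>]] a_def)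
    done
  define U where "U = \<lparr>cphi = \<phi>, cPhi = \<Phi>, cpsi = \<psi>, cPsi = \<Psi>, cw = y, cW = Y, cth = \<theta>, ceta = \<eta>, cxi = \<xi>, czeta = \<zeta>\<rparr>"
  have U: "DAs U"
    unfolding DA_def inH_def H1s_def L2s_iff[OF ell] U_def
    using H H2 \<Phi>(1) \<psi> \<Psi> y Y \<theta>(1) \<xi>(1) z0 P0 m\<eta> m\<zeta> \<eta>(1) \<zeta>(1) by simp
  have ae: "AE s in Hl. AE x in Om ell. ceta (sh U) s x = ceta F s x" "AE s in Hl. AE x in Om ell. czeta (sh U) s x = czeta F s x"
    unfolding sh_eta using \<eta>(2) \<zeta>(2) by (simp_all add: U_def)
  have "mode_eqs U F n" for n
    unfolding mode_eqs_def mode_vec_def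
    using vM[of n] by (simp add: U_def vn \<phi>(2) \<Phi>(2) \<psi>(2) \<Psi>(2) y(2) Y(2) \<theta>(2) \<xi>(2) P_def Q_def W_def)
  from eqH_if_mode_eqs[OF U F ae this] U show ?thesis by (intro exI[of _ U] conjI)
qed

lemma resolvent: "\<i> * of_real \<beta> \<in> resolvent_set_A ell \<rho>1 \<rho>2 \<rho>3 k k0 b \<omega> l \<gamma> mu nu"
  unfolding resolvent_set_A_def mem_Collect_eq sh_def[symmetric]
  using exists_solution sh_inj Hnorm_bound by blast

end

theorem theorem7p10:
  fixes ell \<rho>1 \<rho>2 \<rho>3 k k0 b \<omega> l \<gamma> :: real
    and \<mu> \<nu> :: "real \<Rightarrow> real"
  assumes "ell > 0" "\<rho>1 > 0" "\<rho>2 > 0" "\<rho>3 > 0" "k > 0" "k0 > 0" "b > 0" "\<omega> > 0"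
    "l > 0" "\<gamma> > 0"
    and "\<forall>n::nat. n > 0 \<longrightarrow> l * ell \<noteq> real n * pi"
    and "kernel \<mu>" and "kernel \<nu>"
  shows "{\<i> * of_real \<beta> | \<beta>. True} \<subseteq> resolvent_set_A ell \<rho>1 \<rho>2 \<rho>3 k k0 b \<omega> l \<gamma> \<mu> \<nu>"
proof
  fix z :: complex
  assume "z \<in> {\<i> * of_real \<beta> | \<beta>. True}"
  then obtain \<beta> :: real where z: "z = \<i> * of_real \<beta>" by blast
  obtain dm where m: "mem_kernel \<mu> dm" by (rule mem_kernel_if_kernel[OF \<open>kernel \<mu>\<close>])
  obtain dn where n: "mem_kernel \<nu> dn" by (rule mem_kernel_if_kernel[OF \<open>kernel \<nu>\<close>])
  interpret thermo \<mu> dm \<nu> dn ell \<rho>1 \<rho>2 \<rho>3 k k0 b \<omega> l \<gamma> \<beta>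
    by (intro thermo.intro mem_space.intro mem_space_axioms.intro thermo_axioms.intro m n) (use assms in auto)
  show "z \<in> resolvent_set_A ell \<rho>1 \<rho>2 \<rho>3 k k0 b \<omega> l \<gamma> \<mu> \<nu>" unfolding z by (rule resolvent)
qed

end
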